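(* Let $s\in(0,1)$, let $N>2s$ be an integer, and let $a,c,f:\mathbb{R}^N\to\mathbb{R}$ satisfy the following, for some $\sigma\in(0,1)$: $a\in C^{0,\sigma}_{loc}(\mathbb{R}^N)$ with $a(x)>0$ for all $x\in\mathbb{R}^N$; there exist $C_0>0$ and $\alpha>2s$ such that $a(x)\ge C_0(1+|x|^2)^{\alpha/2}$ for all $x\in\mathbb{R}^N$; and $c,f\in C^{0,\sigma}_{loc}(\mathbb{R}^N)\cap L^\infty(\mathbb{R}^N)$. Let $T>0$, $g\in C([0,T])$, $u_0\in C(\mathbb{R}^N)\cap L^\infty(\mathbb{R}^N)$, and suppose that $\lim_{|x|\to\infty}u_0(x)=g(0)$. Then there exists a unique solution $u$ (in the viscosity sense defined in the context) of the problem $$\partial_t u=-a(-\Delta)^s u+cu+f \ \text{ in } \mathbb{R}^N\times(0,T],\qquad u=u_0\ \text{ in }\mathbb{R}^N\times\{0\},$$ such that $$\lim_{|x|\to\infty}u(x,t)=g(t)\quad\text{uniformly with respect to } t\in[0,T].$$ Furthermore, $|u|\le Ce^{\beta T}$ in $\mathbb{R}^N\times[0,T]$ for some $C>0$ and $\beta>0$.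
   Context: Let $S_T:=\mathbb{R}^N\times(0,T]$ and $\overline{S_T}=\mathbb{R}^N\times[0,T]$. The fractional Laplacian (acting in the space variable) is $(-\Delta)^s u(x)=C_{N,s}\,\mathrm{P.V.}\int_{\mathbb{R}^N}\frac{u(x)-u(y)}{|x-y|^{N+2s}}\,dy$ with $C_{N,s}=\frac{2^{2s}s\,\Gamma((N+2s)/2)}{\pi^{N/2}\Gamma(1-s)}$, for functions that are sufficiently regular near $x$ and belong to $\mathcal{L}^s(\mathbb{R}^N):=\{u \text{ measurable}: \int_{\mathbb{R}^N}\frac{|u(x)|}{1+|x|^{N+2s}}dx<\infty\}$. Sub- and supersolutions below are understood to belong to $\mathcal{L}^s(\mathbb{R}^N)$ in $x$ for every $t$, so that the expressions make sense. Subsolution of the equation: $u$ is a subsolution of $\partial_t u=-a(-\Delta)^su+cu+f$ in $S_T$ if (i) $u$ is upper semicontinuous in $S_T$; (ii) for any open bounded subset $U\subset S_T$, any $(x_0,t_0)\in U$, and any test function $\varphi\in C^2(S_T)$ such that $u(x_0,t_0)=\varphi(x_0,t_0)$ and $u(x_0,t_0)-\varphi(x_0,t_0)\ge u(x,t)-\varphi(x,t)$ for all $(x,t)\in U$, one has $$\partial_t\psi(x_0,t_0)\le -a(x_0)(-\Delta)^s\psi(x_0,t_0)+c(x_0)u(x_0,t_0)+f(x_0),$$ where $\psi:=\varphi$ in $U$ and $\psi:=u$ in $S_T\setminus U$. Supersolution: the same with "lower semicontinuous" and with both inequalities (in the touching condition and in the equation) reversed. Subsolution of the Cauchy problem: $u$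 is upper semicontinuous in $\overline{S_T}$, is a subsolution of the equation in $S_T$, and $u(x,0)\le u_0(x)$ for all $x\in\mathbb{R}^N$. Supersolution of the Cauchy problem: $u$ is lower semicontinuous in $\overline{S_T}$, is a supersolution of the equation in $S_T$, and $u(x,0)\ge u_0(x)$ for all $x$. A solution is a function that is both a subsolution and a supersolution of the Cauchy problem (hence it is continuous on $\overline{S_T}$ and $u(\cdot,0)=u_0$). *)

theory Defs
  imports "HOL-Analysis.Analysis"
begin

definition ST :: "real \<Rightarrow> ('a::euclidean_space \<times> real) set" where
  "ST T = UNIV \<times> {0<..T}"

definition ST_closed :: "real \<Rightarrow> ('a::euclidean_space \<times> real) set" where
  "ST_closed T = UNIV \<times> {0..T}"

definition locally_holder :: "real \<Rightarrow> ('a::euclidean_space \<Rightarrow> real) \<Rightarrow> bool" where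
  "locally_holder \<sigma> h \<longleftrightarrow>
     (\<forall>K. compact K \<longrightarrow> (\<exists>L. \<forall>x\<in>K. \<forall>y\<in>K. \<bar>h x - h y\<bar> \<le> L * dist x y powr \<sigma>))"

definition usc_on :: "'b::topological_space set \<Rightarrow> ('b \<Rightarrow> real) \<Rightarrow> bool" where
  "usc_on S u \<longleftrightarrow> (\<forall>z\<in>S. \<forall>b. u z < b \<longrightarrow> (\<forall>\<^sub>F w in at z within S. u w < b))"

definition lsc_on :: "'b::topological_space set \<Rightarrow> ('b \<Rightarrow> real) \<Rightarrow> bool" where
  "lsc_on S u \<longleftrightarrow> (\<forall>z\<in>S. \<forall>b. b < u z \<longrightarrow> (\<forall>\<^sub>F w in at z within S. b < u w))"

text \<open>Derivatives are taken within \<open>S\<close>, so that for \<open>S = ST T\<close> they are one-sided in time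
  at \<open>t = T\<close> and the values of \<open>\<phi>\<close> outside \<open>S\<close> play no role.\<close>

definition C2_on :: "'b::euclidean_space set \<Rightarrow> ('b \<Rightarrow> real) \<Rightarrow> bool" where
  "C2_on S \<phi> \<longleftrightarrow>
     (\<exists>(D :: 'b \<Rightarrow> 'b \<Rightarrow>\<^sub>L real) (D2 :: 'b \<Rightarrow> 'b \<Rightarrow>\<^sub>L 'b \<Rightarrow>\<^sub>L real).
        (\<forall>z\<in>S. (\<phi> has_derivative blinfun_apply (D z)) (at z within S)) \<and>
        (\<forall>z\<in>S. (D has_derivative blinfun_apply (D2 z)) (at z within S)) \<and>
        continuous_on S D2)"

text \<open>The space \<open>\<L>\<^sup>s\<close> of measurable functions with finite weighted integral.\<close>

definition Ls_space :: "real \<Rightarrow> ('a::euclidean_space \<Rightarrow> real) set" where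
  "Ls_space s = {v. v \<in> borel_measurable lebesgue \<and>
     integrable lebesgue (\<lambda>x. \<bar>v x\<bar> / (1 + norm x powr (real DIM('a) + 2 * s)))}"

definition frac_const :: "nat \<Rightarrow> real \<Rightarrow> real" where
  "frac_const N s =
     2 powr (2 * s) * s * Gamma ((real N + 2 * s) / 2) / (pi powr (real N / 2) * Gamma (1 - s))"

text \<open>The principal value is the limit of the integrals over \<open>|x - y| > \<epsilon>\<close> as \<open>\<epsilon>\<close> decreases
  to \<open>0\<close>. It exists whenever \<open>v \<in> Ls_space s\<close> is twice continuously differentiable near \<open>x\<close>,
  which is the only situation in which the operator is used below.\<close>

definition frac_laplacian :: "real \<Rightarrow> ('a::euclidean_space \<Rightarrow> real) \<Rightarrow> 'a \<Rightarrow> real" where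
  "frac_laplacian s v x =
     frac_const DIM('a) s *
     Lim (at_right 0) (\<lambda>\<epsilon>. LINT y:{y. \<epsilon> < norm (x - y)}|lebesgue.
       (v x - v y) / norm (x - y) powr (real DIM('a) + 2 * s))"

definition glue :: "'b set \<Rightarrow> ('b \<Rightarrow> real) \<Rightarrow> ('b \<Rightarrow> real) \<Rightarrow> 'b \<Rightarrow> real" where
  "glue U \<phi> u = (\<lambda>z. if z \<in> U then \<phi> z else u z)"

text \<open>Time derivative along \<open>(0, T]\<close>: two-sided for \<open>t < T\<close>, the left derivative at \<open>t = T\<close>.\<close>

definition time_deriv :: "real \<Rightarrow> ('a \<times> real \<Rightarrow> real) \<Rightarrow> 'a \<Rightarrow> real \<Rightarrow> real" where
  "time_deriv T \<psi> x t = vector_derivative (\<lambda>\<tau>. \<psi> (x, \<tau>)) (at t within {0<..T})"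

text \<open>The neighbourhoods \<open>U\<close> are open relative to \<open>ST T\<close>, so that the equation is also tested
  at the final time \<open>t = T\<close>.\<close>

definition subsolution_eq ::
  "real \<Rightarrow> ('a::euclidean_space \<Rightarrow> real) \<Rightarrow> ('a \<Rightarrow> real) \<Rightarrow> ('a \<Rightarrow> real) \<Rightarrow> real
    \<Rightarrow> ('a \<times> real \<Rightarrow> real) \<Rightarrow> bool" where
  "subsolution_eq s a c f T u \<longleftrightarrow>
     (\<forall>t\<in>{0<..T}. (\<lambda>x. u (x, t)) \<in> Ls_space s) \<and>
     usc_on (ST T) u \<and>
     (\<forall>U x\<^sub>0 t\<^sub>0 \<phi>.
        openin (top_of_set (ST T)) U \<longrightarrow> bounded U \<longrightarrow> (x\<^sub>0, t\<^sub>0) \<in> U \<longrightarrow> C2_on (ST T) \<phi> \<longrightarrow>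
        u (x\<^sub>0, t\<^sub>0) = \<phi> (x\<^sub>0, t\<^sub>0) \<longrightarrow>
        (\<forall>z\<in>U. u (x\<^sub>0, t\<^sub>0) - \<phi> (x\<^sub>0, t\<^sub>0) \<ge> u z - \<phi> z) \<longrightarrow>
        time_deriv T (glue U \<phi> u) x\<^sub>0 t\<^sub>0
          \<le> - a x\<^sub>0 * frac_laplacian s (\<lambda>x. glue U \<phi> u (x, t\<^sub>0)) x\<^sub>0
             + c x\<^sub>0 * u (x\<^sub>0, t\<^sub>0) + f x\<^sub>0)"

definition supersolution_eq ::
  "real \<Rightarrow> ('a::euclidean_space \<Rightarrow> real) \<Rightarrow> ('a \<Rightarrow> real) \<Rightarrow> ('a \<Rightarrow> real) \<Rightarrow> real
    \<Rightarrow> ('a \<times> real \<Rightarrow> real) \<Rightarrow> bool" where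
  "supersolution_eq s a c f T u \<longleftrightarrow>
     (\<forall>t\<in>{0<..T}. (\<lambda>x. u (x, t)) \<in> Ls_space s) \<and>
     lsc_on (ST T) u \<and>
     (\<forall>U x\<^sub>0 t\<^sub>0 \<phi>.
        openin (top_of_set (ST T)) U \<longrightarrow> bounded U \<longrightarrow> (x\<^sub>0, t\<^sub>0) \<in> U \<longrightarrow> C2_on (ST T) \<phi> \<longrightarrow>
        u (x\<^sub>0, t\<^sub>0) = \<phi> (x\<^sub>0, t\<^sub>0) \<longrightarrow>
        (\<forall>z\<in>U. u (x\<^sub>0, t\<^sub>0) - \<phi> (x\<^sub>0, t\<^sub>0) \<le> u z - \<phi> z) \<longrightarrow>
        time_deriv T (glue U \<phi> u) x\<^sub>0 t\<^sub>0
          \<ge> - a x\<^sub>0 * frac_laplacian s (\<lambda>x. glue U \<phi> u (x, t\<^sub>0)) x\<^sub>0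
             + c x\<^sub>0 * u (x\<^sub>0, t\<^sub>0) + f x\<^sub>0)"

definition cauchy_subsolution ::
  "real \<Rightarrow> ('a::euclidean_space \<Rightarrow> real) \<Rightarrow> ('a \<Rightarrow> real) \<Rightarrow> ('a \<Rightarrow> real) \<Rightarrow> real
    \<Rightarrow> ('a \<Rightarrow> real) \<Rightarrow> ('a \<times> real \<Rightarrow> real) \<Rightarrow> bool" where
  "cauchy_subsolution s a c f T u\<^sub>0 u \<longleftrightarrow>
     (\<forall>t\<in>{0..T}. (\<lambda>x. u (x, t)) \<in> Ls_space s) \<and>
     usc_on (ST_closed T) u \<and> subsolution_eq s a c f T u \<and> (\<forall>x. u (x, 0) \<le> u\<^sub>0 x)"

definition cauchy_supersolution ::
  "real \<Rightarrow> ('a::euclidean_space \<Rightarrow> real) \<Rightarrow> ('a \<Rightarrow> real) \<Rightarrow> ('a \<Rightarrow> real) \<Rightarrow> real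
    \<Rightarrow> ('a \<Rightarrow> real) \<Rightarrow> ('a \<times> real \<Rightarrow> real) \<Rightarrow> bool" where
  "cauchy_supersolution s a c f T u\<^sub>0 u \<longleftrightarrow>
     (\<forall>t\<in>{0..T}. (\<lambda>x. u (x, t)) \<in> Ls_space s) \<and>
     lsc_on (ST_closed T) u \<and> supersolution_eq s a c f T u \<and> (\<forall>x. u (x, 0) \<ge> u\<^sub>0 x)"

definition cauchy_solution ::
  "real \<Rightarrow> ('a::euclidean_space \<Rightarrow> real) \<Rightarrow> ('a \<Rightarrow> real) \<Rightarrow> ('a \<Rightarrow> real) \<Rightarrow> real
    \<Rightarrow> ('a \<Rightarrow> real) \<Rightarrow> ('a \<times> real \<Rightarrow> real) \<Rightarrow> bool" where
  "cauchy_solution s a c f T u\<^sub>0 u \<longleftrightarrow>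
     cauchy_subsolution s a c f T u\<^sub>0 u \<and> cauchy_supersolution s a c f T u\<^sub>0 u"

end

theory Submission
  imports Defs "HOL-Probability.Probability" "HOL-Real_Asymp.Real_Asymp"
begin

text \<open>The coefficient \<open>a\<close> is bounded below but has no growth bound from above, so
  a smoothing error multiplied by \<open>a\<close> need not even be bounded. For this reason
  smoothing acts on the density of the potential, and errors of densities are compared before
  \<open>a\<close> is multiplied in. The exponents above 2s serve two ends: a density of such decay
  has a bounded potential that vanishes at infinity, and a gap between two exponents turns smallness
  on compact sets into smallness in the weaker weight. The delayed equation is posed for all real
  times and has no initial time. The initial datum is imposed by the source, which keeps a profile
  stationary up to time -tau and is switched on linearly during (-tau, 0). Factoring out
  \<open>exp (be * t)\<close> with \<open>be\<close> above the bound of \<open>c\<close> makes the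
  zero-order coefficient at least 1; constants then bound the delayed solution independently of the
  delay, so that the delay can be chosen after the width of the time mollification. For the same
  reason many estimates are linear in the data, with constants that do not depend on the
  function.\<close>

abbreviation bmeas :: "('a::topological_space \<Rightarrow> 'b::topological_space) set" where
  "bmeas \<equiv> borel_measurable borel"

lemmas cont_bmeas = borel_measurable_continuous_onI
  and lint_bound = Bochner_Integration.integrable_bound
  and lint_cong = Bochner_Integration.integral_cong
  and lint_diff = Bochner_Integration.integral_diff
  and lint_add = Bochner_Integration.integrable_add

text \<open>
  Up to a constant, \<open>(-\<Delta>)^s w\<close> is the integral of \<open>t^(-1-s) (w - e^(t\<Delta>) w)\<close> over \<open>t > 0\<close>. It is
  inverted by the potential \<open>\<integral> q^(s-1) e^(q\<Delta>) F dq\<close>, which vanishes at infinity when the density \<open>F\<close>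
  decays like \<open>|x|^(-\<beta>)\<close> with \<open>\<beta> > 2s\<close>. Since \<open>1/a\<close> decays in this way, the equation with a delayed
  difference quotient, \<open>(w(t) - w(t - h))/h = -a (-\<Delta>)^s w - b w + G\<close> with \<open>b \<ge> 1\<close>, can be solved among
  potentials by the maximum principle and the method of continuity, without any regularity theory.
  Mollification in space and time yields smooth functions that solve the equation up to an error which
  is small relative to \<open>a |x|^(-\<beta>')\<close>, where \<open>2s < \<beta>' < \<beta>\<close>. The potential of \<open>|x|^(-\<beta>')\<close> is a bounded
  barrier that absorbs this error. Hence there are classical sub- and supersolutions that are uniformly
  close to each other and enclose the data at \<open>t = 0\<close> and at infinity. The function between them is a
  viscosity solution by stability, and every solution lies between them by comparison; only comparison
  with classical functions is needed, so no doubling of variables occurs.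
\<close>

section \<open>The heat semigroup\<close>

definition hk :: "real \<Rightarrow> 'a::euclidean_space \<Rightarrow> real" where
  "hk t x = (4 * pi * t) powr (- (real DIM('a) / 2)) * exp (- (norm x)\<^sup>2 / (4 * t))"

lemma hk_nonneg [simp]: "0 \<le> hk t x"
  by (simp add: hk_def)

lemma hk_minus [simp]: "hk t (- x) = hk t x"
  by (simp add: hk_def)

lemma hk_measurable [measurable]:
  assumes [measurable]: "f \<in> borel_measurable M" "g \<in> borel_measurable M"
  shows "(\<lambda>w. hk (f w) (g w :: 'a::euclidean_space)) \<in> borel_measurable M" unfolding hk_def by measurable

text \<open>Each coordinate is a centred normal variable of variance 2t. Total mass and the
  semigroup law are thereby reduced to facts on one-dimensional normal densities.\<close>

lemma hk_prod:
  fixes x :: "'a::euclidean_space"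
  assumes "0 < t"
  shows "hk t x = (\<Prod>b\<in>Basis. normal_density 0 (sqrt (2 * t)) (x \<bullet> b))"
proof -
  have 1: "normal_density 0 (sqrt (2 * t)) y = (4 * pi * t) powr (- (1/2)) * exp (- y\<^sup>2 / (4 * t))" for y
  proof -
    have "(4 * pi * t) powr (- (1/2)) = 1 / sqrt (4 * pi * t)" using assms by (simp add: powr_minus_divide powr_half_sqrt)
    moreover have "2 * pi * (sqrt (2 * t))\<^sup>2 = 4 * pi * t" "2 * (sqrt (2 * t))\<^sup>2 = 4 * t" using assms by auto
    ultimately show ?thesis by (simp add: normal_density_def)
  qed
  have "(\<Prod>b\<in>(Basis::'a set). normal_density 0 (sqrt (2 * t)) (x \<bullet> b))
      = ((4 * pi * t) powr (- (1/2))) ^ DIM('a) * exp (\<Sum>b\<in>(Basis::'a set). - (x \<bullet> b)\<^sup>2 / (4 * t))"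
    by (simp add: 1 prod.distrib exp_sum)
  also have "((4 * pi * t) powr (- (1/2))) ^ DIM('a) = (4 * pi * t) powr (- (real DIM('a) / 2))"
    using assms by (simp add: powr_powr flip: powr_realpow)
  also have "(\<Sum>b\<in>(Basis::'a set). - (x \<bullet> b)\<^sup>2 / (4 * t)) = - (norm x)\<^sup>2 / (4 * t)" unfolding norm_eq_sqrt_inner
    by (subst euclidean_inner[of x x]) (simp add: sum_nonneg sum_negf sum_divide_distrib power2_eq_square)
  finally show ?thesis by (simp add: hk_def)
qed

lemma nn_integral_hk:
  assumes "0 < t" shows "(\<integral>\<^sup>+x. hk t (x::'a::euclidean_space) \<partial>lborel) = 1"
proof -
  have "(\<integral>\<^sup>+x. hk t (x::'a) \<partial>lborel) = (\<integral>\<^sup>+x. (\<Prod>b\<in>Basis. ennreal (normal_density 0 (sqrt (2 * t)) ((x::'a) \<bullet> b))) \<partial>lborel)"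
    by (simp add: hk_prod[OF assms] prod_ennreal normal_density_nonneg)
  also have "\<dots> = (\<Prod>b\<in>(Basis::'a set). (\<integral>\<^sup>+y. ennreal (normal_density 0 (sqrt (2 * t)) y) \<partial>lborel))"
    by (rule nn_integral_lborel_prod) auto
  also have "(\<integral>\<^sup>+y. ennreal (normal_density 0 (sqrt (2 * t)) y) \<partial>lborel) = 1"
    using assms by (subst nn_integral_eq_integral) (auto simp: integral_normal_density integrable_normal_density normal_density_nonneg)
  finally show ?thesis by simp
qed

lemma integrable_hk: "0 < t \<Longrightarrow> integrable lborel (hk t :: 'a::euclidean_space \<Rightarrow> real)"
  by (rule integrableI_nonneg) (auto simp: nn_integral_hk)

lemma integral_hk: "0 < t \<Longrightarrow> (LBINT x. hk t (x::'a::euclidean_space)) = 1"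
  by (subst integral_eq_nn_integral) (auto simp: nn_integral_hk)

text \<open>The convolution factorises over the coordinates, where the variances 2t and 2q of
  independent normal variables add up.\<close>

lemma nn_hk_conv:
  assumes "0 < t" "0 < q"
  shows "(\<integral>\<^sup>+y. hk t (x - y) * hk q (y::'a::euclidean_space) \<partial>lborel) = hk (t + q) x"
proof -
  let ?n = "\<lambda>t. normal_density 0 (sqrt (2 * t))"
  have "(\<integral>\<^sup>+y. hk t (x - y) * hk q (y::'a) \<partial>lborel)
     = (\<integral>\<^sup>+y. (\<Prod>b\<in>Basis. ennreal (?n t (x \<bullet> b - (y::'a) \<bullet> b) * ?n q (y \<bullet> b))) \<partial>lborel)"
    using assms by (simp add: hk_prod prod_ennreal normal_density_nonneg inner_diff_left flip: prod.distrib)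
  also have "\<dots> = (\<Prod>b\<in>(Basis::'a set). (\<integral>\<^sup>+y. ennreal (?n t (x \<bullet> b - y) * ?n q y) \<partial>lborel))"
    by (rule nn_integral_lborel_prod[where f="\<lambda>b y. ennreal (?n t (x \<bullet> b - y) * ?n q y)"]) auto
  also have "\<dots> = (\<Prod>b\<in>(Basis::'a set). ennreal (?n (t + q) (x \<bullet> b)))"
    using fun_cong[OF conv_normal_density_zero_mean[of "sqrt (2 * t)" "sqrt (2 * q)"]] assms by (simp add: distrib_left)
  also have "\<dots> = hk (t + q) x" using assms by (simp add: hk_prod prod_ennreal normal_density_nonneg)
  finally show ?thesis .
qed

text \<open>With \<open>v = |z|^2/t\<close>, a power of \<open>1 + v\<close> is absorbed by half of
  the exponent: \<open>exp (-v/4)\<close> becomes \<open>exp (-v/8)\<close>, the Gaussian at time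
  2t. Later bounds on derivatives, tails and moments of the kernel rest on this trade.\<close>

lemma hk_moment_bound:
  assumes "0 \<le> M"
  obtains C where "0 < C"
    "\<And>t z. 0 < t \<Longrightarrow> (1 + (norm z)\<^sup>2 / t) powr M * hk t (z::'a::euclidean_space) \<le> C * hk (2 * t) z"
proof
  \<comment> \<open>The choice gives \<open>K >= 1\<close> and \<open>M / K <= 1/8\<close>, so that
    \<open>1 + y <= exp y\<close> at \<open>y = v / K\<close> yields the claim.\<close>
  define K where "K = 8 * M + 8"
  show "0 < K powr M * 2 powr (real DIM('a) / 2)" using assms by (simp add: K_def)
  fix t :: real and z :: 'a
  assume t: "0 < t"
  define v where "v = (norm z)\<^sup>2 / t"
  have v: "0 \<le> v" using t by (simp add: v_def)
  have K: "1 \<le> K" using assms by (simp add: K_def)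
  have "1 + v / K \<le> exp (v / K)" by simp
  hence "1 + v \<le> K * exp (v / K)"
  proof -
    have "1 + v \<le> K * (1 + v / K)" using K by (simp add: distrib_left)
    also have "\<dots> \<le> K * exp (v / K)" using K by (intro mult_left_mono) auto
    finally show ?thesis .
  qed
  hence "(1 + v) powr M \<le> (K * exp (v / K)) powr M" using v assms by (intro powr_mono2) auto
  also have "\<dots> = K powr M * exp (v * M / K)" using K by (simp add: powr_mult exp_powr_real mult.commute)
  also have "\<dots> \<le> K powr M * exp (v / 8)"
  proof -
    have "M / K \<le> 1 / 8" using assms by (simp add: K_def field_simps)
    hence "v * (M / K) \<le> v * (1/8)" using v by (rule mult_left_mono)
    hence "v * M / K \<le> v / 8" by simp
    thus ?thesis using K by (intro mult_left_mono) auto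
  qed
  finally have 1: "(1 + v) powr M \<le> K powr M * exp (v / 8)" .
  have e1: "- (norm z)\<^sup>2 / (4 * t) = - v / 4" "- (norm z)\<^sup>2 / (4 * (2 * t)) = - v / 8" using t by (auto simp: v_def field_simps)
  have e2: "(4 * pi * t) powr (- (real DIM('a) / 2)) = 2 powr (real DIM('a) / 2) * (4 * pi * (2 * t)) powr (- (real DIM('a) / 2))"
  proof -
    have "(4 * pi * (2 * t)) = 2 * (4 * pi * t)" by simp
    hence "(4 * pi * (2 * t)) powr (- (real DIM('a) / 2)) = 2 powr (- (real DIM('a) / 2)) * (4 * pi * t) powr (- (real DIM('a) / 2))"
      using t by (simp only: powr_mult)
    thus ?thesis by (simp add: powr_minus)
  qed
  have "(1 + v) powr M * exp (- v / 4) \<le> K powr M * exp (v / 8) * exp (- v / 4)" using 1 by (intro mult_right_mono) auto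
  also have "\<dots> = K powr M * exp (- v / 8)" by (simp add: mult.assoc flip: exp_add)
  finally have 2: "(1 + v) powr M * exp (- v / 4) \<le> K powr M * exp (- v / 8)" .
  let ?p = "(4 * pi * t) powr (- (real DIM('a) / 2))"
  have "(1 + (norm z)\<^sup>2 / t) powr M * hk t z = ?p * ((1 + v) powr M * exp (- v / 4))" unfolding hk_def e1 v_def by (simp only: mult_ac)
  also have "\<dots> \<le> ?p * (K powr M * exp (- v / 8))" using 2 by (intro mult_left_mono) auto
  also have "\<dots> = K powr M * 2 powr (real DIM('a) / 2) * hk (2 * t) z" unfolding hk_def e1 by (subst e2) (simp only: mult_ac)
  finally show "(1 + (norm z)\<^sup>2 / t) powr M * hk t z \<le> K powr M * 2 powr (real DIM('a) / 2) * hk (2 * t) z" .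
qed

text \<open>The kernel carries the integration variable and \<open>F\<close> the translate, so that
  for bounded \<open>F\<close> the dominating function does not depend on \<open>x\<close>.\<close>

definition heat :: "real \<Rightarrow> ('a::euclidean_space \<Rightarrow> real) \<Rightarrow> 'a \<Rightarrow> real" where
  "heat t F x = (LBINT z. F (x - z) * hk t z)"

lemma lborel_reflect: "lborel = distr lborel borel (\<lambda>y. x - (y::'a::euclidean_space))"
  using lborel_affine[of "-1" x] by (simp add: density_1)

lemma lborel_shift: "lborel = distr lborel borel (\<lambda>y. x + (y::'a::euclidean_space))"
  using lborel_affine[of 1 x] by (simp add: density_1)

lemma lborel_integral_reflect:
  fixes f :: "'a::euclidean_space \<Rightarrow> real"
  assumes [measurable]: "f \<in> bmeas"
  shows "(LBINT y. f (x - y)) = (LBINT y. f y)"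
    and "integrable lborel (\<lambda>y. f (x - y)) \<longleftrightarrow> integrable lborel f"
   apply (subst (2) lborel_reflect[of x], subst integral_distr; simp)
  apply (subst (2) lborel_reflect[of x], subst integrable_distr_eq; simp)
  done

lemma lborel_integral_shift:
  fixes f :: "'a::euclidean_space \<Rightarrow> real"
  assumes [measurable]: "f \<in> bmeas"
  shows "(LBINT y. f (x + y)) = (LBINT y. f y)"
    and "integrable lborel (\<lambda>y. f (x + y)) \<longleftrightarrow> integrable lborel f"
   apply (subst (2) lborel_shift[of x], subst integral_distr; simp)
  apply (subst (2) lborel_shift[of x], subst integrable_distr_eq; simp)
  done

lemma heat_kernel_form:
  assumes [measurable]: "F \<in> bmeas"
  shows "heat t F x = (LBINT y. F y * hk t (x - y))"
    and "integrable lborel (\<lambda>z. F (x - z) * hk t z) \<longleftrightarrow> integrable lborel (\<lambda>y. F y * hk t (x - y))"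
  using lborel_integral_reflect[of "\<lambda>y. F y * hk t (x - y)" x] by (simp_all add: heat_def)

lemma heat_integrable:
  fixes F :: "'a::euclidean_space \<Rightarrow> real"
  assumes [measurable]: "F \<in> bmeas" and b: "\<And>x. \<bar>F x\<bar> \<le> B" and "0 < t"
  shows "integrable lborel (\<lambda>z. F (x - z) * hk t z)"
proof (rule lint_bound)
  show "integrable lborel (\<lambda>z. B * hk t (z::'a))" using \<open>0 < t\<close> by (simp add: integrable_hk)
  show "AE z in lborel. norm (F (x - z) * hk t z) \<le> norm (B * hk t z)"
  proof (intro AE_I2)
    fix z
    have "\<bar>F (x - z)\<bar> * hk t z \<le> \<bar>B\<bar> * hk t z" using b[of "x - z"] by (intro mult_right_mono) auto
    thus "norm (F (x - z) * hk t z) \<le> norm (B * hk t z)" by (simp add: abs_mult)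
  qed
qed simp

lemma heat_measurable [measurable]:
  fixes F :: "'a::euclidean_space \<Rightarrow> real"
  assumes [measurable]: "F \<in> bmeas" "f \<in> borel_measurable M" "g \<in> borel_measurable M"
  shows "(\<lambda>w. heat (f w) F (g w)) \<in> borel_measurable M" unfolding heat_def by measurable

lemma heat_mono:
  fixes F G :: "'a::euclidean_space \<Rightarrow> real"
  assumes [measurable]: "F \<in> bmeas" "G \<in> bmeas"
    and "\<And>x. \<bar>F x\<bar> \<le> B" "\<And>x. \<bar>G x\<bar> \<le> B'" "\<And>x. F x \<le> G x" "0 < t"
  shows "heat t F x \<le> heat t G x"
proof -
  have F: "integrable lborel (\<lambda>z. F (x - z) * hk t z)" by (rule heat_integrable[OF assms(1,3,6)])
  have G: "integrable lborel (\<lambda>z. G (x - z) * hk t z)" by (rule heat_integrable[OF assms(2,4,6)])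
  show ?thesis unfolding heat_def by (rule integral_mono[OF F G]) (simp add: assms(5) mult_right_mono)
qed

lemma heat_const: "0 < t \<Longrightarrow> heat t (\<lambda>_. k) (x::'a::euclidean_space) = k"
  by (simp add: heat_def integral_hk)

lemma heat_abs_le:
  fixes F G :: "'a::euclidean_space \<Rightarrow> real"
  assumes [measurable]: "F \<in> bmeas" "G \<in> bmeas"
    and F: "\<And>x. \<bar>F x\<bar> \<le> G x" and G: "\<And>x. G x \<le> B" and t: "0 < t"
  shows "\<bar>heat t F x\<bar> \<le> heat t G x"
proof -
  have "\<bar>heat t F x\<bar> \<le> (LBINT z. \<bar>F (x - z) * hk t z\<bar>)" unfolding heat_def by (rule integral_abs_bound)
  also have "\<dots> \<le> heat t G x" unfolding heat_def
  proof (rule integral_mono)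
    have G': "\<bar>G x\<bar> \<le> B" for x using F[of x] G[of x] by linarith
    have F': "\<bar>F x\<bar> \<le> B" for x using F[of x] G[of x] by linarith
    show "integrable lborel (\<lambda>z. \<bar>F (x - z) * hk t z\<bar>)" using heat_integrable[OF assms(1) F' t] by (rule integrable_abs)
    show "integrable lborel (\<lambda>z. G (x - z) * hk t z)" using heat_integrable[OF assms(2) G' t] .
  qed (auto simp: abs_mult F intro!: mult_right_mono)
  finally show ?thesis .
qed

lemma heat_bound:
  fixes F :: "'a::euclidean_space \<Rightarrow> real"
  assumes "F \<in> bmeas" "\<And>x. \<bar>F x\<bar> \<le> B" "0 < t"
  shows "\<bar>heat t F x\<bar> \<le> B"
proof -
  have "\<bar>heat t F x\<bar> \<le> heat t (\<lambda>_. B) x" by (rule heat_abs_le[OF assms(1) _ assms(2) _ assms(3)]) auto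
  thus ?thesis by (simp only: heat_const[OF assms(3)])
qed

lemma heat_add:
  fixes F G :: "'a::euclidean_space \<Rightarrow> real"
  assumes [measurable]: "F \<in> bmeas" "G \<in> bmeas"
    and "\<And>x. \<bar>F x\<bar> \<le> B" "\<And>x. \<bar>G x\<bar> \<le> B'" "0 < t"
  shows "heat t (\<lambda>x. F x + G x) x = heat t F x + heat t G x"
    and "heat t (\<lambda>x. F x - G x) x = heat t F x - heat t G x"
proof -
  have F: "integrable lborel (\<lambda>z. F (x - z) * hk t z)" by (rule heat_integrable[OF assms(1,3,5)])
  have G: "integrable lborel (\<lambda>z. G (x - z) * hk t z)" by (rule heat_integrable[OF assms(2,4,5)])
  show "heat t (\<lambda>x. F x + G x) x = heat t F x + heat t G x"
    unfolding heat_def distrib_right by (rule Bochner_Integration.integral_add[OF F G])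
  show "heat t (\<lambda>x. F x - G x) x = heat t F x - heat t G x" unfolding heat_def left_diff_distrib by (rule lint_diff[OF F G])
qed

lemma heat_cmult: "heat t (\<lambda>x. k * F x) x = k * heat t F x"
  unfolding heat_def by (simp add: mult.assoc)

lemma heat_heat:
  fixes F :: "'a::euclidean_space \<Rightarrow> real"
  assumes [measurable]: "F \<in> bmeas" and b: "\<And>x. \<bar>F x\<bar> \<le> B" and t: "0 < t" and q: "0 < q"
  shows "heat t (heat q F) x = heat (t + q) F x"
proof -
  have B: "0 \<le> B" using b[of 0] by linarith
  have conv: "(\<integral>\<^sup>+y. hk t (x - y) * hk q (y - z) \<partial>lborel) = hk (t + q) (x - z)" for z :: 'a
  proof -
    have "(\<integral>\<^sup>+y. hk t (x - y) * hk q (y - z) \<partial>lborel) = (\<integral>\<^sup>+y. hk t ((x - z) - y) * hk q y \<partial>lborel)"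
      by (subst (2) lborel_shift[of "- z"], subst nn_integral_distr) (auto simp: algebra_simps)
    thus ?thesis using nn_hk_conv[OF t q, of "x - z"] by simp
  qed
  have I: "integrable lborel (\<lambda>z. \<bar>F z\<bar> * hk (t + q) (x - z))"
    by (rule iffD1[OF heat_kernel_form(2) heat_integrable[where B=B]]) (use b t q in auto)
  have fub: "integrable (lborel \<Otimes>\<^sub>M lborel) (\<lambda>(y, z). F z * hk q (y - z) * hk t (x - y))"
  proof (rule integrableI_bounded)
    have "(\<integral>\<^sup>+ w. ennreal (norm (case w of (y, z) \<Rightarrow> F z * hk q (y - z) * hk t (x - y))) \<partial>(lborel \<Otimes>\<^sub>M lborel))
      = (\<integral>\<^sup>+ z. \<integral>\<^sup>+ y. ennreal (\<bar>F z\<bar> * hk q (y - z) * hk t (x - y)) \<partial>lborel \<partial>lborel)"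
      by (subst lborel_pair.nn_integral_snd[symmetric]) (auto simp: abs_mult)
    also have "\<dots> = (\<integral>\<^sup>+ z. ennreal (\<bar>F z\<bar> * hk (t + q) (x - z)) \<partial>lborel)"
    proof (rule nn_integral_cong)
      fix z :: 'a
      have "(\<integral>\<^sup>+ y. ennreal (\<bar>F z\<bar> * hk q (y - z) * hk t (x - y)) \<partial>lborel)
         = (\<integral>\<^sup>+ y. ennreal \<bar>F z\<bar> * ennreal (hk t (x - y) * hk q (y - z)) \<partial>lborel)"
        by (simp add: mult_ac flip: ennreal_mult)
      also have "\<dots> = ennreal \<bar>F z\<bar> * hk (t + q) (x - z)" by (subst nn_integral_cmult) (auto simp: conv)
      finally show "(\<integral>\<^sup>+ y. ennreal (\<bar>F z\<bar> * hk q (y - z) * hk t (x - y)) \<partial>lborel)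
          = ennreal (\<bar>F z\<bar> * hk (t + q) (x - z))" by (simp add: ennreal_mult)
    qed
    also have "\<dots> < \<infinity>" using I by (subst nn_integral_eq_integral) auto
    finally show "(\<integral>\<^sup>+ w. ennreal (norm (case w of (y, z) \<Rightarrow> F z * hk q (y - z) * hk t (x - y))) \<partial>(lborel \<Otimes>\<^sub>M lborel)) < \<infinity>" .
  qed simp
  have conv': "(LBINT y. hk t (x - y) * hk q (y - z)) = hk (t + q) (x - z)" for z :: 'a by (subst integral_eq_nn_integral) (auto simp: conv)
  have "heat t (heat q F) x = (LBINT y. (LBINT z. F z * hk q (y - z) * hk t (x - y)))"
    by (subst heat_kernel_form) (auto simp: heat_kernel_form(1)[of F])
  also have "\<dots> = (LBINT z. (LBINT y. F z * hk q (y - z) * hk t (x - y)))" by (rule lborel_pair.Fubini_integral[OF fub, symmetric])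
  also have "\<dots> = (LBINT z. F z * hk (t + q) (x - z))" by (simp add: mult.assoc mult.commute[of "hk q _"] conv')
  also have "\<dots> = heat (t + q) F x" by (subst heat_kernel_form) auto
  finally show ?thesis .
qed

text \<open>The parameter \<open>w\<close> moves the function and the point together. The same
  dominated convergence thus gives continuity in space and joint continuity when the function
  depends on time.\<close>

lemma heat_continuous:
  fixes F :: "'c::metric_space \<Rightarrow> 'a::euclidean_space \<Rightarrow> real" and g :: "'c \<Rightarrow> 'a"
  assumes c: "\<And>z. continuous_on UNIV (\<lambda>w. F w (g w - z))" and m: "\<And>w. F w \<in> bmeas"
    and b: "\<And>w x. \<bar>F w x\<bar> \<le> B" and t: "0 < t"
    and "(X \<longlongrightarrow> w) sequentially"
  shows "((\<lambda>n. heat t (F (X n)) (g (X n))) \<longlongrightarrow> heat t (F w) (g w)) sequentially" unfolding heat_def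
proof (rule integral_dominated_convergence)
  note m[measurable]
  show "(\<lambda>z. F w (g w - z) * hk t z) \<in> borel_measurable lborel" by simp
  show "(\<lambda>z. F (X n) (g (X n) - z) * hk t z) \<in> borel_measurable lborel" for n by simp
  show "integrable lborel (\<lambda>z. B * hk t (z::'a))" using t by (simp add: integrable_hk)
  show "AE z in lborel. (\<lambda>n. F (X n) (g (X n) - z) * hk t z) \<longlonglongrightarrow> F w (g w - z) * hk t z"
  proof (intro AE_I2 tendsto_mult tendsto_const)
    fix z
    have "isCont (\<lambda>w. F w (g w - z)) w" using c[of z] by (simp add: continuous_on_eq_continuous_at)
    thus "(\<lambda>n. F (X n) (g (X n) - z)) \<longlonglongrightarrow> F w (g w - z)" using assms(5) by (rule isCont_tendsto_compose)
  qed
  show "AE z in lborel. norm (F (X n) (g (X n) - z) * hk t z) \<le> B * hk t z" for n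
    using b by (intro AE_I2) (auto simp: abs_mult intro!: mult_right_mono)
qed

lemma heat_continuous_on:
  fixes F :: "'a::euclidean_space \<Rightarrow> real"
  assumes "continuous_on UNIV F" "\<And>x. \<bar>F x\<bar> \<le> B" "0 < t"
  shows "continuous_on UNIV (heat t F)"
proof (clarsimp simp: continuous_on_sequentially comp_def)
  fix X :: "nat \<Rightarrow> 'a" and x assume X: "X \<longlonglongrightarrow> x"
  show "(\<lambda>n. heat t F (X n)) \<longlonglongrightarrow> heat t F x"
    by (rule heat_continuous[where F="\<lambda>_. F" and g="\<lambda>x. x" and B=B])
      (use assms X in \<open>auto intro!: continuous_on_compose2[of UNIV F] continuous_intros cont_bmeas\<close>)
qed

text \<open>Chebyshev's inequality: outside the ball of radius \<open>d\<close> the factor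
  \<open>|z|^2 / d^2\<close> is at least 1, and the second moment is of order
  \<open>t\<close>.\<close>

lemma heat_tail:
  obtains C where "0 < C" "\<And>t d. 0 < t \<Longrightarrow> 0 < d \<Longrightarrow>
    (LBINT z. hk t (z::'a::euclidean_space) * indicator {z. d \<le> norm z} z) \<le> C * t / d\<^sup>2"
proof -
  obtain C where C: "0 < C" "\<And>t z. 0 < t \<Longrightarrow> (1 + (norm (z::'a))\<^sup>2 / t) powr 1 * hk t z \<le> C * hk (2 * t) z"
    using hk_moment_bound[of 1] by auto
  have "(LBINT z. hk t (z::'a) * indicator {z. d \<le> norm z} z) \<le> C * t / d\<^sup>2"
    if t: "0 < t" and d: "0 < d" for t d
  proof -
    have le: "hk t z * indicator {z. d \<le> norm z} z \<le> (C * t / d\<^sup>2) * hk (2 * t) z" for z :: 'a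
    proof (cases "d \<le> norm z")
      case True
      hence "d\<^sup>2 \<le> (norm z)\<^sup>2" using d by (intro power_mono) auto
      hence "1 * hk t z \<le> (t / d\<^sup>2) * (1 + (norm z)\<^sup>2 / t) * hk t z"
      proof (intro mult_right_mono)
        have "(t / d\<^sup>2) * (1 + (norm z)\<^sup>2 / t) = (t + (norm z)\<^sup>2) / d\<^sup>2"
          using t by (simp add: add_divide_distrib distrib_left)
        moreover have "1 \<le> (t + (norm z)\<^sup>2) / d\<^sup>2"
        proof -
          have "d\<^sup>2 \<le> t + (norm z)\<^sup>2" using \<open>d\<^sup>2 \<le> (norm z)\<^sup>2\<close> t by linarith
          moreover have "0 < d\<^sup>2" using d by simp
          ultimately show ?thesis by (simp only: le_divide_eq_1_pos)
        qed
        ultimately show "1 \<le> (t / d\<^sup>2) * (1 + (norm z)\<^sup>2 / t)" by (simp only:)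
      qed simp
      also have "\<dots> \<le> (t / d\<^sup>2) * (C * hk (2 * t) z)"
      proof -
        have "0 < 1 + (norm z)\<^sup>2 / t" using t by (simp add: add_pos_nonneg)
        hence "(1 + (norm z)\<^sup>2 / t) * hk t z \<le> C * hk (2 * t) z" using C(2)[OF t, of z] by simp
        thus ?thesis using t d by (simp only: mult.assoc, intro mult_left_mono) auto
      qed
      finally show ?thesis using True by (simp add: mult_ac)
    qed (use C t in simp)
    have "(LBINT z. hk t (z::'a) * indicator {z. d \<le> norm z} z) \<le> (LBINT z. (C * t / d\<^sup>2) * hk (2 * t) (z::'a))"
    proof (rule integral_mono)
      show i: "integrable lborel (\<lambda>z. (C * t / d\<^sup>2) * hk (2 * t) (z::'a))" using t by (simp add: integrable_hk)
      show "integrable lborel (\<lambda>z. hk t (z::'a) * indicator {z. d \<le> norm z} z)"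
        using i by (rule lint_bound) (use le t C(1) in \<open>auto simp: abs_mult\<close>)
    qed (use le in auto)
    thus ?thesis using t by (simp add: integral_hk)
  qed
  thus ?thesis using that C(1) by blast
qed

text \<open>The index lets one radius serve a whole family; for smoothing in time the index is the
  spatial point. The set \<open>K\<close> consists of pairs, because each member is only tested at
  selected points.\<close>

lemma heat_uniform_approx_family:
  fixes F :: "'i \<Rightarrow> 'a::euclidean_space \<Rightarrow> real"
  assumes F[measurable]: "\<And>i. F i \<in> bmeas" and B: "\<And>i x. \<bar>F i x\<bar> \<le> B"
    and uc: "\<And>e. 0 < e \<Longrightarrow> \<exists>d>0. \<forall>p\<in>K. \<forall>y. dist y (snd p) < d \<longrightarrow> dist (F (fst p) y) (F (fst p) (snd p)) < e" and e: "0 < e"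
  obtains r0 where "0 < r0" "\<And>r i x. 0 < r \<Longrightarrow> r < r0 \<Longrightarrow> (i, x) \<in> K \<Longrightarrow> \<bar>heat r (F i) x - F i x\<bar> \<le> e"
proof -
  obtain C where C: "0 < C" "\<And>t d. 0 < t \<Longrightarrow> 0 < d \<Longrightarrow>
    (LBINT z. hk t (z::'a) * indicator {z. d \<le> norm z} z) \<le> C * t / d\<^sup>2" by (rule heat_tail) blast
  obtain d' where d': "0 < d'" and d: "\<And>i x y. (i, x) \<in> K \<Longrightarrow> dist y x < d' \<Longrightarrow> dist (F i y) (F i x) < e / 2"
    using uc[of "e / 2"] e by fastforce
  have B0: "0 \<le> B" using B[of undefined 0] by linarith
  \<comment> \<open>Far from the point the oscillation is at most \<open>2 * B\<close> and the mass
    at most \<open>C * r / d'^2\<close>; this radius makes the product at most \<open>e / 2\<close>.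
    Writing \<open>B + 1\<close> avoids a division by zero.\<close>
  define r0 where "r0 = e / 2 * d'\<^sup>2 / (2 * (B + 1) * C)"
  have r0: "0 < r0" using e d' B0 C by (simp add: r0_def)
  have "\<bar>heat r (F i) x - F i x\<bar> \<le> e" if r: "0 < r" "r < r0" and x: "(i, x) \<in> K" for r i x
  proof -
    have iF: "integrable lborel (\<lambda>z. F i (x - z) * hk r z)" by (rule heat_integrable) (use B r in auto)
    have iF0: "integrable lborel (\<lambda>z. F i x * hk r (z::'a))" using r by (simp add: integrable_hk)
    have it: "integrable lborel (\<lambda>z. hk r (z::'a) * indicator {z. d' \<le> norm z} z)"
      by (intro integrable_real_mult_indicator integrable_hk r) auto
    have ih: "integrable lborel (\<lambda>z. hk r (z::'a))" by (intro integrable_hk r)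
    have "heat r (F i) x - F i x = (LBINT z. F i (x - z) * hk r z) - (LBINT z. F i x * hk r (z::'a))" using r by (simp add: heat_def integral_hk)
    also have "\<dots> = (LBINT z. F i (x - z) * hk r z - F i x * hk r z)" using lint_diff[OF iF iF0] by simp
    finally have "\<bar>heat r (F i) x - F i x\<bar> \<le> (LBINT z. \<bar>F i (x - z) * hk r z - F i x * hk r z\<bar>)"
      by (simp only: integral_abs_bound)
    also have "\<dots> \<le> (LBINT z. (e / 2) * hk r z + (2 * B) * (hk r (z::'a) * indicator {z. d' \<le> norm z} z))"
    proof (rule integral_mono)
      show "integrable lborel (\<lambda>z. \<bar>F i (x - z) * hk r z - F i x * hk r z\<bar>)"
        using iF iF0 by (intro integrable_abs Bochner_Integration.integrable_diff)
      show "integrable lborel (\<lambda>z. (e / 2) * hk r z + (2 * B) * (hk r (z::'a) * indicator {z. d' \<le> norm z} z))"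
        by (intro lint_add integrable_mult_right it ih)
      fix z :: 'a
      have "\<bar>F i (x - z) * hk r z - F i x * hk r z\<bar> = \<bar>F i (x - z) - F i x\<bar> * hk r z"
        by (simp add: abs_mult flip: left_diff_distrib)
      also have "\<dots> \<le> (e / 2 + 2 * B * indicator {z. d' \<le> norm z} z) * hk r z"
      proof (intro mult_right_mono)
        show "\<bar>F i (x - z) - F i x\<bar> \<le> e / 2 + 2 * B * indicator {z. d' \<le> norm z} z"
        proof (cases "d' \<le> norm z")
          case True
          thus ?thesis using B[of i "x - z"] B[of i x] e by simp
        next
          case False
          hence "dist (F i (x - z)) (F i x) < e / 2" using x by (intro d) (auto simp: dist_norm)
          thus ?thesis using False by (simp add: dist_real_def)
        qed
      qed simp
      finally show "\<bar>F i (x - z) * hk r z - F i x * hk r z\<bar> \<le> (e / 2) * hk r z + (2 * B) * (hk r z * indicator {z. d' \<le> norm z} z)"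
        by (simp add: algebra_simps)
    qed
    also have "\<dots> = (LBINT z. (e / 2) * hk r (z::'a)) + (LBINT z. (2 * B) * (hk r (z::'a) * indicator {z. d' \<le> norm z} z))"
      by (intro Bochner_Integration.integral_add integrable_mult_right it ih)
    also have "\<dots> \<le> e / 2 + 2 * B * (C * r / d'\<^sup>2)"
    proof -
      have "2 * B * (LBINT z. hk r (z::'a) * indicator {z. d' \<le> norm z} z) \<le> 2 * B * (C * r / d'\<^sup>2)"
        using C(2)[OF r(1) d'] B0 by (intro mult_left_mono) auto
      moreover have "(LBINT z. (e / 2) * hk r (z::'a)) = e / 2" using r by (simp add: integral_hk)
      moreover have "(LBINT z. (2 * B) * (hk r (z::'a) * indicator {z. d' \<le> norm z} z))
        = 2 * B * (LBINT z. hk r (z::'a) * indicator {z. d' \<le> norm z} z)" by (rule integral_mult_right_zero)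
      ultimately show ?thesis by linarith
    qed
    also have "2 * B * (C * r / d'\<^sup>2) \<le> 2 * (B + 1) * (C * r0 / d'\<^sup>2)" using r C B0 by (intro mult_mono divide_right_mono) auto
    also have "\<dots> = e / 2"
    proof -
      have "B + 1 \<noteq> 0" "C \<noteq> 0" "d' \<noteq> 0" using B0 C d' by auto
      thus ?thesis unfolding r0_def by (simp add: divide_simps)
    qed
    finally show ?thesis by simp
  qed
  thus ?thesis using that r0 by blast
qed

lemma heat_uniform_approx:
  fixes F :: "'a::euclidean_space \<Rightarrow> real"
  assumes "F \<in> bmeas" "\<And>x. \<bar>F x\<bar> \<le> B"
    and "\<And>e. 0 < e \<Longrightarrow> \<exists>d>0. \<forall>x\<in>K. \<forall>y. dist y x < d \<longrightarrow> dist (F y) (F x) < e" and "0 < e"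
  obtains r0 where "0 < r0" "\<And>r x. 0 < r \<Longrightarrow> r < r0 \<Longrightarrow> x \<in> K \<Longrightarrow> \<bar>heat r F x - F x\<bar> \<le> e"
  by (rule heat_uniform_approx_family[of "\<lambda>_::unit. F" B "UNIV \<times> K" e]) (use assms in \<open>auto intro: that\<close>)

lemma heat_locally_uniform:
  fixes F :: "'a::euclidean_space \<Rightarrow> real"
  assumes cont: "continuous_on UNIV F" and B: "\<And>x. \<bar>F x\<bar> \<le> B" and K: "compact K" and e: "0 < e"
  obtains r0 where "0 < r0" "\<And>r x. 0 < r \<Longrightarrow> r < r0 \<Longrightarrow> x \<in> K \<Longrightarrow> \<bar>heat r F x - F x\<bar> \<le> e"
proof -
  \<comment> \<open>\<open>K'\<close> contains every point at distance at most 1 from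
    \<open>K\<close>. It is compact, so continuity is uniform there, and the modulus is cut off at 1
    accordingly.\<close>
  define K' where "K' = (\<lambda>p. fst p - snd p) ` (K \<times> cball 0 1)"
  have "compact K'" unfolding K'_def by (intro compact_continuous_image compact_Times K continuous_intros) auto
  hence uc: "uniformly_continuous_on K' F" using cont by (intro compact_uniformly_continuous) (auto intro: continuous_on_subset)
  have "\<exists>d>0. \<forall>x\<in>K. \<forall>y. dist y x < d \<longrightarrow> dist (F y) (F x) < e" if "0 < e" for e
  proof -
    obtain d where d: "0 < d" "\<And>x y. x \<in> K' \<Longrightarrow> y \<in> K' \<Longrightarrow> dist y x < d \<Longrightarrow> dist (F y) (F x) < e"
      using uc \<open>0 < e\<close> unfolding uniformly_continuous_on_def by meson
    have "dist (F y) (F x) < e" if x: "x \<in> K" and y: "dist y x < min d 1" for x y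
    proof -
      have "y \<in> K'" "x \<in> K'"
        unfolding K'_def using image_eqI[of "y" "\<lambda>p. fst p - snd p" "(x, x - y)"] image_eqI[of x "\<lambda>p. fst p - snd p" "(x, 0)"] x y
        by (auto simp: dist_norm norm_minus_commute)
      thus ?thesis using y by (intro d) auto
    qed
    thus ?thesis using d(1) by (intro exI[of _ "min d 1"]) auto
  qed
  thus ?thesis using heat_uniform_approx[OF cont_bmeas[OF cont] B _ e, of K] that by blast
qed

section \<open>Weights of polynomial decay under the heat flow\<close>

definition pw :: "real \<Rightarrow> 'a::euclidean_space \<Rightarrow> real" where
  "pw al x = (1 + (norm x)\<^sup>2) powr (- (al / 2))"

lemma one_plus_sq_pos [simp]: "0 < 1 + (norm x)\<^sup>2"
  by (simp add: add_pos_nonneg)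

lemma one_plus_sq_neq_0 [simp]: "1 + (norm x)\<^sup>2 \<noteq> 0"
  using one_plus_sq_pos[of x] by linarith

lemma pw_pos [simp]: "0 < pw al x"
  by (simp add: pw_def add_nonneg_eq_0_iff)

lemma pw_nonneg [simp]: "0 \<le> pw al x"
  using pw_pos[of al x] by linarith

lemma pw_neq_0 [simp]: "pw al x \<noteq> 0"
  using pw_pos[of al x] by linarith

lemma pw_le_1: "0 \<le> al \<Longrightarrow> pw al x \<le> 1"
  using powr_mono[of "- (al / 2)" 0 "1 + (norm x)\<^sup>2"] by (simp add: pw_def)

lemma pw_antimono: "al \<le> be \<Longrightarrow> pw be x \<le> pw al x"
  unfolding pw_def by (intro powr_mono) auto

lemma pw_continuous: "continuous_on UNIV (pw al :: 'a::euclidean_space \<Rightarrow> real)"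
  unfolding pw_def by (intro continuous_intros) (auto simp: add_nonneg_eq_0_iff)

lemma pw_measurable [measurable]: "pw al \<in> bmeas"
  using pw_continuous by (rule cont_bmeas)

lemma pw_tendsto_0:
  assumes "0 < al" shows "((pw al :: 'a::euclidean_space \<Rightarrow> real) \<longlongrightarrow> 0) at_infinity"
proof -
  have "filterlim (\<lambda>x::'a. 1 + (norm x)\<^sup>2) at_top at_infinity"
    by (intro filterlim_tendsto_add_at_top[OF tendsto_const] filterlim_pow_at_top filterlim_norm_at_top) auto
  thus ?thesis unfolding pw_def using assms by (intro tendsto_neg_powr) auto
qed

text \<open>Peetre's inequality: translating a weight costs only a polynomial factor in the
  translation.\<close>

lemma peetre:
  fixes x z :: "'a::euclidean_space"
  shows "1 + (norm (x - z))\<^sup>2 \<le> 2 * ((1 + (norm x)\<^sup>2) * (1 + (norm z)\<^sup>2))"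
proof -
  have "norm (x - z) \<le> norm x + norm z" by (rule norm_triangle_ineq4)
  hence "(norm (x - z))\<^sup>2 \<le> (norm x + norm z)\<^sup>2" by (intro power_mono) auto
  moreover have "2 * norm x * norm z \<le> (norm x)\<^sup>2 + (norm z)\<^sup>2" by (rule sum_squares_bound)
  moreover have "0 \<le> (norm x)\<^sup>2 * (norm z)\<^sup>2" by simp
  moreover have "2 * ((1 + (norm x)\<^sup>2) * (1 + (norm z)\<^sup>2)) = 2 + 2 * (norm x)\<^sup>2 + 2 * (norm z)\<^sup>2 + 2 * ((norm x)\<^sup>2 * (norm z)\<^sup>2)"
    by (simp add: algebra_simps)
  moreover have "0 \<le> (norm x)\<^sup>2" "0 \<le> (norm z)\<^sup>2" by auto
  ultimately show ?thesis unfolding power2_sum by linarith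
qed

lemma pw_shift:
  fixes x z :: "'a::euclidean_space"
  assumes "0 \<le> al"
  shows "pw al (x - z) \<le> 2 powr (al / 2) * (1 + (norm z)\<^sup>2) powr (al / 2) * pw al x"
    and "2 powr (- (al / 2)) * pw al x * pw al z \<le> pw al (x - z)"
proof -
  have "1 + (norm (x - z - (- z)))\<^sup>2 \<le> 2 * ((1 + (norm (x - z))\<^sup>2) * (1 + (norm (- z))\<^sup>2))" by (rule peetre)
  hence "(2 * ((1 + (norm (x - z))\<^sup>2) * (1 + (norm z)\<^sup>2))) powr (- (al / 2)) \<le> (1 + (norm x)\<^sup>2) powr (- (al / 2))"
    using assms by (intro powr_mono2') auto
  hence "2 powr (- (al / 2)) * pw al (x - z) * (1 + (norm z)\<^sup>2) powr (- (al / 2)) \<le> pw al x" by (simp add: pw_def powr_mult mult.assoc)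
  hence "(2 powr (al / 2) * (1 + (norm z)\<^sup>2) powr (al / 2)) * (2 powr (- (al / 2)) * pw al (x - z) * (1 + (norm z)\<^sup>2) powr (- (al / 2)))
      \<le> (2 powr (al / 2) * (1 + (norm z)\<^sup>2) powr (al / 2)) * pw al x" by (intro mult_left_mono) auto
  moreover have "(2 powr (al / 2) * (1 + (norm z)\<^sup>2) powr (al / 2)) * (2 powr (- (al / 2)) * pw al (x - z) * (1 + (norm z)\<^sup>2) powr (- (al / 2)))
     = pw al (x - z)" by (simp add: powr_minus field_simps)
  ultimately show "pw al (x - z) \<le> 2 powr (al / 2) * (1 + (norm z)\<^sup>2) powr (al / 2) * pw al x" by simp
  have "(2 * ((1 + (norm x)\<^sup>2) * (1 + (norm z)\<^sup>2))) powr (- (al / 2)) \<le> (1 + (norm (x - z))\<^sup>2) powr (- (al / 2))"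
    using assms peetre[of x z] by (intro powr_mono2') auto
  thus "2 powr (- (al / 2)) * pw al x * pw al z \<le> pw al (x - z)" by (simp add: pw_def powr_mult mult.assoc)
qed

text \<open>By Peetre's inequality the weight at \<open>x - z\<close> is the weight at
  \<open>x\<close> times a power of \<open>1 + |z|^2\<close>, which is at most
  \<open>(1 + t) (1 + |z|^2/t)\<close>; the Gaussian absorbs the second factor.\<close>

lemma heat_pw_le:
  assumes "0 \<le> al"
  obtains C where "0 < C" "\<And>t x. 0 < t \<Longrightarrow> heat t (pw al) (x::'a::euclidean_space) \<le> C * (1 + t) powr (al / 2) * pw al x"
proof -
  obtain C where C: "0 < C" "\<And>t z. 0 < t \<Longrightarrow> (1 + (norm (z::'a))\<^sup>2 / t) powr (al / 2) * hk t z \<le> C * hk (2 * t) z"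
    using hk_moment_bound[of "al / 2"] assms by auto
  have "heat t (pw al) x \<le> (2 powr (al / 2) * C) * (1 + t) powr (al / 2) * pw al x" if t: "0 < t" for t and x :: 'a
  proof -
    let ?k = "2 powr (al / 2) * pw al x * (1 + t) powr (al / 2) * C"
    have "heat t (pw al) x \<le> (LBINT z. ?k * hk (2 * t) (z::'a))" unfolding heat_def
    proof (rule integral_mono)
      show "integrable lborel (\<lambda>z. pw al (x - z) * hk t z)" by (rule heat_integrable[where B=1]) (use t pw_le_1[OF assms] in auto)
      show "integrable lborel (\<lambda>z. ?k * hk (2 * t) (z::'a))" using t by (simp add: integrable_hk)
      fix z :: 'a
      have "1 + (norm z)\<^sup>2 \<le> (1 + t) * (1 + (norm z)\<^sup>2 / t)" using t by (simp add: field_simps)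
      hence "(1 + (norm z)\<^sup>2) powr (al / 2) \<le> ((1 + t) * (1 + (norm z)\<^sup>2 / t)) powr (al / 2)" using assms by (intro powr_mono2) auto
      also have "\<dots> = (1 + t) powr (al / 2) * (1 + (norm z)\<^sup>2 / t) powr (al / 2)" by (rule powr_mult)
      finally have 1: "(1 + (norm z)\<^sup>2) powr (al / 2) * hk t z \<le> (1 + t) powr (al / 2) * (1 + (norm z)\<^sup>2 / t) powr (al / 2) * hk t z"
        by (intro mult_right_mono) auto
      also have "\<dots> \<le> (1 + t) powr (al / 2) * (C * hk (2 * t) z)"
        using C(2)[OF t, of z] by (simp only: mult.assoc, intro mult_left_mono) auto
      finally have 2: "(1 + (norm z)\<^sup>2) powr (al / 2) * hk t z \<le> (1 + t) powr (al / 2) * (C * hk (2 * t) z)" .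
      have "pw al (x - z) * hk t z \<le> (2 powr (al / 2) * (1 + (norm z)\<^sup>2) powr (al / 2) * pw al x) * hk t z"
        by (intro mult_right_mono pw_shift assms) auto
      also have "\<dots> = (2 powr (al / 2) * pw al x) * ((1 + (norm z)\<^sup>2) powr (al / 2) * hk t z)" by (simp only: mult_ac)
      also have "\<dots> \<le> (2 powr (al / 2) * pw al x) * ((1 + t) powr (al / 2) * (C * hk (2 * t) z))" using 2 by (intro mult_left_mono) auto
      finally show "pw al (x - z) * hk t z \<le> ?k * hk (2 * t) z" by (simp only: mult_ac)
    qed
    thus ?thesis using t by (simp add: integral_hk mult_ac)
  qed
  thus ?thesis using that[of "2 powr (al / 2) * C"] C(1) by simp
qed

text \<open>The other half of Peetre's inequality, integrated. It keeps the smoothed density of the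
  barrier comparable with the weight from below.\<close>

lemma heat_pw_ge:
  assumes "0 \<le> al"
  obtains c where "0 < c" "\<And>x. c * pw al (x::'a::euclidean_space) \<le> heat 1 (pw al) x"
proof -
  let ?I = "\<integral>z. pw al (z::'a) * hk 1 z \<partial>lborel"
  have i: "integrable lborel (\<lambda>z. pw al (x - z) * hk 1 z)" for x :: 'a by (rule heat_integrable[where B=1]) (use pw_le_1[OF assms] in auto)
  have i0: "integrable lborel (\<lambda>z. pw al (z::'a) * hk 1 z)" using i[of 0] by (simp add: pw_def)
  have "?I \<noteq> 0"
  proof
    assume "?I = 0"
    hence "AE z in lborel. pw al (z::'a) * hk 1 z = 0" using i0 by (subst (asm) integral_nonneg_eq_0_iff_AE) auto
    moreover have "pw al (z::'a) * hk 1 z \<noteq> 0" for z by (simp add: hk_def)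
    ultimately have "AE z in (lborel :: 'a measure). False" by simp
    hence "emeasure (lborel :: 'a measure) UNIV = 0" by (simp add: AE_iff_measurable[OF _ refl])
    thus False by simp
  qed
  moreover have "0 \<le> ?I" by (intro integral_nonneg_AE) auto
  ultimately have I: "0 < ?I" by linarith
  have "2 powr (- (al / 2)) * ?I * pw al x \<le> heat 1 (pw al) x" for x :: 'a
  proof -
    have "(LBINT z. (2 powr (- (al / 2)) * pw al x) * (pw al (z::'a) * hk 1 z)) \<le> heat 1 (pw al) x" unfolding heat_def
    proof (rule integral_mono)
      fix z :: 'a
      have "2 powr (- (al / 2)) * pw al x * pw al z * hk 1 z \<le> pw al (x - z) * hk 1 z" by (intro mult_right_mono pw_shift assms) auto
      thus "(2 powr (- (al / 2)) * pw al x) * (pw al z * hk 1 z) \<le> pw al (x - z) * hk 1 z" by (simp only: mult_ac)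
    qed (use i i0 in auto)
    thus ?thesis unfolding integral_mult_right_zero by (simp only: mult_ac)
  qed
  thus ?thesis using that[of "2 powr (- (al / 2)) * ?I"] I by simp
qed

text \<open>For \<open>|u| <= sqrt t\<close> the Gaussian is at most \<open>t powr (-1/2)\<close>
  and \<open>|u| powr (-th)\<close> is integrable because \<open>th < 1\<close>; for larger
  \<open>|u|\<close> the weight is at most \<open>t powr (-th/2)\<close> and the Gaussian has mass
  1. Both parts scale alike.\<close>

lemma pw1_heat_bound:
  fixes th :: real
  assumes th: "0 < th" "th < 1"
  obtains C where "0 < C"
    "\<And>t x. 0 < t \<Longrightarrow> (\<integral>\<^sup>+y. ennreal ((1 + (x - y)\<^sup>2) powr (- (th / 2)) * normal_density 0 (sqrt (2 * t)) y) \<partial>lborel)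
        \<le> ennreal (C * t powr (- (th / 2)))"
proof -
  define C where "C = 2 / (1 - th) + 1"
  have C: "0 < C" using th by (simp add: C_def add_pos_pos)
  have main: "(\<integral>\<^sup>+y. ennreal ((1 + (x - y)\<^sup>2) powr (- (th / 2)) * normal_density 0 (sqrt (2 * t)) y) \<partial>lborel)
        \<le> ennreal (C * t powr (- (th / 2)))" if t: "0 < t" for t x :: real
  proof -
    let ?n = "normal_density 0 (sqrt (2 * t))"
    have nle: "?n y \<le> t powr (- (1/2))" for y
    proof -
      have "?n y \<le> 1 / sqrt (4 * pi * t)"
      proof -
        have "?n y = 1 / sqrt (4 * pi * t) * exp (- (y\<^sup>2 / (4 * t)))" using t by (simp add: normal_density_def)
        also have "\<dots> \<le> 1 / sqrt (4 * pi * t) * 1" using t by (intro mult_left_mono) auto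
        finally show ?thesis by simp
      qed
      also have "\<dots> \<le> 1 / sqrt t"
      proof -
        have "1 * t \<le> (4 * pi) * t" using t pi_gt3 by (intro mult_right_mono) auto
        thus ?thesis using t by (intro divide_left_mono) (auto simp: mult_pos_pos)
      qed
      also have "\<dots> = t powr (- (1/2))" using t by (simp add: powr_minus_divide powr_half_sqrt)
      finally show ?thesis .
    qed
    \<comment> \<open>Supported on the right half-line; the mirror image \<open>?g (- u)\<close>
      covers the other side.\<close>
    let ?g = "\<lambda>u. indicator {0..sqrt t} u * u powr (- th)"
    have le: "(1 + u\<^sup>2) powr (- (th / 2)) * m \<le> t powr (- (1/2)) * (?g u + ?g (- u)) + t powr (- (th / 2)) * m"
      if m: "0 \<le> m" "m \<le> t powr (- (1/2))" and u0: "u \<noteq> 0" for u m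
    proof -
      have sq: "(u\<^sup>2) powr (- (th / 2)) = \<bar>u\<bar> powr (- th)" 
      proof -
        have "u\<^sup>2 = \<bar>u\<bar> powr 2" using u0 by (simp add: powr_numeral)
        thus ?thesis by (simp only: powr_powr) simp
      qed
      have 1: "(1 + u\<^sup>2) powr (- (th / 2)) \<le> \<bar>u\<bar> powr (- th)" unfolding sq[symmetric] using th u0 by (intro powr_mono2') auto
      show ?thesis
      proof (cases "\<bar>u\<bar> \<le> sqrt t")
        case True
        have "\<bar>u\<bar> powr (- th) \<le> ?g u + ?g (- u)" using True u0 by (cases "0 \<le> u") (auto simp: indicator_def)
        hence "(1 + u\<^sup>2) powr (- (th / 2)) * m \<le> (?g u + ?g (- u)) * t powr (- (1/2))" using 1 m by (intro mult_mono) auto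
        moreover have "0 \<le> t powr (- (th / 2)) * m" using m by simp
        ultimately show ?thesis by (simp add: mult.commute)
      next
        case False
        hence "(sqrt t)\<^sup>2 \<le> \<bar>u\<bar>\<^sup>2" using t by (intro power_mono) auto
        hence "t \<le> u\<^sup>2" using t by simp
        hence "(1 + u\<^sup>2) powr (- (th / 2)) \<le> t powr (- (th / 2))" using th t by (intro powr_mono2') auto
        hence "(1 + u\<^sup>2) powr (- (th / 2)) * m \<le> t powr (- (th / 2)) * m" using m by (intro mult_right_mono) auto
        thus ?thesis by (simp add: add_increasing)
      qed
    qed
    have "(\<integral>\<^sup>+y. ennreal ((1 + (x - y)\<^sup>2) powr (- (th / 2)) * ?n y) \<partial>lborel)
      = (\<integral>\<^sup>+u. ennreal ((1 + u\<^sup>2) powr (- (th / 2)) * ?n (x - u)) \<partial>lborel)"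
      by (subst (2) lborel_reflect[of x], subst nn_integral_distr) auto
    also have "\<dots> \<le> (\<integral>\<^sup>+u. ennreal (t powr (- (1/2))) * (ennreal (?g u) + ennreal (?g (- u))) + ennreal (t powr (- (th / 2))) * ennreal (?n (x - u)) \<partial>lborel)"
    proof (rule nn_integral_mono_AE)
      have "AE u in lborel. u \<noteq> (0::real)" by (rule AE_lborel_singleton)
      thus "AE u in lborel. ennreal ((1 + u\<^sup>2) powr (- (th / 2)) * ?n (x - u)) \<le>
          ennreal (t powr (- (1/2))) * (ennreal (?g u) + ennreal (?g (- u))) + ennreal (t powr (- (th / 2))) * ennreal (?n (x - u))"
      proof (rule AE_mp, intro AE_I2 impI)
        fix u :: real assume "u \<noteq> 0"
        hence "ennreal ((1 + u\<^sup>2) powr (- (th / 2)) * ?n (x - u)) \<le>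
           ennreal (t powr (- (1/2)) * (?g u + ?g (- u)) + t powr (- (th / 2)) * ?n (x - u))"
          by (intro ennreal_leI le nle) (auto simp: normal_density_nonneg)
        also have "\<dots> = ennreal (t powr (- (1/2))) * (ennreal (?g u) + ennreal (?g (- u))) + ennreal (t powr (- (th / 2))) * ennreal (?n (x - u))"
          by (simp add: ennreal_mult ennreal_plus normal_density_nonneg)
        finally show "ennreal ((1 + u\<^sup>2) powr (- (th / 2)) * ?n (x - u)) \<le> \<dots>" .
      qed
    qed
    also have "\<dots> = ennreal (t powr (- (1/2))) * ((\<integral>\<^sup>+u. ?g u \<partial>lborel) + (\<integral>\<^sup>+u. ?g (- u) \<partial>lborel)) + ennreal (t powr (- (th / 2))) * (\<integral>\<^sup>+u. ?n (x - u) \<partial>lborel)"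
      by (simp add: nn_integral_add nn_integral_cmult)
    also have "(\<integral>\<^sup>+u. ?n (x - u) \<partial>lborel) = (\<integral>\<^sup>+u. ?n u \<partial>lborel)"
      by (subst (2) lborel_reflect[of x], subst nn_integral_distr) auto
    also have "(\<integral>\<^sup>+u. ?n u \<partial>lborel) = 1"
      using t by (subst nn_integral_eq_integral) (auto simp: integral_normal_density integrable_normal_density normal_density_nonneg)
    also have "(\<integral>\<^sup>+u. ?g (- u) \<partial>lborel) = (\<integral>\<^sup>+u. ?g u \<partial>lborel)"
      using nn_integral_distr[of "\<lambda>u. 0 - u" lborel borel "\<lambda>u. ennreal (?g u)"] lborel_reflect[of "0::real"] by simp
    also have "(\<integral>\<^sup>+u. ?g u \<partial>lborel) = ennreal (sqrt t powr (1 - th) / (1 - th))"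
    proof -
      have "((\<lambda>u. u powr (- th)) has_integral (sqrt t powr (- th + 1) / (- th + 1))) {0..sqrt t}"
        using th t by (intro has_integral_powr_from_0) auto
      from nn_integral_has_integral_lebesgue[OF _ this] show ?thesis by simp
    qed
    also have "sqrt t powr (1 - th) = t powr ((1 - th) / 2)" using t by (simp add: powr_powr flip: powr_half_sqrt)
    also have "ennreal (t powr (- (1/2))) * (ennreal (t powr ((1 - th) / 2) / (1 - th)) + ennreal (t powr ((1 - th) / 2) / (1 - th))) + ennreal (t powr (- (th / 2))) * 1
       = ennreal (t powr (- (1/2)) * (2 * (t powr ((1 - th) / 2) / (1 - th))) + t powr (- (th / 2)))"
    proof -
      have *: "ennreal p * (ennreal q + ennreal q) + ennreal r * 1 = ennreal (p * (2 * q) + r)"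
        if "0 \<le> p" "0 \<le> q" "0 \<le> r" for p q r
      proof -
        have "ennreal q + ennreal q = ennreal (2 * q)" using that by (metis ennreal_plus mult_2)
        moreover have "ennreal p * ennreal (2 * q) = ennreal (p * (2 * q))" using that by (simp add: ennreal_mult)
        moreover have "ennreal (p * (2 * q) + r) = ennreal (p * (2 * q)) + ennreal r" using that by (intro ennreal_plus) auto
        ultimately show ?thesis by simp
      qed
      show ?thesis using th by (intro *) auto
    qed
    also have "t powr (- (1/2)) * (2 * (t powr ((1 - th) / 2) / (1 - th))) + t powr (- (th / 2)) = C * t powr (- (th / 2))"
    proof -
      have "t powr (- (1/2)) * t powr ((1 - th) / 2) = t powr (- (th / 2))"
        unfolding powr_add[symmetric] by (rule arg_cong[where f="(powr) t"]) (simp add: field_simps)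
      moreover have "t powr (- (1/2)) * (2 * (t powr ((1 - th) / 2) / (1 - th))) = 2 / (1 - th) * (t powr (- (1/2)) * t powr ((1 - th) / 2))" by simp
      ultimately show ?thesis by (simp only: C_def distrib_right mult_1)
    qed
    finally show ?thesis by simp
  qed
  show ?thesis by (rule that[OF C main])
qed

text \<open>Since \<open>1 + |x|^2\<close> dominates the same expression in each coordinate, the
  weight is at most a product of one-dimensional weights of exponent \<open>al / N < 1\<close>, and
  the Gaussian integral factorises.\<close>

lemma heat_pw_decay:
  assumes al: "0 < al" "al < real DIM('a)"
  obtains C where "0 < C" "\<And>t x. 0 < t \<Longrightarrow> heat t (pw al) (x::'a::euclidean_space) \<le> C * t powr (- (al / 2))"
proof -
  define th where "th = al / real DIM('a)"
  have th: "0 < th" "th < 1" using al by (auto simp: th_def)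
  have thN: "th / 2 * real DIM('a) = al / 2" by (simp add: th_def)
  obtain C where C: "0 < C"
    "\<And>t x. 0 < t \<Longrightarrow> (\<integral>\<^sup>+y. ennreal ((1 + (x - y)\<^sup>2) powr (- (th / 2)) * normal_density 0 (sqrt (2 * t)) y) \<partial>lborel)
        \<le> ennreal (C * t powr (- (th / 2)))" using pw1_heat_bound[OF th] by blast
  have "heat t (pw al) x \<le> C ^ DIM('a) * t powr (- (al / 2))" if t: "0 < t" for t and x :: 'a
  proof -
    let ?n = "normal_density 0 (sqrt (2 * t))"
    have pwle: "pw al y \<le> (\<Prod>b\<in>Basis. (1 + (y \<bullet> b)\<^sup>2) powr (- (th / 2)))" for y :: 'a
    proof -
      have "pw al y = (\<Prod>b\<in>(Basis::'a set). (1 + (norm y)\<^sup>2) powr (- (th / 2)))"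
      proof -
        have "- (th / 2) * real DIM('a) = - (al / 2)" using thN by simp
        thus ?thesis by (simp only: pw_def prod_constant powr_realpow[symmetric] powr_gt_zero one_plus_sq_neq_0 powr_powr not_False_eq_True)
      qed
      also have "\<dots> \<le> (\<Prod>b\<in>Basis. (1 + (y \<bullet> b)\<^sup>2) powr (- (th / 2)))"
      proof (intro prod_mono conjI powr_mono2')
        fix b :: 'a assume b: "b \<in> Basis"
        have "\<bar>y \<bullet> b\<bar>\<^sup>2 \<le> (norm y)\<^sup>2" using b by (intro power_mono Basis_le_norm) auto
        thus "1 + (y \<bullet> b)\<^sup>2 \<le> 1 + (norm y)\<^sup>2" by simp
        show "0 < 1 + (y \<bullet> b)\<^sup>2" by (simp add: add_pos_nonneg)
      qed (use th in auto)
      finally show ?thesis .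
    qed
    have i: "integrable lborel (\<lambda>z. pw al (x - z) * hk t z)" by (rule heat_integrable[where B=1]) (use t pw_le_1[of al] al in auto)
    have "ennreal (heat t (pw al) x) = (\<integral>\<^sup>+z. ennreal (pw al (x - z) * hk t z) \<partial>lborel)"
      unfolding heat_def using i by (subst nn_integral_eq_integral) auto
    also have "\<dots> \<le> (\<integral>\<^sup>+z. (\<Prod>b\<in>Basis. ennreal ((1 + (x \<bullet> b - z \<bullet> b)\<^sup>2) powr (- (th / 2)) * ?n (z \<bullet> b))) \<partial>lborel)"
    proof (rule nn_integral_mono)
      fix z :: 'a
      have "pw al (x - z) * hk t z \<le> (\<Prod>b\<in>Basis. (1 + ((x - z) \<bullet> b)\<^sup>2) powr (- (th / 2))) * (\<Prod>b\<in>Basis. ?n (z \<bullet> b))"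
        unfolding hk_prod[OF t] by (intro mult_right_mono pwle prod_nonneg) (auto simp: normal_density_nonneg)
      thus "ennreal (pw al (x - z) * hk t z) \<le> (\<Prod>b\<in>Basis. ennreal ((1 + (x \<bullet> b - z \<bullet> b)\<^sup>2) powr (- (th / 2)) * ?n (z \<bullet> b)))"
        by (subst prod_ennreal) (auto simp: normal_density_nonneg inner_diff_left prod.distrib intro!: ennreal_leI)
    qed
    also have "\<dots> = (\<Prod>b\<in>(Basis::'a set). (\<integral>\<^sup>+y. ennreal ((1 + (x \<bullet> b - y)\<^sup>2) powr (- (th / 2)) * ?n y) \<partial>lborel))"
      by (rule nn_integral_lborel_prod[where f="\<lambda>b y. ennreal ((1 + (x \<bullet> b - y)\<^sup>2) powr (- (th / 2)) * ?n y)"]) auto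
    also have "\<dots> \<le> (\<Prod>b\<in>(Basis::'a set). ennreal (C * t powr (- (th / 2))))"
    proof -
      have "(\<Prod>b\<in>S. (\<integral>\<^sup>+y. ennreal ((1 + (x \<bullet> b - y)\<^sup>2) powr (- (th / 2)) * ?n y) \<partial>lborel))
        \<le> (\<Prod>b\<in>S. ennreal (C * t powr (- (th / 2))))" if "finite S" for S :: "'a set"
        using that by induction (auto intro!: mult_mono C(2)[OF t])
      thus ?thesis by simp
    qed
    also have "\<dots> = ennreal ((C * t powr (- (th / 2))) ^ DIM('a))" using C(1) t by (simp add: ennreal_power)
    also have "(C * t powr (- (th / 2))) ^ DIM('a) = C ^ DIM('a) * t powr (- (al / 2))"
    proof -
      have "- (th / 2) * real DIM('a) = - (al / 2)" using thN by simp
      hence "(t powr (- (th / 2))) ^ DIM('a) = t powr (- (al / 2))" using t by (simp only: powr_realpow[symmetric] powr_gt_zero powr_powr)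
      thus ?thesis by (simp add: power_mult_distrib)
    qed
    finally show ?thesis using C(1) by (simp add: ennreal_le_iff)
  qed
  thus ?thesis using that[of "C ^ DIM('a)"] C(1) by simp
qed

text \<open>Interpolation: one bound keeps the full spatial decay but grows in time, the other
  decays in time but forgets space. Their geometric mean with parameter \<open>la\<close> keeps some
  of both.\<close>

lemma heat_pw_dom:
  assumes al: "0 < al" "al < real DIM('a)" "al \<le> be" and la: "0 < la" "la < 1" and ka: "0 \<le> (1 - la) * al - la * be"
  obtains C where "0 < C" "\<And>t x. 0 < t \<Longrightarrow>
     heat t (pw be) (x::'a::euclidean_space) \<le> C * (1 + t) powr (- (((1 - la) * al - la * be) / 2)) * pw (la * be) x"
proof -
  have al0: "0 < al" "0 < be" using al by simp_all
  obtain C1 where C1: "0 < C1" "\<And>t x. 0 < t \<Longrightarrow> heat t (pw be) (x::'a) \<le> C1 * (1 + t) powr (be / 2) * pw be x"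
    using heat_pw_le[of be] al0 by (metis less_imp_le)
  obtain C2 where C2: "0 < C2" "\<And>t x. 0 < t \<Longrightarrow> heat t (pw al) (x::'a) \<le> C2 * t powr (- (al / 2))"
    using heat_pw_decay[where 'a='a, of al] al0 al by metis
  \<comment> \<open>The decay in time is available only for exponents below the dimension; a larger
    \<open>be\<close> goes through the weight of order \<open>al\<close>, which dominates
    it.\<close>
  have C2: "0 < C2" "\<And>t x. 0 < t \<Longrightarrow> heat t (pw be) (x::'a) \<le> C2 * t powr (- (al / 2))"
  proof -
    fix t and x :: 'a assume "0 < (t::real)"
    hence "heat t (pw be) x \<le> heat t (pw al) x"
      using al0 al pw_le_1[of al] pw_le_1[of be] by (intro heat_mono[where B=1 and B'=1] pw_antimono) auto
    thus "heat t (pw be) x \<le> C2 * t powr (- (al / 2))" using C2(2)[OF \<open>0 < t\<close>, of x] by linarith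
  qed (rule C2(1))
  let ?ka = "((1 - la) * al - la * be) / 2"
  define C where "C = C1 * 2 powr (be / 2) * 2 powr ?ka + (C1 * 2 powr (be / 2)) powr la * C2 powr (1 - la) * 2 powr ?ka"
  have "heat t (pw be) x \<le> C * (1 + t) powr (- ?ka) * pw (la * be) x" if t: "0 < t" for t and x :: 'a
  proof -
    have h0: "0 \<le> heat t (pw be) x" unfolding heat_def by (intro integral_nonneg_AE) auto
    have ka: "0 \<le> ?ka" using ka by simp
    show ?thesis
    proof (cases "t \<le> 1")
      case True
      have "heat t (pw be) x \<le> C1 * (1 + t) powr (be / 2) * pw be x" using C1(2)[OF t] .
      also have "\<dots> \<le> C1 * 2 powr (be / 2) * pw (la * be) x"
        using True t al0 la C1 mult_left_le_one_le[of be la] by (intro mult_mono powr_mono2 pw_antimono) auto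
      also have "\<dots> \<le> C1 * 2 powr (be / 2) * (2 powr ?ka * (1 + t) powr (- ?ka)) * pw (la * be) x"
      proof -
        have "2 powr (- ?ka) \<le> (1 + t) powr (- ?ka)" using True t ka by (intro powr_mono2') auto
        hence "2 powr ?ka * 2 powr (- ?ka) \<le> 2 powr ?ka * (1 + t) powr (- ?ka)" by (intro mult_left_mono) auto
        moreover have "2 powr ?ka * 2 powr (- ?ka) = (1::real)" by (simp flip: powr_add)
        ultimately have "1 \<le> 2 powr ?ka * (1 + t) powr (- ?ka)" by linarith
        hence "(C1 * 2 powr (be / 2)) * 1 \<le> (C1 * 2 powr (be / 2)) * (2 powr ?ka * (1 + t) powr (- ?ka))" using C1 by (intro mult_left_mono) auto
        thus ?thesis by (intro mult_right_mono) auto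
      qed
      also have "\<dots> \<le> C * (1 + t) powr (- ?ka) * pw (la * be) x"
        unfolding C_def using C1 C2 by (intro mult_right_mono) (auto simp: algebra_simps)
      finally show ?thesis .
    next
      case False
      hence t1: "1 \<le> t" by simp
      let ?h = "heat t (pw be) x"
      have A: "?h \<le> C1 * 2 powr (be / 2) * t powr (be / 2) * pw be x"
      proof -
        have "(1 + t) powr (be / 2) \<le> (2 * t) powr (be / 2)" using t1 al0 by (intro powr_mono2) auto
        hence "(1 + t) powr (be / 2) \<le> 2 powr (be / 2) * t powr (be / 2)" by (simp add: powr_mult)
        hence "C1 * (1 + t) powr (be / 2) * pw be x \<le> C1 * (2 powr (be / 2) * t powr (be / 2)) * pw be x"
          using C1 by (intro mult_right_mono mult_left_mono) auto
        thus ?thesis using C1(2)[OF t, of x] by (simp add: mult.assoc)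
      qed
      have "?h = ?h powr la * ?h powr (1 - la)" using h0 by (simp flip: powr_add)
      also have "\<dots> \<le> (C1 * 2 powr (be / 2) * t powr (be / 2) * pw be x) powr la * (C2 * t powr (- (al / 2))) powr (1 - la)"
        using A C2(2)[OF t, of x] h0 la by (intro mult_mono powr_mono2) auto
      also have "\<dots> = ((C1 * 2 powr (be / 2)) powr la * C2 powr (1 - la)) * (t powr (be / 2 * la) * t powr (- (al / 2) * (1 - la))) * pw be x powr la"
        by (simp only: powr_mult powr_powr mult_ac)
      also have "t powr (be / 2 * la) * t powr (- (al / 2) * (1 - la)) = t powr (- ?ka)"
      proof -
        have "be / 2 * la + (- (al / 2) * (1 - la)) = - ?ka" by (simp add: field_simps)
        thus ?thesis by (simp only: powr_add[symmetric])
      qed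
      also have "pw be x powr la = pw (la * be) x" unfolding pw_def powr_powr by (simp add: mult.commute)
      also have "((C1 * 2 powr (be / 2)) powr la * C2 powr (1 - la)) * t powr (- ?ka) * pw (la * be) x
        \<le> ((C1 * 2 powr (be / 2)) powr la * C2 powr (1 - la)) * (2 powr ?ka * (1 + t) powr (- ?ka)) * pw (la * be) x"
      proof (intro mult_right_mono mult_left_mono)
        have "(2 * t) powr (- ?ka) \<le> (1 + t) powr (- ?ka)" using t1 ka by (intro powr_mono2') auto
        hence "2 powr ?ka * (2 powr (- ?ka) * t powr (- ?ka)) \<le> 2 powr ?ka * (1 + t) powr (- ?ka)"
          by (intro mult_left_mono) (auto simp: powr_mult)
        moreover have "2 powr ?ka * 2 powr (- ?ka) = (1::real)" by (simp flip: powr_add)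
        ultimately show "t powr (- ?ka) \<le> 2 powr ?ka * (1 + t) powr (- ?ka)" by (simp add: mult.assoc[symmetric])
      qed auto
      also have "\<dots> \<le> C * (1 + t) powr (- ?ka) * pw (la * be) x"
      proof -
        have "((C1 * 2 powr (be / 2)) powr la * C2 powr (1 - la)) * 2 powr ?ka \<le> C" unfolding C_def using C1 by simp
        hence "((C1 * 2 powr (be / 2)) powr la * C2 powr (1 - la)) * 2 powr ?ka * ((1 + t) powr (- ?ka) * pw (la * be) x)
           \<le> C * ((1 + t) powr (- ?ka) * pw (la * be) x)" by (intro mult_right_mono) auto
        thus ?thesis by (simp only: mult.assoc)
      qed
      finally show ?thesis .
    qed
  qed
  moreover have "0 < C" unfolding C_def using C1 by (intro add_pos_nonneg) auto
  ultimately show ?thesis using that by blast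
qed

section \<open>Power weights on the half-line\<close>

definition ppw :: "real \<Rightarrow> real \<Rightarrow> real" where
  "ppw p q = indicator {0<..} q * q powr p"

lemma ppw_nonneg [simp]: "0 \<le> ppw p q"
  by (simp add: ppw_def)

lemma ppw_measurable [measurable]: "ppw p \<in> bmeas"
  unfolding ppw_def by measurable

lemma ppw_nonpos [simp]: "q \<le> 0 \<Longrightarrow> ppw p q = 0"
  by (simp add: ppw_def)

lemma ppw_pos: "0 < q \<Longrightarrow> ppw p q = q powr p"
  by (simp add: ppw_def)

lemma integrable_ppw_split:
  fixes f :: "real \<Rightarrow> real"
  assumes f [measurable]: "f \<in> bmeas"
    and a: "-1 < a" and b: "b < -1" and K: "0 \<le> K"
    and le1: "\<And>q. 0 < q \<Longrightarrow> q \<le> 1 \<Longrightarrow> \<bar>f q\<bar> \<le> K * q powr a"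
    and le2: "\<And>q. 1 \<le> q \<Longrightarrow> \<bar>f q\<bar> \<le> K * q powr b"
    and le0: "\<And>q. q \<le> 0 \<Longrightarrow> f q = 0"
  shows "integrable lborel f"
proof (rule lint_bound)
  have "((\<lambda>q. q powr a) has_integral (1 powr (a + 1) / (a + 1))) {0..1}" using a by (intro has_integral_powr_from_0) auto
  from nn_integral_has_integral_lebesgue[OF _ this]
  have 1: "integrable lborel (\<lambda>q. indicator {0..1} q * q powr a)" by (intro integrableI_nonneg) auto
  have "((\<lambda>q. q powr b) has_integral (- (1 powr (b + 1) / (b + 1)))) {1..}" using has_integral_powr_to_inf[of b 1] b by simp
  from nn_integral_has_integral_lebesgue[OF _ this]
  have 2: "integrable lborel (\<lambda>q. indicator {1..} q * q powr b)" by (intro integrableI_nonneg) auto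
  show "integrable lborel (\<lambda>q. K * (indicator {0..1} q * q powr a + indicator {1..} q * q powr b))"
    using 1 2 by (intro integrable_mult_right lint_add)
  show "AE q in lborel. norm (f q) \<le> norm (K * (indicator {0..1} q * q powr a + indicator {1..} q * q powr b))"
  proof (intro AE_I2)
    fix q :: real
    consider "q \<le> 0" | "0 < q" "q \<le> 1" | "1 < q" by linarith
    thus "norm (f q) \<le> norm (K * (indicator {0..1} q * q powr a + indicator {1..} q * q powr b))"
    proof cases
      case 2
      have "\<bar>f q\<bar> \<le> K * q powr a" using le1 2 by simp
      also have "\<dots> \<le> K * (indicator {0..1} q * q powr a + indicator {1..} q * q powr b)" using 2 K by (intro mult_left_mono) auto
      finally show ?thesis using K by simp
    next
      case 3
      have "\<bar>f q\<bar> \<le> K * q powr b" using le2 3 by simp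
      thus ?thesis using 3 K by simp
    qed (simp add: le0)
  qed
qed simp

lemma integrable_ppw_decay:
  assumes "-1 < a" "a < k - 1" "0 \<le> k"
  shows "integrable lborel (\<lambda>q. ppw a q * (1 + q) powr (- k))"
proof (rule integrable_ppw_split[where a=a and b="a - k" and K=1])
  fix q :: real assume q: "0 < q" "q \<le> 1"
  have "(1 + q) powr (- k) \<le> 1 powr (- k)" using assms q by (intro powr_mono2') auto
  hence "q powr a * (1 + q) powr (- k) \<le> q powr a * 1" by (intro mult_left_mono) auto
  thus "\<bar>ppw a q * (1 + q) powr (- k)\<bar> \<le> 1 * q powr a" using q by (simp add: ppw_pos)
next
  fix q :: real assume q: "1 \<le> q"
  have "(1 + q) powr (- k) \<le> q powr (- k)" using assms q by (intro powr_mono2') auto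
  hence "q powr a * (1 + q) powr (- k) \<le> q powr a * q powr (- k)" by (intro mult_left_mono) auto
  also have "\<dots> = q powr (a - k)" by (simp flip: powr_add)
  finally show "\<bar>ppw a q * (1 + q) powr (- k)\<bar> \<le> 1 * q powr (a - k)" using q by (simp add: ppw_pos)
qed (use assms in auto)

lemma integrable_ppw_min:
  assumes "0 < s" "s < 1"
  shows "integrable lborel (\<lambda>t. ppw (-1 - s) t * min 1 t)"
proof (rule integrable_ppw_split[where a="- s" and b="-1 - s" and K=1])
  fix q :: real assume q: "0 < q" "q \<le> 1"
  have "q powr (-1 - s) * q = q powr (- s)" using q powr_add[of q "-1 - s" 1] by simp
  thus "\<bar>ppw (-1 - s) q * min 1 q\<bar> \<le> 1 * q powr (- s)" using q by (simp add: ppw_pos)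
qed (use assms in \<open>auto simp: ppw_pos\<close>)

section \<open>The time derivative of the heat flow\<close>

definition dhk :: "real \<Rightarrow> 'a::euclidean_space \<Rightarrow> real" where
  "dhk t x = ((norm x)\<^sup>2 / (4 * t\<^sup>2) - real DIM('a) / (2 * t)) * hk t x"

lemma dhk_measurable [measurable]:
  assumes [measurable]: "f \<in> borel_measurable M" "g \<in> borel_measurable M"
  shows "(\<lambda>w. dhk (f w) (g w :: 'a::euclidean_space)) \<in> borel_measurable M" unfolding dhk_def by measurable

lemma hk_deriv:
  assumes t: "0 < t" shows "((\<lambda>t. hk t x) has_real_derivative dhk t x) (at t)"
proof -
  let ?N = "- (real DIM('a) / 2)"
  have 1: "((\<lambda>t. (4 * pi * t) powr ?N) has_real_derivative (?N * (4 * pi * t) powr (?N - 1) * (4 * pi))) (at t)"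
    using t by (auto intro!: derivative_eq_intros)
  have 2: "((\<lambda>t. exp (- (norm x)\<^sup>2 / (4 * t))) has_real_derivative (exp (- (norm x)\<^sup>2 / (4 * t)) * ((norm x)\<^sup>2 / (4 * t\<^sup>2)))) (at t)"
    using t by (auto intro!: derivative_eq_intros simp: power2_eq_square)
  have 3: "?N * (4 * pi * t) powr (?N - 1) * (4 * pi) = ?N / t * (4 * pi * t) powr ?N" using t by (simp add: powr_diff)
  have "?N / t * (4 * pi * t) powr ?N * exp (- (norm x)\<^sup>2 / (4 * t)) + exp (- (norm x)\<^sup>2 / (4 * t)) * ((norm x)\<^sup>2 / (4 * t\<^sup>2)) * (4 * pi * t) powr ?N
    = dhk t x" unfolding dhk_def hk_def by (simp add: left_diff_distrib algebra_simps)
  thus ?thesis using DERIV_mult'[OF 1 2] unfolding hk_def 3 by (simp add: algebra_simps)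
qed

text \<open>The bracket in \<open>dhk\<close> is at most a multiple of
  \<open>(1 + |z|^2/t) / t\<close>, and the moment bound absorbs the numerator.\<close>

lemma dhk_bound:
  obtains C where "0 < C" "\<And>t z. 0 < t \<Longrightarrow> \<bar>dhk t (z::'a::euclidean_space)\<bar> \<le> C / t * hk (2 * t) z"
proof -
  obtain C where C: "0 < C" "\<And>t z. 0 < t \<Longrightarrow> (1 + (norm (z::'a))\<^sup>2 / t) powr 1 * hk t z \<le> C * hk (2 * t) z"
    using hk_moment_bound[of 1] by auto
  have "\<bar>dhk t (z::'a)\<bar> \<le> (DIM('a) * C) / t * hk (2 * t) z" if t: "0 < t" for t z
  proof -
    have N: "1 \<le> real DIM('a)" by (simp add: Suc_leI)
    define v where "v = (norm z)\<^sup>2 / t"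
    have v: "0 \<le> v" using t by (simp add: v_def)
    have "(norm z)\<^sup>2 / (4 * t\<^sup>2) - real DIM('a) / (2 * t) = (v / 4 - real DIM('a) / 2) / t"
      using t by (simp add: v_def field_simps power2_eq_square)
    hence "\<bar>(norm z)\<^sup>2 / (4 * t\<^sup>2) - real DIM('a) / (2 * t)\<bar> = \<bar>v / 4 - real DIM('a) / 2\<bar> / t" using t by simp
    also have "\<dots> \<le> (real DIM('a) * (1 + v)) / t"
    proof (rule divide_right_mono)
      have "1 * v \<le> real DIM('a) * v" using N v by (intro mult_right_mono) auto
      thus "\<bar>v / 4 - real DIM('a) / 2\<bar> \<le> real DIM('a) * (1 + v)" using N v by (simp add: distrib_left)
    qed (use t in simp)
    finally have "\<bar>dhk t z\<bar> \<le> (real DIM('a) * (1 + v)) / t * hk t z"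
      unfolding dhk_def abs_mult abs_of_nonneg[OF hk_nonneg] by (rule mult_right_mono) simp
    also have "\<dots> = real DIM('a) / t * ((1 + v) powr 1 * hk t z)" using v by simp
    also have "\<dots> \<le> real DIM('a) / t * (C * hk (2 * t) z)" using C(2)[OF t, of z] t by (intro mult_left_mono) (auto simp: v_def)
    finally show ?thesis by (simp add: mult_ac)
  qed
  thus ?thesis using that[of "DIM('a) * C"] C(1) by simp
qed

definition dheat :: "real \<Rightarrow> ('a::euclidean_space \<Rightarrow> real) \<Rightarrow> 'a \<Rightarrow> real" where
  "dheat t F x = (LBINT z. F (x - z) * dhk t z)"

lemma dheat_measurable [measurable]:
  fixes F :: "'a::euclidean_space \<Rightarrow> real"
  assumes [measurable]: "F \<in> bmeas" "f \<in> borel_measurable M" "g \<in> borel_measurable M"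
  shows "(\<lambda>w. dheat (f w) F (g w)) \<in> borel_measurable M" unfolding dheat_def by measurable

text \<open>Comparison with a majorant \<open>G\<close> rather than with a constant keeps the
  spatial decay of \<open>F\<close> in the derivative.\<close>

lemma dheat_bound:
  obtains C where "0 < C" "\<And>F G B t x. F \<in> bmeas \<Longrightarrow> G \<in> bmeas \<Longrightarrow>
     (\<And>x. \<bar>F x\<bar> \<le> G x) \<Longrightarrow> (\<And>x. G x \<le> B) \<Longrightarrow> 0 < t \<Longrightarrow> \<bar>dheat t F (x::'a::euclidean_space)\<bar> \<le> C / t * heat (2 * t) G x"
proof -
  obtain C where C: "0 < C" "\<And>t z. 0 < t \<Longrightarrow> \<bar>dhk t (z::'a::euclidean_space)\<bar> \<le> C / t * hk (2 * t) z"
    using dhk_bound by blast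
  have "\<bar>dheat t F (x::'a)\<bar> \<le> C / t * heat (2 * t) G x"
    if [measurable]: "F \<in> bmeas" "G \<in> bmeas"
      and FG: "\<And>x. \<bar>F x\<bar> \<le> G x" and GB: "\<And>x. G x \<le> B" and t: "0 < t" for F G B t x
  proof -
    have GB': "\<bar>G x\<bar> \<le> B" for x using FG[of x] GB[of x] by linarith
    have i: "integrable lborel (\<lambda>z. C / t * (G (x - z) * hk (2 * t) z))"
      using t by (intro integrable_mult_right heat_integrable[OF _ GB']) auto
    have le: "\<bar>F (x - z) * dhk t z\<bar> \<le> C / t * (G (x - z) * hk (2 * t) z)" for z
    proof -
      have "\<bar>F (x - z)\<bar> * \<bar>dhk t z\<bar> \<le> G (x - z) * (C / t * hk (2 * t) z)" using FG[of "x - z"] by (intro mult_mono C t) auto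
      thus ?thesis by (simp add: abs_mult mult_ac)
    qed
    have "\<bar>dheat t F x\<bar> \<le> (LBINT z. \<bar>F (x - z) * dhk t z\<bar>)" unfolding dheat_def by (rule integral_abs_bound)
    also have "\<dots> \<le> (LBINT z. C / t * (G (x - z) * hk (2 * t) z))"
    proof (rule integral_mono[OF _ i le])
      show "integrable lborel (\<lambda>z. \<bar>F (x - z) * dhk t z\<bar>)"
      proof (rule lint_bound[OF i])
        have "norm \<bar>F (x - z) * dhk t z\<bar> \<le> norm (C / t * (G (x - z) * hk (2 * t) z))" for z
          using order_trans[OF le[of z] abs_ge_self] by (simp only: real_norm_def abs_idempotent)
        thus "AE z in lborel. norm \<bar>F (x - z) * dhk t z\<bar> \<le> norm (C / t * (G (x - z) * hk (2 * t) z))" by simp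
      qed simp
    qed
    also have "\<dots> = C / t * heat (2 * t) G x" unfolding heat_def by (rule integral_mult_right_zero)
    finally show ?thesis .
  qed
  thus ?thesis using that C(1) by blast
qed

text \<open>The fundamental theorem is applied to the kernel and the integrals are exchanged, so
  that the flow itself need not be differentiated.\<close>

lemma heat_ftc:
  fixes F :: "'a::euclidean_space \<Rightarrow> real"
  assumes [measurable]: "F \<in> bmeas" and b: "\<And>x. \<bar>F x\<bar> \<le> B" and ab: "0 < a" "a \<le> b"
  shows "heat b F x - heat a F x = (LBINT t. indicator {a<..b} t * dheat t F x)"
proof -
  obtain C where C: "0 < C" "\<And>t z. 0 < t \<Longrightarrow> \<bar>dhk t (z::'a::euclidean_space)\<bar> \<le> C / t * hk (2 * t) z"
    using dhk_bound by blast
  have B0: "0 \<le> B" using b[of 0] by linarith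
  have 1: "(LBINT t. dhk t z * indicator {a..b} t) = hk b z - hk a z" for z :: 'a
  proof (rule integral_FTC_Icc_real[OF ab(2)])
    fix t assume "a \<le> t" "t \<le> b"
    hence t: "0 < t" using ab by simp
    thus "((\<lambda>t. hk t z) has_real_derivative dhk t z) (at t)" by (rule hk_deriv)
    show "isCont (\<lambda>t. dhk t z) t" unfolding dhk_def hk_def using t by (intro continuous_intros) auto
  qed
  \<comment> \<open>The fundamental theorem speaks of the closed interval; the half-open one differs
    by a null set and is the form used in \<open>wk\<close>.\<close>
  have ind: "AE t in lborel. indicator {a..b} t = (indicator {a<..b} t :: real)"
    by (rule AE_mp[OF AE_lborel_singleton[of a]]) (auto simp: indicator_def intro!: AE_I2)
  have hk1: "(LBINT t. indicator {a<..b} t * dhk t z) = hk b z - hk a z" for z :: 'a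
    unfolding 1[symmetric] by (rule integral_cong_AE) (use ind in auto)
  have fub: "integrable (lborel \<Otimes>\<^sub>M lborel) (\<lambda>(t, z). indicator {a<..b} t * (F (x - z) * dhk t z))"
  proof (rule integrableI_bounded)
    have "(\<integral>\<^sup>+ w. ennreal (norm (case w of (t, z) \<Rightarrow> indicator {a<..b} t * (F (x - z) * dhk t z))) \<partial>(lborel \<Otimes>\<^sub>M lborel))
      \<le> (\<integral>\<^sup>+ w. ennreal (case w of (t, z) \<Rightarrow> indicator {a<..b} t * (B * C / a) * hk (2 * t) (z::'a)) \<partial>(lborel \<Otimes>\<^sub>M lborel))"
    proof (rule nn_integral_mono, clarify, rule ennreal_leI)
      fix t and z :: 'a
      show "norm (indicator {a<..b} t * (F (x - z) * dhk t z)) \<le> indicator {a<..b} t * (B * C / a) * hk (2 * t) z"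
      proof (cases "t \<in> {a<..b}")
        case True
        hence t: "0 < t" "a \<le> t" using ab by auto
        have "\<bar>F (x - z)\<bar> * \<bar>dhk t z\<bar> \<le> B * (C / t * hk (2 * t) z)" using b[of "x - z"] B0 t by (intro mult_mono C) auto
        also have "\<dots> \<le> B * (C / a * hk (2 * t) z)" using B0 C t ab by (intro mult_left_mono mult_right_mono divide_left_mono) auto
        finally show ?thesis using True by (simp add: abs_mult)
      qed simp
    qed
    also have "\<dots> = (\<integral>\<^sup>+ t. \<integral>\<^sup>+ z. ennreal (indicator {a<..b} t * (B * C / a) * hk (2 * t) (z::'a)) \<partial>lborel \<partial>lborel)"
      by (subst lborel.nn_integral_fst[symmetric]) auto
    also have "\<dots> = (\<integral>\<^sup>+ t. ennreal (B * C / a) * indicator {a<..b} t \<partial>lborel)"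
    proof (rule nn_integral_cong)
      fix t :: real
      show "(\<integral>\<^sup>+ z. ennreal (indicator {a<..b} t * (B * C / a) * hk (2 * t) (z::'a)) \<partial>lborel) = ennreal (B * C / a) * indicator {a<..b} t"
      proof (cases "t \<in> {a<..b}")
        case True
        have "(\<integral>\<^sup>+ z. ennreal (indicator {a<..b} t * (B * C / a) * hk (2 * t) (z::'a)) \<partial>lborel)
          = (\<integral>\<^sup>+ z. ennreal (B * C / a) * ennreal (hk (2 * t) (z::'a)) \<partial>lborel)"
          using True B0 C ab by (intro nn_integral_cong) (simp add: ennreal_mult flip: ennreal_mult)
        also have "\<dots> = ennreal (B * C / a)" using True ab by (simp add: nn_integral_cmult nn_integral_hk)
        finally show ?thesis using True by simp
      qed simp
    qed
    also have "\<dots> < \<infinity>" by (simp add: nn_integral_cmult ab ennreal_mult_less_top)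
    finally show "(\<integral>\<^sup>+ w. ennreal (norm (case w of (t, z) \<Rightarrow> indicator {a<..b} t * (F (x - z) * dhk t z))) \<partial>(lborel \<Otimes>\<^sub>M lborel)) < \<infinity>" .
  qed simp
  have ia: "integrable lborel (\<lambda>z. F (x - z) * hk a z)" and ib: "integrable lborel (\<lambda>z. F (x - z) * hk b z)"
    using ab by (auto intro!: heat_integrable[OF assms(1) b])
  have "heat b F x - heat a F x = (LBINT z. F (x - z) * hk b z - F (x - z) * hk a z)" unfolding heat_def by (rule lint_diff[OF ib ia, symmetric])
  also have "\<dots> = (LBINT z. (LBINT t. indicator {a<..b} t * (F (x - z) * dhk t z)))"
  proof (rule lint_cong[OF refl])
    fix z :: 'a
    have "(LBINT t. indicator {a<..b} t * (F (x - z) * dhk t z)) = (LBINT t. F (x - z) * (indicator {a<..b} t * dhk t z))" by (simp only: mult_ac)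
    also have "\<dots> = F (x - z) * (hk b z - hk a z)" by (simp add: hk1)
    finally show "F (x - z) * hk b z - F (x - z) * hk a z = (LBINT t. indicator {a<..b} t * (F (x - z) * dhk t z))" by (simp add: right_diff_distrib)
  qed
  also have "\<dots> = (LBINT t. (LBINT z. indicator {a<..b} t * (F (x - z) * dhk t z)))" by (rule lborel_pair.Fubini_integral[OF fub])
  also have "\<dots> = (LBINT t. indicator {a<..b} t * dheat t F x)" unfolding dheat_def by simp
  finally show ?thesis .
qed

section \<open>The Weyl identity in one variable\<close>

definition wk :: "real \<Rightarrow> real \<times> real \<Rightarrow> real \<Rightarrow> real" where
  "wk s p th = ppw (s - 1) (fst p) * (ppw (-1 - s) (snd p) * indicator {fst p<..fst p + snd p} th)"

lemma wk_eq: "wk s p th = ppw (s - 1) (fst p) * (ppw (-1 - s) (snd p) * (if fst p < th \<and> th \<le> fst p + snd p then 1 else 0))"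
  by (simp add: wk_def indicator_def)

lemma wk_nonneg [simp]: "0 \<le> wk s p th"
  by (simp add: wk_def)

lemma wk_measurable [measurable]:
  assumes [measurable]: "f \<in> borel_measurable M" "g \<in> borel_measurable M"
  shows "(\<lambda>w. wk s (f w) (g w)) \<in> borel_measurable M"
proof -
  have [measurable]: "fst \<in> borel_measurable (borel :: (real \<times> real) measure)" "snd \<in> borel_measurable (borel :: (real \<times> real) measure)"
    by (auto intro!: cont_bmeas continuous_intros)
  show ?thesis unfolding wk_eq by measurable
qed

text \<open>The product of \<open>Gamma s\<close>, the constant hidden in \<open>pot\<close>, and
  \<open>Gamma (1 - s) / s\<close>, the constant hidden in \<open>Lam\<close>.\<close>

definition wconst :: "real \<Rightarrow> real" where "wconst s = Beta s (1 - s) / s"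

lemma wconst_pos: "0 < s \<Longrightarrow> s < 1 \<Longrightarrow> 0 < wconst s"
  unfolding wconst_def Beta_def by (simp add: Gamma_real_pos)

text \<open>Here \<open>q = fst p\<close> and \<open>t = snd p\<close> are the variables of the
  potential and of the fractional operator, and \<open>th\<close> is a heat time between
  \<open>q\<close> and \<open>q + t\<close>. Integrating out \<open>t\<close> leaves
  \<open>(th - q) powr (-s) / s\<close>; the remaining Beta integral is homogeneous of degree 0 in
  \<open>th\<close>, hence constant.\<close>

lemma nn_wk:
  assumes s: "0 < s" "s < 1" and th: "0 < th"
  shows "(\<integral>\<^sup>+p. wk s p th \<partial>lborel) = wconst s"
proof -
  have inner: "(\<integral>\<^sup>+t. wk s (q, t) th \<partial>lborel) = ennreal (ppw (s - 1) q * ppw (- s) (th - q) / s)" for q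
  proof (cases "0 < q \<and> q < th")
    case True
    have "((\<lambda>t. t powr (-1 - s)) has_integral (- ((th - q) powr (-1 - s + 1) / (-1 - s + 1)))) {th - q..}"
      using has_integral_powr_to_inf[of "-1 - s" "th - q"] s True by simp
    also have "- ((th - q) powr (-1 - s + 1) / (-1 - s + 1)) = (th - q) powr (- s) / s" using s by (simp add: field_simps)
    finally have I: "(\<integral>\<^sup>+t. ennreal (indicator {th - q..} t * t powr (-1 - s)) \<partial>lborel) = ennreal ((th - q) powr (- s) / s)"
      by (intro nn_integral_has_integral_lebesgue) auto
    have "(\<integral>\<^sup>+t. wk s (q, t) th \<partial>lborel) = (\<integral>\<^sup>+t. ennreal (ppw (s - 1) q) * ennreal (indicator {th - q..} t * t powr (-1 - s)) \<partial>lborel)"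
      using True by (intro nn_integral_cong) (auto simp: wk_def ppw_def indicator_def ennreal_mult)
    also have "\<dots> = ennreal (ppw (s - 1) q) * ennreal ((th - q) powr (- s) / s)" by (simp add: nn_integral_cmult I)
    also have "\<dots> = ennreal (ppw (s - 1) q * ppw (- s) (th - q) / s)" using True s by (simp add: ppw_pos flip: ennreal_mult)
    finally show ?thesis .
  next
    case False
    hence "wk s (q, t) th = 0" for t by (auto simp: wk_def indicator_def)
    moreover have "ppw (s - 1) q * ppw (- s) (th - q) = 0" using False by auto
    ultimately show ?thesis by (simp only: div_0 ennreal_0 nn_integral_const mult_zero_left)
  qed
  have beta: "(\<integral>\<^sup>+r. ennreal (ppw (s - 1) r * ppw (- s) (1 - r)) \<partial>lborel) = ennreal (Beta s (1 - s))"
  proof -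
    have "((\<lambda>t. t powr (s - 1) * (1 - t) powr (1 - s - 1)) has_integral Beta s (1 - s)) {0..1}" using s by (intro has_integral_Beta_real) auto
    from nn_integral_has_integral_lebesgue[OF _ this]
    have "(\<integral>\<^sup>+r. ennreal (indicator {0..1} r * (r powr (s - 1) * (1 - r) powr (- s))) \<partial>lborel) = ennreal (Beta s (1 - s))" by simp
    moreover have "(\<integral>\<^sup>+r. ennreal (ppw (s - 1) r * ppw (- s) (1 - r)) \<partial>lborel) = (\<integral>\<^sup>+r. ennreal (indicator {0..1} r * (r powr (s - 1) * (1 - r) powr (- s))) \<partial>lborel)"
      by (intro nn_integral_cong) (auto simp: ppw_def indicator_def)
    ultimately show ?thesis by simp
  qed
  have "(\<integral>\<^sup>+p. wk s p th \<partial>lborel) = (\<integral>\<^sup>+q. \<integral>\<^sup>+t. wk s (q, t) th \<partial>lborel \<partial>lborel)"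
    unfolding lborel_prod[symmetric] by (subst lborel.nn_integral_fst[symmetric]) (auto simp: lborel_prod)
  also have "\<dots> = (\<integral>\<^sup>+q. ennreal (ppw (s - 1) q * ppw (- s) (th - q) / s) \<partial>lborel)" by (simp add: inner)
  also have "\<dots> = ennreal \<bar>th\<bar> * (\<integral>\<^sup>+r. ennreal (ppw (s - 1) (0 + th * r) * ppw (- s) (th - (0 + th * r)) / s) \<partial>lborel)"
    using th by (intro nn_integral_real_affine) auto
  also have "(\<integral>\<^sup>+r. ennreal (ppw (s - 1) (0 + th * r) * ppw (- s) (th - (0 + th * r)) / s) \<partial>lborel)
    = (\<integral>\<^sup>+r. ennreal (1 / (th * s)) * ennreal (ppw (s - 1) r * ppw (- s) (1 - r)) \<partial>lborel)"
  proof (rule nn_integral_cong)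
    fix r :: real
    have "ppw (s - 1) (0 + th * r) * ppw (- s) (th - (0 + th * r)) / s = 1 / (th * s) * (ppw (s - 1) r * ppw (- s) (1 - r))"
    proof (cases "0 < r \<and> r < 1")
      case True
      have e: "th - (0 + th * r) = th * (1 - r)" by (simp add: algebra_simps)
      have "ppw (s - 1) (0 + th * r) = th powr (s - 1) * r powr (s - 1)" using True th by (simp add: ppw_pos powr_mult)
      moreover have "ppw (- s) (th - (0 + th * r)) = th powr (- s) * (1 - r) powr (- s)" unfolding e using True th by (simp add: ppw_pos powr_mult)
      moreover have "th powr (s - 1) * th powr (- s) = 1 / th" using th by (simp only: powr_add[symmetric]) (simp add: powr_neg_one)
      ultimately have "ppw (s - 1) (0 + th * r) * ppw (- s) (th - (0 + th * r)) = 1 / th * (r powr (s - 1) * (1 - r) powr (- s))"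
        by (metis (no_types, opaque_lifting) mult.assoc mult.commute)
      thus ?thesis using True by (simp add: ppw_pos)
    next
      case False
      hence "ppw (s - 1) r * ppw (- s) (1 - r) = 0" by auto
      moreover have "ppw (s - 1) (0 + th * r) * ppw (- s) (th - (0 + th * r)) = 0" using False th by (auto simp: not_less mult_le_0_iff)
      ultimately show ?thesis by (simp only: div_0 mult_zero_right)
    qed
    thus "ennreal (ppw (s - 1) (0 + th * r) * ppw (- s) (th - (0 + th * r)) / s) = ennreal (1 / (th * s)) * ennreal (ppw (s - 1) r * ppw (- s) (1 - r))"
      using th s by (simp flip: ennreal_mult)
  qed
  also have "\<dots> = ennreal (1 / (th * s)) * ennreal (Beta s (1 - s))" by (simp add: nn_integral_cmult beta)
  also have "ennreal \<bar>th\<bar> * (ennreal (1 / (th * s)) * ennreal (Beta s (1 - s))) = wconst s"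
  proof -
    have "0 \<le> Beta s (1 - s)" using wconst_pos[OF s] s by (simp add: wconst_def zero_less_divide_iff)
    thus ?thesis using th s by (simp add: wconst_def flip: ennreal_mult)
  qed
  finally show ?thesis .
qed

text \<open>The one-dimensional identity behind the inversion formula: the Weyl derivative of order \<open>s\<close>
  undoes the Weyl integral of order \<open>s\<close>, up to a constant.\<close>

lemma weyl:
  fixes H :: "real \<Rightarrow> real"
  assumes s: "0 < s" "s < 1" and H: "integrable lborel H" and H0: "\<And>th. th \<le> 0 \<Longrightarrow> H th = 0"
  defines "D \<equiv> \<lambda>q t. \<integral>th. indicator {q<..q + t} th * H th \<partial>lborel"
  shows "(LBINT q. ppw (s - 1) q * (LBINT t. ppw (-1 - s) t * D q t)) = wconst s * (LBINT th. H th)"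
    and "(LBINT t. ppw (-1 - s) t * (LBINT q. ppw (s - 1) q * D q t)) = wconst s * (LBINT th. H th)"
proof -
  have [measurable]: "H \<in> bmeas" using borel_measurable_integrable[OF H] by simp
  let ?f = "\<lambda>(p, th). wk s p th * H th"
  \<comment> \<open>For \<open>th <= 0\<close> both sides vanish with \<open>H\<close>, so the value
    of the inner integral does not matter there.\<close>
  have wint: "(\<integral>\<^sup>+p. wk s p th \<partial>lborel) * ennreal (norm (H th)) = ennreal (wconst s) * ennreal (norm (H th))" for th
    using nn_wk[OF s, of th] H0[of th] by (cases "0 < th") auto
  have fub: "integrable (lborel \<Otimes>\<^sub>M lborel) ?f"
  proof (rule integrableI_bounded)
    have "(\<integral>\<^sup>+w. ennreal (norm (?f w)) \<partial>(lborel \<Otimes>\<^sub>M lborel)) = (\<integral>\<^sup>+th. \<integral>\<^sup>+p. ennreal (norm (wk s p th * H th)) \<partial>lborel \<partial>lborel)"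
      by (subst lborel_pair.nn_integral_snd[symmetric]) auto
    also have "\<dots> = (\<integral>\<^sup>+th. ennreal (wconst s) * ennreal (norm (H th)) \<partial>lborel)"
    proof (rule nn_integral_cong)
      fix th
      have "(\<integral>\<^sup>+p. ennreal (norm (wk s p th * H th)) \<partial>lborel) = (\<integral>\<^sup>+p. ennreal (wk s p th) * ennreal (norm (H th)) \<partial>lborel)"
        by (simp add: abs_mult ennreal_mult)
      also have "\<dots> = (\<integral>\<^sup>+p. wk s p th \<partial>lborel) * ennreal (norm (H th))" by (rule nn_integral_multc) simp
      finally show "(\<integral>\<^sup>+p. ennreal (norm (wk s p th * H th)) \<partial>lborel) = ennreal (wconst s) * ennreal (norm (H th))"
        using wint by simp
    qed
    also have "\<dots> < \<infinity>" using H by (simp add: nn_integral_cmult nn_integral_eq_integral ennreal_mult_less_top integrable_norm)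
    finally show "(\<integral>\<^sup>+w. ennreal (norm (?f w)) \<partial>(lborel \<Otimes>\<^sub>M lborel)) < \<infinity>" .
  qed simp
  have P: "(LBINT th. wk s (q, t) th * H th) = ppw (s - 1) q * (ppw (-1 - s) t * D q t)" for q t unfolding wk_def D_def by (simp add: mult.assoc)
  have iP: "integrable lborel (\<lambda>p. \<integral>th. wk s p th * H th \<partial>lborel)" using lborel_pair.integrable_fst'[OF fub] by simp
  have eP: "(LBINT p. (LBINT th. wk s p th * H th)) = wconst s * (LBINT th. H th)"
  proof -
    have "(LBINT p. (LBINT th. wk s p th * H th)) = (LBINT th. (LBINT p. wk s p th * H th))" by (rule lborel_pair.Fubini_integral[OF fub, symmetric])
    also have "\<dots> = (LBINT th. wconst s * H th)"
    proof (rule lint_cong[OF refl])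
      fix th
      show "(LBINT p. wk s p th * H th) = wconst s * H th"
      proof (cases "0 < th")
        case True
        have "(LBINT p. wk s p th) = wconst s" using nn_wk[OF s True] wconst_pos[OF s] by (subst integral_eq_nn_integral) auto
        thus ?thesis by simp
      qed (simp add: H0)
    qed
    finally show ?thesis by simp
  qed
  have iP': "integrable (lborel \<Otimes>\<^sub>M lborel) (\<lambda>(q, t). ppw (s - 1) q * (ppw (-1 - s) t * D q t))"
    using iP unfolding lborel_prod by (simp add: P[symmetric] case_prod_unfold)
  have "(LBINT q. (LBINT t. ppw (s - 1) q * (ppw (-1 - s) t * D q t))) = (LBINT p. (LBINT th. wk s p th * H th))"
    using lborel_pair.integral_fst'[OF iP'] unfolding lborel_prod by (simp add: P[symmetric] case_prod_unfold)
  thus "(LBINT q. ppw (s - 1) q * (LBINT t. ppw (-1 - s) t * D q t)) = wconst s * (LBINT th. H th)" using eP by simp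
  have "(LBINT t. (LBINT q. ppw (s - 1) q * (ppw (-1 - s) t * D q t))) = (LBINT q. (LBINT t. ppw (s - 1) q * (ppw (-1 - s) t * D q t)))"
    by (rule lborel_pair.Fubini_integral[OF iP'])
  also have "\<dots> = wconst s * (LBINT th. H th)" using eP \<open>(LBINT q. (LBINT t. ppw (s - 1) q * (ppw (-1 - s) t * D q t))) = _\<close> by simp
  also have "(LBINT t. (LBINT q. ppw (s - 1) q * (ppw (-1 - s) t * D q t)))
     = (LBINT t. ppw (-1 - s) t * (LBINT q. ppw (s - 1) q * D q t))" by (simp add: mult.left_commute[of "ppw (s - 1) _"])
  finally show "(LBINT t. ppw (-1 - s) t * (LBINT q. ppw (s - 1) q * D q t)) = wconst s * (LBINT th. H th)" .
qed

section \<open>Fractional potentials\<close>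

lemma integrable_prod_mult:
  fixes f :: "'b::euclidean_space \<Rightarrow> real" and g :: "'c::euclidean_space \<Rightarrow> real"
  assumes f: "integrable lborel f" and g: "integrable lborel g"
  shows "integrable (lborel \<Otimes>\<^sub>M lborel) (\<lambda>(x, y). f x * g y)"
proof -
  have [measurable]: "f \<in> bmeas" "g \<in> bmeas" using borel_measurable_integrable[OF f] borel_measurable_integrable[OF g] by auto
  show ?thesis
  proof (rule lborel_pair.Fubini_integrable)
    show "integrable lborel (\<lambda>x. \<integral>y. norm (case (x, y) of (x, y) \<Rightarrow> f x * g y) \<partial>lborel)"
      using f by (simp add: abs_mult)
    show "AE x in lborel. integrable lborel (\<lambda>y. case (x, y) of (x, y) \<Rightarrow> f x * g y)" using g by simp
  qed simp
qed

text \<open>For \<open>r = 0\<close> this is \<open>Gamma s\<close> times the Riesz potential of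
  order 2s. The shift \<open>r\<close> is an additional smoothing by the heat flow, which makes the
  potential regular enough for \<open>Lam\<close>.\<close>

definition pot :: "real \<Rightarrow> real \<Rightarrow> ('a::euclidean_space \<Rightarrow> real) \<Rightarrow> 'a \<Rightarrow> real" where
  "pot s r F x = (LBINT q. ppw (s - 1) q * heat (q + r) F x)"

text \<open>The constant by which this differs from \<open>(-Delta)^s\<close> is
  \<open>Gamma (1 - s) / s\<close>.\<close>

definition Lam :: "real \<Rightarrow> ('a::euclidean_space \<Rightarrow> real) \<Rightarrow> 'a \<Rightarrow> real" where
  "Lam s w x = (LBINT t. ppw (-1 - s) t * (w x - heat t w x))"

text \<open>Minus the time derivative of the flow started at time \<open>r\<close>, extended by
  zero. Its integral over \<open>(q, q + t]\<close> is the decrease of the flow, which is the shape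
  that \<open>weyl\<close> needs.\<close>

definition Hd :: "('a::euclidean_space \<Rightarrow> real) \<Rightarrow> real \<Rightarrow> 'a \<Rightarrow> real \<Rightarrow> real" where
  "Hd V r x th = - (indicator {0<..} th * dheat (th + r) V x)"

lemma Hd_measurable [measurable]:
  fixes V :: "'a::euclidean_space \<Rightarrow> real"
  assumes [measurable]: "V \<in> bmeas"
  shows "Hd V r x \<in> bmeas" unfolding Hd_def by measurable

lemma Hd_nonpos: "th \<le> 0 \<Longrightarrow> Hd V r x th = 0"
  by (simp add: Hd_def)

lemma heat_diff_Hd:
  fixes V :: "'a::euclidean_space \<Rightarrow> real"
  assumes [measurable]: "V \<in> bmeas" and B: "\<And>x. \<bar>V x\<bar> \<le> B" and r: "0 < r" and q: "0 \<le> q" and t: "0 \<le> t"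
  shows "heat (q + r) V x - heat (q + t + r) V x = (LBINT th. indicator {q<..q + t} th * Hd V r x th)"
proof -
  have "heat (q + t + r) V x - heat (q + r) V x = (LBINT th. indicator {q + r<..q + t + r} th * dheat th V x)"
    by (rule heat_ftc[where B=B]) (use B r q t in auto)
  also have "\<dots> = (LBINT th. indicator {q + r<..q + t + r} (r + th) * dheat (r + th) V x)"
    by (rule lborel_integral_shift(1)[symmetric]) measurable
  also have "\<dots> = (LBINT th. - (indicator {q<..q + t} th * Hd V r x th))"
    using q by (intro lint_cong) (auto simp: Hd_def indicator_def add.commute)
  also have "\<dots> = - (LBINT th. indicator {q<..q + t} th * Hd V r x th)" by (rule Bochner_Integration.integral_minus)
  finally show ?thesis by simp
qed

text \<open>A decay budget: the flow of the weight of order \<open>be\<close> decays in time at rate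
  \<open>k\<close> while keeping the spatial decay \<open>ga\<close>. The type argument fixes the
  space, which no other argument determines.\<close>

definition dom :: "real \<Rightarrow> real \<Rightarrow> real \<Rightarrow> real \<Rightarrow> 'a::euclidean_space itself \<Rightarrow> bool" where
  "dom be C k ga ty \<longleftrightarrow> 0 \<le> be \<and> 0 \<le> ga \<and> 0 < C \<and> 0 < k \<and>
     (\<forall>t>0. \<forall>x::'a. heat t (pw be) x \<le> C * (1 + t) powr (- k) * pw ga x)"

lemma heat_dom:
  fixes F :: "'a::euclidean_space \<Rightarrow> real"
  assumes d: "dom be C k ga TYPE('a)" and [measurable]: "F \<in> bmeas"
    and F: "\<And>x. \<bar>F x\<bar> \<le> K * pw be x" and t: "0 < t"
  shows "\<bar>heat t F x\<bar> \<le> K * C * (1 + t) powr (- k) * pw ga x"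
proof -
  have K: "0 \<le> K" using F[of 0] by (simp add: pw_def)
  have be: "0 \<le> be" using d by (simp add: dom_def)
  have "\<bar>heat t F x\<bar> \<le> heat t (\<lambda>x. K * pw be x) x"
    by (rule heat_abs_le[where B=K]) (use F t K mult_left_mono[OF pw_le_1[OF be] K] in auto)
  also have "\<dots> = K * heat t (pw be) x" by (rule heat_cmult)
  also have "\<dots> \<le> K * (C * (1 + t) powr (- k) * pw ga x)" using d t K by (intro mult_left_mono) (auto simp: dom_def)
  finally show ?thesis by (simp add: mult.assoc)
qed

text \<open>The factor \<open>1/t\<close> of the time derivative adds 1 to the rate
  \<open>k\<close>, which gives integrability at infinity; the shift \<open>r\<close> removes the
  singularity at 0. The bound is linear in \<open>K\<close>, with \<open>M\<close> independent of
  \<open>V\<close>.\<close>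

lemma Hd_bound:
  fixes ty :: "'a::euclidean_space itself"
  assumes d: "dom be C k ga TYPE('a)" and r: "0 < r"
  obtains M where "0 < M" "\<And>V K x th. V \<in> bmeas \<Longrightarrow> (\<And>x. \<bar>V x\<bar> \<le> K * pw be x) \<Longrightarrow>
    \<bar>Hd V r (x::'a) th\<bar> \<le> K * M * pw ga x * (ppw 0 th * (1 + th) powr (- (1 + k)))"
proof -
  obtain Cd where Cd: "0 < Cd" "\<And>F G B t x. F \<in> bmeas \<Longrightarrow> G \<in> bmeas \<Longrightarrow>
     (\<And>x. \<bar>F x\<bar> \<le> G x) \<Longrightarrow> (\<And>x. G x \<le> B) \<Longrightarrow> 0 < t \<Longrightarrow> \<bar>dheat t F (x::'a)\<bar> \<le> Cd / t * heat (2 * t) G x"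
    using dheat_bound[where 'a='a] by metis
  have C: "0 < C" and k: "0 < k" and be: "0 \<le> be" using d by (auto simp: dom_def)
  let ?M = "Cd * C * (1 + 1 / r)"
  have "\<bar>Hd V r x th\<bar> \<le> K * ?M * pw ga x * (ppw 0 th * (1 + th) powr (- (1 + k)))"
    if V[measurable]: "V \<in> bmeas" and VK: "\<And>x. \<bar>V x\<bar> \<le> K * pw be x" for V K th and x :: 'a
  proof (cases "0 < th")
    case True
    have K: "0 \<le> K" using VK[of 0] by (simp add: pw_def)
    let ?t = "th + r"
    have t: "0 < ?t" using True r by simp
    have "\<bar>Hd V r x th\<bar> = \<bar>dheat ?t V x\<bar>" using True by (simp add: Hd_def)
    also have "\<dots> \<le> Cd / ?t * heat (2 * ?t) (\<lambda>x. K * pw be x) x"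
      by (rule Cd(2)[where B=K]) (use VK t K mult_left_mono[OF pw_le_1[OF be] K] in auto)
    also have "heat (2 * ?t) (\<lambda>x. K * pw be x) x = K * heat (2 * ?t) (pw be) x" by (rule heat_cmult)
    also have "Cd / ?t * (K * heat (2 * ?t) (pw be) x) \<le> Cd / ?t * (K * (C * (1 + 2 * ?t) powr (- k) * pw ga x))"
      using d t K Cd by (intro mult_left_mono) (auto simp: dom_def)
    also have "\<dots> \<le> (Cd * ((1 + 1 / r) / (1 + th))) * (K * (C * (1 + th) powr (- k) * pw ga x))"
    proof (intro mult_mono)
      have "1 + th \<le> (1 + 1 / r) * ?t" using True r by (simp add: field_simps)
      hence "1 / ?t \<le> (1 + 1 / r) / (1 + th)" using True r t by (simp add: divide_simps mult.commute)
      hence "Cd * (1 / ?t) \<le> Cd * ((1 + 1 / r) / (1 + th))" using Cd(1) by (intro mult_left_mono) auto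
      thus "Cd / ?t \<le> Cd * ((1 + 1 / r) / (1 + th))" by simp
      show "(1 + 2 * ?t) powr (- k) \<le> (1 + th) powr (- k)" using True r k by (intro powr_mono2') auto
    qed (use True r K C Cd in auto)
    also have "\<dots> = K * ?M * pw ga x * ((1 + th) powr (- k) / (1 + th))" by (simp add: mult_ac)
    also have "(1 + th) powr (- k) / (1 + th) = (1 + th) powr (- (1 + k))"
    proof -
      have "- (1 + k) = - k - 1" by simp
      thus ?thesis using True by (simp only: powr_diff) simp
    qed
    finally show ?thesis using True by (simp add: ppw_pos)
  qed (simp add: Hd_def)
  moreover have "0 < ?M" using Cd C r by (intro mult_pos_pos) (auto simp: add_pos_pos)
  ultimately show ?thesis using that by blast
qed

lemma Hd_integrable:
  fixes V :: "'a::euclidean_space \<Rightarrow> real"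
  assumes d: "dom be C k ga TYPE('a)" and r: "0 < r" and V[measurable]: "V \<in> bmeas" and VK: "\<And>x. \<bar>V x\<bar> \<le> K * pw be x"
  shows "integrable lborel (Hd V r x)"
proof -
  obtain M where M: "\<And>V K x th. V \<in> bmeas \<Longrightarrow> (\<And>x. \<bar>V x\<bar> \<le> K * pw be x) \<Longrightarrow>
    \<bar>Hd V r (x::'a) th\<bar> \<le> K * M * pw ga x * (ppw 0 th * (1 + th) powr (- (1 + k)))" using Hd_bound[OF d r] by metis
  have k: "0 < k" using d by (simp add: dom_def)
  have i: "integrable lborel (\<lambda>th. K * M * pw ga x * (ppw 0 th * (1 + th) powr (- (1 + k))))"
    using k by (intro integrable_mult_right integrable_ppw_decay) auto
  show ?thesis by (rule lint_bound[OF i])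
      (use order_trans[OF M[OF V VK] abs_ge_self] in \<open>simp_all only: real_norm_def AE_I2, measurable\<close>)
qed

text \<open>Integrating the bound on \<open>Hd\<close> over \<open>(0, t]\<close> gives at most its
  total mass and at most a multiple of \<open>t\<close>. The factor \<open>min 1 t\<close> is what
  makes \<open>t powr (-1-s)\<close> integrable at both ends.\<close>

lemma heat_diff_bound:
  fixes ty :: "'a::euclidean_space itself"
  assumes d: "dom be C k ga TYPE('a)" and r: "0 < r"
  obtains M where "0 < M" "\<And>V K x t. V \<in> bmeas \<Longrightarrow> (\<And>x. \<bar>V x\<bar> \<le> K * pw be x) \<Longrightarrow> 0 < t \<Longrightarrow>
    \<bar>heat r V (x::'a) - heat (t + r) V x\<bar> \<le> K * M * min 1 t * pw ga x"
proof -
  obtain M where M: "0 < M" "\<And>V K x th. V \<in> bmeas \<Longrightarrow> (\<And>x. \<bar>V x\<bar> \<le> K * pw be x) \<Longrightarrow>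
    \<bar>Hd V r (x::'a) th\<bar> \<le> K * M * pw ga x * (ppw 0 th * (1 + th) powr (- (1 + k)))" using Hd_bound[OF d r] by metis
  have k: "0 < k" and be: "0 \<le> be" using d by (auto simp: dom_def)
  let ?g = "\<lambda>th. ppw 0 th * (1 + th) powr (- (1 + k))"
  define I where "I = (LBINT th. ?g th)"
  have ig: "integrable lborel ?g" using k by (intro integrable_ppw_decay) auto
  have I0: "0 \<le> I" unfolding I_def by (intro integral_nonneg_AE) auto
  have "\<bar>heat r V x - heat (t + r) V x\<bar> \<le> K * (M * (1 + I)) * min 1 t * pw ga x"
    if V[measurable]: "V \<in> bmeas" and VK: "\<And>x. \<bar>V x\<bar> \<le> K * pw be x" and t: "0 < t" for V K t and x :: 'a
  proof -
    have K: "0 \<le> K" using VK[of 0] by (simp add: pw_def)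
    have VB: "\<bar>V x\<bar> \<le> K" for x using order_trans[OF VK[of x] mult_left_mono[OF pw_le_1[OF be] K]] by simp
    have gi: "integrable lborel (\<lambda>th. indicator {0<..t} th * ?g th)"
      using integrable_real_mult_indicator[OF _ ig, of "{0<..t}"] by (simp add: mult.commute)
    have "\<bar>heat r V x - heat (t + r) V x\<bar> = \<bar>\<integral>th. indicator {0<..t} th * Hd V r x th \<partial>lborel\<bar>"
      using heat_diff_Hd[OF V VB r, of 0 t x] t by simp
    also have "\<dots> \<le> (LBINT th. \<bar>indicator {0<..t} th * Hd V r x th\<bar>)" by (rule integral_abs_bound)
    also have "\<dots> \<le> (LBINT th. K * M * pw ga x * (indicator {0<..t} th * ?g th))"
    proof (rule integral_mono)
      show "integrable lborel (\<lambda>th. \<bar>indicator {0<..t} th * Hd V r x th\<bar>)"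
        using integrable_real_mult_indicator[OF _ Hd_integrable[OF d r V VK], of "{0<..t}" x] by (intro integrable_abs) (simp add: mult.commute)
      show "integrable lborel (\<lambda>th. K * M * pw ga x * (indicator {0<..t} th * ?g th))" by (intro integrable_mult_right gi)
      show "\<bar>indicator {0<..t} th * Hd V r x th\<bar> \<le> K * M * pw ga x * (indicator {0<..t} th * ?g th)" for th
        using M(2)[OF V VK, of x th] by (cases "th \<in> {0<..t}") auto
    qed
    also have "\<dots> = K * M * pw ga x * (LBINT th. indicator {0<..t} th * ?g th)" by (rule integral_mult_right_zero)
    also have "\<dots> \<le> K * M * pw ga x * ((1 + I) * min 1 t)"
    proof (intro mult_left_mono)
      have 1: "(LBINT th. indicator {0<..t} th * ?g th) \<le> I" unfolding I_def by (rule integral_mono[OF gi ig]) (auto simp: indicator_def)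
      have 2: "(LBINT th. indicator {0<..t} th * ?g th) \<le> (LBINT th. indicator {0<..t} th)"
      proof (rule integral_mono[OF gi])
        show "integrable lborel (indicator {0<..t} :: real \<Rightarrow> real)" using t by (intro integrable_real_indicator) auto
        fix th :: real
        have "(1 + th) powr (- (1 + k)) \<le> 1" if "0 < th" using powr_mono2'[of "- (1 + k)" 1 "1 + th"] k that by simp
        thus "indicator {0<..t} th * ?g th \<le> indicator {0<..t} th" by (auto simp: indicator_def ppw_pos)
      qed
      show "(LBINT th. indicator {0<..t} th * ?g th) \<le> (1 + I) * min 1 t"
      proof (cases "t \<le> 1")
        case True
        have "(LBINT th. indicator {0<..t} th) = t" using t by simp
        moreover have "1 * t \<le> (1 + I) * t" using I0 t by (intro mult_right_mono) auto
        moreover have "min 1 t = t" using True by simp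
        ultimately show ?thesis using 2 unfolding \<open>min 1 t = t\<close> by linarith
      next
        case False thus ?thesis using 1 by simp
      qed
    qed (use K M in auto)
    finally show ?thesis by (simp add: mult_ac)
  qed
  moreover have "0 < M * (1 + I)" using M(1) I0 by simp
  ultimately show ?thesis using that by blast
qed

text \<open>Makes \<open>Lam\<close> of a smoothed function an admissible density: the spatial decay
  of the flow survives the integration in \<open>t\<close>.\<close>

lemma Lam_heat_bound:
  fixes ty :: "'a::euclidean_space itself"
  assumes s: "0 < s" "s < 1" and d: "dom be C k ga TYPE('a)" and r: "0 < r"
  obtains M where "0 < M" "\<And>V K x. V \<in> bmeas \<Longrightarrow> (\<And>x. \<bar>V x\<bar> \<le> K * pw be x) \<Longrightarrow>
    \<bar>Lam s (heat r V) (x::'a)\<bar> \<le> K * M * pw ga x"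
proof -
  obtain M where M: "0 < M" "\<And>V K x t. V \<in> bmeas \<Longrightarrow> (\<And>x. \<bar>V x\<bar> \<le> K * pw be x) \<Longrightarrow> 0 < t \<Longrightarrow>
    \<bar>heat r V (x::'a) - heat (t + r) V x\<bar> \<le> K * M * min 1 t * pw ga x" using heat_diff_bound[OF d r] by metis
  define J where "J = (LBINT t. ppw (-1 - s) t * min 1 t)"
  have J0: "0 \<le> J" unfolding J_def by (intro integral_nonneg_AE AE_I2) (auto simp: ppw_def indicator_def)
  have be: "0 \<le> be" using d by (auto simp: dom_def)
  have "\<bar>Lam s (heat r V) x\<bar> \<le> K * (M * (J + 1)) * pw ga x"
    if V[measurable]: "V \<in> bmeas" and VK: "\<And>x. \<bar>V x\<bar> \<le> K * pw be x" for V K and x :: 'a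
  proof -
    have K: "0 \<le> K" using VK[of 0] by (simp add: pw_def)
    have VB: "\<bar>V x\<bar> \<le> K" for x using order_trans[OF VK[of x] mult_left_mono[OF pw_le_1[OF be] K]] by simp
    have le: "\<bar>ppw (-1 - s) t * (heat r V x - heat t (heat r V) x)\<bar> \<le> K * M * pw ga x * (ppw (-1 - s) t * min 1 t)" for t
    proof (cases "0 < t")
      case True
      have "\<bar>heat r V x - heat t (heat r V) x\<bar> \<le> K * M * min 1 t * pw ga x"
        using M(2)[OF V VK True, of x] heat_heat[OF V VB True r, of x] by simp
      hence "ppw (-1 - s) t * \<bar>heat r V x - heat t (heat r V) x\<bar> \<le> ppw (-1 - s) t * (K * M * min 1 t * pw ga x)"
        by (intro mult_left_mono) auto
      thus ?thesis by (simp add: abs_mult mult_ac)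
    qed simp
    have i: "integrable lborel (\<lambda>t. K * M * pw ga x * (ppw (-1 - s) t * min 1 t))" by (intro integrable_mult_right integrable_ppw_min s)
    have "\<bar>Lam s (heat r V) x\<bar> \<le> (LBINT t. \<bar>ppw (-1 - s) t * (heat r V x - heat t (heat r V) x)\<bar>)"
      unfolding Lam_def by (rule integral_abs_bound)
    also have "\<dots> \<le> (LBINT t. K * M * pw ga x * (ppw (-1 - s) t * min 1 t))"
    proof (rule integral_mono[OF _ i le])
      show "integrable lborel (\<lambda>t. \<bar>ppw (-1 - s) t * (heat r V x - heat t (heat r V) x)\<bar>)"
      proof (rule lint_bound[OF i])
        show "AE t in lborel. norm \<bar>ppw (-1 - s) t * (heat r V x - heat t (heat r V) x)\<bar> \<le> norm (K * M * pw ga x * (ppw (-1 - s) t * min 1 t))"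
          using order_trans[OF le abs_ge_self] by (simp only: real_norm_def abs_idempotent AE_I2)
      qed measurable
    qed
    also have "\<dots> = K * M * pw ga x * J" unfolding J_def by (rule integral_mult_right_zero)
    also have "\<dots> \<le> K * M * pw ga x * (J + 1)" using K M by (intro mult_left_mono) auto
    finally show ?thesis by (simp add: mult_ac)
  qed
  moreover have "0 < M * (J + 1)" using M(1) J0 by simp
  ultimately show ?thesis using that by blast
qed

text \<open>\<open>s < k\<close> makes \<open>q powr (s - 1)\<close> times the time decay
  integrable, so that potentials are finite; \<open>0 < ga\<close> makes them vanish at
  infinity.\<close>

locale fpot =
  fixes s be C k ga :: real and ty :: "'a::euclidean_space itself"
  assumes s: "0 < s" "s < 1" and dom: "dom be C k ga TYPE('a)" and ks: "s < k" and ga: "0 < ga"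
begin

lemma C: "0 < C" and be: "0 \<le> be" and k: "0 < k"
  using dom by (auto simp: dom_def)

definition pC where "pC = C * (LBINT q. ppw (s - 1) q * (1 + q) powr (- k))"

lemma pC_int: "integrable lborel (\<lambda>q. ppw (s - 1) q * (1 + q) powr (- k))"
  using s ks by (intro integrable_ppw_decay) auto

lemma pC_nonneg: "0 \<le> pC"
  unfolding pC_def using C by (intro mult_nonneg_nonneg integral_nonneg_AE) auto

context
  fixes F :: "'a \<Rightarrow> real" and K :: real
  assumes F[measurable]: "F \<in> bmeas" and FK: "\<And>x. \<bar>F x\<bar> \<le> K * pw be x"
begin

lemma K_nonneg: "0 \<le> K" using FK[of 0] by (simp add: pw_def)

lemma F_bound: "\<bar>F x\<bar> \<le> K"
  using order_trans[OF FK[of x] mult_left_mono[OF pw_le_1[OF be] K_nonneg]] by simp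

lemma pot_integrand:
  assumes r: "0 \<le> r"
  shows "\<bar>ppw (s - 1) q * heat (q + r) F x\<bar> \<le> K * C * pw ga x * (ppw (s - 1) q * (1 + q) powr (- k))"
proof (cases "0 < q")
  case True
  have "\<bar>heat (q + r) F x\<bar> \<le> K * C * (1 + (q + r)) powr (- k) * pw ga x" using True r by (intro heat_dom[OF dom F FK]) auto
  also have "\<dots> \<le> K * C * (1 + q) powr (- k) * pw ga x" using True r k K_nonneg C by (intro mult_right_mono mult_left_mono powr_mono2') auto
  finally have "ppw (s - 1) q * \<bar>heat (q + r) F x\<bar> \<le> ppw (s - 1) q * (K * C * (1 + q) powr (- k) * pw ga x)"
    by (intro mult_left_mono) auto
  thus ?thesis by (simp add: abs_mult mult_ac)
qed simp

lemma pot_integrand':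
  assumes r: "0 \<le> r"
  shows "\<bar>ppw (s - 1) q * heat (q + r) F x\<bar> \<le> K * C * (ppw (s - 1) q * (1 + q) powr (- k))"
proof -
  have "pw ga x \<le> 1" using ga by (intro pw_le_1) simp
  hence "K * C * pw ga x * (ppw (s - 1) q * (1 + q) powr (- k)) \<le> K * C * 1 * (ppw (s - 1) q * (1 + q) powr (- k))"
    using K_nonneg C by (intro mult_right_mono mult_left_mono) auto
  thus ?thesis using pot_integrand[OF r, of q x] by simp
qed

lemma pot_integrable:
  assumes r: "0 \<le> r"
  shows "integrable lborel (\<lambda>q. ppw (s - 1) q * heat (q + r) F x)"
proof (rule lint_bound)
  show "integrable lborel (\<lambda>q. K * C * pw ga x * (ppw (s - 1) q * (1 + q) powr (- k)))" by (intro integrable_mult_right pC_int)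
  show "AE q in lborel. norm (ppw (s - 1) q * heat (q + r) F x) \<le> norm (K * C * pw ga x * (ppw (s - 1) q * (1 + q) powr (- k)))"
    using order_trans[OF pot_integrand[OF r] abs_ge_self] by (simp only: real_norm_def AE_I2)
qed measurable

lemma pot_bound:
  assumes r: "0 \<le> r" shows "\<bar>pot s r F x\<bar> \<le> K * pC * pw ga x"
proof -
  have "\<bar>pot s r F x\<bar> \<le> (LBINT q. \<bar>ppw (s - 1) q * heat (q + r) F x\<bar>)" unfolding pot_def by (rule integral_abs_bound)
  also have "\<dots> \<le> (LBINT q. K * C * pw ga x * (ppw (s - 1) q * (1 + q) powr (- k)))"
    by (intro integral_mono integrable_abs pot_integrable r pot_integrand integrable_mult_right pC_int)
  also have "\<dots> = K * pC * pw ga x" unfolding pC_def by (simp add: mult_ac)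
  finally show ?thesis .
qed

lemma pot_bound': 
  assumes r: "0 \<le> r" shows "\<bar>pot s r F x\<bar> \<le> K * pC"
proof -
  have "K * pC * pw ga x \<le> K * pC * 1" using K_nonneg pC_nonneg ga by (intro mult_left_mono pw_le_1) auto
  thus ?thesis using pot_bound[OF r, of x] by simp
qed

lemma pot_measurable [measurable]: "pot s r F \<in> bmeas"
  unfolding pot_def by measurable

text \<open>The semigroup law under the integral: smoothing a potential only increases its
  shift.\<close>

lemma heat_pot:
  assumes r: "0 \<le> r" and t: "0 < t"
  shows "heat t (pot s r F) x = pot s (r + t) F x"
proof -
  have fub: "integrable (lborel \<Otimes>\<^sub>M lborel) (\<lambda>(q, z). ppw (s - 1) q * heat (q + r) F (x - z) * hk t z)"
  proof (rule lint_bound)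
    show "integrable (lborel \<Otimes>\<^sub>M lborel) (\<lambda>(q, z::'a). (K * C * (ppw (s - 1) q * (1 + q) powr (- k))) * hk t z)"
      using t by (intro integrable_prod_mult integrable_mult_right pC_int integrable_hk)
    show "AE w in lborel \<Otimes>\<^sub>M lborel. norm (case w of (q, z) \<Rightarrow> ppw (s - 1) q * heat (q + r) F (x - z) * hk t z)
       \<le> norm (case w of (q, z::'a) \<Rightarrow> (K * C * (ppw (s - 1) q * (1 + q) powr (- k))) * hk t z)"
    proof (intro AE_I2, clarify)
      fix q and z :: 'a
      have "\<bar>ppw (s - 1) q * heat (q + r) F (x - z)\<bar> * hk t z \<le> \<bar>K * C * (ppw (s - 1) q * (1 + q) powr (- k))\<bar> * hk t z"
        by (intro mult_right_mono order_trans[OF pot_integrand'[OF r] abs_ge_self]) simp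
      thus "norm (ppw (s - 1) q * heat (q + r) F (x - z) * hk t z) \<le> norm (K * C * (ppw (s - 1) q * (1 + q) powr (- k)) * hk t z)"
        by (simp only: real_norm_def abs_mult[of _ "hk t z"] abs_of_nonneg[OF hk_nonneg])
    qed
  qed measurable
  have "heat t (pot s r F) x = (LBINT z. (LBINT q. ppw (s - 1) q * heat (q + r) F (x - z) * hk t z))" unfolding heat_def[of t] pot_def by simp
  also have "\<dots> = (LBINT q. (LBINT z. ppw (s - 1) q * heat (q + r) F (x - z) * hk t z))" by (rule lborel_pair.Fubini_integral[OF fub])
  also have "\<dots> = (LBINT q. ppw (s - 1) q * heat t (heat (q + r) F) x)" unfolding heat_def[of t] by (simp add: mult.assoc)
  also have "\<dots> = pot s (r + t) F x" unfolding pot_def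
  proof (rule lint_cong[OF refl])
    fix q show "ppw (s - 1) q * heat t (heat (q + r) F) x = ppw (s - 1) q * heat (q + (r + t)) F x"
      using heat_heat[OF F F_bound t, of "q + r" x] r by (cases "0 < q") (auto simp: add_ac)
  qed
  finally show ?thesis .
qed

text \<open>Over \<open>(0, n]\<close> the integral is \<open>heat r F x - heat (n + r) F x\<close>,
  and the second term tends to 0 by the time decay.\<close>

lemma integral_Hd:
  assumes r: "0 < r" shows "(LBINT th. Hd F r x th) = heat r F x"
proof -
  have iH: "integrable lborel (Hd F r x)" by (rule Hd_integrable[OF dom r F FK])
  have "(\<lambda>n. \<integral>th. indicator {0<..real n} th * Hd F r x th \<partial>lborel) \<longlonglongrightarrow> (LBINT th. Hd F r x th)"
  proof (rule integral_dominated_convergence[where w="\<lambda>th. \<bar>Hd F r x th\<bar>"])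
    show "AE th in lborel. (\<lambda>n. indicator {0<..real n} th * Hd F r x th) \<longlonglongrightarrow> Hd F r x th"
    proof (intro AE_I2)
      fix th :: real
      obtain n0 where "th \<le> real n0" using real_arch_simple by blast
      hence "\<forall>\<^sub>F n in sequentially. indicator {0<..real n} th * Hd F r x th = Hd F r x th"
        using Hd_nonpos[of th F r x] by (intro eventually_sequentiallyI[of n0]) (auto simp: indicator_def)
      thus "(\<lambda>n. indicator {0<..real n} th * Hd F r x th) \<longlonglongrightarrow> Hd F r x th" by (rule tendsto_eventually)
    qed
  qed (use iH in \<open>auto simp: indicator_def intro!: AE_I2\<close>)
  moreover have "(\<lambda>n. \<integral>th. indicator {0<..real n} th * Hd F r x th \<partial>lborel) = (\<lambda>n. heat r F x - heat (real n + r) F x)"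
    using heat_diff_Hd[OF F F_bound r, of 0] by simp
  moreover have "(\<lambda>n. heat (real n + r) F x) \<longlonglongrightarrow> 0"
  proof (rule Lim_null_comparison)
    show "\<forall>\<^sub>F n in sequentially. norm (heat (real n + r) F x) \<le> K * C * (1 + (real n + r)) powr (- k) * pw ga x"
      using r heat_dom[OF dom F FK] by (intro always_eventually allI) simp
    have "filterlim (\<lambda>n. 1 + (real n + r)) at_top sequentially" by real_asymp
    hence "(\<lambda>n. (1 + (real n + r)) powr (- k)) \<longlonglongrightarrow> 0" using k by (intro tendsto_neg_powr) auto
    thus "(\<lambda>n. K * C * (1 + (real n + r)) powr (- k) * pw ga x) \<longlonglongrightarrow> 0"
      by (intro tendsto_mult_left_zero tendsto_mult_right_zero)
  qed
  hence "(\<lambda>n. heat r F x - heat (real n + r) F x) \<longlonglongrightarrow> heat r F x"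
    using tendsto_diff[OF tendsto_const[of "heat r F x"]] by fastforce
  ultimately show ?thesis using LIMSEQ_unique by metis
qed

text \<open>Both operators together become a double integral of the integrals of \<open>Hd\<close>
  over \<open>(q, q + t]\<close>, with \<open>q\<close> inside and \<open>t\<close> outside: the
  second part of \<open>weyl\<close>.\<close>

lemma Lam_pot:
  assumes r: "0 < r" shows "Lam s (pot s r F) x = wconst s * heat r F x"
proof -
  have "Lam s (pot s r F) x = (LBINT t. ppw (-1 - s) t * (LBINT q. ppw (s - 1) q * (LBINT th. indicator {q<..q + t} th * Hd F r x th)))"
    unfolding Lam_def
  proof (rule lint_cong[OF refl])
    fix t :: real
    show "ppw (-1 - s) t * (pot s r F x - heat t (pot s r F) x) = ppw (-1 - s) t * (LBINT q. ppw (s - 1) q * (LBINT th. indicator {q<..q + t} th * Hd F r x th))"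
    proof (cases "0 < t")
      case True
      have "pot s r F x - heat t (pot s r F) x = pot s r F x - pot s (r + t) F x" using True r by (simp add: heat_pot)
      also have "\<dots> = (LBINT q. ppw (s - 1) q * heat (q + r) F x - ppw (s - 1) q * heat (q + (r + t)) F x)"
        unfolding pot_def using r True by (intro lint_diff[symmetric] pot_integrable) auto
      also have "\<dots> = (LBINT q. ppw (s - 1) q * (LBINT th. indicator {q<..q + t} th * Hd F r x th))"
      proof (rule lint_cong[OF refl])
        fix q show "ppw (s - 1) q * heat (q + r) F x - ppw (s - 1) q * heat (q + (r + t)) F x = ppw (s - 1) q * (LBINT th. indicator {q<..q + t} th * Hd F r x th)"
        proof (cases "0 < q")
          case q: True
          have "heat (q + r) F x - heat (q + (r + t)) F x = (LBINT th. indicator {q<..q + t} th * Hd F r x th)"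
            using heat_diff_Hd[OF F F_bound r, of q t x] True q by (simp add: add_ac)
          thus ?thesis by (simp only: right_diff_distrib[symmetric])
        qed simp
      qed
      finally show ?thesis by simp
    qed simp
  qed
  also have "\<dots> = wconst s * (LBINT th. Hd F r x th)" by (rule weyl(2)[OF s Hd_integrable[OF dom r F FK] Hd_nonpos])
  finally show ?thesis by (simp add: integral_Hd[OF r])
qed

lemma heat_diff_min:
  assumes r: "0 < r"
  obtains M where "0 < M" "\<And>x t. 0 < t \<Longrightarrow> \<bar>heat r F x - heat (t + r) F x\<bar> \<le> M * min 1 t"
proof -
  obtain M where M: "0 < M" "\<And>V K x t. V \<in> bmeas \<Longrightarrow> (\<And>x. \<bar>V x\<bar> \<le> K * pw be x) \<Longrightarrow> 0 < t \<Longrightarrow>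
    \<bar>heat r V (x::'a) - heat (t + r) V x\<bar> \<le> K * M * min 1 t * pw ga x" using heat_diff_bound[OF dom r] by metis
  have "\<bar>heat r F x - heat (t + r) F x\<bar> \<le> ((K + 1) * M) * min 1 t" if t: "0 < t" for x t
  proof -
    have "\<bar>heat r F x - heat (t + r) F x\<bar> \<le> K * M * min 1 t * pw ga x" by (rule M(2)[OF F FK t])
    also have "\<dots> \<le> (K + 1) * M * min 1 t * 1" using K_nonneg M(1) t ga by (intro mult_mono mult_right_mono pw_le_1) auto
    finally show ?thesis by simp
  qed
  thus ?thesis using that[of "(K + 1) * M"] M(1) K_nonneg by simp
qed

text \<open>Smoothing passes through \<open>Lam\<close> by Fubini, with \<open>M * min 1 t\<close>
  as majorant in \<open>t\<close>.\<close>

lemma heat_Lam: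
  assumes r: "0 < r" and q: "0 < q"
  shows "heat q (Lam s (heat r F)) x = (LBINT t. ppw (-1 - s) t * (heat (q + r) F x - heat (q + t + r) F x))"
proof -
  obtain M where M: "0 < M" "\<And>x t. 0 < t \<Longrightarrow> \<bar>heat r F x - heat (t + r) F x\<bar> \<le> M * min 1 t"
    using heat_diff_min[OF r] by blast
  have Leq: "Lam s (heat r F) y = (LBINT t. ppw (-1 - s) t * (heat r F y - heat (t + r) F y))" for y unfolding Lam_def
  proof (rule lint_cong[OF refl])
    fix t show "ppw (-1 - s) t * (heat r F y - heat t (heat r F) y) = ppw (-1 - s) t * (heat r F y - heat (t + r) F y)"
      using heat_heat[OF F F_bound _ r, of t y] by (cases "0 < t") auto
  qed
  have fub: "integrable (lborel \<Otimes>\<^sub>M lborel) (\<lambda>(t, z). ppw (-1 - s) t * (heat r F (x - z) - heat (t + r) F (x - z)) * hk q z)"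
  proof (rule lint_bound)
    show "integrable (lborel \<Otimes>\<^sub>M lborel) (\<lambda>(t, z::'a). (M * (ppw (-1 - s) t * min 1 t)) * hk q z)"
      using q s by (intro integrable_prod_mult integrable_mult_right integrable_ppw_min integrable_hk)
    show "AE w in lborel \<Otimes>\<^sub>M lborel. norm (case w of (t, z) \<Rightarrow> ppw (-1 - s) t * (heat r F (x - z) - heat (t + r) F (x - z)) * hk q z)
       \<le> norm (case w of (t, z::'a) \<Rightarrow> (M * (ppw (-1 - s) t * min 1 t)) * hk q z)"
    proof (intro AE_I2, clarify)
      fix t and z :: 'a
      have "\<bar>ppw (-1 - s) t * (heat r F (x - z) - heat (t + r) F (x - z))\<bar> \<le> \<bar>M * (ppw (-1 - s) t * min 1 t)\<bar>"
      proof (cases "0 < t")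
        case True
        have "ppw (-1 - s) t * \<bar>heat r F (x - z) - heat (t + r) F (x - z)\<bar> \<le> ppw (-1 - s) t * (M * min 1 t)"
          by (intro mult_left_mono M(2) True) simp
        thus ?thesis using True M(1) by (simp add: abs_mult mult_ac)
      qed simp
      hence "\<bar>ppw (-1 - s) t * (heat r F (x - z) - heat (t + r) F (x - z))\<bar> * hk q z \<le> \<bar>M * (ppw (-1 - s) t * min 1 t)\<bar> * hk q z"
        by (intro mult_right_mono) auto
      thus "norm (ppw (-1 - s) t * (heat r F (x - z) - heat (t + r) F (x - z)) * hk q z) \<le> norm (M * (ppw (-1 - s) t * min 1 t) * hk q z)"
        by (simp only: real_norm_def abs_mult[of _ "hk q z"] abs_of_nonneg[OF hk_nonneg])
    qed
  qed measurable
  have "heat q (Lam s (heat r F)) x = (LBINT z. (LBINT t. ppw (-1 - s) t * (heat r F (x - z) - heat (t + r) F (x - z)) * hk q z))"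
    unfolding heat_def[of q] Leq by simp
  also have "\<dots> = (LBINT t. (LBINT z. ppw (-1 - s) t * (heat r F (x - z) - heat (t + r) F (x - z)) * hk q z))"
    by (rule lborel_pair.Fubini_integral[OF fub])
  also have "\<dots> = (LBINT t. ppw (-1 - s) t * heat q (\<lambda>y. heat r F y - heat (t + r) F y) x)"
    unfolding heat_def[of q] by (simp add: mult.assoc)
  also have "\<dots> = (LBINT t. ppw (-1 - s) t * (heat (q + r) F x - heat (q + t + r) F x))"
  proof (rule lint_cong[OF refl])
    fix t show "ppw (-1 - s) t * heat q (\<lambda>y. heat r F y - heat (t + r) F y) x = ppw (-1 - s) t * (heat (q + r) F x - heat (q + t + r) F x)"
    proof (cases "0 < t")
      case True
      have "heat q (\<lambda>y. heat r F y - heat (t + r) F y) x = heat q (heat r F) x - heat q (heat (t + r) F) x"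
        by (rule heat_add(2)[where B=K and B'=K]) (use True r q F_bound in \<open>auto intro!: heat_bound\<close>)
      also have "\<dots> = heat (q + r) F x - heat (q + (t + r)) F x" using True r q by (simp add: heat_heat[OF F F_bound])
      finally show ?thesis by (simp add: add_ac)
    qed simp
  qed
  finally show ?thesis .
qed

text \<open>The composition in the other order, from the first part of \<open>weyl\<close>. It
  exhibits every smoothed function of the class as a potential.\<close>

lemma pot_Lam:
  assumes r: "0 < r" shows "pot s 0 (Lam s (heat r F)) x = wconst s * heat r F x"
proof -
  have "pot s 0 (Lam s (heat r F)) x = (LBINT q. ppw (s - 1) q * (LBINT t. ppw (-1 - s) t * (LBINT th. indicator {q<..q + t} th * Hd F r x th)))"
    unfolding pot_def
  proof (rule lint_cong[OF refl])
    fix q :: real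
    show "ppw (s - 1) q * heat (q + 0) (Lam s (heat r F)) x = ppw (s - 1) q * (LBINT t. ppw (-1 - s) t * (LBINT th. indicator {q<..q + t} th * Hd F r x th))"
    proof (cases "0 < q")
      case True
      have "heat q (Lam s (heat r F)) x = (LBINT t. ppw (-1 - s) t * (heat (q + r) F x - heat (q + t + r) F x))" by (rule heat_Lam[OF r True])
      also have "\<dots> = (LBINT t. ppw (-1 - s) t * (LBINT th. indicator {q<..q + t} th * Hd F r x th))"
      proof (rule lint_cong[OF refl])
        fix t show "ppw (-1 - s) t * (heat (q + r) F x - heat (q + t + r) F x) = ppw (-1 - s) t * (LBINT th. indicator {q<..q + t} th * Hd F r x th)"
          using heat_diff_Hd[OF F F_bound r, of q t x] True by (cases "0 < t") auto
      qed
      finally show ?thesis by simp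
    qed simp
  qed
  also have "\<dots> = wconst s * (LBINT th. Hd F r x th)" by (rule weyl(1)[OF s Hd_integrable[OF dom r F FK] Hd_nonpos])
  finally show ?thesis by (simp add: integral_Hd[OF r])
qed

end

text \<open>Density and point vary together. This covers continuity of one potential in space as
  well as joint continuity when the density depends on time.\<close>

lemma pot_tendsto:
  fixes F :: "nat \<Rightarrow> 'a \<Rightarrow> real"
  assumes Fm: "\<And>n. F n \<in> bmeas" and FK: "\<And>n x. \<bar>F n x\<bar> \<le> K * pw be x"
    and G: "G \<in> bmeas" and r: "0 \<le> r"
    and lim: "\<And>q. 0 < q \<Longrightarrow> (\<lambda>n. heat q (F n) (X n)) \<longlonglongrightarrow> heat q G x"
  shows "(\<lambda>n. pot s r (F n) (X n)) \<longlonglongrightarrow> pot s r G x" unfolding pot_def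
proof (rule integral_dominated_convergence)
  note Fm[measurable] G[measurable]
  show "(\<lambda>q. ppw (s - 1) q * heat (q + r) G x) \<in> borel_measurable lborel" by measurable
  show "(\<lambda>q. ppw (s - 1) q * heat (q + r) (F n) (X n)) \<in> borel_measurable lborel" for n by measurable
  show "integrable lborel (\<lambda>q. K * C * (ppw (s - 1) q * (1 + q) powr (- k)))" by (intro integrable_mult_right pC_int)
  show "AE q in lborel. norm (ppw (s - 1) q * heat (q + r) (F n) (X n)) \<le> K * C * (ppw (s - 1) q * (1 + q) powr (- k))" for n
    using pot_integrand'[OF Fm FK r] by (simp only: real_norm_def AE_I2)
  show "AE q in lborel. (\<lambda>n. ppw (s - 1) q * heat (q + r) (F n) (X n)) \<longlonglongrightarrow> ppw (s - 1) q * heat (q + r) G x"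
  proof (intro AE_I2)
    fix q show "(\<lambda>n. ppw (s - 1) q * heat (q + r) (F n) (X n)) \<longlonglongrightarrow> ppw (s - 1) q * heat (q + r) G x"
      using lim[of "q + r"] r by (cases "0 < q") (auto intro!: tendsto_intros)
  qed
qed

lemma pot_add:
  assumes [measurable]: "F \<in> bmeas" "G \<in> bmeas"
    and FK: "\<And>x. \<bar>F x\<bar> \<le> K * pw be x" and GK: "\<And>x. \<bar>G x\<bar> \<le> K' * pw be (x::'a)" and r: "0 \<le> r"
  shows "pot s r (\<lambda>x. F x + G x) x = pot s r F x + pot s r G x"
    and "pot s r (\<lambda>x. F x - G x) x = pot s r F x - pot s r G x"
proof -
  have e: "ppw (s - 1) q * heat (q + r) (\<lambda>x. F x + G x) x = ppw (s - 1) q * heat (q + r) F x + ppw (s - 1) q * heat (q + r) G x"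
    "ppw (s - 1) q * heat (q + r) (\<lambda>x. F x - G x) x = ppw (s - 1) q * heat (q + r) F x - ppw (s - 1) q * heat (q + r) G x" for q
    using heat_add[of F G K K' "q + r" x] F_bound[OF assms(1) FK] F_bound[OF assms(2) GK] r
    by (cases "0 < q"; simp add: distrib_left right_diff_distrib)+
  show "pot s r (\<lambda>x. F x + G x) x = pot s r F x + pot s r G x"
    unfolding pot_def e by (intro Bochner_Integration.integral_add pot_integrable[OF _ FK] pot_integrable[OF _ GK] r) auto
  show "pot s r (\<lambda>x. F x - G x) x = pot s r F x - pot s r G x"
    unfolding pot_def e by (intro lint_diff pot_integrable[OF _ FK] pot_integrable[OF _ GK] r) auto
qed

end

lemma pot_cmult: "pot s r (\<lambda>x. c * F x) x = c * pot s r F x"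
  unfolding pot_def heat_cmult by (simp add: mult.left_commute)

text \<open>The excess \<open>al - 2 * s\<close> is shared by the choice of \<open>la\<close>: the
  time rate \<open>(al + 2 * s) / 4\<close> lies halfway between \<open>s\<close> and
  \<open>al / 2\<close>, hence above \<open>s\<close> as \<open>fpot\<close> demands, and a positive
  spatial rate remains.\<close>

lemma dom_exists:
  assumes "0 < s" "2 * s < al" "al < real DIM('a::euclidean_space)"
  obtains C where "dom al C ((al + 2 * s) / 4) ((al - 2 * s) / 4) TYPE('a)"
proof -
  define la where "la = (al - 2 * s) / (4 * al)"
  have la: "0 < la" "la < 1" using assms by (auto simp: la_def field_simps)
  have lal: "la * al = (al - 2 * s) / 4" using assms by (simp add: la_def)
  have e: "((1 - la) * al - la * al) / 2 = (al + 2 * s) / 4" using lal by (simp add: left_diff_distrib field_simps)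
  have "0 \<le> ((1 - la) * al - la * al) / 2" unfolding e using assms by simp
  hence e0: "0 \<le> (1 - la) * al - la * al" by (simp only: zero_le_divide_iff) auto
  have al: "0 < al" "al < real DIM('a)" "al \<le> al" using assms by auto
  obtain C where "0 < C" "\<And>t x. 0 < t \<Longrightarrow>
     heat t (pw al) (x::'a) \<le> C * (1 + t) powr (- ((al + 2 * s) / 4)) * pw ((al - 2 * s) / 4) x"
    using heat_pw_dom[where 'a='a, OF al la e0] unfolding e unfolding lal by blast
  hence "dom al C ((al + 2 * s) / 4) ((al - 2 * s) / 4) TYPE('a)" unfolding dom_def using assms by simp
  thus ?thesis by (rule that)
qed

text \<open>Any spatial rate below the dimension is reachable if the density decays fast enough; the
  time rate is then merely positive. This serves compactly supported functions, for which
  \<open>be\<close> can be taken as large as desired.\<close>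

lemma dom_exists_large:
  assumes "0 < ga" "ga < real DIM('a::euclidean_space)"
  obtains be C k where "ga \<le> be" "dom be C k ga TYPE('a)"
proof -
  define al where "al = (ga + real DIM('a)) / 2"
  have al: "0 < al" "ga < al" "al < real DIM('a)" using assms by (auto simp: al_def)
  \<comment> \<open>Large enough that \<open>la = ga / be\<close> lies below
    \<open>1 - ga / al\<close>, which is the positivity of the time rate.\<close>
  define be where "be = 2 * ga / (1 - ga / al) + al"
  define la where "la = ga / be"
  have p: "0 < 1 - ga / al" using al assms by simp
  have "0 < 2 * ga / (1 - ga / al)" by (rule divide_pos_pos[OF _ p]) (use assms in simp)
  hence be: "al < be" by (simp only: be_def)
  have la: "0 < la" "la < 1" using assms al be by (auto simp: la_def)
  have lab: "la * be = ga" using be al by (simp add: la_def)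
  have "ga < be * (1 - ga / al)"
  proof -
    have "ga < 2 * ga" using assms by simp
    also have "\<dots> = (2 * ga / (1 - ga / al)) * (1 - ga / al)"
    proof -
      obtain d where d: "d = 1 - ga / al" by simp
      have "d \<noteq> 0" using p unfolding d[symmetric] by simp
      thus ?thesis unfolding d[symmetric] by simp
    qed
    also have "\<dots> \<le> be * (1 - ga / al)" using p al by (intro mult_right_mono) (auto simp: be_def)
    finally show ?thesis .
  qed
  hence "la < 1 - ga / al" using be al by (simp add: la_def divide_less_eq mult.commute)
  hence "la * al < (1 - ga / al) * al" using al by (intro mult_strict_right_mono) auto
  hence e0: "0 < (1 - la) * al - la * be" using al unfolding lab by (simp add: left_diff_distrib)
  obtain C where "0 < C" "\<And>t x. 0 < t \<Longrightarrow>
     heat t (pw be) (x::'a) \<le> C * (1 + t) powr (- (((1 - la) * al - la * be) / 2)) * pw (la * be) x"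
    using heat_pw_dom[where 'a='a, OF al(1,3) less_imp_le[OF be] la less_imp_le[OF e0]] by blast
  hence "dom be C (((1 - la) * al - la * be) / 2) ga TYPE('a)" unfolding dom_def lab using e0 lab be al assms by simp
  thus ?thesis using that be al by (meson less_imp_le less_trans)
qed

lemma pw_add: "pw (a + b) x = pw a x * pw b x"
  unfolding pw_def by (simp add: add_divide_distrib flip: powr_add)

lemma pw_eventually_small:
  assumes "0 < g" "0 < e" "0 \<le> K"
  obtains R where "0 < R" "\<And>x. R \<le> norm (x::'a::euclidean_space) \<Longrightarrow> K * pw g x \<le> e"
proof -
  have "((\<lambda>x::'a. K * pw g x) \<longlongrightarrow> K * 0) at_infinity" by (intro tendsto_mult_left pw_tendsto_0 assms)
  hence "\<forall>\<^sub>F x::'a in at_infinity. K * pw g x < e" using assms by (intro order_tendstoD(2)) auto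
  then obtain R where "\<And>x. R \<le> norm (x::'a) \<Longrightarrow> K * pw g x < e" unfolding eventually_at_infinity by blast
  thus ?thesis by (intro that[of "max R 1"]) (auto intro: less_imp_le)
qed

definition cutoff :: "real \<Rightarrow> 'a::euclidean_space \<Rightarrow> real" where
  "cutoff R x = max 0 (min 1 (R + 1 - norm x))"

lemma cutoff_props:
  "0 \<le> cutoff R x" "cutoff R x \<le> 1" "norm x \<le> R \<Longrightarrow> cutoff R x = 1" "R + 1 \<le> norm x \<Longrightarrow> cutoff R x = 0"
  by (auto simp: cutoff_def)

lemma cutoff_continuous: "continuous_on S (cutoff R)"
  unfolding cutoff_def by (intro continuous_intros)

context fpot
begin

context
  fixes F :: "'a \<Rightarrow> real" and K :: real
  assumes Fc: "continuous_on UNIV F" and FK: "\<And>x. \<bar>F x\<bar> \<le> K * pw be x"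
begin

lemma Fm: "F \<in> bmeas" using Fc by (rule cont_bmeas)

lemma heat_cont: "0 < t \<Longrightarrow> continuous_on UNIV (heat t F)"
  by (rule heat_continuous_on[OF Fc F_bound[OF Fm FK]])

lemma pot_continuous: "0 \<le> r \<Longrightarrow> continuous_on UNIV (pot s r F)"
proof (clarsimp simp: continuous_on_sequentially comp_def)
  fix X :: "nat \<Rightarrow> 'a" and x assume r: "0 \<le> r" and X: "X \<longlonglongrightarrow> x"
  show "(\<lambda>n. pot s r F (X n)) \<longlonglongrightarrow> pot s r F x"
  proof (rule pot_tendsto[OF Fm FK Fm r])
    fix q :: real assume "0 < q"
    hence "isCont (heat q F) x" using heat_cont[of q] by (simp add: continuous_on_eq_continuous_at)
    thus "(\<lambda>n. heat q F (X n)) \<longlonglongrightarrow> heat q F x" using X by (rule isCont_tendsto_compose)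
  qed
qed

lemma Lam_continuous:
  assumes r: "0 < r" shows "continuous_on UNIV (Lam s (heat r F))"
proof (clarsimp simp: continuous_on_sequentially comp_def)
  fix X :: "nat \<Rightarrow> 'a" and x assume X: "X \<longlonglongrightarrow> x"
  note Fm[measurable]
  obtain M where M: "0 < M" "\<And>x t. 0 < t \<Longrightarrow> \<bar>heat r F x - heat (t + r) F x\<bar> \<le> M * min 1 t"
    using heat_diff_min[OF Fm FK r] by blast
  have hh: "ppw (-1 - s) t * (heat r F y - heat t (heat r F) y) = ppw (-1 - s) t * (heat r F y - heat (t + r) F y)" for t y
    using heat_heat[OF Fm F_bound[OF Fm FK] _ r, of t y] by (cases "0 < t") auto
  have hl: "(\<lambda>n. heat q F (X n)) \<longlonglongrightarrow> heat q F x" if "0 < q" for q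
    using heat_cont[OF that] X by (auto simp: continuous_on_eq_continuous_at intro: isCont_tendsto_compose)
  show "(\<lambda>n. Lam s (heat r F) (X n)) \<longlonglongrightarrow> Lam s (heat r F) x" unfolding Lam_def hh
  proof (rule integral_dominated_convergence)
    show "(\<lambda>t. ppw (-1 - s) t * (heat r F x - heat (t + r) F x)) \<in> borel_measurable lborel" by measurable
    show "(\<lambda>t. ppw (-1 - s) t * (heat r F (X n) - heat (t + r) F (X n))) \<in> borel_measurable lborel" for n by measurable
    show "integrable lborel (\<lambda>t. M * (ppw (-1 - s) t * min 1 t))" by (intro integrable_mult_right integrable_ppw_min s)
    show "AE t in lborel. norm (ppw (-1 - s) t * (heat r F (X n) - heat (t + r) F (X n))) \<le> M * (ppw (-1 - s) t * min 1 t)" for n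
    proof (intro AE_I2)
      fix t show "norm (ppw (-1 - s) t * (heat r F (X n) - heat (t + r) F (X n))) \<le> M * (ppw (-1 - s) t * min 1 t)"
      proof (cases "0 < t")
        case True
        have "ppw (-1 - s) t * \<bar>heat r F (X n) - heat (t + r) F (X n)\<bar> \<le> ppw (-1 - s) t * (M * min 1 t)"
          by (intro mult_left_mono M(2) True) simp
        thus ?thesis by (simp add: abs_mult mult_ac)
      qed simp
    qed
    show "AE t in lborel. (\<lambda>n. ppw (-1 - s) t * (heat r F (X n) - heat (t + r) F (X n))) \<longlonglongrightarrow> ppw (-1 - s) t * (heat r F x - heat (t + r) F x)"
    proof (intro AE_I2)
      fix t show "(\<lambda>n. ppw (-1 - s) t * (heat r F (X n) - heat (t + r) F (X n))) \<longlonglongrightarrow> ppw (-1 - s) t * (heat r F x - heat (t + r) F x)"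
        using hl[of r] hl[of "t + r"] r by (cases "0 < t") (auto intro!: tendsto_intros)
    qed
  qed
qed

text \<open>The maximum principle for potentials. It is proved for the regularised potential, which attains
  its maximum at a point where the regularised density is nonnegative, and then passes to the limit.\<close>

lemma pot_max_principle:
  assumes pos: "0 < pot s 0 F y"
  obtains x where "\<And>z. pot s 0 F z \<le> pot s 0 F x" "0 \<le> F x"
proof -
  note Fm[measurable]
  let ?v = "pot s 0 F"
  \<comment> \<open>\<open>Lam_pot\<close> needs a positive shift, hence the potentials
    \<open>v n\<close> with shifts tending to 0.\<close>
  define r where "r = (\<lambda>n. 1 / (real n + 1))"
  have r: "0 < r n" for n by (simp add: r_def)
  have r0: "r \<longlonglongrightarrow> 0" unfolding r_def by real_asymp
  define v where "v = (\<lambda>n. pot s (r n) F)"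
  have vh: "v n = heat (r n) ?v" for n using heat_pot[OF Fm FK _ r[of n], of 0] by (auto simp: v_def)
  have vB: "\<bar>?v x\<bar> \<le> K * pC" for x by (rule pot_bound'[OF Fm FK]) simp
  have vc: "continuous_on UNIV ?v" by (rule pot_continuous) simp
  have Kp: "0 \<le> K * pC" using vB[of 0] by linarith
  \<comment> \<open>Outside this ball every \<open>v n\<close> stays below a quarter of the value at
    \<open>y\<close>, so the maxima cannot escape to infinity.\<close>
  obtain R where R: "0 < R" "\<And>x. R \<le> norm (x::'a) \<Longrightarrow> K * pC * pw ga x \<le> ?v y / 4"
    using pw_eventually_small[OF ga _ Kp, of "?v y / 4"] pos by auto
  define R' where "R' = max R (norm y)"
  define S where "S = cball (0::'a) R'"
  have S: "compact S" "y \<in> S" by (auto simp: S_def R'_def)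
  have out: "v n x \<le> ?v y / 4" if "x \<notin> S" for x n
  proof -
    have "\<bar>v n x\<bar> \<le> K * pC * pw ga x" unfolding v_def by (rule pot_bound[OF Fm FK]) (simp add: less_imp_le r)
    also have "\<dots> \<le> ?v y / 4" using that by (intro R) (auto simp: S_def R'_def)
    finally show ?thesis by linarith
  qed
  have LU: "\<forall>\<^sub>F n in sequentially. \<forall>x\<in>S. \<bar>heat (r n) G x - G x\<bar> \<le> e"
    if Gc: "continuous_on UNIV G" and Gb: "\<And>x. \<bar>G x\<bar> \<le> B" and e: "0 < e" for G B e
  proof -
    obtain r1 where "0 < r1" "\<And>r x. 0 < r \<Longrightarrow> r < r1 \<Longrightarrow> x \<in> S \<Longrightarrow> \<bar>heat r G x - G x\<bar> \<le> e"
      using heat_locally_uniform[OF Gc Gb S(1) e] by blast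
    moreover have "\<forall>\<^sub>F n in sequentially. r n < r1" using r0 \<open>0 < r1\<close> by (intro order_tendstoD(2)) auto
    ultimately show ?thesis using r by (auto elim!: eventually_mono)
  qed
  have "\<exists>x\<in>S. \<forall>z\<in>S. v n z \<le> v n x" for n
  proof -
    have "continuous_on S (v n)" unfolding v_def using less_imp_le[OF r] by (rule continuous_on_subset[OF pot_continuous]) simp
    thus ?thesis using continuous_attains_sup[of S "v n"] S by blast
  qed
  then obtain X where XS: "\<And>n. X n \<in> S" and Xmax: "\<And>n z. z \<in> S \<Longrightarrow> v n z \<le> v n (X n)" by metis
  obtain x \<phi> where x: "x \<in> S" and \<phi>: "strict_mono \<phi>" and lim: "(X \<circ> \<phi>) \<longlonglongrightarrow> x"
    using S(1) XS unfolding compact_def by metis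
  have sub: "\<forall>\<^sub>F n in sequentially. P (\<phi> n)" if "\<forall>\<^sub>F n in sequentially. P n" for P
    using that \<phi> by (rule eventually_subseq[rotated])
  have limG: "(\<lambda>n. heat (r (\<phi> n)) G (X (\<phi> n))) \<longlonglongrightarrow> G x"
    if c: "continuous_on UNIV G" and b: "\<And>x. \<bar>G x\<bar> \<le> B" for G B
  proof -
    have "isCont G x" using c by (simp add: continuous_on_eq_continuous_at)
    from isCont_tendsto_compose[OF this lim] have 1: "(\<lambda>n. G (X (\<phi> n))) \<longlonglongrightarrow> G x" by (simp add: comp_def)
    have "(\<lambda>n. heat (r (\<phi> n)) G (X (\<phi> n)) - G (X (\<phi> n))) \<longlonglongrightarrow> 0"
    proof (rule tendstoI)
      fix e :: real assume "0 < e"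
      hence "\<forall>\<^sub>F n in sequentially. \<forall>x\<in>S. \<bar>heat (r n) G x - G x\<bar> \<le> e / 2" by (intro LU[OF c b]) auto
      from sub[OF this] show "\<forall>\<^sub>F n in sequentially. dist (heat (r (\<phi> n)) G (X (\<phi> n)) - G (X (\<phi> n))) 0 < e"
      proof eventually_elim
        case (elim n)
        hence "\<bar>heat (r (\<phi> n)) G (X (\<phi> n)) - G (X (\<phi> n))\<bar> \<le> e / 2" using XS by blast
        thus ?case using \<open>0 < e\<close> by (simp add: dist_real_def)
      qed
    qed
    from tendsto_add[OF this 1] show ?thesis by simp
  qed
  have limv: "(\<lambda>n. v (\<phi> n) (X (\<phi> n))) \<longlonglongrightarrow> ?v x" using limG[OF vc vB] by (simp add: vh)
  have vz: "(\<lambda>n. v n z) \<longlonglongrightarrow> ?v z" for z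
  proof (rule tendstoI)
    fix e :: real assume e: "0 < e"
    obtain r1 where "0 < r1" "\<And>r x. 0 < r \<Longrightarrow> r < r1 \<Longrightarrow> x \<in> {z} \<Longrightarrow> \<bar>heat r ?v x - ?v x\<bar> \<le> e / 2"
      using heat_locally_uniform[OF vc vB, of "{z}" "e / 2"] e by auto
    moreover have "\<forall>\<^sub>F n in sequentially. r n < r1" using r0 \<open>0 < r1\<close> by (intro order_tendstoD(2)) auto
    ultimately show "\<forall>\<^sub>F n in sequentially. dist (v n z) (?v z) < e"
      using r e by (auto elim!: eventually_mono simp: vh dist_real_def) (smt (verit) field_sum_of_halves)
  qed
  \<comment> \<open>Eventually \<open>v n y\<close> exceeds the bound outside the ball, so the
    maximum over the ball is a global one.\<close>
  have ev: "\<forall>\<^sub>F n in sequentially. \<forall>z. v n z \<le> v n (X n)"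
  proof -
    have "\<forall>\<^sub>F n in sequentially. ?v y / 4 < v n y" using vz[of y] pos by (intro order_tendstoD(1)) auto
    thus ?thesis
    proof eventually_elim
      case (elim n)
      show ?case
      proof
        fix z show "v n z \<le> v n (X n)" using out[of z n] elim Xmax[OF S(2), of n] Xmax[of z n] by (cases "z \<in> S") auto
      qed
    qed
  qed
  have max: "?v z \<le> ?v x" for z
  proof (rule tendsto_le[OF _ limv])
    show "(\<lambda>n. v (\<phi> n) z) \<longlonglongrightarrow> ?v z" using LIMSEQ_subseq_LIMSEQ[OF vz \<phi>] by (simp add: comp_def)
    show "\<forall>\<^sub>F n in sequentially. v (\<phi> n) z \<le> v (\<phi> n) (X (\<phi> n))" using sub[OF ev] by eventually_elim simp
  qed simp
  have "0 \<le> F x"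
  proof (rule tendsto_lowerbound[OF limG[OF Fc F_bound[OF Fm FK]]])
    show "\<forall>\<^sub>F n in sequentially. 0 \<le> heat (r (\<phi> n)) F (X (\<phi> n))" using sub[OF ev]
    proof eventually_elim
      case (elim n)
      let ?m = "\<phi> n"
      \<comment> \<open>At a global maximum every average is at most the value itself, so the
        integrand of \<open>Lam\<close> is nonnegative; \<open>Lam_pot\<close> passes the sign on to
        the density.\<close>
      have "0 \<le> Lam s (v ?m) (X ?m)" unfolding Lam_def
      proof (intro integral_nonneg_AE AE_I2)
        fix t
        show "0 \<le> ppw (-1 - s) t * (v ?m (X ?m) - heat t (v ?m) (X ?m))"
        proof (cases "0 < t")
          case True
          have "heat t (v ?m) (X ?m) \<le> heat t (\<lambda>_. v ?m (X ?m)) (X ?m)" using elim True r less_imp_le[OF r]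
            by (intro heat_mono[where B="K * pC" and B'="\<bar>v ?m (X ?m)\<bar>"])
              (auto simp: v_def intro!: pot_measurable[OF Fm FK] pot_bound'[OF Fm FK])
          thus ?thesis using True by (simp add: heat_const)
        qed simp
      qed
      hence "0 \<le> wconst s * heat (r ?m) F (X ?m)" unfolding v_def by (simp add: Lam_pot[OF Fm FK r])
      thus ?case using wconst_pos[OF s] by (simp add: zero_le_mult_iff)
    qed
  qed simp
  thus ?thesis using that max by blast
qed

end

end

section \<open>Density of potentials among the continuous functions vanishing at infinity\<close>

lemma C0_uniform:
  fixes f :: "'a::euclidean_space \<Rightarrow> real"
  assumes c: "continuous_on UNIV f" and l: "(f \<longlongrightarrow> 0) at_infinity" and e: "0 < e"
  shows "\<exists>d>0. \<forall>x\<in>UNIV. \<forall>y. dist y x < d \<longrightarrow> dist (f y) (f x) < e"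
proof -
  have "\<forall>\<^sub>F x in at_infinity. dist (f x) 0 < e / 2" using l e by (intro tendstoD) auto
  then obtain R where R: "\<And>x. R \<le> norm x \<Longrightarrow> \<bar>f x\<bar> < e / 2"
    unfolding eventually_at_infinity by (auto simp: dist_real_def)
  have "uniformly_continuous_on (cball 0 (R + 1)) f" by (intro compact_uniformly_continuous continuous_on_subset[OF c]) auto
  then obtain d where d: "0 < d" "\<And>x y. x \<in> cball 0 (R + 1) \<Longrightarrow> y \<in> cball 0 (R + 1) \<Longrightarrow> dist y x < d \<Longrightarrow> dist (f y) (f x) < e"
    unfolding uniformly_continuous_on_def using e by meson
  have "dist (f y) (f x) < e" if xy: "dist y x < min d 1" for x y
  proof (cases "x \<in> cball 0 (R + 1) \<and> y \<in> cball 0 (R + 1)")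
    case True thus ?thesis using d(2) xy by auto
  next
    case False
    have n: "norm x \<le> norm y + dist y x" "norm y \<le> norm x + dist y x"
      using norm_triangle_sub[of x y] norm_triangle_sub[of y x] by (auto simp: dist_norm norm_minus_commute)
    hence "R \<le> norm x" "R \<le> norm y" using False xy by auto
    hence "\<bar>f x\<bar> < e / 2" "\<bar>f y\<bar> < e / 2" using R by auto
    thus ?thesis unfolding dist_real_def by linarith
  qed
  thus ?thesis using d(1) by (intro exI[of _ "min d 1"]) auto
qed

text \<open>The datum is cut off and smoothed, and \<open>pot_Lam\<close> writes the result as a
  potential whose density comes from \<open>Lam\<close>. Cutting off that density is harmless,
  because it decays with order \<open>g1\<close> while potentials are controlled by the weaker
  weight of order \<open>g2\<close>.\<close>

lemma range_pot_dense:
  fixes v0 :: "'a::euclidean_space \<Rightarrow> real"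
  assumes s: "0 < s" "s < 1" "2 * s < real DIM('a)" and v0: "continuous_on UNIV v0" "(v0 \<longlongrightarrow> 0) at_infinity" and e: "0 < e"
  obtains F0 R where "continuous_on UNIV F0" "0 < R" "\<And>x. R \<le> norm x \<Longrightarrow> F0 x = 0" "\<And>x. \<bar>pot s 0 F0 x - v0 x\<bar> \<le> e"
proof -
  \<comment> \<open>Two exponents with \<open>2 * s < g2 < g1 < N\<close>: the gap makes the tail of
    a density of order \<open>g1\<close> small in the weight of order \<open>g2\<close>.\<close>
  define g1 where "g1 = (2 * s + real DIM('a)) / 2"
  define g2 where "g2 = (2 * s + g1) / 2"
  have g: "2 * s < g2" "g2 < g1" "g1 < real DIM('a)" "0 < g1" "0 < g2" 
  proof -
    obtain N where N: "N = real DIM('a)" by simp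
    have s3: "2 * s < N" using s N by simp
    show "2 * s < g2" unfolding g1_def g2_def N[symmetric] using s3 by (simp add: field_simps)
    show "g2 < g1" unfolding g1_def g2_def N[symmetric] using s3 by (simp add: field_simps)
    show "g1 < real DIM('a)" unfolding g1_def g2_def N[symmetric] using s3 by (simp add: field_simps)
    have N0: "0 < N" using s(1) s3 by linarith
    show "0 < g1" unfolding g1_def N[symmetric] using s(1) N0 by simp
    thus "0 < g2" unfolding g2_def using s(1) by simp
  qed
  obtain be C k where bege: "g1 \<le> be" and dbe: "dom be C k g1 TYPE('a)" using dom_exists_large[OF g(4,3)] by blast
  obtain C2 where d2: "dom g2 C2 ((g2 + 2 * s) / 4) ((g2 - 2 * s) / 4) TYPE('a)" using dom_exists[of s g2, where 'a='a] s g by auto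
  interpret fpot s g2 C2 "(g2 + 2 * s) / 4" "(g2 - 2 * s) / 4" "TYPE('a)" using s g d2 by unfold_locales auto
  obtain R where R: "0 < R" "\<And>x. R \<le> norm x \<Longrightarrow> \<bar>v0 x\<bar> \<le> e / 4"
  proof -
    have "\<forall>\<^sub>F x in at_infinity. dist (v0 x) 0 < e / 4" using v0(2) e by (intro tendstoD) auto
    then obtain R where "\<And>x. R \<le> norm x \<Longrightarrow> dist (v0 x) 0 < e / 4" unfolding eventually_at_infinity by blast
    thus ?thesis by (intro that[of "max R 1"]) (auto simp: dist_real_def intro: less_imp_le)
  qed
  define V where "V = (\<lambda>x. cutoff R x * v0 x)"
  have Vc: "continuous_on UNIV V" unfolding V_def by (intro continuous_intros cutoff_continuous v0)
  have Vm[measurable]: "V \<in> bmeas" using Vc by (rule cont_bmeas)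
  have V0: "V x = 0" if "R + 1 \<le> norm x" for x using that by (simp add: V_def cutoff_props)
  have Vv: "\<bar>V x - v0 x\<bar> \<le> e / 4" for x
  proof (cases "norm x \<le> R")
    case True thus ?thesis using e by (simp add: V_def cutoff_props)
  next
    case False
    have "\<bar>V x - v0 x\<bar> = \<bar>1 - cutoff R x\<bar> * \<bar>v0 x\<bar>"
      by (simp add: V_def abs_mult[symmetric] left_diff_distrib abs_minus_commute)
    also have "\<dots> \<le> 1 * (e / 4)" using False R cutoff_props[where R=R and x=x] by (intro mult_mono) auto
    finally show ?thesis by simp
  qed
  have V_lim: "(V \<longlongrightarrow> 0) at_infinity" using V0 by (intro tendsto_eventually) (auto simp: eventually_at_infinity)
  obtain B where B: "\<And>x. \<bar>V x\<bar> \<le> B" "0 \<le> B"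
  proof -
    have "compact (V ` cball 0 (R + 1))" by (intro compact_continuous_image continuous_on_subset[OF Vc]) auto
    hence "bounded (V ` cball 0 (R + 1))" by (rule compact_imp_bounded)
    then obtain B where B: "\<forall>x\<in>cball 0 (R + 1). \<bar>V x\<bar> \<le> B" by (auto simp: bounded_iff)
    have "\<bar>V x\<bar> \<le> max B 0" for x using V0[of x] B by (cases "R + 1 \<le> norm x") (auto simp: le_max_iff_disj)
    thus ?thesis using that[of "max B 0"] by auto
  qed
  \<comment> \<open>The weight is bounded below on the support of \<open>V\<close>, so a bounded
    function with compact support satisfies the bound for any exponent.\<close>
  define K where "K = B * (1 + (R + 1)\<^sup>2) powr (be / 2)"
  have VK: "\<bar>V x\<bar> \<le> K * pw be x" for x
  proof (cases "R + 1 \<le> norm x")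
    case True thus ?thesis using B by (simp add: V0 K_def)
  next
    case False
    have "(norm x)\<^sup>2 \<le> (R + 1)\<^sup>2" using False R by (intro power_mono) auto
    hence "(1 + (R + 1)\<^sup>2) powr (- (be / 2)) \<le> pw be x" unfolding pw_def using bege g by (intro powr_mono2') (auto simp: add_pos_nonneg)
    hence "K * (1 + (R + 1)\<^sup>2) powr (- (be / 2)) \<le> K * pw be x" using B by (intro mult_left_mono) (auto simp: K_def)
    moreover have "K * (1 + (R + 1)\<^sup>2) powr (- (be / 2)) = B"
    proof -
      have "1 + (R + 1)\<^sup>2 \<noteq> 0" by (smt (verit) zero_le_power2)
      thus ?thesis unfolding K_def by (simp add: powr_minus)
    qed
    ultimately show ?thesis using B(1)[of x] by linarith
  qed
  have K0: "0 \<le> K" using B by (simp add: K_def)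
  have VK2: "\<bar>V x\<bar> \<le> K * pw g2 x" for x using VK[of x] mult_left_mono[OF pw_antimono[of g2 be, where x=x] K0] bege g by simp
  obtain r0 where r0: "0 < r0" "\<And>r x. 0 < r \<Longrightarrow> r < r0 \<Longrightarrow> x \<in> UNIV \<Longrightarrow> \<bar>heat r V x - V x\<bar> \<le> e / 4"
    using heat_uniform_approx[where K=UNIV and e="e / 4", OF Vm B(1) C0_uniform[OF Vc V_lim]] e by auto
  define r where "r = r0 / 2"
  have r: "0 < r" "\<And>x. \<bar>heat r V x - V x\<bar> \<le> e / 4" using r0 by (auto simp: r_def)
  obtain M where M: "0 < M" "\<And>V K x. V \<in> bmeas \<Longrightarrow> (\<And>x. \<bar>V x\<bar> \<le> K * pw be x) \<Longrightarrow>
    \<bar>Lam s (heat r V) (x::'a)\<bar> \<le> K * M * pw g1 x" using Lam_heat_bound[OF s(1,2) dbe r(1)] by metis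
  define c where "c = wconst s"
  have c: "0 < c" using wconst_pos[OF s(1,2)] by (simp add: c_def)
  define F1 where "F1 = (\<lambda>x. 1 / c * Lam s (heat r V) x)"
  define K1 where "K1 = 1 / c * (K * M)"
  have K1: "0 \<le> K1" using K0 M(1) c by (simp add: K1_def)
  have F1K: "\<bar>F1 x\<bar> \<le> K1 * pw g1 x" for x
  proof -
    have "\<bar>F1 x\<bar> = 1 / c * \<bar>Lam s (heat r V) x\<bar>" using c by (simp add: F1_def abs_mult)
    also have "\<dots> \<le> 1 / c * (K * M * pw g1 x)" using c by (intro mult_left_mono M(2)[OF Vm VK]) auto
    finally show ?thesis by (simp add: K1_def)
  qed
  have F1c: "continuous_on UNIV F1" unfolding F1_def by (intro continuous_intros Lam_continuous[OF Vc VK2 r(1)])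
  have F1m[measurable]: "F1 \<in> bmeas" using F1c by (rule cont_bmeas)
  have F1K2: "\<bar>F1 x\<bar> \<le> K1 * pw g2 x" for x using F1K[of x] mult_left_mono[OF pw_antimono[of g2 g1, where x=x] K1] g by simp
  have pF1: "pot s 0 F1 x = heat r V x" for x unfolding F1_def pot_cmult using pot_Lam[OF Vm VK2 r(1), of x] c by (simp add: c_def)
  \<comment> \<open>Matched to the bound \<open>pC\<close> of the potential operator, so that
    cutting off the density costs at most \<open>e / 4\<close>.\<close>
  define e2 where "e2 = e / (4 * (pC + 1))"
  have e2: "0 < e2" using e pC_nonneg by (simp add: e2_def)
  obtain R2 where R2: "0 < R2" "\<And>x. R2 \<le> norm (x::'a) \<Longrightarrow> K1 * pw (g1 - g2) x \<le> e2"
    using pw_eventually_small[of "g1 - g2" e2 K1, where 'a='a] g e2 K1 by auto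
  define F0 where "F0 = (\<lambda>x. cutoff R2 x * F1 x)"
  have F0c: "continuous_on UNIV F0" unfolding F0_def by (intro continuous_intros cutoff_continuous F1c)
  have F0m[measurable]: "F0 \<in> bmeas" using F0c by (rule cont_bmeas)
  have F0F1: "\<bar>F0 x\<bar> \<le> \<bar>F1 x\<bar>" for x
    using mult_right_mono[OF cutoff_props(2)[where R=R2 and x=x], of "\<bar>F1 x\<bar>"] cutoff_props(1)[where R=R2 and x=x] by (simp add: F0_def abs_mult)
  have diff: "\<bar>F0 x - F1 x\<bar> \<le> e2 * pw g2 x" for x
  proof (cases "norm x \<le> R2")
    case True thus ?thesis using e2 by (simp add: F0_def cutoff_props)
  next
    case False
    have "\<bar>F0 x - F1 x\<bar> = \<bar>1 - cutoff R2 x\<bar> * \<bar>F1 x\<bar>"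
      by (simp add: F0_def abs_mult[symmetric] left_diff_distrib abs_minus_commute)
    also have "\<dots> \<le> 1 * (K1 * pw g1 x)" using cutoff_props[where R=R2 and x=x] F1K[of x] by (intro mult_mono) auto
    also have "\<dots> = (K1 * pw (g1 - g2) x) * pw g2 x" using pw_add[of "g1 - g2" g2, where x=x] by (simp add: mult.assoc)
    also have "\<dots> \<le> e2 * pw g2 x" using R2(2)[of x] False by (intro mult_right_mono) auto
    finally show ?thesis .
  qed
  have F0K2: "\<bar>F0 x\<bar> \<le> K1 * pw g2 x" for x using F0F1[of x] F1K2[of x] by linarith
  have "\<bar>pot s 0 F0 x - v0 x\<bar> \<le> e" for x
  proof -
    have "pot s 0 (\<lambda>x. F0 x - F1 x) x = pot s 0 F0 x - pot s 0 F1 x" by (rule pot_add(2)[OF F0m F1m F0K2 F1K2]) simp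
    moreover have "\<bar>pot s 0 (\<lambda>x. F0 x - F1 x) x\<bar> \<le> e2 * pC" by (rule pot_bound'[OF _ diff]) auto
    moreover have "e2 * pC \<le> e / 4"
    proof -
      have "e2 * pC \<le> e2 * (pC + 1)" using e2 by simp
      also have "\<dots> = e / 4" using pC_nonneg by (simp add: e2_def field_simps)
      finally show ?thesis .
    qed
    ultimately show ?thesis using pF1[of x] r(2)[of x] Vv[of x] e by linarith
  qed
  thus ?thesis using that[of F0 "R2 + 1"] F0c R2 by (simp add: F0_def cutoff_props)
qed

section \<open>Smoothing by the heat kernel\<close>

text \<open>The kernel is arbitrary, because derivatives fall on it and produce kernels other than
  \<open>hk\<close>.\<close>

definition cv :: "('b::euclidean_space \<Rightarrow> real) \<Rightarrow> ('b \<Rightarrow> real) \<Rightarrow> 'b \<Rightarrow> real" where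
  "cv v \<kappa> x = (LBINT y. v y * \<kappa> (x - y))"

lemma quot_tendsto:
  fixes g :: "'b::real_normed_vector \<Rightarrow> 'c::real_normed_vector"
  assumes "((\<lambda>h. g h /\<^sub>R norm h) \<longlongrightarrow> 0) F"
  shows "((\<lambda>h. norm (g h) / norm h) \<longlongrightarrow> 0) F" using tendsto_norm_zero[OF assms] by (simp add: divide_inverse mult.commute)

text \<open>A shift by at most 1 is absorbed by doubling the time, since
  \<open>|z|^2 <= 2 |z + k|^2 + 2 |k|^2\<close>. This yields one integrable majorant for all points
  near a given one.\<close>

lemma hk_near:
  fixes z k :: "'b::euclidean_space"
  assumes r: "0 < r" and k: "norm k \<le> 1"
  shows "hk r (z + k) \<le> 2 powr (real DIM('b) / 2) * exp (1 / (4 * r)) * hk (2 * r) z"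
proof -
  have "norm z \<le> norm (z + k) + norm k" using norm_triangle_ineq4[of "z + k" k] by simp
  hence "(norm z)\<^sup>2 \<le> (norm (z + k) + norm k)\<^sup>2" by (intro power_mono) auto
  also have "\<dots> \<le> 2 * (norm (z + k))\<^sup>2 + 2 * (norm k)\<^sup>2"
    using sum_squares_bound[of "norm (z + k)" "norm k"] by (simp add: power2_sum)
  also have "(norm k)\<^sup>2 \<le> 1" using k by (simp add: power_le_one)
  finally have "(norm z)\<^sup>2 / 2 - 1 \<le> (norm (z + k))\<^sup>2" by simp
  hence "- (norm (z + k))\<^sup>2 / (4 * r) \<le> (1 - (norm z)\<^sup>2 / 2) / (4 * r)" using r by (intro divide_right_mono) auto
  also have "\<dots> = 1 / (4 * r) + - (norm z)\<^sup>2 / (4 * (2 * r))" using r by (simp add: field_simps)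
  finally have 1: "exp (- (norm (z + k))\<^sup>2 / (4 * r)) \<le> exp (1 / (4 * r)) * exp (- (norm z)\<^sup>2 / (4 * (2 * r)))"
    by (simp only: exp_add[symmetric] exp_le_cancel_iff)
  have 2: "(4 * pi * r) powr (- (real DIM('b) / 2)) = 2 powr (real DIM('b) / 2) * (4 * pi * (2 * r)) powr (- (real DIM('b) / 2))"
  proof -
    have "(4 * pi * (2 * r)) = 2 * (4 * pi * r)" by simp
    hence "(4 * pi * (2 * r)) powr (- (real DIM('b) / 2)) = 2 powr (- (real DIM('b) / 2)) * (4 * pi * r) powr (- (real DIM('b) / 2))"
      by (simp only: powr_mult)
    thus ?thesis by (simp add: powr_minus)
  qed
  have "hk r (z + k) \<le> (4 * pi * r) powr (- (real DIM('b) / 2)) * (exp (1 / (4 * r)) * exp (- (norm z)\<^sup>2 / (4 * (2 * r))))"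
    unfolding hk_def using 1 by (intro mult_left_mono) auto
  also have "\<dots> = 2 powr (real DIM('b) / 2) * exp (1 / (4 * r)) * hk (2 * r) z" unfolding hk_def 2 by (simp only: mult_ac)
  finally show ?thesis .
qed

context
  fixes v :: "'b::euclidean_space \<Rightarrow> real" and B :: real
  assumes v[measurable]: "v \<in> bmeas" and vB: "\<And>x. \<bar>v x\<bar> \<le> B"
begin

lemma cv_dom_integrable:
  assumes r: "0 < r"
  shows "integrable lborel (\<lambda>y::'b. K * hk r (x - y))"
  using lborel_integral_reflect(2)[of "hk r :: 'b \<Rightarrow> real" x] integrable_hk[OF r, where 'a='b] by (intro integrable_mult_right) simp

lemma B_nonneg: "0 \<le> B" using vB[of 0] by linarith

lemma cv_integrand:
  assumes "\<And>z. \<bar>\<kappa> z\<bar> \<le> K * hk r z"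
  shows "\<bar>v y * \<kappa> (x - y)\<bar> \<le> B * K * hk r (x - y)"
  using mult_mono[OF vB[of y] assms[of "x - y"] B_nonneg] by (simp add: abs_mult mult.assoc)

lemma cv_integrable:
  assumes [measurable]: "\<kappa> \<in> bmeas" and r: "0 < r" and \<kappa>: "\<And>z. \<bar>\<kappa> z\<bar> \<le> K * hk r z"
  shows "integrable lborel (\<lambda>y. v y * \<kappa> (x - y))"
proof (rule lint_bound[OF cv_dom_integrable[OF r, of "B * K" x]])
  show "AE y in lborel. norm (v y * \<kappa> (x - y)) \<le> norm (B * K * hk r (x - y))"
    using order_trans[OF cv_integrand[where \<kappa>=\<kappa>, OF \<kappa>] abs_ge_self] by (simp only: real_norm_def AE_I2)
qed measurable

lemma cv_bound:
  assumes [measurable]: "\<kappa> \<in> bmeas" and r: "0 < r" and \<kappa>: "\<And>z. \<bar>\<kappa> z\<bar> \<le> K * hk r z"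
  shows "\<bar>cv v \<kappa> x\<bar> \<le> B * K"
proof -
  have "\<bar>cv v \<kappa> x\<bar> \<le> (LBINT y. \<bar>v y * \<kappa> (x - y)\<bar>)" unfolding cv_def by (rule integral_abs_bound)
  also have "\<dots> \<le> (LBINT y. B * K * hk r (x - y))"
    by (intro integral_mono integrable_abs cv_integrable[OF assms] cv_dom_integrable r cv_integrand \<kappa>)
  also have "\<dots> = B * K" using lborel_integral_reflect(1)[of "hk r :: 'b \<Rightarrow> real" x] r by (simp add: integral_hk)
  finally show ?thesis .
qed

lemma cv_continuous:
  assumes c: "continuous_on UNIV \<kappa>" and r: "0 < r" and \<kappa>: "\<And>z. \<bar>\<kappa> z\<bar> \<le> K * hk r z"
  shows "continuous_on UNIV (cv v \<kappa>)"
proof (clarsimp simp: continuous_on_sequentially comp_def)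
  fix X :: "nat \<Rightarrow> 'b" and x assume X: "X \<longlonglongrightarrow> x"
  have [measurable]: "\<kappa> \<in> bmeas" using c by (rule cont_bmeas)
  let ?E = "2 powr (real DIM('b) / 2) * exp (1 / (4 * r))"
  have hkp: "0 < hk r (0::'b)" using r by (simp add: hk_def)
  have K: "0 \<le> K" using order_trans[OF abs_ge_zero \<kappa>[of 0]] hkp by (simp add: zero_le_mult_iff)
  have "\<forall>\<^sub>F n in sequentially. dist (X n) x < 1" using X by (intro tendstoD) auto
  then obtain n0 where n0: "\<And>n. n0 \<le> n \<Longrightarrow> dist (X n) x < 1" unfolding eventually_sequentially by blast
  have "(\<lambda>n. cv v \<kappa> (X (n + n0))) \<longlonglongrightarrow> cv v \<kappa> x" unfolding cv_def
  proof (rule integral_dominated_convergence)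
    show "(\<lambda>y. v y * \<kappa> (x - y)) \<in> borel_measurable lborel" by measurable
    show "(\<lambda>y. v y * \<kappa> (X (n + n0) - y)) \<in> borel_measurable lborel" for n by measurable
    show "integrable lborel (\<lambda>y. B * K * ?E * hk (2 * r) (x - y))" using r by (intro cv_dom_integrable) simp
    show "AE y in lborel. (\<lambda>n. v y * \<kappa> (X (n + n0) - y)) \<longlonglongrightarrow> v y * \<kappa> (x - y)"
    proof (intro AE_I2 tendsto_mult tendsto_const)
      fix y
      have "isCont \<kappa> (x - y)" using c by (simp add: continuous_on_eq_continuous_at)
      thus "(\<lambda>n. \<kappa> (X (n + n0) - y)) \<longlonglongrightarrow> \<kappa> (x - y)"
        by (rule isCont_tendsto_compose) (intro tendsto_diff tendsto_const LIMSEQ_ignore_initial_segment X)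
    qed
    show "AE y in lborel. norm (v y * \<kappa> (X (n + n0) - y)) \<le> B * K * ?E * hk (2 * r) (x - y)" for n
    proof (intro AE_I2)
      fix y
      have "\<bar>v y * \<kappa> (X (n + n0) - y)\<bar> \<le> B * K * hk r (X (n + n0) - y)" by (rule cv_integrand[OF \<kappa>])
      also have "hk r (X (n + n0) - y) \<le> ?E * hk (2 * r) (x - y)"
        using hk_near[OF r, of "X (n + n0) - x" "x - y"] n0[of "n + n0"] by (simp add: dist_norm)
      finally show "norm (v y * \<kappa> (X (n + n0) - y)) \<le> B * K * ?E * hk (2 * r) (x - y)"
        using B_nonneg K by (simp add: mult_left_mono mult.assoc)
    qed
  qed
  thus "(\<lambda>n. cv v \<kappa> (X n)) \<longlonglongrightarrow> cv v \<kappa> x" by (rule LIMSEQ_offset)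
qed

text \<open>Differentiation under the integral along sequences: the mean value inequality bounds
  increments of the kernel by its gradient, and \<open>hk_near\<close> makes the bound uniform for
  increments of norm at most 1.\<close>

lemma cv_has_derivative:
  assumes d: "\<And>z. (\<kappa> has_derivative (\<lambda>h. \<kappa>' z \<bullet> h)) (at z)" and r: "0 < r"
    and \<kappa>'c: "continuous_on UNIV \<kappa>'"
    and \<kappa>: "\<And>z. \<bar>\<kappa> z\<bar> \<le> K * hk r z" and \<kappa>': "\<And>z. norm (\<kappa>' z) \<le> K * hk r z"
  shows "(cv v \<kappa> has_derivative (\<lambda>h. \<Sum>b\<in>Basis. (h \<bullet> b) * cv v (\<lambda>z. \<kappa>' z \<bullet> b) x)) (at x)"
proof -
  have \<kappa>c: "continuous_on UNIV \<kappa>" using d by (meson has_derivative_continuous continuous_at_imp_continuous_on)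
  have [measurable]: "\<kappa> \<in> bmeas" using \<kappa>c by (rule cont_bmeas)
  have [measurable]: "\<kappa>' \<in> bmeas" using \<kappa>'c by (rule cont_bmeas)
  let ?E = "2 powr (real DIM('b) / 2) * exp (1 / (4 * r))"
  have hkp: "0 < hk r (0::'b)" using r by (simp add: hk_def)
  have K: "0 \<le> K" using order_trans[OF abs_ge_zero \<kappa>[of 0]] hkp by (simp add: zero_le_mult_iff)
  have kb: "\<bar>\<kappa>' z \<bullet> b\<bar> \<le> K * hk r z" if "b \<in> Basis" for z b using order_trans[OF Basis_le_norm[OF that] \<kappa>'] .
  let ?D = "\<lambda>h. \<Sum>b\<in>Basis. (h \<bullet> b) * cv v (\<lambda>z. \<kappa>' z \<bullet> b) x"
  have D: "?D h = (LBINT y. v y * (\<kappa>' (x - y) \<bullet> h))" for h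
  proof -
    have "?D h = (\<Sum>b\<in>Basis. (LBINT y. (h \<bullet> b) * (v y * (\<kappa>' (x - y) \<bullet> b))))" by (simp add: cv_def)
    also have "\<dots> = (LBINT y. (\<Sum>b\<in>Basis. (h \<bullet> b) * (v y * (\<kappa>' (x - y) \<bullet> b))))"
      by (rule Bochner_Integration.integral_sum[symmetric])
        (intro integrable_mult_right cv_integrable[OF _ r kb, where x=x]; simp)
    also have "\<dots> = (LBINT y. v y * (\<kappa>' (x - y) \<bullet> h))"
      by (subst euclidean_inner[of "\<kappa>' _" h]) (simp add: sum_distrib_left mult_ac)
    finally show ?thesis .
  qed
  have Dint: "integrable lborel (\<lambda>y. v y * (\<kappa>' (x - y) \<bullet> h))" for h
  proof (rule cv_integrable[OF _ r, where K="norm h * K"])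
    show "\<bar>\<kappa>' z \<bullet> h\<bar> \<le> norm h * K * hk r z" for z
      using Cauchy_Schwarz_ineq2[of "\<kappa>' z" h] mult_right_mono[OF \<kappa>'[of z], of "norm h"] by (simp add: mult_ac)
  qed measurable
  have lip: "\<bar>\<kappa> (z + h) - \<kappa> z\<bar> \<le> K * ?E * hk (2 * r) z * norm h" if h: "norm h \<le> 1" for z h
  proof -
    have "norm (\<kappa> (z + h) - \<kappa> z) \<le> (K * ?E * hk (2 * r) z) * norm ((z + h) - z)"
    proof (rule differentiable_bound[of "cball z 1" \<kappa> "\<lambda>z h. \<kappa>' z \<bullet> h"])
      fix w assume w: "w \<in> cball z 1"
      show "(\<kappa> has_derivative (\<bullet>) (\<kappa>' w)) (at w within cball z 1)" using d by (rule has_derivative_at_withinI)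
      have "onorm ((\<bullet>) (\<kappa>' w)) \<le> norm (\<kappa>' w)" by (rule onorm_le) (simp add: Cauchy_Schwarz_ineq2)
      also have "\<dots> \<le> K * hk r w" by (rule \<kappa>')
      also have "\<dots> \<le> K * (?E * hk (2 * r) z)"
        using hk_near[OF r, of "w - z" z] w K by (intro mult_left_mono) (auto simp: dist_norm norm_minus_commute)
      finally show "onorm ((\<bullet>) (\<kappa>' w)) \<le> K * ?E * hk (2 * r) z" by (simp add: mult.assoc)
    qed (use h in \<open>auto simp: dist_norm\<close>)
    thus ?thesis by simp
  qed
  have bl: "bounded_linear ?D" by (intro bounded_linear_sum bounded_linear_mult_left[THEN bounded_linear_compose] bounded_linear_inner_left)
  have "((\<lambda>h. (cv v \<kappa> (x + h) - cv v \<kappa> x - ?D h) /\<^sub>R norm h) \<longlongrightarrow> 0) (at 0)"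
    unfolding tendsto_at_iff_sequentially
  proof (intro allI impI)
    fix X :: "nat \<Rightarrow> 'b" assume X0: "\<forall>i. X i \<in> UNIV - {0}" and X: "X \<longlonglongrightarrow> 0"
    have "\<forall>\<^sub>F n in sequentially. dist (X n) 0 < 1" using X by (intro tendstoD) auto
    then obtain n0 where n0: "\<And>n. n0 \<le> n \<Longrightarrow> norm (X n) \<le> 1" unfolding eventually_sequentially by (force simp: dist_norm)
    define Y where "Y = (\<lambda>n. X (n + n0))"
    have Y: "Y \<longlonglongrightarrow> 0" "\<And>n. Y n \<noteq> 0" "\<And>n. norm (Y n) \<le> 1"
      using X X0 n0 LIMSEQ_ignore_initial_segment[OF X, of n0] by (auto simp: Y_def)
    have eq: "(cv v \<kappa> (x + Y n) - cv v \<kappa> x - ?D (Y n)) /\<^sub>R norm (Y n)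
        = (LBINT y. v y * ((\<kappa> (x - y + Y n) - \<kappa> (x - y) - \<kappa>' (x - y) \<bullet> Y n) / norm (Y n)))" for n
    proof -
      have i1: "integrable lborel (\<lambda>y. v y * \<kappa> (x + Y n - y))" "integrable lborel (\<lambda>y. v y * \<kappa> (x - y))"
        by (rule cv_integrable[OF _ r \<kappa>]; simp)+
      have "cv v \<kappa> (x + Y n) - cv v \<kappa> x - ?D (Y n) = (LBINT y. v y * \<kappa> (x + Y n - y) - v y * \<kappa> (x - y) - v y * (\<kappa>' (x - y) \<bullet> Y n))"
        unfolding D unfolding cv_def using i1 Dint[of "Y n"] by simp
      also have "\<dots> = (LBINT y. v y * (\<kappa> (x - y + Y n) - \<kappa> (x - y) - \<kappa>' (x - y) \<bullet> Y n))"
        by (simp add: right_diff_distrib algebra_simps)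
      finally have f: "cv v \<kappa> (x + Y n) - cv v \<kappa> x - ?D (Y n) = (LBINT y. v y * (\<kappa> (x - y + Y n) - \<kappa> (x - y) - \<kappa>' (x - y) \<bullet> Y n))" .
      have "(LBINT y. v y * ((\<kappa> (x - y + Y n) - \<kappa> (x - y) - \<kappa>' (x - y) \<bullet> Y n) / norm (Y n)))
         = (LBINT y. inverse (norm (Y n)) * (v y * (\<kappa> (x - y + Y n) - \<kappa> (x - y) - \<kappa>' (x - y) \<bullet> Y n)))"
        by (rule lint_cong) (auto simp: divide_inverse)
      also have "\<dots> = inverse (norm (Y n)) * (LBINT y. v y * (\<kappa> (x - y + Y n) - \<kappa> (x - y) - \<kappa>' (x - y) \<bullet> Y n))"
        by (rule integral_mult_right_zero)
      finally show ?thesis unfolding f real_scaleR_def by (rule sym)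
    qed
    have "(\<lambda>n. \<integral>y. v y * ((\<kappa> (x - y + Y n) - \<kappa> (x - y) - \<kappa>' (x - y) \<bullet> Y n) / norm (Y n)) \<partial>lborel) \<longlonglongrightarrow> (\<integral>y. 0 \<partial>(lborel :: 'b measure))"
    proof (rule integral_dominated_convergence)
      show "(\<lambda>y. v y * ((\<kappa> (x - y + Y n) - \<kappa> (x - y) - \<kappa>' (x - y) \<bullet> Y n) / norm (Y n))) \<in> borel_measurable lborel" for n by measurable
      show "integrable lborel (\<lambda>y. B * (K * ?E) * hk (2 * r) (x - y) + B * K * hk r (x - y))"
        using r by (intro lint_add cv_dom_integrable) auto
      show "AE y in lborel. (\<lambda>n. v y * ((\<kappa> (x - y + Y n) - \<kappa> (x - y) - \<kappa>' (x - y) \<bullet> Y n) / norm (Y n))) \<longlonglongrightarrow> 0"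
      proof (intro AE_I2 tendsto_mult_right_zero)
        fix y
        have "((\<lambda>h. (\<kappa> (x - y + h) - \<kappa> (x - y) - \<kappa>' (x - y) \<bullet> h) /\<^sub>R norm h) \<longlongrightarrow> 0) (at 0)"
          using d[of "x - y"] unfolding has_derivative_at by (auto simp: tendsto_norm_zero_iff divide_inverse_commute[symmetric] intro: tendsto_norm_zero_cancel)
        thus "(\<lambda>n. (\<kappa> (x - y + Y n) - \<kappa> (x - y) - \<kappa>' (x - y) \<bullet> Y n) / norm (Y n)) \<longlonglongrightarrow> 0"
          unfolding tendsto_at_iff_sequentially using Y by (auto simp: comp_def divide_inverse_commute)
      qed
      show "AE y in lborel. norm (v y * ((\<kappa> (x - y + Y n) - \<kappa> (x - y) - \<kappa>' (x - y) \<bullet> Y n) / norm (Y n)))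
          \<le> B * (K * ?E) * hk (2 * r) (x - y) + B * K * hk r (x - y)" for n
      proof (intro AE_I2)
        fix y
        let ?z = "x - y"
        have n: "0 < norm (Y n)" using Y by simp
        have "\<bar>\<kappa> (?z + Y n) - \<kappa> ?z - \<kappa>' ?z \<bullet> Y n\<bar> \<le> \<bar>\<kappa> (?z + Y n) - \<kappa> ?z\<bar> + \<bar>\<kappa>' ?z \<bullet> Y n\<bar>" by linarith
        also have "\<dots> \<le> K * ?E * hk (2 * r) ?z * norm (Y n) + K * hk r ?z * norm (Y n)"
          using Cauchy_Schwarz_ineq2[of "\<kappa>' ?z" "Y n"] mult_right_mono[OF \<kappa>'[of ?z], of "norm (Y n)"] by (intro add_mono lip Y) auto
        finally have "\<bar>\<kappa> (?z + Y n) - \<kappa> ?z - \<kappa>' ?z \<bullet> Y n\<bar> / norm (Y n) \<le> K * ?E * hk (2 * r) ?z + K * hk r ?z"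
          using n by (simp add: divide_le_eq distrib_right)
        hence "\<bar>v y\<bar> * (\<bar>\<kappa> (?z + Y n) - \<kappa> ?z - \<kappa>' ?z \<bullet> Y n\<bar> / norm (Y n)) \<le> B * (K * ?E * hk (2 * r) ?z + K * hk r ?z)"
          using vB[of y] B_nonneg by (intro mult_mono) auto
        thus "norm (v y * ((\<kappa> (?z + Y n) - \<kappa> ?z - \<kappa>' ?z \<bullet> Y n) / norm (Y n)))
          \<le> B * (K * ?E) * hk (2 * r) ?z + B * K * hk r ?z" by (simp add: abs_mult distrib_left mult.assoc)
      qed
    qed measurable
    hence "(\<lambda>n. (cv v \<kappa> (x + Y n) - cv v \<kappa> x - ?D (Y n)) /\<^sub>R norm (Y n)) \<longlonglongrightarrow> 0" unfolding eq by simp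
    thus "((\<lambda>h. (cv v \<kappa> (x + h) - cv v \<kappa> x - ?D h) /\<^sub>R norm h) \<circ> X) \<longlonglongrightarrow> 0"
      unfolding Y_def comp_def by (rule LIMSEQ_offset)
  qed
  from quot_tendsto[OF this] bl show ?thesis unfolding has_derivative_at by (intro conjI)
qed

end

section \<open>Derivatives of the Gaussian and quantitative smoothness\<close>

definition gk1 :: "real \<Rightarrow> 'b::euclidean_space \<Rightarrow> 'b" where
  "gk1 r z = (- (1 / (2 * r)) * hk r z) *\<^sub>R z"

text \<open>The gradient of the component of \<open>gk1\<close> along \<open>b\<close>, that is, the
  row of the Hessian of the Gaussian belonging to \<open>b\<close>.\<close>

definition gk2 :: "real \<Rightarrow> 'b::euclidean_space \<Rightarrow> 'b \<Rightarrow> 'b" where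
  "gk2 r b z = (- (1 / (2 * r)) * hk r z) *\<^sub>R b + (1 / (4 * r\<^sup>2) * hk r z * (z \<bullet> b)) *\<^sub>R z"

lemma hk_continuous: "continuous_on S (hk r :: 'b::euclidean_space \<Rightarrow> real)"
  unfolding hk_def divide_inverse by (intro continuous_intros)

lemma hk_has_derivative:
  assumes r: "0 < r" shows "(hk r has_derivative (\<lambda>h. gk1 r z \<bullet> h)) (at (z::'b::euclidean_space))"
proof -
  have "((\<lambda>z::'b. hk r z) has_derivative (\<lambda>h. (4 * pi * r) powr (- (real DIM('b) / 2)) * (exp (- (z \<bullet> z) / (4 * r)) * (- (h \<bullet> z + z \<bullet> h) / (4 * r))))) (at z)"
    unfolding hk_def power2_norm_eq_inner using r by (auto intro!: derivative_eq_intros simp: inner_commute)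
  moreover have "(\<lambda>h. (4 * pi * r) powr (- (real DIM('b) / 2)) * (exp (- (z \<bullet> z) / (4 * r)) * (- (h \<bullet> z + z \<bullet> h) / (4 * r)))) = (\<lambda>h. gk1 r z \<bullet> h)"
    by (auto simp: gk1_def hk_def power2_norm_eq_inner inner_commute)
  ultimately show ?thesis by simp
qed

lemma gk1_has_derivative:
  assumes r: "0 < r" shows "((\<lambda>z. gk1 r z \<bullet> b) has_derivative (\<lambda>h. gk2 r b z \<bullet> h)) (at (z::'b::euclidean_space))"
proof -
  have "((\<lambda>z. hk r z * (z \<bullet> b)) has_derivative (\<lambda>h. hk r z * (h \<bullet> b) + (gk1 r z \<bullet> h) * (z \<bullet> b))) (at z)"
    by (rule has_derivative_mult[OF hk_has_derivative[OF r] has_derivative_inner_left[OF has_derivative_ident]])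
  hence "((\<lambda>z. - (1 / (2 * r)) * (hk r z * (z \<bullet> b))) has_derivative (\<lambda>h. - (1 / (2 * r)) * (hk r z * (h \<bullet> b) + (gk1 r z \<bullet> h) * (z \<bullet> b)))) (at z)"
    by (rule has_derivative_mult_right)
  moreover have "(\<lambda>h. - (1 / (2 * r)) * (hk r z * (h \<bullet> b) + (gk1 r z \<bullet> h) * (z \<bullet> b))) = (\<lambda>h. gk2 r b z \<bullet> h)"
  proof
    fix h
    have "gk2 r b z \<bullet> h = - (1 / (2 * r)) * (hk r z * (h \<bullet> b)) + 1 / (4 * r\<^sup>2) * hk r z * (z \<bullet> b) * (z \<bullet> h)"
      unfolding gk2_def by (simp add: inner_add_left inner_diff_left inner_commute[of b h])
    moreover have "gk1 r z \<bullet> h = - (1 / (2 * r)) * hk r z * (z \<bullet> h)" by (simp add: gk1_def)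
    moreover have "1 / (4 * r\<^sup>2) = (1 / (2 * r)) * (1 / (2 * r))" by (simp add: power2_eq_square)
    ultimately show "- (1 / (2 * r)) * (hk r z * (h \<bullet> b) + (gk1 r z \<bullet> h) * (z \<bullet> b)) = gk2 r b z \<bullet> h"
      by (simp add: algebra_simps)
  qed
  moreover have "(\<lambda>z. - (1 / (2 * r)) * (hk r z * (z \<bullet> b))) = (\<lambda>z. gk1 r z \<bullet> b)" by (simp add: gk1_def)
  ultimately show ?thesis by simp
qed

lemma gk1_continuous: "continuous_on S (gk1 r :: 'b::euclidean_space \<Rightarrow> 'b)"
  unfolding gk1_def by (intro continuous_intros hk_continuous)

lemma gk2_continuous: "continuous_on S (gk2 r b :: 'b::euclidean_space \<Rightarrow> 'b)"
  unfolding gk2_def by (intro continuous_intros hk_continuous)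

lemma gk_bounds:
  assumes r: "0 < r"
  obtains K where "0 < K" "\<And>z. \<bar>hk r (z::'b::euclidean_space)\<bar> \<le> K * hk (2 * r) z" "\<And>z. norm (gk1 r (z::'b)) \<le> K * hk (2 * r) z"
    "\<And>b z. b \<in> Basis \<Longrightarrow> norm (gk2 r b (z::'b)) \<le> K * hk (2 * r) z"
proof -
  obtain C where C: "0 < C" "\<And>t z. 0 < t \<Longrightarrow> (1 + (norm (z::'b))\<^sup>2 / t) powr 1 * hk t z \<le> C * hk (2 * t) z"
    using hk_moment_bound[of 1] by auto
  have m: "hk r z + (norm z)\<^sup>2 / r * hk r z \<le> C * hk (2 * r) z" for z :: 'b
  proof -
    have "0 < 1 + (norm z)\<^sup>2 / r" using r by (simp add: add_pos_nonneg)
    thus ?thesis using C(2)[OF r, of z] by (simp add: distrib_right)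
  qed
  have m2: "(norm z)\<^sup>2 / r * hk r z \<le> C * hk (2 * r) z" "hk r z \<le> C * hk (2 * r) z" for z :: 'b
    using m[of z] r by (smt (verit) hk_nonneg mult_nonneg_nonneg zero_le_divide_iff zero_le_power2)+
  have m3: "(norm z)\<^sup>2 * hk r z \<le> r * C * hk (2 * r) z" for z :: 'b using mult_left_mono[OF m2(1)[of z], of r] r by simp
  have m4: "norm z * hk r z \<le> (1 + r) * C * hk (2 * r) z" for z :: 'b
  proof -
    have "2 * norm z \<le> 1 + (norm z)\<^sup>2" using sum_squares_bound[of 1 "norm z"] by simp
    hence "norm z \<le> 1 + (norm z)\<^sup>2" using norm_ge_zero[of z] by linarith
    hence "norm z * hk r z \<le> (1 + (norm z)\<^sup>2) * hk r z" by (intro mult_right_mono) auto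
    also have "\<dots> \<le> C * hk (2 * r) z + r * C * hk (2 * r) z" using m2(2)[of z] m3[of z] by (simp add: distrib_right)
    finally show ?thesis by (simp add: algebra_simps)
  qed
  let ?K = "C + 1 / (2 * r) * ((1 + r) * C) + 1 / (2 * r) * C + 1 / (4 * r\<^sup>2) * (r * C)"
  have nn: "0 \<le> 1 / (2 * r) * ((1 + r) * C)" "0 \<le> 1 / (2 * r) * C" "0 \<le> 1 / (4 * r\<^sup>2) * (r * C)" using r C by auto
  show ?thesis
  proof (rule that[of ?K])
    show "0 < ?K" using nn C(1) by linarith
    show "\<bar>hk r z\<bar> \<le> ?K * hk (2 * r) z" for z :: 'b
    proof -
      have "C * hk (2 * r) z \<le> ?K * hk (2 * r) z" using nn by (intro mult_right_mono) auto
      thus ?thesis using m2(2)[of z] by simp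
    qed
    show "norm (gk1 r z) \<le> ?K * hk (2 * r) z" for z :: 'b
    proof -
      have "norm (gk1 r z) = 1 / (2 * r) * (norm z * hk r z)" using r by (simp add: gk1_def mult_ac)
      also have "\<dots> \<le> 1 / (2 * r) * ((1 + r) * C * hk (2 * r) z)" using r by (intro mult_left_mono m4) auto
      also have "\<dots> = (1 / (2 * r) * ((1 + r) * C)) * hk (2 * r) z" by simp
      also have "\<dots> \<le> ?K * hk (2 * r) z" using nn C(1) by (intro mult_right_mono) auto
      finally show ?thesis .
    qed
    show "norm (gk2 r b z) \<le> ?K * hk (2 * r) z" if b: "b \<in> Basis" for b z :: 'b
    proof -
      have "norm (gk2 r b z) \<le> norm ((- (1 / (2 * r)) * hk r z) *\<^sub>R b) + norm ((1 / (4 * r\<^sup>2) * hk r z * (z \<bullet> b)) *\<^sub>R z)"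
        unfolding gk2_def by (rule norm_triangle_ineq)
      also have "norm ((- (1 / (2 * r)) * hk r z) *\<^sub>R b) = 1 / (2 * r) * hk r z" using b r by simp
      also have "norm ((1 / (4 * r\<^sup>2) * hk r z * (z \<bullet> b)) *\<^sub>R z) = 1 / (4 * r\<^sup>2) * (hk r z * (\<bar>z \<bullet> b\<bar> * norm z))"
        by (simp add: abs_mult mult_ac)
      also have "1 / (2 * r) * hk r z \<le> 1 / (2 * r) * (C * hk (2 * r) z)" using r by (intro mult_left_mono m2) auto
      also have "1 / (4 * r\<^sup>2) * (hk r z * (\<bar>z \<bullet> b\<bar> * norm z)) \<le> 1 / (4 * r\<^sup>2) * (r * C * hk (2 * r) z)"
      proof (rule mult_left_mono)
        have "\<bar>z \<bullet> b\<bar> * norm z \<le> (norm z)\<^sup>2" using Basis_le_norm[OF b, of z] by (simp add: power2_eq_square mult_right_mono)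
        hence "hk r z * (\<bar>z \<bullet> b\<bar> * norm z) \<le> hk r z * (norm z)\<^sup>2" by (intro mult_left_mono) auto
        thus "hk r z * (\<bar>z \<bullet> b\<bar> * norm z) \<le> r * C * hk (2 * r) z" using m3[of z] by (simp add: mult.commute)
      qed simp
      finally have "norm (gk2 r b z) \<le> (1 / (2 * r) * C + 1 / (4 * r\<^sup>2) * (r * C)) * hk (2 * r) z" by (simp add: distrib_right mult.assoc)
      also have "\<dots> \<le> ?K * hk (2 * r) z" using nn C(1) by (intro mult_right_mono) auto
      finally show ?thesis .
    qed
  qed
qed

definition C2_bounded :: "('b::euclidean_space \<Rightarrow> real) \<Rightarrow> real \<Rightarrow> bool" where
  "C2_bounded w L \<longleftrightarrow> (\<exists>(D :: 'b \<Rightarrow> 'b \<Rightarrow>\<^sub>L real) (D2 :: 'b \<Rightarrow> 'b \<Rightarrow>\<^sub>L 'b \<Rightarrow>\<^sub>L real).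
      (\<forall>z. (w has_derivative blinfun_apply (D z)) (at z)) \<and>
      (\<forall>z. (D has_derivative blinfun_apply (D2 z)) (at z)) \<and> continuous_on UNIV D2 \<and> (\<forall>z. norm (D2 z) \<le> L))"

text \<open>The constant depends on the smoothing time alone and the bound is linear in
  \<open>B\<close>. Later parameters can therefore be fixed before the function to be smoothed is
  known.\<close>

lemma heat_smooth:
  assumes r: "0 < r"
  obtains M where "0 < M" "\<And>v B. v \<in> bmeas \<Longrightarrow> (\<And>x::'b::euclidean_space. \<bar>v x\<bar> \<le> B) \<Longrightarrow> C2_bounded (heat r v) (M * B)"
proof -
  obtain K where K: "0 < K" "\<And>z. \<bar>hk r (z::'b)\<bar> \<le> K * hk (2 * r) z" "\<And>z. norm (gk1 r (z::'b)) \<le> K * hk (2 * r) z"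
    "\<And>b z. b \<in> Basis \<Longrightarrow> norm (gk2 r b (z::'b)) \<le> K * hk (2 * r) z" using gk_bounds[OF r] by metis
  have r2: "0 < 2 * r" using r by simp
  let ?l = "blinfun_inner_left :: 'b \<Rightarrow> 'b \<Rightarrow>\<^sub>L real"
  have nl: "norm (?l b) \<le> 1" if "b \<in> Basis" for b by (rule norm_blinfun_bound) (use Basis_le_norm[OF that] in auto)
  have "C2_bounded (heat r v) (real DIM('b) * real DIM('b) * K * B)"
    if v[measurable]: "v \<in> bmeas" and vB: "\<And>x::'b. \<bar>v x\<bar> \<le> B" for v B
  proof -
    define d where "d = (\<lambda>b. cv v (\<lambda>z. gk1 r z \<bullet> b))"
    define e where "e = (\<lambda>b c. cv v (\<lambda>z. gk2 r b z \<bullet> c))"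
    have hc: "heat r v = cv v (hk r)" by (rule ext) (simp add: cv_def heat_kernel_form)
    have k1: "\<bar>gk1 r z \<bullet> b\<bar> \<le> K * hk (2 * r) z" if "b \<in> Basis" for b z :: 'b
      using order_trans[OF Basis_le_norm[OF that] K(3)] .
    have k2: "\<bar>gk2 r b z \<bullet> c\<bar> \<le> K * hk (2 * r) z" if "b \<in> Basis" "c \<in> Basis" for b c z :: 'b
      using order_trans[OF Basis_le_norm[OF that(2)] K(4)[OF that(1)]] .
    have ec: "continuous_on UNIV (e b c)" if "b \<in> Basis" "c \<in> Basis" for b c
      unfolding e_def by (rule cv_continuous[OF v vB _ r2 k2[OF that]]) (intro continuous_intros gk2_continuous)
    have eB: "\<bar>e b c z\<bar> \<le> B * K" if "b \<in> Basis" "c \<in> Basis" for b c z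
      unfolding e_def by (rule cv_bound[OF v vB _ r2 k2[OF that]]) (intro cont_bmeas continuous_intros gk2_continuous)
    have d1: "(heat r v has_derivative (\<lambda>h. \<Sum>b\<in>Basis. (h \<bullet> b) * d b z)) (at z)" for z
      unfolding hc d_def by (rule cv_has_derivative[OF v vB hk_has_derivative[OF r] r2 gk1_continuous K(2,3)])
    have d2: "(d b has_derivative (\<lambda>h. \<Sum>c\<in>Basis. (h \<bullet> c) * e b c z)) (at z)" if "b \<in> Basis" for b z unfolding d_def e_def
      by (rule cv_has_derivative[OF v vB gk1_has_derivative[OF r] r2 gk2_continuous k1[OF that] K(4)[OF that]])
    define D where "D = (\<lambda>z. \<Sum>b\<in>Basis. d b z *\<^sub>R ?l b)"
    define D2 where "D2 = (\<lambda>z. \<Sum>b\<in>Basis. \<Sum>c\<in>Basis. e b c z *\<^sub>R (blinfun_scaleR_left (?l b) o\<^sub>L ?l c))"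
    have "(heat r v has_derivative blinfun_apply (D z)) (at z)" for z
    proof -
      have "blinfun_apply (D z) = (\<lambda>h. \<Sum>b\<in>Basis. (h \<bullet> b) * d b z)"
        by (rule ext) (simp add: D_def blinfun.sum_left blinfun.scaleR_left mult.commute)
      thus ?thesis using d1 by simp
    qed
    moreover have "(D has_derivative blinfun_apply (D2 z)) (at z)" for z
    proof -
      have "(D has_derivative (\<lambda>h. \<Sum>b\<in>Basis. (\<Sum>c\<in>Basis. (h \<bullet> c) * e b c z) *\<^sub>R ?l b)) (at z)"
        unfolding D_def by (intro has_derivative_sum has_derivative_scaleR_left d2)
      moreover have "blinfun_apply (D2 z) = (\<lambda>h. \<Sum>b\<in>Basis. (\<Sum>c\<in>Basis. (h \<bullet> c) * e b c z) *\<^sub>R ?l b)"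
        by (rule ext) (simp add: D2_def blinfun.sum_left blinfun.scaleR_left scaleR_sum_left mult.commute)
      ultimately show ?thesis by simp
    qed
    moreover have "continuous_on UNIV D2" unfolding D2_def by (intro continuous_intros ec)
    moreover have "norm (D2 z) \<le> (real DIM('b) * real DIM('b) * K) * B" for z
    proof -
      have n1: "norm (blinfun_scaleR_left (?l b) o\<^sub>L ?l c) \<le> 1" if "b \<in> Basis" "c \<in> Basis" for b c
      proof (rule norm_blinfun_bound)
        fix h
        have "norm (blinfun_apply (blinfun_scaleR_left (?l b) o\<^sub>L ?l c) h) = \<bar>h \<bullet> c\<bar> * norm (?l b)" by simp
        also have "\<dots> \<le> norm h * 1" by (intro mult_mono Basis_le_norm nl that) auto
        finally show "norm (blinfun_apply (blinfun_scaleR_left (?l b) o\<^sub>L ?l c) h) \<le> 1 * norm h" by simp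
      qed simp
      have "norm (D2 z) \<le> (\<Sum>b\<in>(Basis::'b set). \<Sum>c\<in>(Basis::'b set). B * K)" unfolding D2_def
      proof (intro sum_norm_le)
        fix b c :: 'b assume bc: "b \<in> Basis" "c \<in> Basis"
        have "\<bar>e b c z\<bar> * norm (blinfun_scaleR_left (?l b) o\<^sub>L ?l c) \<le> \<bar>e b c z\<bar> * 1"
          by (intro mult_left_mono n1 bc) auto
        thus "norm (e b c z *\<^sub>R (blinfun_scaleR_left (?l b) o\<^sub>L ?l c)) \<le> B * K" using eB[OF bc, of z] by simp
      qed
      thus ?thesis by (simp add: mult_ac)
    qed
    ultimately show ?thesis unfolding C2_bounded_def by blast
  qed
  moreover have "0 < real DIM('b) * real DIM('b) * K" using K by simp
  ultimately show ?thesis using that by blast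
qed

text \<open>The error of a backward difference quotient is controlled by the second derivative.
  Since \<open>M\<close> depends only on \<open>r\<close>, a delay \<open>h\<close> can be chosen
  before the delayed equation is solved.\<close>

lemma heat_time_quotient:
  assumes r: "0 < r"
  obtains M where "0 < M" "\<And>\<psi> B t h d. \<psi> \<in> bmeas \<Longrightarrow> (\<And>x::real. \<bar>\<psi> x\<bar> \<le> B) \<Longrightarrow> 0 < h \<Longrightarrow>
    (heat r \<psi> has_real_derivative d) (at t) \<Longrightarrow> \<bar>d - (heat r \<psi> t - heat r \<psi> (t - h)) / h\<bar> \<le> M * B * h"
proof -
  obtain M where M: "0 < M" "\<And>v B. v \<in> bmeas \<Longrightarrow> (\<And>x::real. \<bar>v x\<bar> \<le> B) \<Longrightarrow> C2_bounded (heat r v) (M * B)"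
    using heat_smooth[OF r, where 'b=real] by metis
  have "\<bar>d - (heat r \<psi> t - heat r \<psi> (t - h)) / h\<bar> \<le> M * B * h"
    if \<psi>: "\<psi> \<in> bmeas" "\<And>x::real. \<bar>\<psi> x\<bar> \<le> B" and h: "0 < h" and d: "(heat r \<psi> has_real_derivative d) (at t)" for \<psi> B t h d
  proof -
    obtain D D2 where D: "\<And>z. (heat r \<psi> has_derivative blinfun_apply (D z)) (at z)"
      and D2: "\<And>z. (D has_derivative blinfun_apply (D2 z)) (at z)" "\<And>z. norm (D2 z) \<le> M * B"
      using M(2)[OF \<psi>] unfolding C2_bounded_def by metis
    have real: "(heat r \<psi> has_real_derivative D z 1) (at z)" for z
    proof -
      have "blinfun_apply (D z) = (*) (D z 1)" by (rule ext) (metis blinfun.scaleR_right mult.commute mult.right_neutral real_scaleR_def)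
      thus ?thesis using D[of z] unfolding has_field_derivative_def by simp
    qed
    obtain \<xi> where \<xi>: "t - h < \<xi>" "\<xi> < t" "heat r \<psi> t - heat r \<psi> (t - h) = (t - (t - h)) * D \<xi> 1"
      using MVT2[of "t - h" t "heat r \<psi>" "\<lambda>z. D z 1"] real h by auto
    have "d = D t 1" using d real by (rule DERIV_unique)
    moreover have "(heat r \<psi> t - heat r \<psi> (t - h)) / h = D \<xi> 1" using \<xi>(3) h by simp
    moreover have "\<bar>D t 1 - D \<xi> 1\<bar> \<le> M * B * h"
    proof -
      have "norm (D t - D \<xi>) \<le> M * B * norm (t - \<xi>)"
      proof (rule differentiable_bound[of UNIV D "\<lambda>z. blinfun_apply (D2 z)"])
        show "onorm (blinfun_apply (D2 z)) \<le> M * B" for z using D2(2)[of z] by (simp add: norm_blinfun.rep_eq)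
      qed (use D2 in auto)
      also have "\<dots> \<le> M * B * h"
      proof (rule mult_left_mono)
        show "norm (t - \<xi>) \<le> h" using \<xi> by simp
        show "0 \<le> M * B" using D2(2)[of 0] norm_ge_zero order_trans by blast
      qed
      finally have "norm (D t - D \<xi>) \<le> M * B * h" .
      moreover have "\<bar>D t 1 - D \<xi> 1\<bar> \<le> norm (D t - D \<xi>)"
        using norm_blinfun[of "D t - D \<xi>" 1] by (simp add: blinfun.diff_left)
      ultimately show ?thesis by linarith
    qed
    ultimately show ?thesis by simp
  qed
  thus ?thesis using that M(1) by blast
qed

section \<open>The delayed equation\<close>

lemma hk_Pair: "0 < r \<Longrightarrow> hk r (z::'a::euclidean_space, t::real) = hk r z * hk r t"
  by (simp add: hk_def norm_Pair add_divide_distrib diff_divide_distrib powr_add[symmetric] exp_add[symmetric] mult.assoc mult.left_commute)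

lemma slice_measurable [measurable]:
  fixes v :: "'a::euclidean_space \<times> real \<Rightarrow> real"
  assumes [measurable]: "v \<in> bmeas" "f \<in> borel_measurable M" "g \<in> borel_measurable M"
  shows "(\<lambda>w. v (f w, g w)) \<in> borel_measurable M"
proof -
  have "(\<lambda>w. (f w, g w)) \<in> M \<rightarrow>\<^sub>M (borel :: ('a \<times> real) measure)" unfolding borel_prod[symmetric] by measurable
  from measurable_compose[OF this assms(1)] show ?thesis by simp
qed

text \<open>Fubini for Gaussians in space and in time. As the space-time Gaussian factorises, the
  flow in \<open>N + 1\<close> variables is a smoothing first in time and then in space.\<close>

lemma heat_swap:
  fixes v :: "'a::euclidean_space \<times> real \<Rightarrow> real"
  assumes [measurable]: "v \<in> bmeas" and B: "\<And>p. \<bar>v p\<bar> \<le> B" and r: "0 < r" "0 < q"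
  shows "heat r (\<lambda>y. heat q (\<lambda>t. v (y, t)) t) x = heat q (\<lambda>t. heat r (\<lambda>y. v (y, t)) x) t"
    and "r = q \<Longrightarrow> heat r v (x, t) = heat r (\<lambda>y. heat r (\<lambda>t. v (y, t)) t) x"
proof -
  have B0: "0 \<le> B" using B[of undefined] by linarith
  have fub: "integrable (lborel \<Otimes>\<^sub>M lborel) (\<lambda>(z, u). v (x - z, t - u) * hk q u * hk r z)"
  proof (rule lint_bound)
    show "integrable (lborel \<Otimes>\<^sub>M lborel) (\<lambda>(z::'a, u::real). (B * hk r z) * hk q u)"
      using r by (intro integrable_prod_mult integrable_mult_right integrable_hk)
    show "AE w in lborel \<Otimes>\<^sub>M lborel. norm (case w of (z, u) \<Rightarrow> v (x - z, t - u) * hk q u * hk r z)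
       \<le> norm (case w of (z::'a, u::real) \<Rightarrow> (B * hk r z) * hk q u)"
    proof (intro AE_I2, clarify)
      fix z :: 'a and u :: real
      have "\<bar>v (x - z, t - u)\<bar> * (hk q u * hk r z) \<le> B * (hk q u * hk r z)" by (intro mult_right_mono B) simp
      thus "norm (v (x - z, t - u) * hk q u * hk r z) \<le> norm (B * hk r z * hk q u)" using B0 by (simp add: abs_mult mult_ac)
    qed
  qed measurable
  have 1: "heat r (\<lambda>y. heat q (\<lambda>t. v (y, t)) t) x = (LBINT z. (LBINT u. v (x - z, t - u) * hk q u * hk r z))"
    unfolding heat_def by simp
  also have "\<dots> = (LBINT u. (LBINT z. v (x - z, t - u) * hk q u * hk r z))" by (rule lborel_pair.Fubini_integral[OF fub, symmetric])
  also have "\<dots> = (LBINT u. (LBINT z. v (x - z, t - u) * hk r z * hk q u))" by (simp only: mult_ac)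
  also have "\<dots> = heat q (\<lambda>t. heat r (\<lambda>y. v (y, t)) x) t" unfolding heat_def by simp
  finally show "heat r (\<lambda>y. heat q (\<lambda>t. v (y, t)) t) x = heat q (\<lambda>t. heat r (\<lambda>y. v (y, t)) x) t" .
  assume rq: "r = q"
  have "(LBINT z. (LBINT u. v (x - z, t - u) * hk q u * hk r z))
    = (\<integral>p. v ((x, t) - p) * hk r p \<partial>(lborel \<Otimes>\<^sub>M lborel))"
  proof -
    have hp: "hk q p = hk q (fst p) * hk q (snd p)" for p :: "'a \<times> real" using hk_Pair[OF r(2), of "fst p" "snd p"] by simp
    show ?thesis using lborel_pair.integral_fst'[OF fub] rq by (simp add: case_prod_unfold hp mult_ac minus_prod_def)
  qed
  thus "heat r v (x, t) = heat r (\<lambda>y. heat r (\<lambda>t. v (y, t)) t) x" using 1 rq unfolding heat_def[of r v] lborel_prod by simp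
qed

text \<open>Averages in time only, and therefore commutes with coefficients that depend on space
  alone.\<close>

definition tmol :: "real \<Rightarrow> ('a::euclidean_space \<times> real \<Rightarrow> real) \<Rightarrow> 'a \<times> real \<Rightarrow> real" where
  "tmol d v p = heat d (\<lambda>t. v (fst p, t)) (snd p)"

lemma tmol_continuous:
  fixes v :: "'a::euclidean_space \<times> real \<Rightarrow> real"
  assumes c: "continuous_on UNIV v" and B: "\<And>p. \<bar>v p\<bar> \<le> B" and d: "0 < d"
  shows "continuous_on UNIV (tmol d v)"
proof (clarsimp simp: continuous_on_sequentially comp_def simp del: split_paired_All)
  fix X :: "nat \<Rightarrow> 'a \<times> real" and p assume X: "X \<longlonglongrightarrow> p"
  show "(\<lambda>n. tmol d v (X n)) \<longlonglongrightarrow> tmol d v p" unfolding tmol_def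
  proof (rule heat_continuous[where F="\<lambda>w t. v (fst w, t)" and g=snd and B=B])
    show "continuous_on UNIV (\<lambda>w. v (fst w, snd w - z))" for z by (intro continuous_on_compose2[OF c] continuous_intros) auto
    show "(\<lambda>t. v (fst w, t)) \<in> bmeas" for w by (intro cont_bmeas continuous_on_compose2[OF c] continuous_intros) auto
  qed (use B d X in auto)
qed

lemma tmol_bound:
  fixes v :: "'a::euclidean_space \<times> real \<Rightarrow> real"
  assumes [measurable]: "v \<in> bmeas" and B: "\<And>t. \<bar>v (x, t)\<bar> \<le> B" and d: "0 < d"
  shows "\<bar>tmol d v (x, t)\<bar> \<le> B" unfolding tmol_def using B d by (intro heat_bound) auto

text \<open>The first form is a spatial smoothing of time averages and suits potentials; the second
  has the time smoothing of width \<open>d\<close> outermost and suits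
  \<open>heat_time_quotient\<close>.\<close>

lemma heat_tmol:
  fixes v :: "'a::euclidean_space \<times> real \<Rightarrow> real"
  assumes [measurable]: "v \<in> bmeas" and B: "\<And>p. \<bar>v p\<bar> \<le> B" and r: "0 < r" "0 < d"
    and m[measurable]: "tmol d v \<in> bmeas"
  shows "heat r (tmol d v) (x, t) = heat r (\<lambda>y. heat (r + d) (\<lambda>t. v (y, t)) t) x"
    and "heat r (tmol d v) (x, t) = heat d (heat r (\<lambda>t. heat r (\<lambda>y. v (y, t)) x)) t"
proof -
  have mB: "\<bar>tmol d v p\<bar> \<le> B" for p using tmol_bound[OF assms(1) _ r(2), of "fst p" B "snd p"] B by simp
  have e: "heat r (\<lambda>t. tmol d v (y, t)) t = heat (r + d) (\<lambda>t. v (y, t)) t" for y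
  proof -
    have "heat r (heat d (\<lambda>t. v (y, t))) t = heat (r + d) (\<lambda>t. v (y, t)) t" by (rule heat_heat[where B=B]) (use B r in auto)
    thus ?thesis by (simp add: tmol_def)
  qed
  have "heat r (tmol d v) (x, t) = heat r (\<lambda>y. heat r (\<lambda>t. tmol d v (y, t)) t) x" using heat_swap(2)[OF m mB r(1) r(1)] by simp
  thus 1: "heat r (tmol d v) (x, t) = heat r (\<lambda>y. heat (r + d) (\<lambda>t. v (y, t)) t) x" by (simp add: e)
  also have "\<dots> = heat (d + r) (\<lambda>t. heat r (\<lambda>y. v (y, t)) x) t"
    using heat_swap(1)[OF assms(1) B r(1), of "r + d" t x] r by (simp add: add.commute)
  also have "\<dots> = heat d (heat r (\<lambda>t. heat r (\<lambda>y. v (y, t)) x)) t"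
  proof (rule heat_heat[where B=B, symmetric])
    show "(\<lambda>t. heat r (\<lambda>y. v (y, t)) x) \<in> bmeas" unfolding heat_def by measurable
  qed (use B r in \<open>auto intro!: heat_bound\<close>)
  finally show "heat r (tmol d v) (x, t) = heat d (heat r (\<lambda>t. heat r (\<lambda>y. v (y, t)) x)) t" .
qed

text \<open>The bound \<open>c\<close> is the same for all \<open>th\<close>, so the solution
  operators share a Lipschitz constant and the parameter advances in steps of fixed length
  \<open>1 / n\<close>, each step by a contraction.\<close>

lemma continuity_method:
  fixes Bo :: "'x::{real_normed_vector, complete_space} \<Rightarrow> 'x"
  assumes bl: "bounded_linear Bo" and c: "0 \<le> c"
    and ap: "\<And>th z. 0 \<le> th \<Longrightarrow> th \<le> 1 \<Longrightarrow> norm z \<le> c * norm (z + th *\<^sub>R Bo z)"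
  shows "\<exists>z. z + Bo z = Y"
proof -
  interpret Bo: bounded_linear Bo by fact
  obtain L where L: "0 < L" "\<And>z. norm (Bo z) \<le> norm z * L" using Bo.pos_bounded by blast
  \<comment> \<open>Makes the contraction factor \<open>c * L / n\<close> smaller than 1.\<close>
  obtain n :: nat where n: "c * L < real n" using reals_Archimedean2 by blast
  have n0: "0 < n" using n c L by (metis less_le_trans linorder_not_less mult_nonneg_nonneg less_imp_le of_nat_0_less_iff order_refl zero_less_iff_neq_zero of_nat_0 le_less_trans)
  have "\<forall>Y. \<exists>z. z + (real m / real n) *\<^sub>R Bo z = Y" if "m \<le> n" for m using that
  proof (induction m)
    case (Suc m)
    define th where "th = real m / real n"
    have th: "0 \<le> th" "th \<le> 1" using Suc.prems n0 by (auto simp: th_def)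
    have IH: "\<forall>Y. \<exists>z. z + th *\<^sub>R Bo z = Y" using Suc by (simp add: th_def)
    then obtain S where S: "\<And>Y. S Y + th *\<^sub>R Bo (S Y) = Y" by metis
    have lip: "norm (S Y - S Y') \<le> c * norm (Y - Y')" for Y Y'
    proof -
      have "(S Y - S Y') + th *\<^sub>R Bo (S Y - S Y') = (S Y + th *\<^sub>R Bo (S Y)) - (S Y' + th *\<^sub>R Bo (S Y'))"
        by (simp add: Bo.diff scaleR_diff_right)
      hence "(S Y - S Y') + th *\<^sub>R Bo (S Y - S Y') = Y - Y'" by (simp only: S)
      thus ?thesis using ap[OF th, of "S Y - S Y'"] by simp
    qed
    show ?case
    proof
      fix Y
      \<comment> \<open>The additional part of \<open>Bo z\<close> is moved to the right-hand side
        of the equation already solvable at \<open>th\<close>; a fixed point solves the equation at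
        \<open>th + 1 / n\<close>.\<close>
      define \<Phi> where "\<Phi> = (\<lambda>z. S (Y - (1 / real n) *\<^sub>R Bo z))"
      define k where "k = c * L / real n"
      have k: "0 \<le> k" "k < 1" using n n0 c L by (auto simp: k_def)
      have "\<exists>!z. \<Phi> z = z"
      proof (rule banach_fix_type[OF k])
        show "\<forall>x. \<forall>y. dist (\<Phi> x) (\<Phi> y) \<le> k * dist x y"
        proof (intro allI)
          fix x y
          have "dist (\<Phi> x) (\<Phi> y) \<le> c * norm ((Y - (1 / real n) *\<^sub>R Bo x) - (Y - (1 / real n) *\<^sub>R Bo y))"
            unfolding \<Phi>_def dist_norm by (rule lip)
          also have "(Y - (1 / real n) *\<^sub>R Bo x) - (Y - (1 / real n) *\<^sub>R Bo y) = (1 / real n) *\<^sub>R Bo (y - x)"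
            by (simp add: Bo.diff scaleR_diff_right)
          also have "c * norm ((1 / real n) *\<^sub>R Bo (y - x)) \<le> c * ((1 / real n) * (norm (y - x) * L))"
            using c n0 L(2)[of "y - x"] by (intro mult_left_mono) (auto intro!: divide_right_mono)
          also have "\<dots> = k * dist x y" by (simp add: k_def dist_norm norm_minus_commute mult_ac)
          finally show "dist (\<Phi> x) (\<Phi> y) \<le> k * dist x y" .
        qed
      qed
      then obtain z where z: "S (Y - (1 / real n) *\<^sub>R Bo z) = z" unfolding \<Phi>_def by blast
      have "z + th *\<^sub>R Bo z = Y - (1 / real n) *\<^sub>R Bo z" using S[of "Y - (1 / real n) *\<^sub>R Bo z"] unfolding z .
      hence "z + (th + 1 / real n) *\<^sub>R Bo z = Y" by (simp add: scaleR_add_left algebra_simps)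
      moreover have "th + 1 / real n = real (Suc m) / real n" by (simp add: th_def add_divide_distrib)
      ultimately show "\<exists>z. z + (real (Suc m) / real n) *\<^sub>R Bo z = Y" by auto
    qed
  qed simp
  from this[of n] show ?thesis using n0 by simp
qed

text \<open>The bound on \<open>1 / A\<close> turns every bounded source \<open>g\<close> into an
  admissible density \<open>g / A\<close>; \<open>1 <= b0\<close> lets constants bound the
  solutions.\<close>

locale parab = fpot s be C k ga ty for s be C k ga :: real and ty :: "'a::euclidean_space itself" +
  fixes A b0 :: "'a \<Rightarrow> real" and KA Bb :: real
  assumes sN: "2 * s < real DIM('a)"
    and Ac: "continuous_on UNIV A" and Apos: "\<And>x. 0 < A x" and AK: "\<And>x. 1 / A x \<le> KA * pw be x"
    and b0c: "continuous_on UNIV b0" and b01: "\<And>x. 1 \<le> b0 x" and b0B: "\<And>x. b0 x \<le> Bb"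
begin

lemma KA_pos: "0 < KA"
proof -
  have "0 < 1 / A 0" using Apos[of 0] by simp
  also have "\<dots> \<le> KA * pw be (0::'a)" by (rule AK)
  finally show ?thesis using pw_pos[of be "0::'a"] by (simp add: zero_less_mult_iff)
qed

lemma Bb_ge: "1 \<le> Bb" using b01[of 0] b0B[of 0] by linarith

definition dens :: "('a \<times> real \<Rightarrow> real) \<Rightarrow> real \<Rightarrow> 'a \<Rightarrow> real" where
  "dens g t y = g (y, t) / A y"

text \<open>At each fixed time the inverse of \<open>A * (-Delta)^s\<close>, up to a constant. The
  relation \<open>v = KK (G - MM h v)\<close> expresses the delayed equation without any derivative
  of \<open>v\<close>.\<close>

definition KK :: "('a \<times> real \<Rightarrow> real) \<Rightarrow> 'a \<times> real \<Rightarrow> real" where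
  "KK g p = pot s 0 (dens g (snd p)) (fst p)"

context
  fixes g :: "'a \<times> real \<Rightarrow> real" and B :: real
  assumes gc: "continuous_on UNIV g" and gB: "\<And>p. \<bar>g p\<bar> \<le> B"
begin

lemma dens_cont: "continuous_on UNIV (dens g t)"
  unfolding dens_def using Apos by (intro continuous_intros continuous_on_compose2[OF gc] Ac) (auto simp: less_imp_neq[symmetric])

lemma dens_meas: "dens g t \<in> bmeas"
  using dens_cont by (rule cont_bmeas)

lemma dens_bound: "\<bar>dens g t y\<bar> \<le> (B * KA) * pw be y"
proof -
  have "\<bar>dens g t y\<bar> = \<bar>g (y, t)\<bar> * (1 / A y)" using Apos[of y] by (simp add: dens_def)
  also have "\<dots> \<le> B * (KA * pw be y)" using gB[of "(y, t)"] Apos[of y] by (intro mult_mono AK) auto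
  finally show ?thesis by (simp add: mult.assoc)
qed

lemma KK_cont: "continuous_on UNIV (KK g)"
proof (clarsimp simp: continuous_on_sequentially comp_def simp del: split_paired_All)
  fix X :: "nat \<Rightarrow> 'a \<times> real" and p assume X: "X \<longlonglongrightarrow> p"
  show "(\<lambda>n. KK g (X n)) \<longlonglongrightarrow> KK g p" unfolding KK_def
  proof (rule pot_tendsto[OF dens_meas dens_bound dens_meas])
    fix q :: real assume q: "0 < q"
    show "(\<lambda>n. heat q (dens g (snd (X n))) (fst (X n))) \<longlonglongrightarrow> heat q (dens g (snd p)) (fst p)"
    proof (rule heat_continuous[where F="\<lambda>w. dens g (snd w)" and g=fst and B="B * KA"])
      show "continuous_on UNIV (\<lambda>w. dens g (snd w) (fst w - z))" for z unfolding dens_def using Apos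
        by (intro continuous_intros continuous_on_compose2[OF gc] continuous_on_compose2[OF Ac]) (auto simp: less_imp_neq[symmetric])
      show "\<bar>dens g (snd w) x\<bar> \<le> B * KA" for w x by (rule F_bound[OF dens_meas dens_bound])
    qed (use q X dens_meas in auto)
  qed simp
qed

lemma KK_bound: "\<bar>KK g p\<bar> \<le> B * KA * pC"
  unfolding KK_def by (rule pot_bound'[OF dens_meas dens_bound]) simp

end

abbreviation ap :: "(('a \<times> real) \<Rightarrow>\<^sub>C real) \<Rightarrow> 'a \<times> real \<Rightarrow> real" where "ap \<equiv> apply_bcontfun"

text \<open>\<open>KX\<close> and the later \<open>MX\<close> lift \<open>KK\<close> and
  \<open>MM\<close> to the Banach space of bounded continuous functions, where
  \<open>continuity_method\<close> applies.\<close>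

definition KX :: "(('a \<times> real) \<Rightarrow>\<^sub>C real) \<Rightarrow> (('a \<times> real) \<Rightarrow>\<^sub>C real)" where
  "KX g = Bcontfun (KK (ap g))"

lemma ap_bound: "\<bar>ap g p\<bar> \<le> norm g"
  using norm_bounded[of g p] by simp

lemma ap_cont: "continuous_on UNIV (ap g)" by simp

lemma ap_KX: "ap (KX g) = KK (ap g)"
  unfolding KX_def by (rule Bcontfun_inverse) (rule bcontfun_normI[OF KK_cont[OF ap_cont ap_bound]], use KK_bound[OF ap_cont ap_bound] in simp)

lemma norm_KX: "norm (KX g) \<le> norm g * (KA * pC)"
  by (rule norm_bound) (use KK_bound[OF ap_cont ap_bound, of g] in \<open>simp add: ap_KX mult.assoc\<close>)

lemma KX_linear: "bounded_linear KX"
proof (rule bounded_linear_intro[where K="KA * pC"])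
  fix f g :: "('a \<times> real) \<Rightarrow>\<^sub>C real" and c :: real
  show "KX (f + g) = KX f + KX g"
  proof (rule bcontfun_eqI)
    fix p
    have "dens (ap (f + g)) t = (\<lambda>y. dens (ap f) t y + dens (ap g) t y)" for t by (rule ext) (simp add: dens_def add_divide_distrib)
    thus "ap (KX (f + g)) p = ap (KX f + KX g) p"
      by (simp add: ap_KX KK_def pot_add(1)[OF dens_meas[OF ap_cont ap_bound] dens_meas[OF ap_cont ap_bound] dens_bound[OF ap_cont ap_bound] dens_bound[OF ap_cont ap_bound]])
  qed
  show "KX (c *\<^sub>R f) = c *\<^sub>R KX f"
  proof (rule bcontfun_eqI)
    fix p
    have "dens (ap (c *\<^sub>R f)) t = (\<lambda>y. c * dens (ap f) t y)" for t by (rule ext) (simp add: dens_def)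
    thus "ap (KX (c *\<^sub>R f)) p = ap (c *\<^sub>R KX f) p" by (simp add: ap_KX KK_def pot_cmult)
  qed
  show "norm (KX f) \<le> norm f * (KA * pC)" by (rule norm_KX)
qed

definition MM :: "real \<Rightarrow> ('a \<times> real \<Rightarrow> real) \<Rightarrow> 'a \<times> real \<Rightarrow> real" where
  "MM h z p = (z p - z (fst p, snd p - h)) / h + b0 (fst p) * z p"

definition MX :: "real \<Rightarrow> (('a \<times> real) \<Rightarrow>\<^sub>C real) \<Rightarrow> (('a \<times> real) \<Rightarrow>\<^sub>C real)" where
  "MX h z = Bcontfun (MM h (ap z))"

lemma MM_cont:
  assumes z: "continuous_on UNIV z" shows "continuous_on UNIV (MM h z)"
proof -
  have 1: "continuous_on UNIV (\<lambda>p. z (fst p, snd p - h))" by (rule continuous_on_compose2[OF z]) (auto intro!: continuous_intros)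
  have 2: "continuous_on UNIV (\<lambda>p::'a \<times> real. b0 (fst p))" by (rule continuous_on_compose2[OF b0c]) (auto intro!: continuous_intros)
  show ?thesis unfolding MM_def divide_inverse by (intro continuous_on_add continuous_on_mult continuous_on_diff continuous_on_const 1 2 z)
qed

lemma MM_bound:
  assumes h: "0 < h" and z: "\<And>p. \<bar>z p\<bar> \<le> B" shows "\<bar>MM h z p\<bar> \<le> (2 / h + Bb) * B"
proof -
  have B0: "0 \<le> B" using z[of undefined] by linarith
  have 1: "\<bar>(z p - z (fst p, snd p - h)) / h\<bar> \<le> 2 * B / h" using h z[of p] z[of "(fst p, snd p - h)"] by (simp add: divide_right_mono)
  have "\<bar>b0 (fst p) * z p\<bar> = b0 (fst p) * \<bar>z p\<bar>" using b01[of "fst p"] by (simp add: abs_mult)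
  also have "\<dots> \<le> Bb * B" using b0B[of "fst p"] z[of p] Bb_ge by (intro mult_mono) auto
  finally have 2: "\<bar>b0 (fst p) * z p\<bar> \<le> Bb * B" .
  have "(2 / h + Bb) * B = 2 * B / h + Bb * B" by (simp add: distrib_right)
  thus ?thesis using 1 2 unfolding MM_def by linarith
qed

lemma ap_MX: assumes h: "0 < h" shows "ap (MX h z) = MM h (ap z)"
  unfolding MX_def by (rule Bcontfun_inverse) (rule bcontfun_normI[OF MM_cont[OF ap_cont]], use MM_bound[OF h ap_bound] in simp)

lemma norm_MX: "0 < h \<Longrightarrow> norm (MX h z) \<le> norm z * (2 / h + Bb)"
  by (rule norm_bound) (use MM_bound[OF _ ap_bound, of h z] in \<open>simp add: ap_MX mult.commute\<close>)

lemma MX_linear: assumes h: "0 < h" shows "bounded_linear (MX h)"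
proof (rule bounded_linear_intro[where K="2 / h + Bb"])
  show "MX h (f + g) = MX h f + MX h g" for f g by (rule bcontfun_eqI) (simp add: ap_MX h MM_def add_divide_distrib diff_divide_distrib algebra_simps)
  show "MX h (c *\<^sub>R f) = c *\<^sub>R MX h f" for c f
    by (rule bcontfun_eqI) (simp add: ap_MX h MM_def add_divide_distrib diff_divide_distrib algebra_simps)
  show "norm (MX h f) \<le> norm f * (2 / h + Bb)" for f by (rule norm_MX[OF h])
qed

text \<open>The supremum of \<open>z - W\<close> need not be attained in time, so an almost maximal
  time slice is chosen. In that slice \<open>pot_max_principle\<close> supplies an exact spatial
  maximum with nonnegative density, and there the equation bounds \<open>MM h z\<close> by
  \<open>g\<close>. The factor \<open>th\<close> is the parameter of the continuity method.\<close>

lemma delay_comparison: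
  assumes gc: "continuous_on UNIV g" and gB: "\<And>p. \<bar>g p\<bar> \<le> B" and h: "0 < h" and th: "0 < th"
    and z: "\<And>p. z p = KK (\<lambda>p. th * (g p - MM h z p)) p" and zc: "continuous_on UNIV z" and zB: "\<And>p. \<bar>z p\<bar> \<le> Bz"
    and W0: "\<And>t. 0 \<le> W t" and W: "\<And>t. (W t - W (t - h)) / h + W t \<ge> \<Gamma> t" and g\<Gamma>: "\<And>x t. g (x, t) \<le> \<Gamma> t"
  shows "z (x, t) \<le> W t"
proof (rule ccontr)
  assume "\<not> z (x, t) \<le> W t"
  hence gt: "0 < z (x, t) - W t" by simp
  define S where "S = (SUP p. z p - W (snd p))"
  have bdd: "bdd_above (range (\<lambda>p. z p - W (snd p)))"
  proof (rule bdd_aboveI[where M=Bz])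
    fix y assume "y \<in> range (\<lambda>p. z p - W (snd p))"
    then obtain p where "y = z p - W (snd p)" by auto
    thus "y \<le> Bz" using zB[of p] W0[of "snd p"] by simp
  qed
  have Sup: "z p - W (snd p) \<le> S" for p unfolding S_def by (rule cSUP_upper[OF _ bdd]) simp
  have S0: "0 < S" using Sup[of "(x, t)"] gt by simp
  \<comment> \<open>The defect enters the difference quotient as \<open>\<eta> / h\<close> and the
    zero-order term as \<open>\<eta>\<close>; this choice limits their sum to
    \<open>S / 2\<close>.\<close>
  define \<eta> where "\<eta> = S / (2 * (1 + 1 / h))"
  have hp: "0 < 1 + 1 / h" using h by (simp add: add_pos_pos)
  have \<eta>: "0 < \<eta>" "\<eta> < S" "\<eta> * (1 + 1 / h) = S / 2"
  proof -
    show "0 < \<eta>" using S0 hp by (simp add: \<eta>_def)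
    show e: "\<eta> * (1 + 1 / h) = S / 2" using hp unfolding \<eta>_def by (metis less_irrefl mult.commute nonzero_mult_divide_mult_cancel_right times_divide_eq_left)
    have "\<eta> * 1 \<le> \<eta> * (1 + 1 / h)" using \<open>0 < \<eta>\<close> h by (intro mult_left_mono) auto
    thus "\<eta> < S" using e S0 by simp
  qed
  obtain p where p: "S - \<eta> < z p - W (snd p)" using less_cSUP_iff[OF _ bdd, of "S - \<eta>"] \<eta> unfolding S_def by auto
  obtain x1 t1 where p1: "p = (x1, t1)" by (cases p)
  let ?g = "\<lambda>p. th * (g p - MM h z p)"
  have gc': "continuous_on UNIV ?g" by (intro continuous_intros gc MM_cont zc)
  have gB': "\<bar>?g p\<bar> \<le> th * (B + (2 / h + Bb) * Bz)" for p using th gB[of p] MM_bound[where z=z and p=p, OF h zB] by (simp add: abs_mult)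
  \<comment> \<open>\<open>W\<close> is nonnegative, so \<open>z\<close> is positive at the almost
    maximal point, as \<open>pot_max_principle\<close> requires.\<close>
  have pos: "0 < pot s 0 (dens ?g t1) x1" using p z[of p] W0[of t1] \<eta> by (simp add: p1 KK_def)
  obtain x2 where x2: "\<And>y. pot s 0 (dens ?g t1) y \<le> pot s 0 (dens ?g t1) x2" "0 \<le> dens ?g t1 x2"
    using pot_max_principle[OF dens_cont[OF gc' gB'] dens_bound[OF gc' gB'] pos] by blast
  have z2: "z (x1, t1) \<le> z (x2, t1)" using x2(1)[of x1] z[of "(x1, t1)"] z[of "(x2, t1)"] by (simp add: KK_def)
  have "0 \<le> th * (g (x2, t1) - MM h z (x2, t1))" using x2(2) Apos[of x2] by (simp add: dens_def zero_le_divide_iff)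
  hence G: "MM h z (x2, t1) \<le> g (x2, t1)" using th by (simp add: zero_le_mult_iff)
  have big: "S - \<eta> < z (x2, t1) - W t1" using p z2 by (simp add: p1)
  have "(W t1 - W (t1 - h) - \<eta>) / h \<le> (z (x2, t1) - z (x2, t1 - h)) / h" using big Sup[of "(x2, t1 - h)"] h by (intro divide_right_mono) auto
  moreover have "z (x2, t1) \<le> b0 x2 * z (x2, t1)" using mult_right_mono[OF b01[of x2], of "z (x2, t1)"] big \<eta> W0[of t1] by simp
  ultimately have "(W t1 - W (t1 - h) - \<eta>) / h + (W t1 + S - \<eta>) < \<Gamma> t1" using G big g\<Gamma>[of x2 t1] unfolding MM_def by simp
  moreover have "(W t1 - W (t1 - h) - \<eta>) / h + (W t1 + S - \<eta>) = ((W t1 - W (t1 - h)) / h + W t1) + S - \<eta> * (1 + 1 / h)"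
    by (simp add: diff_divide_distrib distrib_left)
  ultimately show False using W[of t1] \<eta>(3) S0 by simp
qed

lemma KK_neg: "KK (\<lambda>p. - g p) p = - KK g p"
proof -
  have "dens (\<lambda>p. - g p) t = (\<lambda>y. -1 * dens g t y)" for t by (rule ext) (simp add: dens_def)
  thus ?thesis using pot_cmult[of s 0 "-1" "dens g (snd p)" "fst p"] by (simp only: KK_def)
qed

lemma delay_comparison_abs:
  assumes gc: "continuous_on UNIV g" and gB: "\<And>p. \<bar>g p\<bar> \<le> B" and h: "0 < h" and th: "0 < th"
    and z: "\<And>p. z p = KK (\<lambda>p. th * (g p - MM h z p)) p" and zc: "continuous_on UNIV z" and zB: "\<And>p. \<bar>z p\<bar> \<le> Bz"
    and W0: "\<And>t. 0 \<le> W t" and W: "\<And>t. (W t - W (t - h)) / h + W t \<ge> \<Gamma> t" and g\<Gamma>: "\<And>x t. \<bar>g (x, t)\<bar> \<le> \<Gamma> t"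
  shows "\<bar>z (x, t)\<bar> \<le> W t"
proof -
  have 1: "z (x, t) \<le> W t"
    by (rule delay_comparison[where g=g and z=z and W=W and \<Gamma>=\<Gamma> and th=th and h=h, OF gc gB h th z zc zB W0 W]) (use g\<Gamma> abs_le_D1 in blast)
  have MMn: "MM h (\<lambda>p. - z p) p = - MM h z p" for p by (simp add: MM_def minus_divide_left)
  have "- z (x, t) \<le> W t"
  proof (rule delay_comparison[where z="\<lambda>p. - z p" and g="\<lambda>p. - g p" and W=W and \<Gamma>=\<Gamma> and th=th and h=h, OF _ _ h th _ _ _ W0 W])
    show "- z p = KK (\<lambda>p. th * (- g p - MM h (\<lambda>p. - z p) p)) p" for p
    proof -
      have "(\<lambda>p. th * (- g p - MM h (\<lambda>p. - z p) p)) = (\<lambda>p. - (th * (g p - MM h z p)))"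
        by (rule ext) (simp add: MMn algebra_simps)
      thus ?thesis using KK_neg[of "\<lambda>p. th * (g p - MM h z p)" p] z[of p] by simp
    qed
    show "- g (x, t) \<le> \<Gamma> t" for x t using g\<Gamma>[of x t] by linarith
  qed (use gB zB in \<open>auto intro!: continuous_intros gc zc\<close>)
  thus ?thesis using 1 by linarith
qed

text \<open>The a priori bound for the continuity method: if \<open>Y\<close> is the right-hand side
  produced by \<open>z\<close>, then \<open>v = Y - z\<close> solves the delayed equation with
  source \<open>MX h Y\<close> and parameter \<open>th\<close>, hence is bounded by the norm of that
  source.\<close>

lemma delay_solve:
  assumes h: "0 < h"
  shows "\<exists>v. v = KX (G - MX h v)"
proof -
  interpret K: bounded_linear KX by (rule KX_linear)
  interpret M: bounded_linear "MX h" by (rule MX_linear[OF h])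
  let ?m = "2 / h + Bb"
  have m: "0 \<le> ?m" using h Bb_ge by simp
  have "\<exists>z. z + (\<lambda>z. KX (MX h z)) z = KX G"
  proof (rule continuity_method[where c="1 + ?m" and Bo="\<lambda>z. KX (MX h z)"])
    show "bounded_linear (\<lambda>z. KX (MX h z))" using bounded_linear_compose[OF KX_linear MX_linear[OF h]] .
    show "0 \<le> 1 + ?m" using m by simp
    fix th z assume th: "0 \<le> (th::real)" "th \<le> 1"
    define Y where "Y = z + th *\<^sub>R KX (MX h z)"
    show "norm z \<le> (1 + ?m) * norm (z + th *\<^sub>R KX (MX h z))"
    proof (cases "th = 0")
      case True thus ?thesis using mult_right_mono[of 1 "1 + ?m" "norm z"] m by simp
    next
      case False
      hence th0: "0 < th" using th by simp
      define v where "v = Y - z"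
      have v: "v = KX (th *\<^sub>R (MX h Y - MX h v))" by (simp add: v_def Y_def K.scaleR M.diff M.add)
      have "\<bar>ap v (x, t)\<bar> \<le> norm (MX h Y)" for x t
      proof (rule delay_comparison_abs[where z="ap v" and g="ap (MX h Y)" and W="\<lambda>_. norm (MX h Y)" and \<Gamma>="\<lambda>_. norm (MX h Y)", OF ap_cont ap_bound h th0 _ ap_cont ap_bound])
        show "ap v p = KK (\<lambda>p. th * (ap (MX h Y) p - MM h (ap v) p)) p" for p
        proof -
          have "ap v p = KK (ap (th *\<^sub>R (MX h Y - MX h v))) p" using v ap_KX by metis
          moreover have "ap (th *\<^sub>R (MX h Y - MX h v)) = (\<lambda>p. th * (ap (MX h Y) p - MM h (ap v) p))"
            by (rule ext) (simp add: ap_MX[OF h])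
          ultimately show ?thesis by simp
        qed
      qed (use ap_bound in auto)
      hence "norm v \<le> norm (MX h Y)" by (intro norm_bound) auto
      also have "\<dots> \<le> norm Y * ?m" by (rule norm_MX[OF h])
      finally have "norm v \<le> norm Y * ?m" .
      moreover have "norm z \<le> norm Y + norm v" unfolding v_def using norm_triangle_ineq4[of Y "Y - z"] by simp
      ultimately show ?thesis unfolding Y_def[symmetric] by (simp add: algebra_simps)
    qed
  qed
  then obtain z where "z + KX (MX h z) = KX G" by auto
  hence "z = KX (G - MX h z)" by (simp add: K.diff eq_diff_eq)
  thus ?thesis by blast
qed

end

section \<open>Smooth approximate solutions\<close>

lemma heat_slice_measurable:
  fixes v :: "'a::euclidean_space \<times> real \<Rightarrow> real"
  assumes [measurable]: "v \<in> bmeas"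
  shows "(\<lambda>u. heat r (\<lambda>y. v (y, u)) x) \<in> bmeas" unfolding heat_def by measurable

lemma heat_borel_measurable:
  assumes "F \<in> bmeas" shows "heat r F \<in> bmeas" using assms by measurable

lemma heat_second_moment:
  obtains C where "0 < C" "\<And>r t. 0 < r \<Longrightarrow> t\<^sup>2 * hk r (t::real) \<le> C * r * hk (2 * r) t"
proof -
  obtain C where C: "0 < C" "\<And>t z. 0 < t \<Longrightarrow> (1 + (norm (z::real))\<^sup>2 / t) powr 1 * hk t z \<le> C * hk (2 * t) z"
    using hk_moment_bound[of 1, where 'a=real] by (metis zero_le_one)
  have "t\<^sup>2 * hk r t \<le> C * r * hk (2 * r) t" if r: "0 < r" for r t :: real
  proof -
    have "t\<^sup>2 / r \<le> (1 + (norm t)\<^sup>2 / r) powr 1" using r by (simp add: add_nonneg_nonneg)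
    hence "t\<^sup>2 / r * hk r t \<le> (1 + (norm t)\<^sup>2 / r) powr 1 * hk r t" by (intro mult_right_mono) auto
    hence "t\<^sup>2 / r * hk r t \<le> C * hk (2 * r) t" using C(2)[OF r, of t] by linarith
    hence "r * (t\<^sup>2 / r * hk r t) \<le> r * (C * hk (2 * r) t)" using r by (intro mult_left_mono) auto
    thus ?thesis using r by (simp add: mult_ac)
  qed
  thus ?thesis using that C(1) by blast
qed

text \<open>Linear growth away from time 0 is harmless when the smoothing time is of order
  \<open>tau^2\<close>: the inequality \<open>|z| <= tau + z^2/tau\<close> reduces the mean of
  \<open>|z|\<close> to the second moment.\<close>

lemma heat_time_small:
  obtains C where "0 < C" "\<And>\<psi> B G tau r. \<psi> \<in> bmeas \<Longrightarrow> (\<And>t. \<bar>\<psi> t\<bar> \<le> (B::real)) \<Longrightarrow> 0 < tau \<Longrightarrow> 0 < r \<Longrightarrow> 0 \<le> G \<Longrightarrow>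
     (\<And>t. \<bar>\<psi> t\<bar> \<le> G * (\<bar>t\<bar> + tau)) \<Longrightarrow> \<bar>heat r \<psi> (0::real)\<bar> \<le> G * (2 * tau + C * r / tau)"
proof -
  obtain C where C: "0 < C" "\<And>r t. 0 < r \<Longrightarrow> t\<^sup>2 * hk r (t::real) \<le> C * r * hk (2 * r) t"
    using heat_second_moment by blast
  have "\<bar>heat r \<psi> 0\<bar> \<le> G * (2 * tau + C * r / tau)"
    if [measurable]: "\<psi> \<in> bmeas" and B: "\<And>t. \<bar>\<psi> t\<bar> \<le> B" and tau: "0 < tau" and r: "0 < r" and G: "0 \<le> G"
      and le: "\<And>t. \<bar>\<psi> t\<bar> \<le> G * (\<bar>t\<bar> + tau)" for \<psi> B G tau r
  proof -
    have i: "integrable lborel (\<lambda>z. G * (2 * tau) * hk r z + G * (C * r / tau) * hk (2 * r) (z::real))"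
      using r by (intro lint_add integrable_mult_right integrable_hk) auto
    have pt: "\<bar>\<psi> (0 - z) * hk r z\<bar> \<le> G * (2 * tau) * hk r z + G * (C * r / tau) * hk (2 * r) z" for z
    proof -
      have "\<bar>z\<bar> \<le> tau + z\<^sup>2 / tau"
      proof -
        have "2 * (\<bar>z\<bar> * tau) \<le> z\<^sup>2 + tau\<^sup>2" using sum_squares_bound[of "\<bar>z\<bar>" tau] by simp
        moreover have "0 \<le> \<bar>z\<bar> * tau" using tau by simp
        ultimately have "\<bar>z\<bar> * tau \<le> tau\<^sup>2 + z\<^sup>2" by linarith
        thus ?thesis using tau by (simp add: field_simps power2_eq_square)
      qed
      hence "G * (\<bar>z\<bar> + tau) \<le> G * (2 * tau + z\<^sup>2 / tau)" using G by (intro mult_left_mono) auto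
      hence "\<bar>\<psi> (0 - z)\<bar> * hk r z \<le> G * (2 * tau + z\<^sup>2 / tau) * hk r z" using le[of "- z"] by (intro mult_right_mono) auto
      also have "\<dots> = G * (2 * tau) * hk r z + G / tau * (z\<^sup>2 * hk r z)" by (simp add: algebra_simps)
      also have "\<dots> \<le> G * (2 * tau) * hk r z + G / tau * (C * r * hk (2 * r) z)"
        using C(2)[OF r, of z] G tau by (intro add_left_mono mult_left_mono) auto
      finally show ?thesis by (simp add: abs_mult mult_ac)
    qed
    have "\<bar>heat r \<psi> 0\<bar> \<le> (LBINT z. \<bar>\<psi> (0 - z) * hk r z\<bar>)" unfolding heat_def by (rule integral_abs_bound)
    also have "\<dots> \<le> (LBINT z. G * (2 * tau) * hk r z + G * (C * r / tau) * hk (2 * r) (z::real))"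
      by (intro integral_mono integrable_abs heat_integrable[OF _ B r] i pt) simp
    also have "\<dots> = G * (2 * tau) + G * (C * r / tau)" using r by (subst Bochner_Integration.integral_add) (auto simp: integral_hk integrable_hk)
    finally show ?thesis by (simp add: distrib_left)
  qed
  thus ?thesis using that C(1) by blast
qed

context parab
begin

lemma pot_swap:
  fixes G :: "'a \<times> real \<Rightarrow> real"
  assumes c: "continuous_on UNIV G" and GK: "\<And>y t. \<bar>G (y, t)\<bar> \<le> K * pw be y" and r: "0 < r"
  shows "pot s 0 (\<lambda>y. heat r (\<lambda>u. G (y, u)) t) x = heat r (\<lambda>u. pot s 0 (\<lambda>y. G (y, u)) x) t"
proof -
  have Gm[measurable]: "G \<in> bmeas" using c by (rule cont_bmeas)
  have K0: "0 \<le> K" using GK[of 0 0] by (simp add: pw_def)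
  have GB: "\<bar>G p\<bar> \<le> K" for p using GK[of "fst p" "snd p"] mult_left_mono[OF pw_le_1[OF be] K0, of "fst p"] by simp
  have Gy: "(\<lambda>y. G (y, u)) \<in> bmeas" for u by measurable
  have fub: "integrable (lborel \<Otimes>\<^sub>M lborel) (\<lambda>(q, u). ppw (s - 1) q * heat q (\<lambda>y. G (y, t - u)) x * hk r u)"
  proof (rule lint_bound)
    show "integrable (lborel \<Otimes>\<^sub>M lborel) (\<lambda>(q, u::real). (K * C * (ppw (s - 1) q * (1 + q) powr (- k))) * hk r u)"
      using r by (intro integrable_prod_mult integrable_mult_right pC_int integrable_hk)
    show "AE w in lborel \<Otimes>\<^sub>M lborel. norm (case w of (q, u) \<Rightarrow> ppw (s - 1) q * heat q (\<lambda>y. G (y, t - u)) x * hk r u)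
       \<le> norm (case w of (q, u::real) \<Rightarrow> (K * C * (ppw (s - 1) q * (1 + q) powr (- k))) * hk r u)"
    proof (intro AE_I2, clarify)
      fix q u :: real
      have "\<bar>ppw (s - 1) q * heat (q + 0) (\<lambda>y. G (y, t - u)) x\<bar> \<le> K * C * (ppw (s - 1) q * (1 + q) powr (- k))"
        by (rule pot_integrand'[OF Gy GK]) simp
      from mult_right_mono[OF order_trans[OF this abs_ge_self] hk_nonneg[of r u]]
      show "norm (ppw (s - 1) q * heat q (\<lambda>y. G (y, t - u)) x * hk r u) \<le> norm (K * C * (ppw (s - 1) q * (1 + q) powr (- k)) * hk r u)"
        by (simp only: real_norm_def abs_mult[of _ "hk r u"] abs_of_nonneg[OF hk_nonneg] add_0_right)
    qed
    show "(\<lambda>(q, u). ppw (s - 1) q * heat q (\<lambda>y. G (y, t - u)) x * hk r u) \<in> borel_measurable (lborel \<Otimes>\<^sub>M lborel)"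
      unfolding heat_def by measurable
  qed
  have "pot s 0 (\<lambda>y. heat r (\<lambda>u. G (y, u)) t) x = (LBINT q. (LBINT u. ppw (s - 1) q * heat q (\<lambda>y. G (y, t - u)) x * hk r u))"
    unfolding pot_def
  proof (rule lint_cong[OF refl])
    fix q :: real
    show "ppw (s - 1) q * heat (q + 0) (\<lambda>y. heat r (\<lambda>u. G (y, u)) t) x = (LBINT u. ppw (s - 1) q * heat q (\<lambda>y. G (y, t - u)) x * hk r u)"
    proof (cases "0 < q")
      case True
      have "heat q (\<lambda>y. heat r (\<lambda>u. G (y, u)) t) x = heat r (\<lambda>u. heat q (\<lambda>y. G (y, u)) x) t"
        by (rule heat_swap(1)[OF Gm GB True r])
      thus ?thesis by (simp add: heat_def[of r] mult.assoc)
    qed simp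
  qed
  also have "\<dots> = (LBINT u. (LBINT q. ppw (s - 1) q * heat q (\<lambda>y. G (y, t - u)) x * hk r u))"
    by (rule lborel_pair.Fubini_integral[OF fub, symmetric])
  also have "\<dots> = heat r (\<lambda>u. pot s 0 (\<lambda>y. G (y, u)) x) t" unfolding heat_def[of r] pot_def by simp
  finally show ?thesis .
qed

lemma inv_A_le: "1 \<le> KA * A x * pw be x"
  using AK[of x] Apos[of x] by (simp add: field_simps)

lemma weight_pos:
  assumes "be1 \<le> be" shows "1 / KA \<le> A x * pw be1 x"
proof -
  have "1 \<le> KA * (A x * pw be x)" using inv_A_le[of x] by (simp add: mult_ac)
  also have "\<dots> \<le> KA * (A x * pw be1 x)" using KA_pos Apos[of x] by (intro mult_left_mono pw_antimono assms) (auto intro: less_imp_le)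
  finally show ?thesis using KA_pos by (simp add: divide_le_eq mult.commute)
qed

text \<open>A residual that is bounded in space-time and small on compact sets is small relative to the
  weight \<open>A * pw be1\<close>, which is the tolerance that the barrier of the comparison argument absorbs.\<close>

lemma tolerance:
  assumes be1: "be1 < be" and e: "0 < e" and B: "0 \<le> B"
  obtains R e' where "0 < R" "0 < e'"
    "\<And>x g. \<bar>g\<bar> \<le> B \<Longrightarrow> (norm x \<le> R \<Longrightarrow> \<bar>g\<bar> \<le> e') \<Longrightarrow> \<bar>g\<bar> \<le> e * (A x * pw be1 x)"
proof -
  obtain R where R: "0 < R" "\<And>x. R \<le> norm (x::'a) \<Longrightarrow> (B * KA) * pw (be - be1) x \<le> e"
    using pw_eventually_small[of "be - be1" e "B * KA", where 'a='a] be1 e B KA_pos by auto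
  show ?thesis
  proof (rule that[of R "e / KA"])
    fix x :: 'a and g :: real assume g: "\<bar>g\<bar> \<le> B" "norm x \<le> R \<Longrightarrow> \<bar>g\<bar> \<le> e / KA"
    show "\<bar>g\<bar> \<le> e * (A x * pw be1 x)"
    proof (cases "norm x \<le> R")
      case True
      have "\<bar>g\<bar> \<le> e * (1 / KA)" using g(2)[OF True] by simp
      also have "\<dots> \<le> e * (A x * pw be1 x)" using e be1 by (intro mult_left_mono weight_pos) auto
      finally show ?thesis .
    next
      case False
      have "\<bar>g\<bar> \<le> B * 1" using g by simp
      also have "\<dots> \<le> B * (KA * A x * pw be x)" using B by (intro mult_left_mono inv_A_le) auto
      also have "\<dots> = ((B * KA) * pw (be - be1) x) * (A x * pw be1 x)" using pw_add[of "be - be1" be1 x] by (simp add: mult_ac)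
      also have "\<dots> \<le> e * (A x * pw be1 x)" using R(2)[of x] False Apos[of x] by (intro mult_right_mono) (auto intro: less_imp_le)
      finally show ?thesis .
    qed
  qed (use R e KA_pos in auto)
qed

text \<open>A solution of the delayed equation on the whole time axis is smoothed in time by
  \<open>dl\<close> and then in space-time by \<open>r\<close>. The parameters are fixed in the
  order \<open>tau\<close>, \<open>dl\<close>, \<open>h\<close>, with \<open>r\<close> last, after
  the solution is known. The density \<open>F\<close> is returned along with \<open>w\<close>,
  because it expresses the fractional operator on \<open>w\<close> as \<open>heat r (F t)\<close>,
  up to a constant.\<close>

lemma approx:
  fixes G0 :: "'a \<times> real \<Rightarrow> real" and v0 :: "'a \<Rightarrow> real"
  assumes G0c: "continuous_on UNIV G0" and G0B: "\<And>p. \<bar>G0 p\<bar> \<le> BG" and v0c: "continuous_on UNIV v0" and v0l: "(v0 \<longlongrightarrow> 0) at_infinity"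
    and be1: "be1 < be" and e: "0 < e"
  obtains w wt v r Bv F KF where "0 < (r::real)" "continuous_on UNIV v" "\<And>p. \<bar>v p\<bar> \<le> Bv" "w = heat r v"
    "\<And>x t. ((\<lambda>u. w (x, u)) has_real_derivative wt x t) (at t)"
    "\<And>t. continuous_on UNIV (F t)" "\<And>t x. \<bar>F t x\<bar> \<le> KF * pw be x" "\<And>x t. w (x, t) = pot s r (F t) x"
    "\<And>x t. 0 \<le> t \<Longrightarrow> t \<le> T \<Longrightarrow> \<bar>wt x t + A x * heat r (F t) x + b0 x * w (x, t) - G0 (x, t)\<bar> \<le> e * (A x * pw be1 x)"
    "\<And>x. \<bar>w (x, 0) - v0 x\<bar> \<le> e"
proof -
  \<comment> \<open>A density with compact support makes \<open>A * F0\<close> bounded although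
    \<open>A\<close> may grow without limit.\<close>
  obtain F0 R0 where F0: "continuous_on UNIV F0" "0 < R0" "\<And>x. R0 \<le> norm x \<Longrightarrow> F0 x = 0" "\<And>x. \<bar>pot s 0 F0 x - v0 x\<bar> \<le> e / 4"
    using range_pot_dense[OF s(1,2) sN v0c v0l, of "e / 4"] e by auto
  have "compact ((\<lambda>x. A x * F0 x) ` cball 0 R0)"
    by (intro compact_continuous_image continuous_intros continuous_on_subset[OF F0(1)] continuous_on_subset[OF Ac]) auto
  hence "bounded ((\<lambda>x. A x * F0 x) ` cball 0 R0)" by (rule compact_imp_bounded)
  then obtain B1 where B1: "\<forall>x\<in>cball 0 R0. \<bar>A x * F0 x\<bar> \<le> B1" by (auto simp: bounded_iff)
  define BA where "BA = max B1 0"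
  have AF: "\<bar>A x * F0 x\<bar> \<le> BA" for x using B1 F0(3)[of x] by (cases "R0 \<le> norm x") (auto simp: BA_def le_max_iff_disj)
  define gA where "gA = (\<lambda>p::'a \<times> real. A (fst p) * F0 (fst p))"
  have gAc: "continuous_on UNIV gA" unfolding gA_def by (intro continuous_intros continuous_on_compose2[OF Ac] continuous_on_compose2[OF F0(1)]) auto
  have gAB: "\<bar>gA p\<bar> \<le> BA" for p using AF by (simp add: gA_def)
  have dgA: "dens gA t = F0" for t using Apos by (auto simp: dens_def gA_def less_imp_neq[symmetric])
  \<comment> \<open>The profile \<open>V\<close> below is stationary: as \<open>KK gA\<close> it
    solves the equation whose source is \<open>gA + b0 * V\<close>.\<close>
  define v0' where "v0' = pot s 0 F0"
  define V where "V = (\<lambda>p::'a \<times> real. v0' (fst p))"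
  have VK: "V p = KK gA p" for p by (simp add: V_def KK_def dgA v0'_def)
  have Vc: "continuous_on UNIV V" using KK_cont[OF gAc gAB] by (simp add: VK[abs_def] fun_eq_iff VK cong: continuous_on_cong)
  have V: "V = KK gA" using VK by auto
  define BV where "BV = BA * KA * pC"
  have VB: "\<bar>V p\<bar> \<le> BV" for p unfolding VK BV_def by (rule KK_bound[OF gAc gAB])
  have nn: "0 \<le> BG" "0 \<le> BA" "0 \<le> BV" using G0B[of undefined] gAB[of undefined] VB[of undefined] by linarith+
  have F0K: "\<bar>F0 x\<bar> \<le> BA * KA * pw be x" for x using dens_bound[OF gAc gAB, of 0 x] by (simp add: dgA)
  have v0'c: "continuous_on UNIV v0'" unfolding v0'_def by (rule pot_continuous[OF F0(1) F0K]) simp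
  have v0'B: "\<bar>v0' x\<bar> \<le> BV" for x using VB[of "(x, 0)"] by (simp add: V_def)
  have v0'l: "(v0' \<longlongrightarrow> 0) at_infinity"
  proof (rule Lim_null_comparison)
    show "\<forall>\<^sub>F x in at_infinity. norm (v0' x) \<le> BV * pw ga x"
      unfolding v0'_def BV_def using pot_bound[OF cont_bmeas[OF F0(1)] F0K, of 0] by simp
    show "((\<lambda>x::'a. BV * pw ga x) \<longlongrightarrow> 0) at_infinity" by (intro tendsto_mult_right_zero pw_tendsto_0 ga)
  qed
  \<comment> \<open>What remains of the source after \<open>V\<close> has been subtracted from the
    unknown.\<close>
  define G1 where "G1 = (\<lambda>p. G0 p - b0 (fst p) * V p - gA p)"
  have b0c': "continuous_on UNIV (\<lambda>p::'a \<times> real. b0 (fst p))" by (intro continuous_on_compose2[OF b0c] continuous_intros) auto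
  have G1c: "continuous_on UNIV G1" unfolding G1_def by (intro continuous_intros G0c Vc gAc b0c')
  define Ga where "Ga = BG + Bb * BV + BA"
  have bV: "\<bar>b0 x * y\<bar> \<le> Bb * B" if "\<bar>y\<bar> \<le> B" for x y B
  proof -
    have "\<bar>b0 x * y\<bar> = b0 x * \<bar>y\<bar>" using b01[of x] by (simp add: abs_mult)
    also have "\<dots> \<le> Bb * B" using b0B[of x] that Bb_ge by (intro mult_mono) auto
    finally show ?thesis .
  qed
  have G1B: "\<bar>G1 p\<bar> \<le> Ga" for p using G0B[of p] gAB[of p] bV[OF VB, of "fst p" p] unfolding G1_def Ga_def by linarith
  have Ga0: "0 \<le> Ga" using G1B[of undefined] by linarith
  \<comment> \<open>Length of the ramp. The smoothed deviation from \<open>V\<close> at time 0 is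
    finally bounded by \<open>3 * Ga * tau\<close>, which is below \<open>e / 4\<close>.\<close>
  define tau where "tau = e / (16 * (Ga + 1))"
  have tau: "0 < tau" "Ga * tau \<le> e / 16"
  proof -
    show "0 < tau" using e Ga0 by (simp add: tau_def)
    hence "Ga * tau \<le> (Ga + 1) * tau" by (intro mult_right_mono) auto
    also have "\<dots> = e / 16" using Ga0 by (simp add: tau_def field_simps)
    finally show "Ga * tau \<le> e / 16" .
  qed
  define chi where "chi = (\<lambda>t. max 0 (min 1 ((t + tau) / tau)))"
  have chi: "0 \<le> chi t" "chi t \<le> 1" "0 \<le> t \<Longrightarrow> chi t = 1" "t \<le> - tau \<Longrightarrow> chi t = 0" "- tau \<le> t \<Longrightarrow> chi t \<le> (t + tau) / tau" for t
    using tau(1) by (auto simp: chi_def min_def max_def field_simps)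
  \<comment> \<open>Equals \<open>G0\<close> for nonnegative times, while before \<open>-tau\<close>
    it is the source for which \<open>V\<close> is stationary; this replaces an initial
    condition.\<close>
  define Gh where "Gh = (\<lambda>p. chi (snd p) * G1 p + gA p + b0 (fst p) * V p)"
  have Ghc: "continuous_on UNIV Gh" unfolding Gh_def chi_def using tau(1) by (intro continuous_intros G1c gAc b0c' Vc) auto
  define BH where "BH = Ga + BA + Bb * BV"
  have GhB: "\<bar>Gh p\<bar> \<le> BH" for p
  proof -
    have "\<bar>chi (snd p) * G1 p\<bar> \<le> 1 * Ga" unfolding abs_mult using chi G1B[of p] by (intro mult_mono) auto
    thus ?thesis using gAB[of p] bV[OF VB, of "fst p" p] unfolding Gh_def BH_def by linarith
  qed
  have BH0: "0 \<le> BH" using GhB[of undefined] by linarith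
  have GhG0: "Gh (x, t) = G0 (x, t)" if "0 \<le> t" for x t using chi(3)[OF that] by (simp add: Gh_def G1_def)
  define X where "X = Bcontfun Gh"
  have apX: "ap X = Gh" unfolding X_def by (rule Bcontfun_inverse) (rule bcontfun_normI[OF Ghc], use GhB in auto)
  obtain Ct where Ct: "0 < Ct" "\<And>\<psi> B G tau r. \<psi> \<in> bmeas \<Longrightarrow> (\<And>t. \<bar>\<psi> t\<bar> \<le> (B::real)) \<Longrightarrow> 0 < tau \<Longrightarrow> 0 < r \<Longrightarrow> 0 \<le> G \<Longrightarrow>
     (\<And>t. \<bar>\<psi> t\<bar> \<le> G * (\<bar>t\<bar> + tau)) \<Longrightarrow> \<bar>heat r \<psi> (0::real)\<bar> \<le> G * (2 * tau + Ct * r / tau)"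
    using heat_time_small by metis
  \<comment> \<open>Four errors of this size make up the residual: the difference quotient, the
    space-time smoothing of the quotient and zero-order terms, the smoothing of the density, and
    that of the source.\<close>
  define e5 where "e5 = e / 5"
  have e5: "0 < e5" using e by (simp add: e5_def)

  obtain R1 e1 where T1: "0 < R1" "0 < e1" "\<And>x g. \<bar>g\<bar> \<le> 2 * BH \<Longrightarrow> (norm x \<le> R1 \<Longrightarrow> \<bar>g\<bar> \<le> e1) \<Longrightarrow> \<bar>g\<bar> \<le> e5 * (A x * pw be1 x)"
    using tolerance[OF be1 e5, of "2 * BH"] BH0 by (metis mult_nonneg_nonneg zero_le_numeral)
  have Ghm[measurable]: "Gh \<in> bmeas" using Ghc by (rule cont_bmeas)
  obtain d1 where d1: "0 < d1" "\<And>d x t. 0 < d \<Longrightarrow> d < d1 \<Longrightarrow> norm x \<le> R1 \<Longrightarrow> 0 \<le> t \<Longrightarrow> t \<le> T \<Longrightarrow> \<bar>tmol d Gh (x, t) - Gh (x, t)\<bar> \<le> e1"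
  proof -
    have uc: "\<exists>d>0. \<forall>p\<in>cball (0::'a) R1 \<times> {0..T}. \<forall>u. dist u (snd p) < d \<longrightarrow> dist (Gh (fst p, u)) (Gh p) < e'" if e': "0 < e'" for e'
    proof -
      \<comment> \<open>The slab is enlarged by 1 in time, because averages reach beyond
        \<open>{0..T}\<close>.\<close>
      have "uniformly_continuous_on (cball (0::'a) R1 \<times> {- 1..T + 1}) Gh"
        by (intro compact_uniformly_continuous continuous_on_subset[OF Ghc] compact_Times) auto
      then obtain d where d: "0 < d" "\<And>p p'. p \<in> cball (0::'a) R1 \<times> {- 1..T + 1} \<Longrightarrow> p' \<in> cball (0::'a) R1 \<times> {- 1..T + 1} \<Longrightarrow> dist p' p < d \<Longrightarrow> dist (Gh p') (Gh p) < e'"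
        unfolding uniformly_continuous_on_def using e' by meson
      have "dist (Gh (fst p, u)) (Gh p) < e'" if p: "p \<in> cball (0::'a) R1 \<times> {0..T}" and u: "dist u (snd p) < min d 1" for p u
      proof (rule d(2))
        show "p \<in> cball 0 R1 \<times> {- 1..T + 1}" using p by auto
        show "(fst p, u) \<in> cball 0 R1 \<times> {- 1..T + 1}" using p u by (cases p) (auto simp: dist_real_def)
        show "dist (fst p, u) p < d" using u by (cases p) (simp add: dist_Pair_Pair)
      qed
      thus ?thesis using d(1) by (intro exI[of _ "min d 1"]) auto
    qed
    show ?thesis
    proof (rule heat_uniform_approx_family[of "\<lambda>x u. Gh (x, u)" BH "cball 0 R1 \<times> {0..T}" e1])
      show "(\<lambda>u. Gh (x, u)) \<in> bmeas" for x by measurable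
      show "\<exists>d>0. \<forall>p\<in>cball 0 R1 \<times> {0..T}. \<forall>y. dist y (snd p) < d \<longrightarrow> dist (Gh (fst p, y)) (Gh (fst p, snd p)) < e'" if "0 < e'" for e'
        using uc[OF that] by simp
      fix r0 assume "0 < r0" "\<And>r x t. 0 < r \<Longrightarrow> r < r0 \<Longrightarrow> (x, t) \<in> cball 0 R1 \<times> {0..T} \<Longrightarrow> \<bar>heat r (\<lambda>u. Gh (x, u)) t - Gh (x, t)\<bar> \<le> e1"
      thus ?thesis by (intro that[of r0]) (auto simp: tmol_def)
    qed (use GhB T1 in auto)
  qed
  \<comment> \<open>The first bound controls the smoothing of the source, the second that of the
    initial value, where \<open>heat_time_small\<close> asks for a smoothing time of order
    \<open>tau^2\<close>.\<close>
  define dl where "dl = min (d1 / 2) (tau\<^sup>2 / (2 * Ct))"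
  have dl: "0 < dl" "dl < d1" "Ct * (2 * dl) \<le> tau\<^sup>2"
  proof -
    show "0 < dl" "dl < d1" using d1(1) tau(1) Ct(1) by (auto simp: dl_def min_def)
    have "Ct * (2 * dl) \<le> Ct * (2 * (tau\<^sup>2 / (2 * Ct)))" using Ct(1) by (intro mult_left_mono) (auto simp: dl_def)
    thus "Ct * (2 * dl) \<le> tau\<^sup>2" using Ct(1) by simp
  qed
  obtain Mq where Mq: "0 < Mq" "\<And>\<psi> B t h d. \<psi> \<in> bmeas \<Longrightarrow> (\<And>x::real. \<bar>\<psi> x\<bar> \<le> B) \<Longrightarrow> 0 < h \<Longrightarrow>
    (heat dl \<psi> has_real_derivative d) (at t) \<Longrightarrow> \<bar>d - (heat dl \<psi> t - heat dl \<psi> (t - h)) / h\<bar> \<le> Mq * B * h"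
    using heat_time_quotient[OF dl(1)] by metis
  \<comment> \<open>\<open>Mq\<close> depends on \<open>dl\<close> but not on the solution, so the
    delay can be fixed here. The bound by \<open>tau\<close> serves the linear barrier for
    \<open>v - V\<close> below.\<close>
  define h where "h = min tau (e5 / (KA * (Mq * (BH + 1))))"
  have h: "0 < h" "h \<le> tau" "Mq * BH * h \<le> e5 / KA"
  proof -
    have p: "0 < KA * (Mq * (BH + 1))" using KA_pos Mq(1) BH0 by simp
    show "0 < h" using tau(1) e5 p by (simp add: h_def)
    show "h \<le> tau" by (simp add: h_def)
    have "Mq * BH * h \<le> Mq * (BH + 1) * (e5 / (KA * (Mq * (BH + 1))))"
      using Mq(1) BH0 \<open>0 < h\<close> by (intro mult_mono) (auto simp: h_def)
    also have "\<dots> = e5 / KA" using Mq(1) BH0 KA_pos by (simp add: divide_simps)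
    finally show "Mq * BH * h \<le> e5 / KA" .
  qed
  obtain vX where vX: "vX = KX (X - MX h vX)" using delay_solve[OF h(1)] by blast
  define v where "v = ap vX"
  have vc: "continuous_on UNIV v" unfolding v_def by simp
  have vm[measurable]: "v \<in> bmeas" using vc by (rule cont_bmeas)
  have veq: "v p = KK (\<lambda>p. Gh p - MM h v p) p" for p
  proof -
    have "v p = KK (ap (X - MX h vX)) p" unfolding v_def using vX ap_KX by metis
    moreover have "ap (X - MX h vX) = (\<lambda>p. Gh p - MM h v p)" by (rule ext) (simp add: ap_MX[OF h(1)] apX v_def)
    ultimately show ?thesis by simp
  qed
  \<comment> \<open>A constant is a barrier because \<open>1 <= b0\<close>; the bound
    \<open>BH\<close> depends on neither \<open>dl\<close> nor \<open>h\<close>.\<close>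
  have vB: "\<bar>v p\<bar> \<le> BH" for p
  proof -
    have "\<bar>v (x, t)\<bar> \<le> BH" for x t
    proof (rule delay_comparison_abs[where z=v and h=h and g=Gh and th=1 and W="\<lambda>_. BH" and \<Gamma>="\<lambda>_. BH", OF Ghc GhB h(1) _ _ vc])
      show "\<bar>v p\<bar> \<le> norm vX" for p unfolding v_def by (rule ap_bound)
    qed (use veq GhB BH0 in auto)
    thus ?thesis by (cases p) simp
  qed
  \<comment> \<open>The difference solves the delayed equation with source \<open>chi * G1\<close>,
    which vanishes before \<open>-tau\<close>; from there on a linear function of time dominates
    it.\<close>
  have vV: "\<bar>v (x, t) - V (x, t)\<bar> \<le> Ga * (\<bar>t\<bar> + tau)" for x t
  proof -
    have gch: "continuous_on UNIV (\<lambda>p. chi (snd p) * G1 p)" unfolding chi_def using tau(1) by (intro continuous_intros G1c) auto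
    have gchB: "\<bar>chi (snd p) * G1 p\<bar> \<le> chi (snd p) * Ga" for p
      unfolding abs_mult using chi(1)[of "snd p"] G1B[of p] by (auto intro!: mult_left_mono)
    have gchB': "\<bar>chi (snd p) * G1 p\<bar> \<le> Ga" for p using gchB[of p] mult_right_mono[OF chi(2)[of "snd p"] Ga0] by simp
    let ?W = "\<lambda>t. Ga * max 0 (t + tau)"
    have "\<bar>v (x, t) - V (x, t)\<bar> \<le> ?W t"
    proof (rule delay_comparison_abs[where z="\<lambda>p. v p - V p" and g="\<lambda>p. chi (snd p) * G1 p" and th=1 and h=h and W="?W" and \<Gamma>="\<lambda>t. chi t * Ga",
          OF gch gchB' h(1)])
      show "v p - V p = KK (\<lambda>p. 1 * (chi (snd p) * G1 p - MM h (\<lambda>p. v p - V p) p)) p" for p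
      proof -
        have g1: "continuous_on UNIV (\<lambda>p. Gh p - MM h v p)" by (intro continuous_intros Ghc MM_cont vc)
        have g1B: "\<bar>Gh p - MM h v p\<bar> \<le> BH + (2 / h + Bb) * BH" for p using GhB[of p] MM_bound[where z=v and p=p, OF h(1) vB] by linarith
        have "dens (\<lambda>p. 1 * (chi (snd p) * G1 p - MM h (\<lambda>p. v p - V p) p)) t = (\<lambda>y. dens (\<lambda>p. Gh p - MM h v p) t y - dens gA t y)" for t
        proof
          fix y
          have "MM h (\<lambda>p. v p - V p) (y, t) = MM h v (y, t) - b0 y * V (y, t)" by (simp add: MM_def V_def right_diff_distrib)
          thus "dens (\<lambda>p. 1 * (chi (snd p) * G1 p - MM h (\<lambda>p. v p - V p) p)) t y = dens (\<lambda>p. Gh p - MM h v p) t y - dens gA t y"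
            unfolding dens_def diff_divide_distrib[symmetric] by (simp add: Gh_def)
        qed
        hence "KK (\<lambda>p. 1 * (chi (snd p) * G1 p - MM h (\<lambda>p. v p - V p) p)) p = KK (\<lambda>p. Gh p - MM h v p) p - KK gA p"
          unfolding KK_def by (simp add: pot_add(2)[OF dens_meas[OF g1 g1B] dens_meas[OF gAc gAB] dens_bound[OF g1 g1B] dens_bound[OF gAc gAB]])
        thus ?thesis using veq[of p] VK[of p] by simp
      qed
      show "continuous_on UNIV (\<lambda>p. v p - V p)" by (intro continuous_intros vc Vc)
      show "\<bar>v p - V p\<bar> \<le> BH + BV" for p using vB[of p] VB[of p] by linarith
      show "0 \<le> ?W t" for t using Ga0 by simp
      show "chi t * Ga \<le> (?W t - ?W (t - h)) / h + ?W t" for t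
      proof -
        \<comment> \<open>Before \<open>-tau\<close> both sides vanish; on the next interval of
          length \<open>h\<close> the quotient is \<open>(t + tau) / h\<close>, which is at least
          \<open>(t + tau) / tau\<close>; later it equals 1.\<close>
        have "chi t \<le> (max 0 (t + tau) - max 0 (t - h + tau)) / h"
        proof -
          consider "t \<le> - tau" | "- tau \<le> t" "t \<le> - tau + h" | "- tau + h \<le> t" by linarith
          thus ?thesis
          proof cases
            case 1 thus ?thesis using chi(4)[of t] h by (simp add: max_def)
          next
            case 2
            have "(t + tau) / tau \<le> (t + tau) / h" using 2 h by (intro divide_left_mono) (auto intro!: mult_pos_pos tau)
            moreover have "max 0 (t + tau) = t + tau" "max 0 (t - h + tau) = 0" using 2 by auto
            ultimately show ?thesis using chi(5)[of t] 2 by simp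
          next
            case 3 thus ?thesis using chi(2)[of t] h by (simp add: max_def field_simps)
          qed
        qed
        hence "Ga * chi t \<le> Ga * ((max 0 (t + tau) - max 0 (t - h + tau)) / h)" using Ga0 by (rule mult_left_mono)
        moreover have "0 \<le> ?W t" using Ga0 by simp
        ultimately show ?thesis by (simp add: right_diff_distrib mult.commute)
      qed
      show "\<bar>chi (snd (x, t)) * G1 (x, t)\<bar> \<le> chi t * Ga" for x t using gchB[of "(x, t)"] by simp
    qed simp
    also have "\<dots> \<le> Ga * (\<bar>t\<bar> + tau)" using Ga0 tau(1) by (intro mult_left_mono) auto
    finally show ?thesis .
  qed

  \<comment> \<open>The density of \<open>v\<close>; smoothing will act on \<open>f\<close> rather
    than on \<open>A * f\<close>.\<close>
  define f where "f = (\<lambda>p. (Gh p - MM h v p) / A (fst p))"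
  have gc: "continuous_on UNIV (\<lambda>p. Gh p - MM h v p)" by (intro continuous_intros Ghc MM_cont vc)
  define Bg where "Bg = BH + (2 / h + Bb) * BH"
  have gB: "\<bar>Gh p - MM h v p\<bar> \<le> Bg" for p using GhB[of p] MM_bound[where z=v and p=p, OF h(1) vB] unfolding Bg_def by linarith
  have Bg0: "0 \<le> Bg" using gB[of undefined] by linarith
  have fc: "continuous_on UNIV f" unfolding f_def using Apos
    by (intro continuous_intros gc continuous_on_compose2[OF Ac]) (auto simp: less_imp_neq[symmetric])
  have fm[measurable]: "f \<in> bmeas" using fc by (rule cont_bmeas)
  have fd: "dens (\<lambda>p. Gh p - MM h v p) t = (\<lambda>y. f (y, t))" for t by (auto simp: dens_def f_def)
  define KF where "KF = Bg * KA"
  have fK: "\<bar>f (y, t)\<bar> \<le> KF * pw be y" for y t using dens_bound[OF gc gB, of t y] by (simp add: fd KF_def)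
  have KF0: "0 \<le> KF" using Bg0 KA_pos by (simp add: KF_def)
  have fB: "\<bar>f p\<bar> \<le> KF" for p using fK[of "fst p" "snd p"] mult_left_mono[OF pw_le_1[OF be] KF0, of "fst p"] by simp
  have vpot: "v (y, t) = pot s 0 (\<lambda>y. f (y, t)) y" for y t using veq[of "(y, t)"] by (simp add: KK_def fd)
  define vd where "vd = tmol dl v"
  define fd' where "fd' = tmol dl f"
  have vdc: "continuous_on UNIV vd" unfolding vd_def by (rule tmol_continuous[OF vc vB dl(1)])
  have vdm[measurable]: "vd \<in> bmeas" using vdc by (rule cont_bmeas)
  have vdB: "\<bar>vd p\<bar> \<le> BH" for p using tmol_bound[OF vm vB dl(1), of "fst p" "snd p"] by (simp add: vd_def)
  have fdc: "continuous_on UNIV fd'" unfolding fd'_def by (rule tmol_continuous[OF fc fB dl(1)])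
  have fdm[measurable]: "fd' \<in> bmeas" using fdc by (rule cont_bmeas)
  have fdK: "\<bar>fd' (y, t)\<bar> \<le> KF * pw be y" for y t unfolding fd'_def by (rule tmol_bound[OF fm fK dl(1)])
  have fdB: "\<bar>fd' p\<bar> \<le> KF" for p using fdK[of "fst p" "snd p"] mult_left_mono[OF pw_le_1[OF be] KF0, of "fst p"] by simp
  define qd where "qd = (\<lambda>p. (vd p - vd (fst p, snd p - h)) / h)"
  have qdc: "continuous_on UNIV qd" unfolding qd_def using h(1) by (intro continuous_intros vdc continuous_on_compose2[OF vdc]) auto
  have qdB: "\<bar>qd p\<bar> \<le> 2 * BH / h" for p
    unfolding qd_def using vdB[of p] vdB[of "(fst p, snd p - h)"] h(1) by (simp add: divide_right_mono)
  \<comment> \<open>Averaging in time commutes with \<open>A\<close> and \<open>b0\<close>, so the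
    delayed equation survives exactly, with the source replaced by its average.\<close>
  have fdeq: "A x * fd' (x, t) = tmol dl Gh (x, t) - b0 x * vd (x, t) - qd (x, t)" for x t
  proof -
    have iv: "(\<lambda>u. v (x, u)) \<in> bmeas" "(\<lambda>u. v (x, u - h)) \<in> bmeas" "(\<lambda>u. Gh (x, u)) \<in> bmeas" by measurable
    have sh: "heat dl (\<lambda>u. v (x, u - h)) t = vd (x, t - h)" unfolding vd_def tmol_def heat_def by (simp add: algebra_simps)
    have "A x * fd' (x, t) = heat dl (\<lambda>u. A x * f (x, u)) t" unfolding fd'_def tmol_def by (simp add: heat_cmult)
    also have "(\<lambda>u. A x * f (x, u)) = (\<lambda>u. Gh (x, u) - (1 / h * (v (x, u) - v (x, u - h)) + b0 x * v (x, u)))"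
      using Apos[of x] by (simp add: f_def MM_def)
    also have "heat dl (\<lambda>u. Gh (x, u) - (1 / h * (v (x, u) - v (x, u - h)) + b0 x * v (x, u))) t
       = heat dl (\<lambda>u. Gh (x, u)) t - heat dl (\<lambda>u. 1 / h * (v (x, u) - v (x, u - h)) + b0 x * v (x, u)) t"
    proof (rule heat_add(2)[where B=BH and B'="(2 / h + Bb) * BH"])
      show "\<bar>1 / h * (v (x, u) - v (x, u - h)) + b0 x * v (x, u)\<bar> \<le> (2 / h + Bb) * BH" for u
        using MM_bound[where z=v and p="(x, u)", OF h(1) vB] by (simp add: MM_def)
    qed (use GhB dl iv in auto)
    also have "heat dl (\<lambda>u. 1 / h * (v (x, u) - v (x, u - h)) + b0 x * v (x, u)) t
       = heat dl (\<lambda>u. 1 / h * (v (x, u) - v (x, u - h))) t + heat dl (\<lambda>u. b0 x * v (x, u)) t"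
    proof (rule heat_add(1)[where B="2 * BH / h" and B'="Bb * BH"])
      show "\<bar>1 / h * (v (x, u) - v (x, u - h))\<bar> \<le> 2 * BH / h" for u
        using vB[of "(x, u)"] vB[of "(x, u - h)"] h(1) by (simp add: divide_right_mono)
      show "\<bar>b0 x * v (x, u)\<bar> \<le> Bb * BH" for u by (rule bV[OF vB])
    qed (use dl iv in auto)
    also have "heat dl (\<lambda>u. 1 / h * (v (x, u) - v (x, u - h))) t = 1 / h * (vd (x, t) - vd (x, t - h))"
      unfolding heat_cmult using heat_add(2)[OF iv(1,2), of BH BH dl t] vB dl sh by (simp add: vd_def tmol_def)
    finally show ?thesis by (simp add: tmol_def heat_cmult vd_def qd_def)
  qed
  define Bm where "Bm = 2 * (2 * BH / h) + Bb * (2 * BH)"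
  have Bm0: "0 \<le> Bm" using BH0 h(1) Bb_ge by (simp add: Bm_def)
  obtain R2 e2 where T2: "0 < R2" "0 < e2" "\<And>x g. \<bar>g\<bar> \<le> Bm \<Longrightarrow> (norm x \<le> R2 \<Longrightarrow> \<bar>g\<bar> \<le> e2) \<Longrightarrow> \<bar>g\<bar> \<le> e5 * (A x * pw be1 x)"
    using tolerance[OF be1 e5 Bm0] by metis
  obtain Cp where Cp: "0 < Cp" "\<And>t x. 0 < t \<Longrightarrow> heat t (pw be) (x::'a) \<le> Cp * (1 + t) powr (be / 2) * pw be x"
    using heat_pw_le[OF be] by metis
  \<comment> \<open>Bounds the smoothed and the unsmoothed density together in the weight of order
    \<open>be\<close>, for smoothing times up to 1.\<close>
  define KH where "KH = KF * (Cp * 2 powr (be / 2)) + KF"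
  have KH0: "0 \<le> KH" using KF0 Cp by (simp add: KH_def)
  obtain R3 where R3: "0 < R3" "\<And>x. R3 \<le> norm (x::'a) \<Longrightarrow> KH * pw (be - be1) x \<le> e5"
    using pw_eventually_small[of "be - be1" e5 KH, where 'a='a] be1 e5 KH0 by auto
  \<comment> \<open>The minimum of the weight on the ball turns absolute smallness there into
    smallness relative to \<open>pw be1\<close>.\<close>
  have "compact (pw be1 ` cball (0::'a) R3)" by (intro compact_continuous_image continuous_on_subset[OF pw_continuous]) auto
  moreover have "pw be1 ` cball (0::'a) R3 \<noteq> {}" using R3(1) by auto
  ultimately obtain mm where "mm \<in> pw be1 ` cball (0::'a) R3" "\<And>y. y \<in> pw be1 ` cball (0::'a) R3 \<Longrightarrow> mm \<le> y"
    using compact_attains_inf by metis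
  hence mm: "0 < mm" "\<And>x. norm (x::'a) \<le> R3 \<Longrightarrow> mm \<le> pw be1 x" by auto
  let ?Q = "cball (0::'a) (max R2 R3) \<times> {0..T}"
  have Q: "compact ?Q" by (intro compact_Times) auto
  obtain r1 where r1: "0 < r1" "\<And>r p. 0 < r \<Longrightarrow> r < r1 \<Longrightarrow> p \<in> ?Q \<Longrightarrow> \<bar>heat r qd p - qd p\<bar> \<le> e2 / 2"
    using heat_locally_uniform[OF qdc qdB Q, of "e2 / 2"] T2(2) by auto
  obtain r2 where r2: "0 < r2" "\<And>r p. 0 < r \<Longrightarrow> r < r2 \<Longrightarrow> p \<in> ?Q \<Longrightarrow> \<bar>heat r vd p - vd p\<bar> \<le> e2 / (2 * Bb)"
    using heat_locally_uniform[OF vdc vdB Q, of "e2 / (2 * Bb)"] T2(2) Bb_ge by auto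
  obtain r3 where r3: "0 < r3" "\<And>r p. 0 < r \<Longrightarrow> r < r3 \<Longrightarrow> p \<in> ?Q \<Longrightarrow> \<bar>heat r fd' p - fd' p\<bar> \<le> e5 * mm"
    using heat_locally_uniform[OF fdc fdB Q, of "e5 * mm"] e5 mm(1) by auto
  obtain r4 where r4: "0 < r4" "\<And>r x. 0 < r \<Longrightarrow> r < r4 \<Longrightarrow> x \<in> UNIV \<Longrightarrow> \<bar>heat r v0' x - v0' x\<bar> \<le> e / 4"
    using heat_uniform_approx[where K=UNIV and e="e / 4", OF cont_bmeas[OF v0'c] v0'B C0_uniform[OF v0'c v0'l]] e by auto
  \<comment> \<open>Chosen last, since the moduli of continuity of \<open>qd\<close>,
    \<open>vd\<close> and \<open>fd'\<close> depend on the solution. \<open>r <= dl\<close> keeps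
    the total smoothing time \<open>r + dl\<close> within \<open>2 * dl\<close>.\<close>
  define r where "r = min (min (r1 / 2) (r2 / 2)) (min (min (r3 / 2) (r4 / 2)) (min dl 1))"
  have r: "0 < r" "r < r1" "r < r2" "r < r3" "r < r4" "r \<le> dl" "r \<le> 1" using r1(1) r2(1) r3(1) r4(1) dl(1) by (auto simp: r_def min_def)
  define w where "w = heat r vd"
  \<comment> \<open>The density of \<open>w\<close>: a time average of \<open>f\<close> of total
    width \<open>r + dl\<close>, while the spatial smoothing stays outside as the shift of the
    potential.\<close>
  define F where "F = (\<lambda>t y. heat (r + dl) (\<lambda>u. f (y, u)) t)"
  have rdl: "0 < r + dl" using r dl by simp
  have Fc: "continuous_on UNIV (F t)" for t
  proof -
    have "F t = (\<lambda>y. tmol (r + dl) f (y, t))" by (rule ext) (simp add: F_def tmol_def)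
    thus ?thesis using tmol_continuous[OF fc fB rdl] by (auto intro!: continuous_on_compose2[of UNIV "tmol (r + dl) f"] continuous_intros)
  qed
  have FK: "\<bar>F t x\<bar> \<le> KF * pw be x" for t x unfolding F_def by (rule heat_bound) (use fK rdl in auto)
  have wF: "w (x, t) = pot s r (F t) x" for x t
  proof -
    have "w (x, t) = heat r (\<lambda>y. heat (r + dl) (\<lambda>u. v (y, u)) t) x"
      unfolding w_def vd_def by (rule heat_tmol(1)[OF vm vB r(1) dl(1)]) (use vdm in \<open>simp add: vd_def\<close>)
    also have "(\<lambda>y. heat (r + dl) (\<lambda>u. v (y, u)) t) = pot s 0 (F t)"
    proof
      fix y show "heat (r + dl) (\<lambda>u. v (y, u)) t = pot s 0 (F t) y" unfolding vpot F_def by (rule pot_swap[OF fc fK rdl, symmetric])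
    qed
    also have "heat r (pot s 0 (F t)) x = pot s r (F t) x" using heat_pot[OF cont_bmeas[OF Fc] FK _ r(1), of 0] by simp
    finally show ?thesis .
  qed
  have hF: "heat r (F t) x = heat r fd' (x, t)" for x t
    unfolding F_def fd'_def by (rule heat_tmol(1)[OF fm fB r(1) dl(1), symmetric]) (use fdm in \<open>simp add: fd'_def\<close>)
  obtain MS where "\<And>v B. v \<in> bmeas \<Longrightarrow> (\<And>x::'a \<times> real. \<bar>v x\<bar> \<le> B) \<Longrightarrow> C2_bounded (heat r v) (MS * B)"
    using heat_smooth[OF r(1), where 'b="'a \<times> real"] by metis
  from this[OF vdm vdB] obtain D where D: "\<And>z. (heat r vd has_derivative blinfun_apply (D z)) (at z)" unfolding C2_bounded_def by blast
  define wt where "wt = (\<lambda>x t. blinfun_apply (D (x, t)) (0, 1))"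
  have wt: "((\<lambda>u. w (x, u)) has_real_derivative wt x t) (at t)" for x t
  proof -
    have "((\<lambda>u. (x, u)) has_derivative (\<lambda>u. (0, u))) (at t)" by (auto intro!: derivative_eq_intros)
    from has_derivative_compose[OF this D] have "((\<lambda>u. w (x, u)) has_derivative (\<lambda>u. blinfun_apply (D (x, t)) (0, u))) (at t)" by (simp add: w_def)
    moreover have "(\<lambda>u. blinfun_apply (D (x, t)) (0, u)) = (*) (wt x t)"
    proof
      fix u :: real
      have "(0::'a, u) = u *\<^sub>R (0, 1)" by simp
      thus "blinfun_apply (D (x, t)) (0, u) = wt x t * u" unfolding wt_def by (simp only: blinfun.scaleR_right) simp
    qed
    ultimately show ?thesis unfolding has_field_derivative_def by simp
  qed
  have vB': "\<bar>heat r (\<lambda>y. v (y, u)) x\<bar> \<le> BH" for u x by (rule heat_bound) (use vB r in auto)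
  have psm: "(\<lambda>u. heat r (\<lambda>y. v (y, u)) x) \<in> bmeas" for x by (rule heat_slice_measurable[OF vm])
  have hpsm: "heat r (\<lambda>u. heat r (\<lambda>y. v (y, u)) x) \<in> bmeas" for x by (rule heat_borel_measurable[OF psm])
  have hpsB: "\<bar>heat r (\<lambda>u. heat r (\<lambda>y. v (y, u)) x) t\<bar> \<le> BH" for x t by (rule heat_bound[OF psm vB' r(1)])
  \<comment> \<open>With the time smoothing of width \<open>dl\<close> outermost,
    \<open>heat_time_quotient\<close> applies with the constant \<open>Mq\<close> fixed
    above.\<close>
  have wt_time: "(\<lambda>u. w (x, u)) = heat dl (heat r (\<lambda>u. heat r (\<lambda>y. v (y, u)) x))" for x
    unfolding w_def vd_def by (rule ext) (rule heat_tmol(2)[OF vm vB r(1) dl(1)], use vdm in \<open>simp add: vd_def\<close>)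
  have I1: "\<bar>wt x t - (w (x, t) - w (x, t - h)) / h\<bar> \<le> e5 * (A x * pw be1 x)" for x t
  proof -
    have "\<bar>wt x t - (w (x, t) - w (x, t - h)) / h\<bar> \<le> Mq * BH * h"
      using Mq(2)[OF hpsm hpsB h(1) wt[unfolded wt_time], of x t] by (simp only: fun_cong[OF wt_time])
    also have "\<dots> \<le> e5 * (1 / KA)" using h(3) by simp
    also have "\<dots> \<le> e5 * (A x * pw be1 x)" using e5 be1 by (intro mult_left_mono weight_pos) auto
    finally show ?thesis .
  qed
  have wq: "(w (x, t) - w (x, t - h)) / h = heat r qd (x, t)" for x t
  proof -
    have sh: "heat r (\<lambda>p. vd (fst p, snd p - h)) (x, t) = w (x, t - h)"
      unfolding w_def heat_def by (rule lint_cong) (auto simp: algebra_simps)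
    have m: "(\<lambda>p::'a \<times> real. vd (fst p, snd p - h)) \<in> bmeas"
      by (intro cont_bmeas continuous_on_compose2[OF vdc] continuous_intros) auto
    have "heat r qd (x, t) = heat r (\<lambda>p. 1 / h * (vd p - vd (fst p, snd p - h))) (x, t)" by (simp add: qd_def)
    also have "\<dots> = 1 / h * heat r (\<lambda>p. vd p - vd (fst p, snd p - h)) (x, t)" by (rule heat_cmult)
    also have "heat r (\<lambda>p. vd p - vd (fst p, snd p - h)) (x, t) = w (x, t) - w (x, t - h)"
      using heat_add(2)[OF vdm m vdB vdB r(1), of "(x, t)"] sh by (simp add: w_def)
    finally show ?thesis by simp
  qed
  have I23: "\<bar>(heat r qd (x, t) - qd (x, t)) + b0 x * (w (x, t) - vd (x, t))\<bar> \<le> e5 * (A x * pw be1 x)" if t: "0 \<le> t" "t \<le> T" for x t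
  proof (rule T2(3))
    have qdm: "qd \<in> bmeas" using qdc by (rule cont_bmeas)
    have "\<bar>heat r qd (x, t)\<bar> \<le> 2 * BH / h" by (rule heat_bound[OF qdm qdB r(1)])
    moreover have "\<bar>w (x, t)\<bar> \<le> BH" unfolding w_def by (rule heat_bound[OF vdm vdB r(1)])
    moreover have "\<bar>b0 x * (w (x, t) - vd (x, t))\<bar> \<le> Bb * (2 * BH)"
      by (rule bV) (use \<open>\<bar>w (x, t)\<bar> \<le> BH\<close> vdB[of "(x, t)"] in linarith)
    ultimately show "\<bar>(heat r qd (x, t) - qd (x, t)) + b0 x * (w (x, t) - vd (x, t))\<bar> \<le> Bm"
      using qdB[of "(x, t)"] unfolding Bm_def by linarith
    assume x: "norm x \<le> R2"
    hence xQ: "(x, t) \<in> ?Q" using t by auto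
    have "\<bar>b0 x * (w (x, t) - vd (x, t))\<bar> \<le> Bb * (e2 / (2 * Bb))" unfolding w_def by (rule bV[OF r2(2)[OF r(1,3) xQ]])
    also have "\<dots> = e2 / 2" using Bb_ge by simp
    finally show "\<bar>(heat r qd (x, t) - qd (x, t)) + b0 x * (w (x, t) - vd (x, t))\<bar> \<le> e2" using r1(2)[OF r(1,2) xQ] by linarith
  qed
  \<comment> \<open>The densities are compared before multiplication by \<open>A\<close>: on a ball
    by uniform convergence, outside it by the decay of order \<open>be\<close> against the weight of
    order \<open>be1\<close>.\<close>
  have I4: "\<bar>A x * (heat r fd' (x, t) - fd' (x, t))\<bar> \<le> e5 * (A x * pw be1 x)" if t: "0 \<le> t" "t \<le> T" for x t
  proof -
    have "\<bar>heat r fd' (x, t) - fd' (x, t)\<bar> \<le> e5 * pw be1 x"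
    proof (cases "norm x \<le> R3")
      case True
      hence "(x, t) \<in> ?Q" using t by auto
      hence "\<bar>heat r fd' (x, t) - fd' (x, t)\<bar> \<le> e5 * mm" by (rule r3(2)[OF r(1,4)])
      also have "\<dots> \<le> e5 * pw be1 x" using e5 mm(2)[OF True] by (intro mult_left_mono) auto
      finally show ?thesis .
    next
      case False
      have "\<bar>heat r (F t) x\<bar> \<le> heat r (\<lambda>y. KF * pw be y) x"
        by (rule heat_abs_le[where B=KF]) (use FK cont_bmeas[OF Fc] mult_left_mono[OF pw_le_1[OF be] KF0] r(1) in auto)
      also have "\<dots> = KF * heat r (pw be) x" by (rule heat_cmult)
      also have "\<dots> \<le> KF * (Cp * (1 + r) powr (be / 2) * pw be x)" by (intro mult_left_mono Cp(2) r(1) KF0)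
      also have "\<dots> \<le> KF * (Cp * 2 powr (be / 2) * pw be x)" using r be Cp(1) KF0 by (intro mult_left_mono mult_right_mono powr_mono2) auto
      finally have "\<bar>heat r fd' (x, t)\<bar> \<le> KF * (Cp * 2 powr (be / 2)) * pw be x" unfolding hF by (simp only: mult.assoc)
      hence "\<bar>heat r fd' (x, t) - fd' (x, t)\<bar> \<le> KH * pw be x" using fdK[of x t] unfolding KH_def distrib_right by linarith
      also have "\<dots> = (KH * pw (be - be1) x) * pw be1 x" using pw_add[of "be - be1" be1 x] by simp
      also have "\<dots> \<le> e5 * pw be1 x" using R3(2)[of x] False by (intro mult_right_mono) auto
      finally show ?thesis .
    qed
    hence "A x * \<bar>heat r fd' (x, t) - fd' (x, t)\<bar> \<le> A x * (e5 * pw be1 x)" using Apos[of x] by (intro mult_left_mono) auto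
    thus ?thesis using Apos[of x] by (simp add: abs_mult mult_ac)
  qed
  have I5: "\<bar>tmol dl Gh (x, t) - Gh (x, t)\<bar> \<le> e5 * (A x * pw be1 x)" if t: "0 \<le> t" "t \<le> T" for x t
  proof (rule T1(3))
    show "\<bar>tmol dl Gh (x, t) - Gh (x, t)\<bar> \<le> 2 * BH" using tmol_bound[OF Ghm GhB dl(1), of x t] GhB[of "(x, t)"] by linarith
    show "\<bar>tmol dl Gh (x, t) - Gh (x, t)\<bar> \<le> e1" if "norm x \<le> R1" by (rule d1(2)[OF dl(1,2) that t])
  qed
  have res: "\<bar>wt x t + A x * heat r (F t) x + b0 x * w (x, t) - G0 (x, t)\<bar> \<le> e * (A x * pw be1 x)" if t: "0 \<le> t" "t \<le> T" for x t
  proof -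
    \<comment> \<open>The averaged equation \<open>fdeq\<close> cancels the leading terms and leaves
      only the four errors.\<close>
    have "wt x t + A x * heat r (F t) x + b0 x * w (x, t) - G0 (x, t)
      = (wt x t - (w (x, t) - w (x, t - h)) / h) + ((heat r qd (x, t) - qd (x, t)) + b0 x * (w (x, t) - vd (x, t)))
        + A x * (heat r fd' (x, t) - fd' (x, t)) + (tmol dl Gh (x, t) - Gh (x, t))"
      using fdeq[of x t] GhG0[OF t(1), of x] unfolding wq hF right_diff_distrib by linarith
    also have "\<bar>\<dots>\<bar> \<le> 4 * (e5 * (A x * pw be1 x))" using I1[of x t] I23[OF t, of x] I4[OF t, of x] I5[OF t, of x] by linarith
    also have "\<dots> = 4 / 5 * (e * (A x * pw be1 x))" by (simp add: e5_def)
    also have "\<dots> \<le> 1 * (e * (A x * pw be1 x))" using e Apos[of x] by (intro mult_right_mono) (auto simp: less_imp_le)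
    finally show ?thesis by simp
  qed
  have init: "\<bar>w (x, 0) - v0 x\<bar> \<le> e" for x
  proof -
    \<comment> \<open>The spatially averaged deviation from \<open>V\<close> as a function of time,
      to which \<open>heat_time_small\<close> applies with smoothing time
      \<open>r + dl\<close>.\<close>
    define \<psi> where "\<psi> = (\<lambda>u. heat r (\<lambda>y. v (y, u) - V (y, u)) x)"
    have Vm[measurable]: "V \<in> bmeas" using Vc by (rule cont_bmeas)
    have v0'm: "v0' \<in> bmeas" using v0'c by (rule cont_bmeas)
    have vVB: "\<bar>v (y, u) - V (y, u)\<bar> \<le> BH + BV" for y u using vB[of "(y, u)"] VB[of "(y, u)"] by linarith
    have \<psi>eq: "\<psi> u = heat r (\<lambda>y. v (y, u)) x - heat r v0' x" for u
      unfolding \<psi>_def using heat_add(2)[of "\<lambda>y. v (y, u)" v0' BH BV r x] vB v0'B r(1) v0'm by (simp add: V_def)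
    have \<psi>m[measurable]: "\<psi> \<in> bmeas"  unfolding \<psi>_def by (rule heat_slice_measurable[of "\<lambda>p. v p - V p"]) measurable
    have \<psi>B: "\<bar>\<psi> u\<bar> \<le> BH + BV" for u unfolding \<psi>_def by (rule heat_bound) (use vVB r in auto)
    have \<psi>G: "\<bar>\<psi> u\<bar> \<le> Ga * (\<bar>u\<bar> + tau)" for u unfolding \<psi>_def by (rule heat_bound) (use vV r in auto)
    have "w (x, 0) = heat (r + dl) (\<lambda>u. heat r (\<lambda>y. v (y, u)) x) 0"
    proof -
      have "w (x, 0) = heat dl (heat r (\<lambda>u. heat r (\<lambda>y. v (y, u)) x)) 0" using fun_cong[OF wt_time, of x 0] by simp
      also have "\<dots> = heat (dl + r) (\<lambda>u. heat r (\<lambda>y. v (y, u)) x) 0" by (rule heat_heat[OF psm vB' dl(1) r(1)])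
      finally show ?thesis by (simp add: add.commute)
    qed
    also have "(\<lambda>u. heat r (\<lambda>y. v (y, u)) x) = (\<lambda>u. \<psi> u + heat r v0' x)" using \<psi>eq by simp
    also have "heat (r + dl) (\<lambda>u. \<psi> u + heat r v0' x) 0 = heat (r + dl) \<psi> 0 + heat r v0' x"
      using heat_add(1)[of \<psi> "\<lambda>_. heat r v0' x" "BH + BV" "\<bar>heat r v0' x\<bar>" "r + dl" 0] \<psi>B rdl by (simp add: heat_const)
    finally have weq: "w (x, 0) = heat (r + dl) \<psi> 0 + heat r v0' x" .
    have "\<bar>heat (r + dl) \<psi> 0\<bar> \<le> Ga * (2 * tau + Ct * (r + dl) / tau)" by (rule Ct(2)[OF \<psi>m \<psi>B tau(1) rdl Ga0 \<psi>G])
    also have "\<dots> \<le> Ga * (2 * tau + tau)"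
    proof (intro mult_left_mono add_left_mono Ga0)
      have "Ct * (r + dl) \<le> Ct * (2 * dl)" using r Ct(1) by (intro mult_left_mono) auto
      also have "\<dots> \<le> tau\<^sup>2" by (rule dl(3))
      finally show "Ct * (r + dl) / tau \<le> tau" using tau(1) by (simp add: divide_le_eq power2_eq_square)
    qed
    also have "\<dots> \<le> e / 4" using tau(2) e by (simp add: algebra_simps)
    finally have "\<bar>heat (r + dl) \<psi> 0\<bar> \<le> e / 4" .
    moreover have "\<bar>heat r v0' x - v0' x\<bar> \<le> e / 4" by (rule r4(2)[OF r(1,5)]) simp
    moreover have "\<bar>v0' x - v0 x\<bar> \<le> e / 4" using F0(4)[of x] by (simp add: v0'_def)
    ultimately show ?thesis unfolding weq using e by linarith
  qed
  show ?thesis by (rule that[OF r(1) vdc vdB w_def wt Fc FK wF res init])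
qed

end

section \<open>The fractional Laplacian as a singular integral\<close>

text \<open>The operator is defined with the completed measure, whose invariance under translation
  and reflection is the affine transformation rule with factors 1 and -1.\<close>

lemma lebesgue_distr:
  fixes x :: "'a::euclidean_space"
  shows "distr lebesgue lebesgue (\<lambda>z. x + z) = lebesgue" "(\<lambda>z. x + z) \<in> lebesgue \<rightarrow>\<^sub>M lebesgue"
    and "distr lebesgue lebesgue (\<lambda>z. x - z) = lebesgue" "(\<lambda>z. x - z) \<in> lebesgue \<rightarrow>\<^sub>M lebesgue"
proof -
  have e: "(\<lambda>z. x + (\<Sum>j\<in>Basis. (1 * (z \<bullet> j)) *\<^sub>R j)) = (\<lambda>z. x + z)"
    "(\<lambda>z. x + (\<Sum>j\<in>Basis. (- 1 * (z \<bullet> j)) *\<^sub>R j)) = (\<lambda>z. x - z)"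
    by (auto simp: euclidean_representation sum_negf)
  show "distr lebesgue lebesgue (\<lambda>z. x + z) = lebesgue"
    using lebesgue_affine_euclidean[of "\<lambda>_. 1" x] unfolding e by (simp add: density_1)
  show "distr lebesgue lebesgue (\<lambda>z. x - z) = lebesgue"
    using lebesgue_affine_euclidean[of "\<lambda>_. -1" x] unfolding e by (simp add: density_1)
  show "(\<lambda>z. x + z) \<in> lebesgue \<rightarrow>\<^sub>M lebesgue" using lebesgue_affine_measurable[of "\<lambda>_. 1" x] unfolding e by simp
  show "(\<lambda>z. x - z) \<in> lebesgue \<rightarrow>\<^sub>M lebesgue" using lebesgue_affine_measurable[of "\<lambda>_. -1" x] unfolding e by simp
qed

lemma lebesgue_shift:
  fixes f :: "'a::euclidean_space \<Rightarrow> real"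
  assumes f: "f \<in> borel_measurable lebesgue"
  shows "(\<integral>z. f (x + z) \<partial>lebesgue) = (\<integral>z. f z \<partial>lebesgue)" "(\<integral>z. f (x - z) \<partial>lebesgue) = (\<integral>z. f z \<partial>lebesgue)"
    "integrable lebesgue (\<lambda>z. f (x + z)) \<longleftrightarrow> integrable lebesgue f" "integrable lebesgue (\<lambda>z. f (x - z)) \<longleftrightarrow> integrable lebesgue f"
    "(\<lambda>z. f (x + z)) \<in> borel_measurable lebesgue" "(\<lambda>z. f (x - z)) \<in> borel_measurable lebesgue"
proof -
  note d = lebesgue_distr[of x]
  show "(\<integral>z. f (x + z) \<partial>lebesgue) = (\<integral>z. f z \<partial>lebesgue)" using integral_distr[OF d(2) f] unfolding d(1) by simp
  show "(\<integral>z. f (x - z) \<partial>lebesgue) = (\<integral>z. f z \<partial>lebesgue)" using integral_distr[OF d(4) f] unfolding d(3) by simp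
  show "integrable lebesgue (\<lambda>z. f (x + z)) \<longleftrightarrow> integrable lebesgue f" using integrable_distr_eq[OF d(2) f] unfolding d(1) by simp
  show "integrable lebesgue (\<lambda>z. f (x - z)) \<longleftrightarrow> integrable lebesgue f" using integrable_distr_eq[OF d(4) f] unfolding d(3) by simp
  show "(\<lambda>z. f (x + z)) \<in> borel_measurable lebesgue" using measurable_compose[OF d(2) f] .
  show "(\<lambda>z. f (x - z)) \<in> borel_measurable lebesgue" using measurable_compose[OF d(4) f] .
qed

lemma borel_lebesgue: "f \<in> bmeas \<Longrightarrow> f \<in> borel_measurable lebesgue" for f :: "'a::euclidean_space \<Rightarrow> real"
  by (rule measurable_completion) simp

section \<open>Subordination of the Levy kernel to the heat kernel\<close>

definition nu :: "real \<Rightarrow> 'a::euclidean_space \<Rightarrow> real" where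
  "nu s z = 1 / norm z powr (real DIM('a) + 2 * s)"

lemma nu_nonneg [simp]: "0 \<le> nu s z" by (simp add: nu_def)

lemma nu_minus [simp]: "nu s (- z) = nu s z" by (simp add: nu_def)

lemma nu_measurable [measurable]: "nu s \<in> bmeas"
  unfolding nu_def by measurable

text \<open>The Gaussian is radial, so any unit vector serves. The value only rescales the
  coefficient of the equation, so positivity suffices in place of a closed form.\<close>

definition usub :: "real \<Rightarrow> 'a::euclidean_space itself \<Rightarrow> real" where
  "usub s ty = (LBINT t. ppw (-1 - s) t * hk t (SOME b. b \<in> (Basis::'a set)))"

lemma some_Basis: "(SOME b. b \<in> (Basis::'a::euclidean_space set)) \<in> Basis"
  using someI_ex[of "\<lambda>b. b \<in> (Basis::'a set)"] nonempty_Basis by blast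

text \<open>Near 0 the moment bound of order \<open>N / 2 + 1\<close> gives
  \<open>hk q e <= C * q\<close>, which tempers \<open>q powr (-1-s)\<close>; for large
  \<open>q\<close> the kernel is bounded.\<close>

lemma usub_integrable:
  assumes s: "0 < s" "s < 1"
  shows "integrable lborel (\<lambda>t. ppw (-1 - s) t * hk t (SOME b. b \<in> (Basis::'a::euclidean_space set)))"
proof -
  define e where "e = (SOME b. b \<in> (Basis::'a set))"
  have e: "norm e = 1" using some_Basis[where 'a='a] by (simp add: e_def)
  define M where "M = real DIM('a) / 2 + 1"
  obtain C where C: "0 < C" "\<And>t z. 0 < t \<Longrightarrow> (1 + (norm (z::'a))\<^sup>2 / t) powr M * hk t z \<le> C * hk (2 * t) z"
    using hk_moment_bound[of M, where 'a='a] by (auto simp: M_def)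
  have hle: "hk t z \<le> t powr (- (real DIM('a) / 2))" if "0 < t" for t and z :: 'a
  proof -
    have "1 * t \<le> 4 * pi * t" using pi_gt3 that by (intro mult_right_mono) auto
    hence "(4 * pi * t) powr (- (real DIM('a) / 2)) \<le> t powr (- (real DIM('a) / 2))" using that by (intro powr_mono2') auto
    moreover have "exp (- (norm z)\<^sup>2 / (4 * t)) \<le> 1" using that by simp
    ultimately have "hk t z \<le> t powr (- (real DIM('a) / 2)) * 1" unfolding hk_def by (intro mult_mono) auto
    thus ?thesis by simp
  qed
  show ?thesis unfolding e_def[symmetric]
  proof (rule integrable_ppw_split[where a="- s" and b="-1 - s" and K="C + 1"])
    fix q :: real assume q: "0 < q" "q \<le> 1"
    have "(1 / q) powr M \<le> (1 + (norm e)\<^sup>2 / q) powr M" using q e by (intro powr_mono2) (auto simp: M_def)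
    hence "(1 / q) powr M * hk q e \<le> (1 + (norm e)\<^sup>2 / q) powr M * hk q e" by (intro mult_right_mono) auto
    also have "\<dots> \<le> C * hk (2 * q) e" by (rule C(2)[OF q(1)])
    also have "\<dots> \<le> C * (2 * q) powr (- (real DIM('a) / 2))" using q C(1) by (intro mult_left_mono hle) auto
    also have "\<dots> \<le> C * q powr (- (real DIM('a) / 2))" using q C(1) by (intro mult_left_mono powr_mono2') auto
    finally have "q powr M * ((1 / q) powr M * hk q e) \<le> q powr M * (C * q powr (- (real DIM('a) / 2)))" by (intro mult_left_mono) auto
    moreover have "q powr M * ((1 / q) powr M * hk q e) = hk q e" using q by (simp add: powr_divide)
    moreover have "q powr M * (C * q powr (- (real DIM('a) / 2))) = C * q"
    proof -
      have "q powr M * q powr (- (real DIM('a) / 2)) = q powr 1" by (simp add: M_def flip: powr_add)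
      thus ?thesis using q by simp
    qed
    ultimately have "hk q e \<le> C * q" by simp
    hence "q powr (-1 - s) * hk q e \<le> q powr (-1 - s) * (C * q)" by (intro mult_left_mono) auto
    also have "\<dots> = C * q powr (- s)" using q powr_add[of q "-1 - s" 1] by simp
    also have "\<dots> \<le> (C + 1) * q powr (- s)" by (intro mult_right_mono) auto
    finally show "\<bar>ppw (-1 - s) q * hk q e\<bar> \<le> (C + 1) * q powr (- s)" using q by (simp add: ppw_pos)
  next
    fix q :: real assume q: "1 \<le> q"
    have "hk q e \<le> q powr (- (real DIM('a) / 2))" using q by (intro hle) auto
    also have "\<dots> \<le> 1" using powr_mono[of "- (real DIM('a) / 2)" 0 q] q by simp
    finally have "q powr (-1 - s) * hk q e \<le> q powr (-1 - s) * (C + 1)" using C(1) by (intro mult_left_mono) auto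
    thus "\<bar>ppw (-1 - s) q * hk q e\<bar> \<le> (C + 1) * q powr (-1 - s)" using q by (simp add: ppw_pos mult.commute)
  qed (use s C(1) in auto)
qed

lemma usub_pos:
  assumes s: "0 < s" "s < 1" shows "0 < usub s TYPE('a::euclidean_space)"
proof -
  let ?e = "SOME b. b \<in> (Basis::'a set)"
  let ?f = "\<lambda>t. ppw (-1 - s) t * hk t ?e"
  have i: "integrable lborel ?f" by (rule usub_integrable[OF s])
  have "usub s TYPE('a) \<noteq> 0"
  proof
    assume "usub s TYPE('a) = 0"
    hence "AE t in lborel. ?f t = 0" unfolding usub_def using i by (subst (asm) integral_nonneg_eq_0_iff_AE) auto
    moreover have "?f t \<noteq> 0" if "0 < t" for t using that by (simp add: ppw_pos hk_def)
    ultimately have "AE t in lborel. \<not> (0 < (t::real))" by (auto elim!: AE_mp)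
    hence "AE t in lborel. t \<notin> {0<..(1::real)}" by (rule eventually_mono) auto
    hence "{0<..(1::real)} \<in> null_sets lborel" by (subst AE_iff_null_sets) auto
    hence "emeasure lborel {0<..(1::real)} = 0" by (rule null_setsD1)
    thus False by simp
  qed
  moreover have "0 \<le> usub s TYPE('a)" unfolding usub_def by (intro integral_nonneg_AE) auto
  ultimately show ?thesis by linarith
qed

lemma hk_scale:
  fixes z :: "'a::euclidean_space"
  assumes z: "z \<noteq> 0" and t: "0 < t" and e: "norm e = 1"
  shows "hk ((norm z)\<^sup>2 * t) z = norm z powr (- real DIM('a)) * hk t (e::'a)"
proof -
  have n: "0 < norm z" using z by simp
  have "(4 * pi * ((norm z)\<^sup>2 * t)) powr (- (real DIM('a) / 2)) = ((norm z)\<^sup>2 * (4 * pi * t)) powr (- (real DIM('a) / 2))" by (simp add: mult_ac)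
  also have "\<dots> = ((norm z)\<^sup>2) powr (- (real DIM('a) / 2)) * (4 * pi * t) powr (- (real DIM('a) / 2))" by (rule powr_mult)
  also have "((norm z)\<^sup>2) powr (- (real DIM('a) / 2)) = norm z powr (- real DIM('a))"
  proof -
    have "(norm z)\<^sup>2 = norm z powr 2" using n by (simp add: powr_numeral)
    thus ?thesis by (simp only: powr_powr) simp
  qed
  finally show ?thesis unfolding hk_def using n t e by simp
qed

text \<open>Substituting \<open>|z|^2 t\<close> for \<open>t\<close> reduces to a unit vector, and
  the powers of \<open>|z|\<close> collect to \<open>|z| powr (-(N + 2s))\<close>.\<close>

lemma nn_subordination:
  fixes z :: "'a::euclidean_space"
  assumes s: "0 < s" "s < 1" and z: "z \<noteq> 0"
  shows "(\<integral>\<^sup>+t. ppw (-1 - s) t * hk t z \<partial>lborel) = ennreal (usub s TYPE('a) * nu s z)"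
proof -
  let ?e = "SOME b. b \<in> (Basis::'a set)"
  have e: "norm ?e = 1" using some_Basis[where 'a='a] by simp
  let ?n = "(norm z)\<^sup>2"
  have n: "0 < ?n" "0 < norm z" using z by auto
  have "(\<integral>\<^sup>+t. ppw (-1 - s) t * hk t z \<partial>lborel) = ennreal \<bar>?n\<bar> * (\<integral>\<^sup>+t. ppw (-1 - s) (0 + ?n * t) * hk (0 + ?n * t) z \<partial>lborel)"
    using n by (intro nn_integral_real_affine) auto
  also have "(\<integral>\<^sup>+t. ppw (-1 - s) (0 + ?n * t) * hk (0 + ?n * t) z \<partial>lborel)
     = (\<integral>\<^sup>+t. ennreal (?n powr (-1 - s) * norm z powr (- real DIM('a))) * ennreal (ppw (-1 - s) t * hk t ?e) \<partial>lborel)"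
  proof (rule nn_integral_cong)
    fix t :: real
    have "ppw (-1 - s) (0 + ?n * t) * hk (0 + ?n * t) z = ?n powr (-1 - s) * norm z powr (- real DIM('a)) * (ppw (-1 - s) t * hk t ?e)"
    proof (cases "0 < t")
      case True
      have "ppw (-1 - s) (0 + ?n * t) = ?n powr (-1 - s) * t powr (-1 - s)" using True n by (simp add: ppw_pos powr_mult)
      moreover have "hk (0 + ?n * t) z = norm z powr (- real DIM('a)) * hk t ?e" using hk_scale[OF z True e] by simp
      ultimately show ?thesis using True by (simp add: ppw_pos mult_ac)
    next
      case False
      hence "?n * t \<le> 0" using n by (simp add: mult_le_0_iff)
      thus ?thesis using False by simp
    qed
    thus "ennreal (ppw (-1 - s) (0 + ?n * t) * hk (0 + ?n * t) z) = ennreal (?n powr (-1 - s) * norm z powr (- real DIM('a))) * ennreal (ppw (-1 - s) t * hk t ?e)"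
      by (simp add: ennreal_mult)
  qed
  also have "\<dots> = ennreal (?n powr (-1 - s) * norm z powr (- real DIM('a))) * ennreal (usub s TYPE('a))"
    unfolding usub_def using usub_integrable[OF s, where 'a='a] by (subst nn_integral_cmult) (auto simp: nn_integral_eq_integral)
  also have "ennreal \<bar>?n\<bar> * (ennreal (?n powr (-1 - s) * norm z powr (- real DIM('a))) * ennreal (usub s TYPE('a)))
     = ennreal (?n * (?n powr (-1 - s) * norm z powr (- real DIM('a))) * usub s TYPE('a))"
    using n usub_pos[OF s, where 'a='a] by (simp add: ennreal_mult mult.assoc)
  also have "?n * (?n powr (-1 - s) * norm z powr (- real DIM('a))) = nu s z"
  proof -
    have "?n = norm z powr 2" using n by (simp add: powr_numeral)
    hence "?n * (?n powr (-1 - s) * norm z powr (- real DIM('a))) = norm z powr (2 + (2 * (-1 - s) + - real DIM('a)))"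
      by (simp only: powr_powr powr_add)
    also have "2 + (2 * (-1 - s) + - real DIM('a)) = - (real DIM('a) + 2 * s)" by simp
    finally show ?thesis unfolding nu_def by (simp only: powr_minus_divide)
  qed
  finally show ?thesis by (simp add: mult.commute)
qed

text \<open>The usual weight for Levy kernels: it controls second differences of bounded functions
  with bounded second derivative.\<close>

definition mn :: "'a::euclidean_space \<Rightarrow> real" where "mn z = min 1 ((norm z)\<^sup>2)"

lemma mn_nonneg [simp]: "0 \<le> mn z" by (simp add: mn_def)

lemma mn_measurable [measurable]: "mn \<in> bmeas" unfolding mn_def by measurable

lemma mn_0 [simp]: "mn 0 = 0" by (simp add: mn_def)

lemma hk_mn:
  obtains C where "0 < C" "\<And>t. 0 < t \<Longrightarrow> (\<integral>\<^sup>+z. mn (z::'a::euclidean_space) * hk t z \<partial>lborel) \<le> ennreal (C * min 1 t)"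
proof -
  obtain C where C: "0 < C" "\<And>t z. 0 < t \<Longrightarrow> (1 + (norm (z::'a))\<^sup>2 / t) powr 1 * hk t z \<le> C * hk (2 * t) z"
    using hk_moment_bound[of 1, where 'a='a] by (metis zero_le_one)
  have "(\<integral>\<^sup>+z. mn (z::'a) * hk t z \<partial>lborel) \<le> ennreal ((C + 1) * min 1 t)" if t: "0 < t" for t
  proof -
    have 1: "(\<integral>\<^sup>+z. mn (z::'a) * hk t z \<partial>lborel) \<le> ennreal 1"
    proof -
      have "(\<integral>\<^sup>+z. mn (z::'a) * hk t z \<partial>lborel) \<le> (\<integral>\<^sup>+z. hk t (z::'a) \<partial>lborel)"
        by (intro nn_integral_mono ennreal_leI) (auto simp: mn_def intro!: mult_left_le_one_le)
      thus ?thesis using t by (simp add: nn_integral_hk)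
    qed
    have 2: "(\<integral>\<^sup>+z. mn (z::'a) * hk t z \<partial>lborel) \<le> ennreal (C * t)"
    proof -
      have le: "mn z * hk t z \<le> (C * t) * hk (2 * t) z" for z :: 'a
      proof -
        have "(norm z)\<^sup>2 / t * hk t z \<le> (1 + (norm z)\<^sup>2 / t) powr 1 * hk t z"
          using t by (intro mult_right_mono) (auto simp: add_nonneg_nonneg)
        hence "(norm z)\<^sup>2 / t * hk t z \<le> C * hk (2 * t) z" using C(2)[OF t, of z] by linarith
        hence "t * ((norm z)\<^sup>2 / t * hk t z) \<le> t * (C * hk (2 * t) z)" using t by (intro mult_left_mono) auto
        moreover have "mn z * hk t z \<le> (norm z)\<^sup>2 * hk t z" by (intro mult_right_mono) (auto simp: mn_def)
        ultimately show ?thesis using t by (simp add: mult_ac)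
      qed
      have "(\<integral>\<^sup>+z. mn (z::'a) * hk t z \<partial>lborel) \<le> (\<integral>\<^sup>+z. ennreal (C * t) * ennreal (hk (2 * t) (z::'a)) \<partial>lborel)"
        using C(1) t by (intro nn_integral_mono) (simp add: le ennreal_leI flip: ennreal_mult)
      also have "\<dots> = ennreal (C * t)" using t by (subst nn_integral_cmult) (auto simp: nn_integral_hk)
      finally show ?thesis .
    qed
    show ?thesis
    proof (cases "t \<le> 1")
      case True
      have "C * t \<le> (C + 1) * min 1 t" using True t by (simp add: distrib_right)
      thus ?thesis using 2 ennreal_leI order_trans by blast
    next
      case False
      have "1 \<le> (C + 1) * min 1 t" using False C(1) by simp
      thus ?thesis using 1 ennreal_leI order_trans by blast
    qed
  qed
  thus ?thesis using that[of "C + 1"] C(1) by simp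
qed

text \<open>The Gaussian integral of \<open>mn\<close> is at most \<open>C * min 1 t\<close>,
  integrable against \<open>t powr (-1-s)\<close>. Exchanging the integrals and using subordination
  turns this into integrability of the Levy kernel against \<open>mn\<close>.\<close>

lemma nn_mn_nu:
  assumes s: "0 < s" "s < 1"
  shows "(\<integral>\<^sup>+p. ennreal (mn (snd p) * (ppw (-1 - s) (fst p) * hk (fst p) (snd p :: 'a::euclidean_space))) \<partial>(lborel \<Otimes>\<^sub>M lborel)) < \<infinity>"
    and "integrable lborel (\<lambda>z::'a. mn z * nu s z)"
proof -
  obtain C where C: "0 < C" "\<And>t. 0 < t \<Longrightarrow> (\<integral>\<^sup>+z. mn (z::'a) * hk t z \<partial>lborel) \<le> ennreal (C * min 1 t)"
    using hk_mn[where 'a='a] by metis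
  let ?I = "\<integral>\<^sup>+p. ennreal (mn (snd p) * (ppw (-1 - s) (fst p) * hk (fst p) (snd p :: 'a))) \<partial>(lborel \<Otimes>\<^sub>M lborel)"
  have "?I = (\<integral>\<^sup>+t. \<integral>\<^sup>+z. ennreal (mn z * (ppw (-1 - s) t * hk t (z :: 'a))) \<partial>lborel \<partial>lborel)"
    by (subst lborel.nn_integral_fst[symmetric]) auto
  also have "\<dots> \<le> (\<integral>\<^sup>+t. ennreal (C * (ppw (-1 - s) t * min 1 t)) \<partial>lborel)"
  proof (rule nn_integral_mono)
    fix t :: real
    show "(\<integral>\<^sup>+z. ennreal (mn z * (ppw (-1 - s) t * hk t (z :: 'a))) \<partial>lborel) \<le> ennreal (C * (ppw (-1 - s) t * min 1 t))"
    proof (cases "0 < t")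
      case True
      have "(\<integral>\<^sup>+z. ennreal (mn z * (ppw (-1 - s) t * hk t (z :: 'a))) \<partial>lborel) = (\<integral>\<^sup>+z. ennreal (ppw (-1 - s) t) * ennreal (mn z * hk t (z :: 'a)) \<partial>lborel)"
        by (simp add: mult_ac flip: ennreal_mult)
      also have "\<dots> = ennreal (ppw (-1 - s) t) * (\<integral>\<^sup>+z. mn z * hk t (z :: 'a) \<partial>lborel)" by (rule nn_integral_cmult) simp
      also have "\<dots> \<le> ennreal (ppw (-1 - s) t) * ennreal (C * min 1 t)" by (intro mult_left_mono C(2) True) simp
      also have "\<dots> = ennreal (C * (ppw (-1 - s) t * min 1 t))" using True C(1) by (simp add: mult_ac flip: ennreal_mult)
      finally show ?thesis .
    qed simp
  qed
  also have "\<dots> < \<infinity>"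
  proof -
    have "integrable lborel (\<lambda>t. C * (ppw (-1 - s) t * min 1 t))" by (intro integrable_mult_right integrable_ppw_min s)
    thus ?thesis unfolding integrable_iff_bounded
    proof (elim conjE)
      assume "(\<integral>\<^sup>+ x. ennreal (norm (C * (ppw (- 1 - s) x * min 1 x))) \<partial>lborel) < \<infinity>"
      moreover have "(\<integral>\<^sup>+t. ennreal (C * (ppw (-1 - s) t * min 1 t)) \<partial>lborel) \<le> (\<integral>\<^sup>+ x. ennreal (norm (C * (ppw (- 1 - s) x * min 1 x))) \<partial>lborel)"
        by (intro nn_integral_mono ennreal_leI) (simp only: real_norm_def abs_ge_self)
      ultimately show ?thesis by (rule le_less_trans[rotated])
    qed
  qed
  finally show fin: "?I < \<infinity>" .
  have u: "0 < usub s TYPE('a)" by (rule usub_pos[OF s])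
  have "?I = (\<integral>\<^sup>+z. \<integral>\<^sup>+t. ennreal (mn z * (ppw (-1 - s) t * hk t (z :: 'a))) \<partial>lborel \<partial>lborel)"
    by (subst lborel_pair.nn_integral_snd[symmetric]) (auto simp: case_prod_unfold)
  also have "\<dots> = (\<integral>\<^sup>+z. ennreal (usub s TYPE('a)) * ennreal (mn z * nu s (z::'a)) \<partial>lborel)"
  proof (rule nn_integral_cong)
    fix z :: 'a
    show "(\<integral>\<^sup>+t. ennreal (mn z * (ppw (-1 - s) t * hk t z)) \<partial>lborel) = ennreal (usub s TYPE('a)) * ennreal (mn z * nu s z)"
    proof (cases "z = 0")
      case False
      have "(\<integral>\<^sup>+t. ennreal (mn z * (ppw (-1 - s) t * hk t z)) \<partial>lborel) = ennreal (mn z) * (\<integral>\<^sup>+t. ennreal (ppw (-1 - s) t * hk t z) \<partial>lborel)"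
        by (subst nn_integral_cmult[symmetric]) (auto simp: ennreal_mult)
      thus ?thesis unfolding nn_subordination[OF s False] using u by (simp add: mult_ac flip: ennreal_mult)
    qed simp
  qed
  also have "\<dots> = ennreal (usub s TYPE('a)) * (\<integral>\<^sup>+z. ennreal (mn z * nu s (z::'a)) \<partial>lborel)" by (rule nn_integral_cmult) simp
  finally have "ennreal (usub s TYPE('a)) * (\<integral>\<^sup>+z. ennreal (mn z * nu s (z::'a)) \<partial>lborel) < \<infinity>" using fin by simp
  hence "(\<integral>\<^sup>+z. ennreal (mn z * nu s (z::'a)) \<partial>lborel) < \<infinity>" using u by (auto simp: ennreal_mult_less_top)
  thus "integrable lborel (\<lambda>z::'a. mn z * nu s z)" by (intro integrableI_nonneg) auto
qed

section \<open>Second differences and the principal value\<close>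

definition sd :: "('a::euclidean_space \<Rightarrow> real) \<Rightarrow> 'a \<Rightarrow> 'a \<Rightarrow> real" where
  "sd w x z = 2 * w x - w (x + z) - w (x - z)"

text \<open>The symmetrised singular integral, without the normalising constant; the sign of
  \<open>sd\<close> makes it nonnegative at a maximum.\<close>

definition flap :: "real \<Rightarrow> ('a::euclidean_space \<Rightarrow> real) \<Rightarrow> 'a \<Rightarrow> real" where
  "flap s w x = 1 / 2 * (\<integral>z. sd w x z * nu s z \<partial>lebesgue)"

lemma sd_borel [measurable]:
  fixes w :: "'a::euclidean_space \<Rightarrow> real"
  assumes [measurable]: "w \<in> bmeas" shows "sd w x \<in> bmeas" unfolding sd_def by measurable

lemma integrable_lebesgue_mn_nu:
  assumes "0 < s" "s < 1" shows "integrable lebesgue (\<lambda>z::'a::euclidean_space. mn z * nu s z)"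
  using nn_mn_nu(2)[OF assms, where 'a='a] by (subst integrable_completion) auto

text \<open>The Levy kernel is a superposition of Gaussians, and Fubini lets space be integrated
  first; evenness of the Gaussian turns the second difference into
  \<open>2 * (w x - heat t w x)\<close>.\<close>

lemma flap_Lam:
  fixes w :: "'a::euclidean_space \<Rightarrow> real"
  assumes s: "0 < s" "s < 1" and w[measurable]: "w \<in> bmeas" and wB: "\<And>x. \<bar>w x\<bar> \<le> B"
    and sdC: "\<And>z. \<bar>sd w x z\<bar> \<le> K * mn z"
  shows "usub s TYPE('a) * flap s w x = Lam s w x"
proof -
  have u: "0 < usub s TYPE('a)" by (rule usub_pos[OF s])
  have K0: "0 \<le> K"
  proof -
    obtain b where b: "b \<in> (Basis::'a set)" using nonempty_Basis by blast
    hence "mn b = 1" by (simp add: mn_def)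
    thus ?thesis using order_trans[OF abs_ge_zero sdC[of b]] by simp
  qed
  have fub: "integrable (lborel \<Otimes>\<^sub>M lborel) (\<lambda>(t, z). sd w x z * (ppw (-1 - s) t * hk t z))"
  proof (rule integrableI_bounded)
    have "(\<integral>\<^sup>+p. ennreal (norm (case p of (t, z) \<Rightarrow> sd w x z * (ppw (-1 - s) t * hk t z))) \<partial>(lborel \<Otimes>\<^sub>M lborel))
      \<le> (\<integral>\<^sup>+p. ennreal K * ennreal (mn (snd p) * (ppw (-1 - s) (fst p) * hk (fst p) (snd p :: 'a))) \<partial>(lborel \<Otimes>\<^sub>M lborel))"
    proof (rule nn_integral_mono, clarify)
      fix t and z :: 'a
      have "\<bar>sd w x z\<bar> * (ppw (-1 - s) t * hk t z) \<le> K * mn z * (ppw (-1 - s) t * hk t z)" by (intro mult_right_mono sdC) auto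
      thus "ennreal (norm (sd w x z * (ppw (-1 - s) t * hk t z))) \<le> ennreal K * ennreal (mn (snd (t, z)) * (ppw (-1 - s) (fst (t, z)) * hk (fst (t, z)) (snd (t, z))))"
        using K0 by (simp add: abs_mult mult.assoc flip: ennreal_mult)
    qed
    also have "\<dots> = ennreal K * (\<integral>\<^sup>+p. ennreal (mn (snd p) * (ppw (-1 - s) (fst p) * hk (fst p) (snd p :: 'a))) \<partial>(lborel \<Otimes>\<^sub>M lborel))"
      by (rule nn_integral_cmult) measurable
    also have "\<dots> < \<infinity>" using nn_mn_nu(1)[OF s, where 'a='a] by (simp add: ennreal_mult_less_top)
    finally show "(\<integral>\<^sup>+p. ennreal (norm (case p of (t, z) \<Rightarrow> sd w x z * (ppw (-1 - s) t * hk t z))) \<partial>(lborel \<Otimes>\<^sub>M lborel)) < \<infinity>" .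
  qed measurable
  \<comment> \<open>At \<open>z = 0\<close> the second difference vanishes, so the value of
    \<open>nu\<close> there, 0 by division by zero, does not matter.\<close>
  have zi: "(LBINT t. sd w x z * (ppw (-1 - s) t * hk t z)) = sd w x z * (usub s TYPE('a) * nu s z)" for z :: 'a
  proof (cases "z = 0")
    case False
    have "(LBINT t. ppw (-1 - s) t * hk t z) = usub s TYPE('a) * nu s z" using u nn_subordination[OF s False] by (subst integral_eq_nn_integral) auto
    thus ?thesis by simp
  qed (simp add: sd_def)
  have ti: "(LBINT z. sd w x z * (ppw (-1 - s) t * hk t z)) = 2 * (ppw (-1 - s) t * (w x - heat t w x))" for t
  proof (cases "0 < t")
    case True
    have i1: "integrable lborel (\<lambda>z. w (x - z) * hk t z)" by (rule heat_integrable[OF w wB True])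
    have i2: "integrable lborel (\<lambda>z. w (x + z) * hk t z)" using lborel_integral_reflect(2)[of "\<lambda>z. w (x + z) * hk t z" 0] i1 by simp
    have e2: "(LBINT z. w (x + z) * hk t z) = heat t w x"
      using lborel_integral_reflect(1)[of "\<lambda>z. w (x + z) * hk t z" 0] by (simp add: heat_def)
    have "(LBINT z. sd w x z * hk t z) = (LBINT z. 2 * w x * hk t z - w (x + z) * hk t z - w (x - z) * hk t z)"
      by (simp add: sd_def left_diff_distrib)
    also have "\<dots> = 2 * w x - heat t w x - heat t w x" using i1 i2 True e2 by (simp add: integrable_hk integral_hk heat_def)
    finally have e: "(LBINT z. sd w x z * hk t z) = 2 * (w x - heat t w x)" by simp
    have "(LBINT z. sd w x z * (ppw (-1 - s) t * hk t z)) = (LBINT z. ppw (-1 - s) t * (sd w x z * hk t z))" by (simp only: mult_ac)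
    also have "\<dots> = ppw (-1 - s) t * (2 * (w x - heat t w x))" unfolding integral_mult_right_zero e ..
    finally show ?thesis by simp
  qed simp
  have "(LBINT z. sd w x z * (usub s TYPE('a) * nu s z)) = (LBINT z. (LBINT t. sd w x z * (ppw (-1 - s) t * hk t z)))" by (simp only: zi)
  also have "\<dots> = (LBINT t. (LBINT z. sd w x z * (ppw (-1 - s) t * hk t z)))" by (rule lborel_pair.Fubini_integral[OF fub])
  also have "\<dots> = (LBINT t. 2 * (ppw (-1 - s) t * (w x - heat t w x)))" by (simp only: ti)
  also have "\<dots> = 2 * Lam s w x" unfolding Lam_def by (rule integral_mult_right_zero)
  finally have "(LBINT z. sd w x z * (usub s TYPE('a) * nu s z)) = 2 * Lam s w x" .
  moreover have "(LBINT z. sd w x z * (usub s TYPE('a) * nu s z)) = usub s TYPE('a) * (LBINT z. sd w x z * nu s z)"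
    by (subst integral_mult_right_zero[symmetric]) (simp only: mult_ac)
  moreover have "(\<integral>z. sd w x z * nu s z \<partial>lebesgue) = (LBINT z. sd w x z * nu s z)" by (rule integral_completion) measurable
  ultimately show ?thesis unfolding flap_def by simp
qed

lemma nu_integrable_far:
  assumes s: "0 < s" "s < 1" and e: "0 < e"
  shows "integrable lebesgue (\<lambda>z::'a::euclidean_space. indicator {z. e < norm z} z * nu s z)"
proof (rule lint_bound)
  show "integrable lebesgue (\<lambda>z::'a. (1 / min 1 (e\<^sup>2)) * (mn z * nu s z))" by (intro integrable_mult_right integrable_lebesgue_mn_nu s)
  show "AE z::'a in lebesgue. norm (indicator {z. e < norm z} z * nu s z) \<le> norm ((1 / min 1 (e\<^sup>2)) * (mn z * nu s z))"
  proof (intro AE_I2)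
    fix z :: 'a
    show "norm (indicator {z. e < norm z} z * nu s z) \<le> norm ((1 / min 1 (e\<^sup>2)) * (mn z * nu s z))"
    proof (cases "e < norm z")
      case True
      hence "e\<^sup>2 \<le> (norm z)\<^sup>2" using e by (intro power_mono) auto
      hence m: "min 1 (e\<^sup>2) \<le> mn z" unfolding mn_def by auto
      have p: "0 < min 1 (e\<^sup>2)" using e by simp
      have "min 1 (e\<^sup>2) * nu s z \<le> mn z * nu s z" using m by (intro mult_right_mono) auto
      hence "nu s z \<le> (1 / min 1 (e\<^sup>2)) * (mn z * nu s z)" using p by (simp add: pos_le_divide_eq mult.commute)
      thus ?thesis using True p by (simp add: abs_mult)
    qed simp
  qed
qed (rule borel_lebesgue, measurable)

lemma Ls_far_integrable:
  fixes w :: "'a::euclidean_space \<Rightarrow> real"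
  assumes s: "0 < s" "s < 1" and w: "w \<in> Ls_space s" and e: "0 < e"
  shows "integrable lebesgue (\<lambda>z. indicator {z. e < norm z} z * (w (x + z) * nu s z))"
proof -
  have wm: "w \<in> borel_measurable lebesgue" and wi: "integrable lebesgue (\<lambda>y. \<bar>w y\<bar> / (1 + norm y powr (real DIM('a) + 2 * s)))"
    using w by (auto simp: Ls_space_def)
  let ?p = "real DIM('a) + 2 * s"
  have p: "0 < ?p" using s by simp
  \<comment> \<open>Bounds \<open>(1 + |x + z|^p) / |z|^p\<close> for \<open>|z| > e\<close>, so
    that the kernel is dominated by the translated weight of \<open>Ls_space\<close>.\<close>
  define K where "K = e powr (- ?p) + (1 + norm x / e) powr ?p"
  have "integrable lebesgue (\<lambda>z. \<bar>w (x + z)\<bar> / (1 + norm (x + z) powr ?p))"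
    using wi lebesgue_shift(3)[of "\<lambda>y. \<bar>w y\<bar> / (1 + norm y powr ?p)" x] borel_measurable_integrable[OF wi] by simp
  hence i: "integrable lebesgue (\<lambda>z. K * (\<bar>w (x + z)\<bar> / (1 + norm (x + z) powr ?p)))" by (rule integrable_mult_right)
  have nm: "nu s \<in> borel_measurable lebesgue" by (rule borel_lebesgue) measurable
  have im: "(\<lambda>z::'a. indicator {z. e < norm z} z :: real) \<in> borel_measurable lebesgue" by (rule borel_lebesgue) measurable
  show ?thesis
  proof (rule lint_bound[OF i])
    show "(\<lambda>z. indicator {z. e < norm z} z * (w (x + z) * nu s z)) \<in> borel_measurable lebesgue"
      by (intro borel_measurable_times im nm lebesgue_shift(5) wm)
    show "AE z in lebesgue. norm (indicator {z. e < norm z} z * (w (x + z) * nu s z)) \<le> norm (K * (\<bar>w (x + z)\<bar> / (1 + norm (x + z) powr ?p)))"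
    proof (intro AE_I2)
      fix z :: 'a
      show "norm (indicator {z. e < norm z} z * (w (x + z) * nu s z)) \<le> norm (K * (\<bar>w (x + z)\<bar> / (1 + norm (x + z) powr ?p)))"
      proof (cases "e < norm z")
        case True
        have n: "0 < norm z" using True e by linarith
        have "1 \<le> e powr (- ?p) * norm z powr ?p"
        proof -
          have "e powr ?p \<le> norm z powr ?p" using True e p by (intro powr_mono2) auto
          hence "e powr (- ?p) * e powr ?p \<le> e powr (- ?p) * norm z powr ?p" by (intro mult_left_mono) auto
          thus ?thesis using e by (simp flip: powr_add)
        qed
        moreover have "norm (x + z) powr ?p \<le> (1 + norm x / e) powr ?p * norm z powr ?p"
        proof -
          have "norm x = norm x / e * e" using e by simp
          also have "\<dots> \<le> norm x / e * norm z" using True e by (intro mult_left_mono) auto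
          finally have "norm (x + z) \<le> (1 + norm x / e) * norm z" using norm_triangle_ineq[of x z] by (simp add: distrib_right)
          hence "norm (x + z) powr ?p \<le> ((1 + norm x / e) * norm z) powr ?p" using p by (intro powr_mono2) auto
          thus ?thesis by (simp only: powr_mult)
        qed
        ultimately have le: "1 + norm (x + z) powr ?p \<le> K * norm z powr ?p" unfolding K_def by (simp add: distrib_right)
        have q: "0 < 1 + norm (x + z) powr ?p" by (simp add: add_pos_nonneg)
        have q2: "0 < norm z powr ?p" using n by simp
        have "nu s z \<le> K / (1 + norm (x + z) powr ?p)" unfolding nu_def using le q q2 by (simp add: divide_simps mult.commute)
        hence "\<bar>w (x + z)\<bar> * nu s z \<le> \<bar>w (x + z)\<bar> * (K / (1 + norm (x + z) powr ?p))" by (intro mult_left_mono) auto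
        moreover have "0 \<le> K" using le q q2 by (smt (verit) mult_nonpos_nonneg)
        ultimately show ?thesis using True q by (simp add: abs_mult mult.commute)
      qed simp
    qed
  qed
qed

text \<open>On the symmetric region \<open>e < |z|\<close> reflection replaces the first difference
  by half the second difference; the quadratic bound then permits dominated convergence as
  \<open>e\<close> tends to 0. Regularity is asked only of second differences at \<open>x\<close>,
  which covers functions glued from two pieces.\<close>

lemma pv_limit:
  fixes w :: "'a::euclidean_space \<Rightarrow> real"
  assumes s: "0 < s" "s < 1" and w: "w \<in> Ls_space s" and rho: "0 < rho" and sdC: "\<And>z. norm z \<le> rho \<Longrightarrow> \<bar>sd w x z\<bar> \<le> K * (norm z)\<^sup>2"
  shows "integrable lebesgue (\<lambda>z. sd w x z * nu s z)"
    and "frac_laplacian s w x = frac_const DIM('a) s * flap s w x"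
proof -
  let ?p = "real DIM('a) + 2 * s"
  have wm: "w \<in> borel_measurable lebesgue" using w by (auto simp: Ls_space_def)
  let ?I = "\<lambda>e z. indicator {z::'a. e < norm z} z :: real"
  have nm: "nu s \<in> borel_measurable (lebesgue :: 'a measure)" by (rule borel_lebesgue) measurable
  have im: "(\<lambda>z. ?I e z) \<in> borel_measurable lebesgue" for e by (rule borel_lebesgue) measurable
  have sdm: "sd w x \<in> borel_measurable lebesgue" unfolding sd_def by (intro borel_measurable_diff borel_measurable_const lebesgue_shift(5,6) wm)
  have mw: "(\<lambda>y. w (- y)) \<in> borel_measurable lebesgue" using lebesgue_shift(6)[OF wm, of 0] by simp
  have i0: "integrable lebesgue (\<lambda>z. w x * (?I e z * nu s z))" if "0 < e" for e by (intro integrable_mult_right nu_integrable_far s that)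
  have ip: "integrable lebesgue (\<lambda>z. ?I e z * (w (x + z) * nu s z))" if "0 < e" for e by (rule Ls_far_integrable[OF s w that])
  have gm: "(\<lambda>z. ?I e z * (w (x + z) * nu s z)) \<in> borel_measurable lebesgue" for e
    by (intro borel_measurable_times im nm lebesgue_shift(5) wm)
  have imn: "integrable lebesgue (\<lambda>z. ?I e z * (w (x - z) * nu s z))"
    and emn: "(\<integral>z. ?I e z * (w (x - z) * nu s z) \<partial>lebesgue) = (\<integral>z. ?I e z * (w (x + z) * nu s z) \<partial>lebesgue)" if "0 < e" for e
    using lebesgue_shift(4)[where x=0, OF gm[of e]] lebesgue_shift(2)[where x=0, OF gm[of e]] ip[OF that] by (simp_all add: indicator_def)
  have isd: "integrable lebesgue (\<lambda>z. ?I e z * (sd w x z * nu s z))" if "0 < e" for e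
  proof -
    have "integrable lebesgue (\<lambda>z. 2 * (w x * (?I e z * nu s z)) - ?I e z * (w (x + z) * nu s z) - ?I e z * (w (x - z) * nu s z))"
      by (intro Bochner_Integration.integrable_diff integrable_mult_right i0 ip imn that)
    thus ?thesis by (rule back_subst[where P="integrable lebesgue"]) (auto simp: sd_def algebra_simps)
  qed
  have J: "(LINT y:{y. e < norm (x - y)}|lebesgue. (w x - w y) / norm (x - y) powr ?p) = 1 / 2 * (\<integral>z. ?I e z * (sd w x z * nu s z) \<partial>lebesgue)"
    if e: "0 < e" for e
  proof -
    let ?g = "\<lambda>y. indicator {y. e < norm (x - y)} y * ((w x - w y) / norm (x - y) powr ?p)"
    have eq: "?g = (\<lambda>y. ?I e (x - y) * ((w x - w y) * nu s (x - y)))" by (rule ext) (simp add: nu_def indicator_def)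
    have gm': "?g \<in> borel_measurable lebesgue"
      unfolding eq by (intro borel_measurable_times borel_measurable_diff borel_measurable_const wm lebesgue_shift(6)[OF nm] lebesgue_shift(6)[OF im])
    have "(LINT y:{y. e < norm (x - y)}|lebesgue. (w x - w y) / norm (x - y) powr ?p) = (\<integral>y. ?g y \<partial>lebesgue)"
      by (simp add: set_lebesgue_integral_def)
    also have "\<dots> = (\<integral>z. ?g (x + z) \<partial>lebesgue)" by (rule lebesgue_shift(1)[OF gm', symmetric])
    also have "\<dots> = (\<integral>z. w x * (?I e z * nu s z) - ?I e z * (w (x + z) * nu s z) \<partial>lebesgue)"
      by (rule lint_cong) (auto simp: nu_def indicator_def diff_divide_distrib)
    also have "\<dots> = (\<integral>z. w x * (?I e z * nu s z) \<partial>lebesgue) - (\<integral>z. ?I e z * (w (x + z) * nu s z) \<partial>lebesgue)"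
      by (rule lint_diff[OF i0[OF e] ip[OF e]])
    finally have 1: "(LINT y:{y. e < norm (x - y)}|lebesgue. (w x - w y) / norm (x - y) powr ?p)
      = (\<integral>z. w x * (?I e z * nu s z) \<partial>lebesgue) - (\<integral>z. ?I e z * (w (x + z) * nu s z) \<partial>lebesgue)" .
    have "(\<integral>z. ?I e z * (sd w x z * nu s z) \<partial>lebesgue) = (\<integral>z. 2 * (w x * (?I e z * nu s z)) - ?I e z * (w (x + z) * nu s z) - ?I e z * (w (x - z) * nu s z) \<partial>lebesgue)"
      by (rule lint_cong) (auto simp: sd_def algebra_simps)
    also have "\<dots> = 2 * (\<integral>z. w x * (?I e z * nu s z) \<partial>lebesgue) - (\<integral>z. ?I e z * (w (x + z) * nu s z) \<partial>lebesgue) - (\<integral>z. ?I e z * (w (x - z) * nu s z) \<partial>lebesgue)"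
    proof -
      have i2: "integrable lebesgue (\<lambda>z. 2 * (w x * (?I e z * nu s z)))" by (intro integrable_mult_right i0 e)
      show ?thesis unfolding lint_diff[OF Bochner_Integration.integrable_diff[OF i2 ip[OF e]] imn[OF e]]
          lint_diff[OF i2 ip[OF e]] integral_mult_right_zero[of _ 2] ..
    qed
    finally show ?thesis using 1 emn[OF e] by simp
  qed
  have K0: "0 \<le> K"
  proof -
    obtain b where b: "b \<in> (Basis::'a set)" using nonempty_Basis by blast
    have "0 \<le> K * (norm (rho *\<^sub>R b))\<^sup>2" using order_trans[OF abs_ge_zero sdC[of "rho *\<^sub>R b"]] b rho by simp
    thus ?thesis using b rho by (simp add: zero_le_mult_iff)
  qed
  show int: "integrable lebesgue (\<lambda>z. sd w x z * nu s z)"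
  proof (rule lint_bound)
    show "integrable lebesgue (\<lambda>z. K * (1 + rho\<^sup>2) * (mn z * nu s z) + \<bar>?I rho z * (sd w x z * nu s z)\<bar>)"
      by (intro lint_add integrable_mult_right integrable_lebesgue_mn_nu s integrable_abs isd rho)
    show "(\<lambda>z. sd w x z * nu s z) \<in> borel_measurable lebesgue" by (intro borel_measurable_times sdm nm)
    show "AE z in lebesgue. norm (sd w x z * nu s z) \<le> norm (K * (1 + rho\<^sup>2) * (mn z * nu s z) + \<bar>?I rho z * (sd w x z * nu s z)\<bar>)"
    proof (intro AE_I2)
      fix z :: 'a
      have nn: "0 \<le> K * (1 + rho\<^sup>2) * (mn z * nu s z)" using K0 by simp
      show "norm (sd w x z * nu s z) \<le> norm (K * (1 + rho\<^sup>2) * (mn z * nu s z) + \<bar>?I rho z * (sd w x z * nu s z)\<bar>)"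
      proof (cases "norm z \<le> rho")
        case True
        have "(norm z)\<^sup>2 \<le> (1 + rho\<^sup>2) * mn z"
        proof (cases "(norm z)\<^sup>2 \<le> 1")
          case True thus ?thesis using mult_right_mono[of 1 "1 + rho\<^sup>2" "(norm z)\<^sup>2"] by (simp add: mn_def)
        next
          case False
          have "(norm z)\<^sup>2 \<le> rho\<^sup>2" using True by (intro power_mono) auto
          thus ?thesis using False by (simp add: mn_def)
        qed
        hence "K * (norm z)\<^sup>2 \<le> K * ((1 + rho\<^sup>2) * mn z)" using K0 by (rule mult_left_mono)
        hence "\<bar>sd w x z\<bar> \<le> K * ((1 + rho\<^sup>2) * mn z)" using sdC[OF True] by linarith
        hence "\<bar>sd w x z\<bar> * nu s z \<le> K * ((1 + rho\<^sup>2) * mn z) * nu s z" by (intro mult_right_mono) auto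
        hence "\<bar>sd w x z * nu s z\<bar> \<le> K * (1 + rho\<^sup>2) * (mn z * nu s z)" by (simp add: abs_mult mult.assoc)
        thus ?thesis using nn by simp
      next
        case False thus ?thesis using nn by simp
      qed
    qed
  qed
  have "((\<lambda>e. LINT y:{y. e < norm (x - y)}|lebesgue. (w x - w y) / norm (x - y) powr ?p) \<longlongrightarrow> flap s w x) (at_right 0)"
    unfolding tendsto_at_iff_sequentially
  proof (intro allI impI)
    fix E :: "nat \<Rightarrow> real" assume E: "\<forall>i. E i \<in> {0<..} - {0}" and lim: "E \<longlonglongrightarrow> 0"
    have "(\<lambda>n. \<integral>z. ?I (E n) z * (sd w x z * nu s z) \<partial>lebesgue) \<longlonglongrightarrow> (\<integral>z. sd w x z * nu s z \<partial>lebesgue)"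
    proof (rule integral_dominated_convergence[where w="\<lambda>z. \<bar>sd w x z * nu s z\<bar>"])
      show "(\<lambda>z. sd w x z * nu s z) \<in> borel_measurable lebesgue" using int by auto
      show "(\<lambda>z. ?I (E n) z * (sd w x z * nu s z)) \<in> borel_measurable lebesgue" for n by (intro borel_measurable_times im sdm nm)
      show "integrable lebesgue (\<lambda>z. \<bar>sd w x z * nu s z\<bar>)" using int by (rule integrable_abs)
      show "AE z in lebesgue. norm (?I (E n) z * (sd w x z * nu s z)) \<le> \<bar>sd w x z * nu s z\<bar>" for n
        by (intro AE_I2) (auto simp: indicator_def)
      show "AE z in lebesgue. (\<lambda>n. ?I (E n) z * (sd w x z * nu s z)) \<longlonglongrightarrow> sd w x z * nu s z"
      proof (intro AE_I2)
        fix z :: 'a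
        show "(\<lambda>n. ?I (E n) z * (sd w x z * nu s z)) \<longlonglongrightarrow> sd w x z * nu s z"
        proof (cases "z = 0")
          case False
          hence "\<forall>\<^sub>F n in sequentially. E n < norm z" using lim by (intro order_tendstoD(2)) auto
          hence "\<forall>\<^sub>F n in sequentially. ?I (E n) z * (sd w x z * nu s z) = sd w x z * nu s z" by eventually_elim simp
          thus ?thesis by (rule tendsto_eventually)
        qed (simp add: sd_def)
      qed
    qed
    hence "(\<lambda>n. 1 / 2 * (\<integral>z. ?I (E n) z * (sd w x z * nu s z) \<partial>lebesgue)) \<longlonglongrightarrow> flap s w x"
      unfolding flap_def by (intro tendsto_mult_left)
    thus "((\<lambda>e. LINT y:{y. e < norm (x - y)}|lebesgue. (w x - w y) / norm (x - y) powr ?p) \<circ> E) \<longlonglongrightarrow> flap s w x"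
      using E by (simp add: comp_def J)
  qed
  from tendsto_Lim[OF _ this] show "frac_laplacian s w x = frac_const DIM('a) s * flap s w x" unfolding frac_laplacian_def by simp
qed

lemma frac_const_pos: "0 < s \<Longrightarrow> s < 1 \<Longrightarrow> 0 < frac_const N s"
  unfolding frac_const_def by (intro divide_pos_pos mult_pos_pos Gamma_real_pos) auto

lemma bounded_Ls:
  fixes w :: "'a::euclidean_space \<Rightarrow> real"
  assumes s: "0 < s" "s < 1" and w: "w \<in> borel_measurable lebesgue" and B: "\<And>x. \<bar>w x\<bar> \<le> B"
  shows "w \<in> Ls_space s"
proof -
  let ?p = "real DIM('a) + 2 * s"
  have m: "(\<lambda>x::'a. 1 + norm x powr ?p) \<in> borel_measurable lebesgue" by (rule borel_lebesgue) measurable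
  have B0: "0 \<le> B" using B[of 0] by linarith
  have "integrable lebesgue (\<lambda>x. \<bar>w x\<bar> / (1 + norm x powr ?p))"
  proof (rule lint_bound)
    show "integrable lebesgue (\<lambda>z::'a. B * (indicator (cball 0 1) z + mn z * nu s z))"
      by (intro integrable_mult_right lint_add integrable_lebesgue_mn_nu s integrable_real_indicator)
        (use emeasure_bounded_finite[OF bounded_cball[of "0::'a" 1]] in auto)
    show "(\<lambda>x. \<bar>w x\<bar> / (1 + norm x powr ?p)) \<in> borel_measurable lebesgue"
      by (intro borel_measurable_divide borel_measurable_abs w m)
    show "AE z in lebesgue. norm (\<bar>w z\<bar> / (1 + norm z powr ?p)) \<le> norm (B * (indicator (cball 0 1) z + mn z * nu s z))"
    proof (intro AE_I2)
      fix z :: 'a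
      have q: "0 < 1 + norm z powr ?p" by (simp add: add_pos_nonneg)
      have "1 / (1 + norm z powr ?p) \<le> indicator (cball 0 1) z + mn z * nu s z"
      proof (cases "norm z \<le> 1")
        case True
        have "1 / (1 + norm z powr ?p) \<le> 1" using q by simp
        thus ?thesis using True by (simp add: add_increasing2)
      next
        case False
        hence "1 \<le> (norm z)\<^sup>2" by (simp add: one_le_power)
        hence "mn z = 1" by (simp add: mn_def)
        moreover have "1 / (1 + norm z powr ?p) \<le> 1 / norm z powr ?p" using False by (intro divide_left_mono) (auto intro!: mult_pos_pos q)
        ultimately show ?thesis by (simp add: nu_def add_increasing)
      qed
      hence "\<bar>w z\<bar> * (1 / (1 + norm z powr ?p)) \<le> B * (indicator (cball 0 1) z + mn z * nu s z)"
        using B[of z] B0 by (intro mult_mono) auto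
      thus "norm (\<bar>w z\<bar> / (1 + norm z powr ?p)) \<le> norm (B * (indicator (cball 0 1) z + mn z * nu s z))" using q by simp
    qed
  qed
  thus ?thesis using w by (simp add: Ls_space_def)
qed

lemma second_difference_bound:
  fixes \<phi> :: "'b::euclidean_space \<Rightarrow> real" and D :: "'b \<Rightarrow> 'b \<Rightarrow>\<^sub>L real" and D2 :: "'b \<Rightarrow> 'b \<Rightarrow>\<^sub>L 'b \<Rightarrow>\<^sub>L real"
  assumes S: "convex S" and D: "\<And>p. p \<in> S \<Longrightarrow> (\<phi> has_derivative blinfun_apply (D p)) (at p within S)"
    and D2: "\<And>p. p \<in> S \<Longrightarrow> (D has_derivative blinfun_apply (D2 p)) (at p within S)"
    and L: "\<And>p. p \<in> S \<Longrightarrow> norm (D2 p) \<le> L" and p: "p + z \<in> S" "p - z \<in> S"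
  shows "\<bar>2 * \<phi> p - \<phi> (p + z) - \<phi> (p - z)\<bar> \<le> 2 * L * (norm z)\<^sup>2"
proof -
  have seg: "p + u *\<^sub>R z \<in> S" if "-1 \<le> u" "u \<le> 1" for u
  proof -
    have *: "a *\<^sub>R (p + z) + b *\<^sub>R (p - z) = (a + b) *\<^sub>R p + (a - b) *\<^sub>R z" for a b by (simp add: algebra_simps)
    have "(1 + u) / 2 + (1 - u) / 2 = 1" "(1 + u) / 2 - (1 - u) / 2 = u" by (auto simp: field_simps)
    hence "p + u *\<^sub>R z = ((1 + u) / 2) *\<^sub>R (p + z) + ((1 - u) / 2) *\<^sub>R (p - z)" unfolding * by simp
    also have "\<dots> \<in> S" using S p that by (intro convexD) (auto simp: field_simps)
    finally show ?thesis .
  qed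
  have lip: "norm (D a - D b) \<le> L * norm (a - b)" if "a \<in> S" "b \<in> S" for a b
  proof (rule differentiable_bound[OF S])
    show "onorm (blinfun_apply (D2 q)) \<le> L" if "q \<in> S" for q using L[OF that] by (simp add: norm_blinfun.rep_eq)
  qed (use D2 that in auto)
  have L0: "0 \<le> L" using order_trans[OF norm_ge_zero L[OF p(1)]] .
  define h where "h = (\<lambda>u. \<phi> (p + u *\<^sub>R z) + \<phi> (p + (- u) *\<^sub>R z))"
  define h' where "h' = (\<lambda>u v. blinfun_apply (D (p + u *\<^sub>R z)) (v *\<^sub>R z) + blinfun_apply (D (p + (- u) *\<^sub>R z)) ((- v) *\<^sub>R z))"
  have hd: "(h has_derivative h' u) (at u within {0..1})" if u: "u \<in> {0..1}" for u unfolding h_def h'_def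
  proof (intro has_derivative_add)
    have a: "((\<lambda>u. p + u *\<^sub>R z) has_derivative (\<lambda>v. v *\<^sub>R z)) (at u within {0..1})"
      "((\<lambda>u. p + (- u) *\<^sub>R z) has_derivative (\<lambda>v. (- v) *\<^sub>R z)) (at u within {0..1})"
      by (auto intro!: derivative_eq_intros)
    have sub: "(\<lambda>u. p + u *\<^sub>R z) ` {0..1} \<subseteq> S" "(\<lambda>u. p + (- u) *\<^sub>R z) ` {0..1} \<subseteq> S"
      using seg seg[of "- _"] by (auto simp del: scaleR_minus_left)
    show "((\<lambda>u. \<phi> (p + u *\<^sub>R z)) has_derivative (\<lambda>v. blinfun_apply (D (p + u *\<^sub>R z)) (v *\<^sub>R z))) (at u within {0..1})"
      by (rule has_derivative_in_compose2[OF _ sub(1) u a(1)]) (use D in auto)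
    show "((\<lambda>u. \<phi> (p + (- u) *\<^sub>R z)) has_derivative (\<lambda>v. blinfun_apply (D (p + (- u) *\<^sub>R z)) ((- v) *\<^sub>R z))) (at u within {0..1})"
      by (rule has_derivative_in_compose2[OF _ sub(2) u a(2)]) (use D in auto)
  qed
  obtain u where u: "u \<in> {0<..<1}" "h 1 - h 0 = h' u (1 - 0)" using mvt_simple[of 0 1 h h'] hd by auto
  have "h' u 1 = blinfun_apply (D (p + u *\<^sub>R z) - D (p + (- u) *\<^sub>R z)) z" by (simp add: h'_def blinfun.diff_left blinfun.minus_right)
  also have "\<bar>\<dots>\<bar> \<le> norm (D (p + u *\<^sub>R z) - D (p + (- u) *\<^sub>R z)) * norm z"
    using norm_blinfun[of "D (p + u *\<^sub>R z) - D (p + (- u) *\<^sub>R z)" z] by simp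
  also have "\<dots> \<le> L * norm ((p + u *\<^sub>R z) - (p + (- u) *\<^sub>R z)) * norm z" using u(1) by (intro mult_right_mono lip seg) auto
  also have "(p + u *\<^sub>R z) - (p + (- u) *\<^sub>R z) = (2 * u) *\<^sub>R z"
  proof -
    have "(p + u *\<^sub>R z) - (p + (- u) *\<^sub>R z) = u *\<^sub>R z + u *\<^sub>R z" by simp
    also have "\<dots> = (u + u) *\<^sub>R z" by (simp only: scaleR_add_left)
    also have "u + u = 2 * u" by simp
    finally show ?thesis .
  qed
  also have "L * norm ((2 * u) *\<^sub>R z) * norm z \<le> L * (2 * norm z) * norm z"
  proof (intro mult_right_mono mult_left_mono)
    have "u * norm z \<le> 1 * norm z" using u(1) by (intro mult_right_mono) auto
    thus "norm ((2 * u) *\<^sub>R z) \<le> 2 * norm z" using u(1) by simp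
  qed (use L0 in auto)
  finally have "\<bar>h' u 1\<bar> \<le> 2 * L * (norm z)\<^sup>2" by (simp add: power2_eq_square mult_ac)
  moreover have "h 1 - h 0 = \<phi> (p + z) + \<phi> (p - z) - 2 * \<phi> p" by (simp add: h_def)
  ultimately show ?thesis using u(2) by simp
qed

section \<open>Comparison with classical supersolutions\<close>

lemma C2_on_add:
  assumes "C2_on S f" "C2_on S g" shows "C2_on S (\<lambda>z. f z + g z)"
proof -
  obtain D D2 where f: "\<And>z. z \<in> S \<Longrightarrow> (f has_derivative blinfun_apply (D z)) (at z within S)"
    "\<And>z. z \<in> S \<Longrightarrow> (D has_derivative blinfun_apply (D2 z)) (at z within S)" "continuous_on S D2"
    using assms(1) unfolding C2_on_def by blast
  obtain E E2 where g: "\<And>z. z \<in> S \<Longrightarrow> (g has_derivative blinfun_apply (E z)) (at z within S)"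
    "\<And>z. z \<in> S \<Longrightarrow> (E has_derivative blinfun_apply (E2 z)) (at z within S)" "continuous_on S E2"
    using assms(2) unfolding C2_on_def by blast
  show ?thesis unfolding C2_on_def
  proof (intro exI conjI ballI)
    fix z assume z: "z \<in> S"
    show "((\<lambda>z. f z + g z) has_derivative blinfun_apply ((\<lambda>z. D z + E z) z)) (at z within S)"
      using has_derivative_add[OF f(1)[OF z] g(1)[OF z]] by (simp add: plus_blinfun.rep_eq)
    show "((\<lambda>z. D z + E z) has_derivative blinfun_apply ((\<lambda>z. D2 z + E2 z) z)) (at z within S)"
      using has_derivative_add[OF f(2)[OF z] g(2)[OF z]] by (simp add: plus_blinfun.rep_eq)
  qed (intro continuous_intros f g)
qed

lemma C2_on_mult:
  assumes "C2_on S f" "C2_on S g" shows "C2_on S (\<lambda>z. f z * g z)"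
proof -
  obtain D D2 where f: "\<And>z. z \<in> S \<Longrightarrow> (f has_derivative blinfun_apply (D z)) (at z within S)"
    "\<And>z. z \<in> S \<Longrightarrow> (D has_derivative blinfun_apply (D2 z)) (at z within S)" "continuous_on S D2"
    using assms(1) unfolding C2_on_def by blast
  obtain E E2 where g: "\<And>z. z \<in> S \<Longrightarrow> (g has_derivative blinfun_apply (E z)) (at z within S)"
    "\<And>z. z \<in> S \<Longrightarrow> (E has_derivative blinfun_apply (E2 z)) (at z within S)" "continuous_on S E2"
    using assms(2) unfolding C2_on_def by blast
  have c: "continuous_on S f" "continuous_on S D" "continuous_on S g" "continuous_on S E"
    using f g by (meson has_derivative_continuous continuous_on_eq_continuous_within)+
  let ?D = "\<lambda>z. f z *\<^sub>R E z + g z *\<^sub>R D z"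
  let ?D2 = "\<lambda>z. (f z *\<^sub>R E2 z + (blinfun_scaleR_left (E z) o\<^sub>L D z)) + (g z *\<^sub>R D2 z + (blinfun_scaleR_left (D z) o\<^sub>L E z))"
  show ?thesis unfolding C2_on_def
  proof (intro exI conjI ballI)
    fix z assume z: "z \<in> S"
    have "((\<lambda>z. f z * g z) has_derivative (\<lambda>h. f z * E z h + D z h * g z)) (at z within S)"
      by (rule has_derivative_mult[OF f(1)[OF z] g(1)[OF z]])
    moreover have "(\<lambda>h. f z * E z h + D z h * g z) = blinfun_apply (?D z)"
      by (rule ext) (simp add: plus_blinfun.rep_eq scaleR_blinfun.rep_eq mult.commute)
    ultimately show "((\<lambda>z. f z * g z) has_derivative blinfun_apply (?D z)) (at z within S)" by simp
    have "(?D has_derivative (\<lambda>h. (f z *\<^sub>R E2 z h + D z h *\<^sub>R E z) + (g z *\<^sub>R D2 z h + E z h *\<^sub>R D z))) (at z within S)"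
      by (intro has_derivative_add has_derivative_scaleR f g z)
    moreover have "(\<lambda>h. (f z *\<^sub>R E2 z h + D z h *\<^sub>R E z) + (g z *\<^sub>R D2 z h + E z h *\<^sub>R D z)) = blinfun_apply (?D2 z)"
      by (rule ext) (simp add: plus_blinfun.rep_eq scaleR_blinfun.rep_eq)
    ultimately show "(?D has_derivative blinfun_apply (?D2 z)) (at z within S)" by simp
  qed (intro continuous_intros f g c bounded_linear.continuous_on[OF bounded_linear_blinfun_scaleR_left])
qed

lemma C2_on_const: "C2_on S (\<lambda>_. k)"
  unfolding C2_on_def
proof (intro exI conjI ballI)
  fix z
  show "((\<lambda>_. k) has_derivative blinfun_apply ((\<lambda>_. 0) z)) (at z within S)" by (simp add: zero_blinfun.rep_eq)
  show "((\<lambda>_. 0) has_derivative blinfun_apply ((\<lambda>_. 0) z)) (at z within S)" by (simp add: zero_blinfun.rep_eq)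
qed (rule continuous_on_const)

lemma C2_on_subset:
  assumes "C2_on UNIV f" shows "C2_on S f" using assms unfolding C2_on_def
  by (meson UNIV_I has_derivative_at_withinI continuous_on_subset subset_UNIV)

lemma C2_on_linear:
  fixes f :: "'b::euclidean_space \<Rightarrow> real" and L :: "'c::euclidean_space \<Rightarrow>\<^sub>L 'b"
  assumes "C2_on UNIV f" shows "C2_on UNIV (\<lambda>z. f (L z))"
proof -
  obtain D D2 where f: "\<And>z. (f has_derivative blinfun_apply (D z)) (at z)"
    "\<And>z. (D has_derivative blinfun_apply (D2 z)) (at z)" "continuous_on UNIV D2" using assms unfolding C2_on_def by auto
  have bl: "bounded_linear (\<lambda>X :: 'b \<Rightarrow>\<^sub>L real. X o\<^sub>L L)"
    by (rule bounded_bilinear.bounded_linear_left[OF bounded_bilinear_blinfun_compose])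
  define Q where "Q = Blinfun (\<lambda>X :: 'b \<Rightarrow>\<^sub>L real. X o\<^sub>L L)"
  have Q: "blinfun_apply Q = (\<lambda>X. X o\<^sub>L L)" unfolding Q_def by (rule bounded_linear_Blinfun_apply[OF bl])
  have Ld: "(blinfun_apply L has_derivative blinfun_apply L) (at z)" for z
    by (rule bounded_linear_imp_has_derivative) (rule blinfun.bounded_linear_right)
  have Lc: "continuous_on UNIV (blinfun_apply L)" by (intro continuous_intros)
  show ?thesis unfolding C2_on_def
  proof (intro exI conjI ballI)
    fix z :: 'c
    show "((\<lambda>z. f (L z)) has_derivative blinfun_apply ((\<lambda>z. D (L z) o\<^sub>L L) z)) (at z within UNIV)"
      using has_derivative_compose[OF Ld f(1)] by (simp add: blinfun_apply_blinfun_compose[abs_def] comp_def)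
    have "((\<lambda>z. D (L z)) has_derivative (\<lambda>h. D2 (L z) (L h))) (at z)" using has_derivative_compose[OF Ld f(2)] by simp
    from bounded_linear.has_derivative[OF bl this]
    have "((\<lambda>z. D (L z) o\<^sub>L L) has_derivative (\<lambda>h. D2 (L z) (L h) o\<^sub>L L)) (at z)" .
    moreover have "(\<lambda>h. D2 (L z) (L h) o\<^sub>L L) = blinfun_apply (Q o\<^sub>L (D2 (L z) o\<^sub>L L))" by (rule ext) (simp add: Q)
    ultimately show "((\<lambda>z. D (L z) o\<^sub>L L) has_derivative blinfun_apply ((\<lambda>z. Q o\<^sub>L (D2 (L z) o\<^sub>L L)) z)) (at z within UNIV)" by simp
  next
    show "continuous_on UNIV (\<lambda>z. Q o\<^sub>L (D2 (L z) o\<^sub>L L))" by (intro continuous_intros continuous_on_compose2[OF f(3) Lc]) auto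
  qed
qed

lemma C2_on_real:
  fixes f f' f'' :: "real \<Rightarrow> real"
  assumes "\<And>t. (f has_real_derivative f' t) (at t)" "\<And>t. (f' has_real_derivative f'' t) (at t)" "continuous_on UNIV f''"
  shows "C2_on UNIV f" unfolding C2_on_def
proof (intro exI conjI ballI)
  fix t :: real
  have bl: "bounded_linear (blinfun_scaleR_left :: real \<Rightarrow> _)" by (rule bounded_linear_blinfun_scaleR_left)
  have e: "blinfun_apply (blinfun_scaleR_left k) = (*) k" for k :: real by (rule ext) (simp add: mult.commute)
  show "(f has_derivative blinfun_apply ((\<lambda>t. blinfun_scaleR_left (f' t)) t)) (at t within UNIV)"
    using assms(1)[of t] unfolding has_field_derivative_def e by simp
  have "((\<lambda>t. blinfun_scaleR_left (f' t) :: real \<Rightarrow>\<^sub>L real) has_derivative (\<lambda>h. blinfun_scaleR_left (f'' t * h))) (at t)"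
    using bounded_linear.has_derivative[OF bl assms(2)[of t, unfolded has_field_derivative_def]] .
  moreover have "(\<lambda>h. blinfun_scaleR_left (f'' t * h) :: real \<Rightarrow>\<^sub>L real) = blinfun_apply (blinfun_scaleR_left (blinfun_scaleR_left (f'' t)))"
    by (rule ext, rule blinfun_eqI) (simp add: scaleR_blinfun.rep_eq)
  ultimately show "((\<lambda>t. blinfun_scaleR_left (f' t) :: real \<Rightarrow>\<^sub>L real) has_derivative blinfun_apply ((\<lambda>t. blinfun_scaleR_left (blinfun_scaleR_left (f'' t))) t)) (at t within UNIV)"
    by simp
next
  show "continuous_on UNIV (\<lambda>t. blinfun_scaleR_left (blinfun_scaleR_left (f'' t)) :: real \<Rightarrow>\<^sub>L (real \<Rightarrow>\<^sub>L real))"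
    by (intro bounded_linear.continuous_on[OF bounded_linear_blinfun_scaleR_left] assms)
qed

lemma C2_on_fst: "C2_on UNIV f \<Longrightarrow> C2_on S (\<lambda>p::'a::euclidean_space \<times> real. f (fst p))"
  using C2_on_subset[OF C2_on_linear[of f fst_blinfun]] by simp

lemma C2_on_snd: "C2_on UNIV f \<Longrightarrow> C2_on S (\<lambda>p::'a::euclidean_space \<times> real. f (snd p))"
  using C2_on_subset[OF C2_on_linear[of f snd_blinfun]] by simp

text \<open>Without a maximum each point \<open>x\<close> has a neighbourhood where \<open>f\<close>
  stays below some larger value \<open>f (q x)\<close>. In a finite subcover the largest of these
  values is contradicted at its own point \<open>q x\<close>.\<close>

lemma usc_attains_sup:
  fixes f :: "'b::t2_space \<Rightarrow> real"
  assumes f: "usc_on S f" and K: "compact K" "K \<subseteq> S" "K \<noteq> {}"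
  shows "\<exists>x\<in>K. \<forall>y\<in>K. f y \<le> f x"
proof (rule ccontr)
  assume "\<not> ?thesis"
  then obtain q where q: "\<And>x. x \<in> K \<Longrightarrow> q x \<in> K \<and> f x < f (q x)" by (metis not_le)
  have "\<exists>V. open V \<and> x \<in> V \<and> (\<forall>w\<in>V \<inter> S. f w < f (q x))" if x: "x \<in> K" for x
  proof -
    have "\<forall>\<^sub>F w in at x within S. f w < f (q x)" using f q[OF x] x K(2) unfolding usc_on_def by blast
    then obtain V where "open V" "x \<in> V" "\<And>w. w \<in> V \<Longrightarrow> w \<noteq> x \<Longrightarrow> w \<in> S \<Longrightarrow> f w < f (q x)"
      unfolding eventually_at_topological by blast
    thus ?thesis using q[OF x] by (intro exI[of _ V]) (metis IntE)
  qed
  then obtain V where V: "\<And>x. x \<in> K \<Longrightarrow> open (V x) \<and> x \<in> V x \<and> (\<forall>w\<in>V x \<inter> S. f w < f (q x))" by metis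
  obtain I where I: "I \<subseteq> K" "finite I" "K \<subseteq> (\<Union>x\<in>I. V x)"
    using compactE_image[OF K(1), of K V] V by (metis (no_types, lifting) UN_iff subsetI)
  have "I \<noteq> {}" using I(3) K(3) by auto
  hence "Max ((\<lambda>x. f (q x)) ` I) \<in> (\<lambda>x. f (q x)) ` I" using I(2) by (intro Max_in) auto
  then obtain x where "x \<in> I" "Max ((\<lambda>x. f (q x)) ` I) = f (q x)" by blast
  moreover have "f (q y) \<le> Max ((\<lambda>x. f (q x)) ` I)" if "y \<in> I" for y using I(2) that by (intro Max_ge) auto
  ultimately have x: "x \<in> I" "\<And>y. y \<in> I \<Longrightarrow> f (q y) \<le> f (q x)" by auto
  have "q x \<in> K" using q x(1) I(1) by blast
  then obtain y where y: "y \<in> I" "q x \<in> V y" using I(3) by blast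
  hence "f (q x) < f (q y)" using V[of y] I(1) K(2) \<open>q x \<in> K\<close> by blast
  thus False using x(2)[OF y(1)] by simp
qed

text \<open>The bound on second differences makes \<open>flap\<close> an absolutely convergent integral.\<close>

definition reg :: "real \<Rightarrow> ('a::euclidean_space \<times> real \<Rightarrow> real) \<Rightarrow> ('a \<Rightarrow> real \<Rightarrow> real) \<Rightarrow> bool" where
  "reg T W Wt \<longleftrightarrow> continuous_on UNIV W \<and> (\<exists>B. \<forall>x. \<forall>t\<in>{0..T}. \<bar>W (x, t)\<bar> \<le> B) \<and>
     (\<forall>x. \<forall>t\<in>{0..T}. ((\<lambda>u. W (x, u)) has_real_derivative Wt x t) (at t)) \<and>
     (\<exists>K. \<forall>x z. \<forall>t\<in>{0..T}. \<bar>sd (\<lambda>y. W (y, t)) x z\<bar> \<le> K * mn z) \<and> C2_on (ST T) W"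

lemma mn_le_sq: "mn z \<le> (norm z)\<^sup>2" by (simp add: mn_def)

lemma slice_cont: "continuous_on UNIV W \<Longrightarrow> continuous_on UNIV (\<lambda>y. W (y, t))"
  by (rule continuous_on_compose2[of UNIV W]) (auto intro!: continuous_intros)

lemma reg_flap:
  fixes W :: "'a::euclidean_space \<times> real \<Rightarrow> real"
  assumes s: "0 < s" "s < 1" and W: "reg T W Wt" and t: "t \<in> {0..T}"
  shows "integrable lebesgue (\<lambda>z. sd (\<lambda>y. W (y, t)) x z * nu s z)" "(\<lambda>y. W (y, t)) \<in> Ls_space s"
proof -
  obtain B K where B: "\<And>x t. t \<in> {0..T} \<Longrightarrow> \<bar>W (x, t)\<bar> \<le> B" and K: "\<And>x z t. t \<in> {0..T} \<Longrightarrow> \<bar>sd (\<lambda>y. W (y, t)) x z\<bar> \<le> K * mn z"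
    and c: "continuous_on UNIV W" using W unfolding reg_def by blast
  show L: "(\<lambda>y. W (y, t)) \<in> Ls_space s" by (rule bounded_Ls[OF s borel_lebesgue[OF cont_bmeas[OF slice_cont[OF c]]] B[OF t]])
  have K0: "0 \<le> K"
  proof -
    obtain b where b: "b \<in> (Basis::'a set)" using nonempty_Basis by blast
    hence "mn b = 1" by (simp add: mn_def)
    thus ?thesis using order_trans[OF abs_ge_zero K[OF t, of x b]] by simp
  qed
  show "integrable lebesgue (\<lambda>z. sd (\<lambda>y. W (y, t)) x z * nu s z)" by (rule pv_limit(1)[OF s L zero_less_one, of _ K])
      (use K[OF t] mult_left_mono[OF mn_le_sq K0] order_trans in blast)
qed

lemma time_deriv_eq:
  assumes d: "((\<lambda>u. \<phi> (x, u)) has_vector_derivative d) (at t within {0<..T})" and t: "t \<in> {0<..T}"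
    and U: "openin (top_of_set (ST T)) U" "(x, t) \<in> U"
  shows "time_deriv T (glue U \<phi> u) x t = d"
proof -
  obtain V where V: "open V" "U = ST T \<inter> V" using U(1) openin_open by blast
  have "open ((\<lambda>u. (x, u)) -` V)" by (intro open_vimage V continuous_intros)
  moreover have "t \<in> (\<lambda>u. (x, u)) -` V" using U V by auto
  ultimately obtain e where e: "0 < e" "ball t e \<subseteq> (\<lambda>u. (x, u)) -` V" using open_contains_ball by blast
  have "((\<lambda>u. glue U \<phi> u' (x, u)) has_vector_derivative d) (at t within {0<..T})" for u'
  proof (rule has_vector_derivative_transform_within[OF d e(1) t])
    fix y assume "y \<in> {0<..T}" "dist y t < e"
    hence "(x, y) \<in> U" using e(2) V(2) by (auto simp: ST_def dist_commute)
    thus "\<phi> (x, y) = glue U \<phi> u' (x, y)" by (simp add: glue_def)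
  qed
  \<comment> \<open>Uniqueness of the derivative comes from times before \<open>t\<close>, which
    exist also for \<open>t = T\<close>.\<close>
  moreover have "at t within {0<..T} \<noteq> bot"
  proof -
    have "t islimpt {0<..<t}" using t by (intro islimpt_greaterThanLessThan2) auto
    hence "t islimpt {0<..T}" by (rule islimpt_subset) (use t in auto)
    thus ?thesis by (simp add: trivial_limit_within)
  qed
  ultimately show ?thesis unfolding time_deriv_def by (intro vector_derivative_within) auto
qed

lemma glue_Ls:
  fixes u \<phi> :: "'a::euclidean_space \<times> real \<Rightarrow> real"
  assumes s: "0 < s" "s < 1" and U: "openin (top_of_set (ST T)) U" "bounded U" and t: "t \<in> {0<..T}"
    and \<phi>: "continuous_on UNIV (\<lambda>y. \<phi> (y, t))" and u: "(\<lambda>y. u (y, t)) \<in> Ls_space s"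
  shows "(\<lambda>y. glue U \<phi> u (y, t)) \<in> Ls_space s"
proof -
  obtain V where V: "open V" "U = ST T \<inter> V" using U(1) openin_open by blast
  \<comment> \<open>The slice of \<open>U\<close> at time \<open>t\<close>: open and bounded in
    space, so that \<open>\<phi>\<close> is bounded on it.\<close>
  define G where "G = (\<lambda>y. (y, t)) -` V"
  have G: "open G" unfolding G_def by (intro open_vimage V continuous_intros)
  have eq: "(\<lambda>y. glue U \<phi> u (y, t)) = (\<lambda>y. if y \<in> G then \<phi> (y, t) else u (y, t))"
    using t by (auto simp: glue_def G_def V ST_def)
  have "G = fst ` (U \<inter> (UNIV \<times> {t}))" using t by (force simp: G_def V ST_def)
  moreover have "bounded (fst ` (U \<inter> (UNIV \<times> {t})))" by (intro bounded_fst bounded_Int) (simp add: U)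
  ultimately have "compact (closure G)" by (simp add: compact_eq_bounded_closed bounded_closure)
  hence "bounded ((\<lambda>y. \<phi> (y, t)) ` closure G)"
    by (intro compact_imp_bounded compact_continuous_image continuous_on_subset[OF \<phi>]) auto
  then obtain B where B0: "\<And>y. y \<in> closure G \<Longrightarrow> \<bar>\<phi> (y, t)\<bar> \<le> B" by (auto simp: bounded_iff)
  have B: "\<bar>\<phi> (y, t)\<bar> \<le> \<bar>B\<bar>" if "y \<in> G" for y using B0[of y] closure_subset[of G] that by fastforce
  have BL: "(\<lambda>y::'a. \<bar>B\<bar>) \<in> Ls_space s" by (rule bounded_Ls[OF s]) auto
  have bm: "G \<in> sets lebesgue" using G by simp
  let ?\<psi> = "\<lambda>y. if y \<in> G then \<phi> (y, t) else u (y, t)"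
  have m1: "?\<psi> \<in> borel_measurable lebesgue" using u borel_lebesgue[OF cont_bmeas[OF \<phi>]] bm
    by (intro measurable_If_set) (auto simp: Ls_space_def)
  let ?q = "\<lambda>w x. \<bar>w x\<bar> / (1 + norm x powr (real DIM('a) + 2 * s))"
  have qm: "?q ?\<psi> \<in> borel_measurable lebesgue" by (intro borel_measurable_divide borel_measurable_abs m1 borel_lebesgue) measurable
  have "integrable lebesgue (?q ?\<psi>)"
  proof (rule lint_bound[where f="\<lambda>x. ?q (\<lambda>y. \<bar>B\<bar>) x + ?q (\<lambda>y. u (y, t)) x"])
    show "integrable lebesgue (\<lambda>x. ?q (\<lambda>y. \<bar>B\<bar>) x + ?q (\<lambda>y. u (y, t)) x)"
      using BL u by (intro lint_add) (auto simp: Ls_space_def)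
    show "AE x in lebesgue. norm (?q ?\<psi> x) \<le> norm (?q (\<lambda>y. \<bar>B\<bar>) x + ?q (\<lambda>y. u (y, t)) x)"
    proof (intro AE_I2)
      fix x :: 'a
      define d where "d = 1 + norm x powr (real DIM('a) + 2 * s)"
      have d: "0 < d" by (simp add: add_pos_nonneg d_def)
      have "\<bar>?\<psi> x\<bar> \<le> \<bar>B\<bar> + \<bar>u (x, t)\<bar>" using B[of x] by (auto intro: add_increasing2)
      hence "\<bar>?\<psi> x\<bar> / d \<le> \<bar>B\<bar> / d + \<bar>u (x, t)\<bar> / d"
        using d by (simp add: add_divide_distrib[symmetric] divide_right_mono)
      moreover have "0 \<le> \<bar>?\<psi> x\<bar> / d" using d by simp
      ultimately show "norm (?q ?\<psi> x) \<le> norm (?q (\<lambda>y. \<bar>B\<bar>) x + ?q (\<lambda>y. u (y, t)) x)"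
        unfolding d_def[symmetric] real_norm_def by linarith
    qed
  qed (rule qm)
  thus ?thesis using m1 unfolding eq by (simp add: Ls_space_def)
qed

text \<open>Nonnegative for classical supersolutions and nonpositive for subsolutions. The operator
  appears as \<open>flap\<close>, to be matched with the principal value by
  \<open>pv_limit\<close>.\<close>

abbreviation resid :: "real \<Rightarrow> ('a::euclidean_space \<Rightarrow> real) \<Rightarrow> ('a \<Rightarrow> real) \<Rightarrow> ('a \<Rightarrow> real) \<Rightarrow> ('a \<times> real \<Rightarrow> real) \<Rightarrow> ('a \<Rightarrow> real \<Rightarrow> real) \<Rightarrow> 'a \<Rightarrow> real \<Rightarrow> real" where
  "resid s a c f W Wt x t \<equiv> Wt x t + a x * (frac_const DIM('a) s * flap s (\<lambda>y. W (y, t)) x) - c x * W (x, t) - f x"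

text \<open>At a positive maximum of \<open>(u - W) * exp (- be * t)\<close> the function
  \<open>W + S * exp (be * t)\<close> touches \<open>u\<close> from above and is smooth, so it is
  itself the test function; \<open>c < be\<close> then contradicts the inequality for
  \<open>W\<close>.\<close>

lemma comparison:
  fixes u W :: "'a::euclidean_space \<times> real \<Rightarrow> real"
  assumes s: "0 < s" "s < 1" and u: "subsolution_eq s a c f T u" and usc: "usc_on (ST_closed T) u"
    and W: "reg T W Wt" and be: "\<And>x. c x < be" and a: "\<And>x. 0 < a x"
    and sup: "\<And>x t. t \<in> {0<..T} \<Longrightarrow> 0 \<le> resid s a c f W Wt x t"
    and init: "\<And>x. u (x, 0) \<le> W (x, 0)" and inf: "\<And>x t. t \<in> {0..T} \<Longrightarrow> R \<le> norm x \<Longrightarrow> u (x, t) \<le> W (x, t)"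
    and xt: "t \<in> {0..T}"
  shows "u (x, t) \<le> W (x, t)"
proof (rule ccontr)
  assume "\<not> u (x, t) \<le> W (x, t)"
  hence gt: "W (x, t) < u (x, t)" by simp
  obtain B K where B: "\<And>x t. t \<in> {0..T} \<Longrightarrow> \<bar>W (x, t)\<bar> \<le> B" and K: "\<And>x z t. t \<in> {0..T} \<Longrightarrow> \<bar>sd (\<lambda>y. W (y, t)) x z\<bar> \<le> K * mn z"
    and Wc: "continuous_on UNIV W" and C2W: "C2_on (ST T) W"
    and Wd: "\<And>x t. t \<in> {0..T} \<Longrightarrow> ((\<lambda>u. W (x, u)) has_real_derivative Wt x t) (at t)" using W unfolding reg_def by blast
  have K0: "0 \<le> K"
  proof -
    obtain b where b: "b \<in> (Basis::'a set)" using nonempty_Basis by blast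
    hence "mn b = 1" by (simp add: mn_def)
    thus ?thesis using order_trans[OF abs_ge_zero K[OF xt, of x b]] by simp
  qed
  define m where "m = (\<lambda>p. (u p - W p) * exp (- be * snd p))"
  have musc: "usc_on (ST_closed T) m" unfolding usc_on_def
  proof (intro ballI allI impI)
    fix z b assume z: "z \<in> ST_closed T" and b: "m z < b"
    have "u z < b * exp (be * snd z) + W z" using b unfolding m_def by (simp add: exp_minus field_simps)
    then obtain e where e: "u z < e" "e < b * exp (be * snd z) + W z" using dense by blast
    have 1: "\<forall>\<^sub>F w in at z within ST_closed T. u w < e" using usc z e(1) unfolding usc_on_def by blast
    have "continuous_on UNIV (\<lambda>w. b * exp (be * snd w) + W w)" by (intro continuous_intros Wc)
    hence "isCont (\<lambda>w. b * exp (be * snd w) + W w) z" using continuous_on_eq_continuous_at[OF open_UNIV] by blast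
    hence "((\<lambda>w. b * exp (be * snd w) + W w) \<longlongrightarrow> b * exp (be * snd z) + W z) (at z within ST_closed T)"
      using continuous_at_imp_continuous_at_within continuous_within by blast
    hence 2: "\<forall>\<^sub>F w in at z within ST_closed T. e < b * exp (be * snd w) + W w" using e(2) by (rule order_tendstoD(1))
    show "\<forall>\<^sub>F w in at z within ST_closed T. m w < b" using 1 2
    proof eventually_elim
      case (elim w)
      hence "u w - W w < b * exp (be * snd w)" by linarith
      hence "(u w - W w) * exp (- be * snd w) < b * exp (be * snd w) * exp (- be * snd w)" by (intro mult_strict_right_mono) auto
      thus ?case unfolding m_def by (simp add: mult.assoc flip: exp_add)
    qed
  qed
  have xR: "norm x < R" using inf[OF xt, of x] gt by (meson not_le order.strict_trans1 order.irrefl)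
  let ?K = "cball (0::'a) R \<times> {0..T}"
  have "compact ?K" by (intro compact_Times) auto
  moreover have "?K \<subseteq> ST_closed T" by (auto simp: ST_closed_def)
  moreover have "(x, t) \<in> ?K" using xR xt by simp
  ultimately have "\<exists>p\<in>?K. \<forall>q\<in>?K. m q \<le> m p" by (intro usc_attains_sup[OF musc]) blast+
  then obtain p where p: "p \<in> ?K" "\<And>q. q \<in> ?K \<Longrightarrow> m q \<le> m p" by blast
  obtain x0 t0 where p0: "p = (x0, t0)" by (cases p)
  have mx: "0 < m (x, t)" using gt by (simp add: m_def)
  define S where "S = m (x0, t0)"
  have S: "0 < S" using p(2)[of "(x, t)"] mx xR xt by (simp add: S_def p0)
  have t0: "t0 \<in> {0..T}" using p(1) by (simp add: p0)
  have t0p: "0 < t0"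
  proof (rule ccontr)
    assume "\<not> 0 < t0"
    hence "t0 = 0" using t0 by simp
    thus False using S init[of x0] by (simp add: S_def m_def zero_less_mult_iff)
  qed
  hence t0': "t0 \<in> {0<..T}" using t0 by simp
  have glob: "u (y, r) \<le> W (y, r) + S * exp (be * r)" if r: "r \<in> {0..T}" for y r
  proof -
    have "m (y, r) \<le> S"
    proof (cases "norm y \<le> R")
      case True thus ?thesis using p(2)[of "(y, r)"] r by (simp add: p0 S_def)
    next
      case False
      hence "m (y, r) \<le> 0" using inf[OF r, of y] by (simp add: m_def mult_le_0_iff)
      thus ?thesis using S by simp
    qed
    hence "m (y, r) * exp (be * r) \<le> S * exp (be * r)" by (intro mult_right_mono) auto
    thus ?thesis by (simp add: m_def mult.assoc flip: exp_add)
  qed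
  \<comment> \<open>Touches \<open>u\<close> at the maximum and lies above it in all of space, as
    the nonlocal term requires, and not only near the point.\<close>
  define \<phi> where "\<phi> = (\<lambda>p. W p + S * exp (be * snd p))"
  have u0: "u (x0, t0) = \<phi> (x0, t0)" unfolding \<phi>_def S_def m_def by (simp add: mult.assoc flip: exp_add)
  have C2e: "C2_on (ST T) (\<lambda>p::'a \<times> real. exp (be * snd p))"
  proof (rule C2_on_snd)
    show "C2_on UNIV (\<lambda>t::real. exp (be * t))"
      by (rule C2_on_real[where f'="\<lambda>t. be * exp (be * t)" and f''="\<lambda>t. be * (be * exp (be * t))"])
        (auto intro!: derivative_eq_intros continuous_intros)
  qed
  have C2\<phi>: "C2_on (ST T) \<phi>" unfolding \<phi>_def by (intro C2_on_add C2W C2_on_mult C2_on_const C2e)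
  \<comment> \<open>A ball of radius 1 over all times keeps the glued function equal to
    \<open>\<phi>\<close> for spatial increments of norm at most 1/2.\<close>
  define U where "U = ST T \<inter> (ball x0 1 \<times> UNIV)"
  have U: "openin (top_of_set (ST T)) U" "bounded U" "(x0, t0) \<in> U"
  proof -
    show "openin (top_of_set (ST T)) U" unfolding U_def by (intro openin_open_Int open_Times) auto
    have "U \<subseteq> ball x0 1 \<times> {0..T}" by (auto simp: U_def ST_def)
    thus "bounded U" by (rule bounded_subset[rotated]) (intro bounded_Times; simp)
    show "(x0, t0) \<in> U" using t0' by (auto simp: U_def ST_def)
  qed
  have touch: "\<forall>z\<in>U. u (x0, t0) - \<phi> (x0, t0) \<ge> u z - \<phi> z"
  proof
    fix z assume "z \<in> U"
    hence "snd z \<in> {0..T}" by (auto simp: U_def ST_def)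
    from glob[OF this, of "fst z"] show "u (x0, t0) - \<phi> (x0, t0) \<ge> u z - \<phi> z" using u0 by (simp add: \<phi>_def)
  qed
  have main: "time_deriv T (glue U \<phi> u) x0 t0 \<le> - a x0 * frac_laplacian s (\<lambda>x. glue U \<phi> u (x, t0)) x0 + c x0 * u (x0, t0) + f x0"
    using u U C2\<phi> u0 touch unfolding subsolution_eq_def by blast
  have td: "time_deriv T (glue U \<phi> u) x0 t0 = Wt x0 t0 + S * (be * exp (be * t0))"
  proof (rule time_deriv_eq[OF _ t0' U(1,3)])
    have "((\<lambda>v. W (x0, v) + S * exp (be * v)) has_real_derivative Wt x0 t0 + S * (be * exp (be * t0))) (at t0)"
      by (auto intro!: derivative_eq_intros Wd[OF t0])
    thus "((\<lambda>v. \<phi> (x0, v)) has_vector_derivative Wt x0 t0 + S * (be * exp (be * t0))) (at t0 within {0<..T})"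
      unfolding \<phi>_def by (auto simp: has_real_derivative_iff_has_vector_derivative intro: has_vector_derivative_at_within)
  qed
  define \<psi> where "\<psi> = (\<lambda>y. glue U \<phi> u (y, t0))"
  have \<psi>1: "\<psi> y = \<phi> (y, t0)" if "dist x0 y < 1" for y using that t0' by (auto simp: \<psi>_def glue_def U_def ST_def)
  have \<psi>le: "\<psi> y \<le> \<phi> (y, t0)" for y using glob[OF t0, of y] by (auto simp: \<psi>_def glue_def \<phi>_def)
  have WL: "(\<lambda>y. W (y, t0)) \<in> Ls_space s" and Wi: "integrable lebesgue (\<lambda>z. sd (\<lambda>y. W (y, t0)) x0 z * nu s z)"
    using reg_flap[OF s W t0] by auto
  have uL: "(\<lambda>y. u (y, t0)) \<in> Ls_space s" using u t0' unfolding subsolution_eq_def by blast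
  have \<phi>c: "continuous_on UNIV (\<lambda>y. \<phi> (y, t0))" unfolding \<phi>_def by (auto intro!: continuous_intros slice_cont[OF Wc])
  have \<psi>L: "\<psi> \<in> Ls_space s" unfolding \<psi>_def by (rule glue_Ls[OF s U(1,2) t0' \<phi>c uL])
  have sdW: "sd (\<lambda>y. \<phi> (y, t0)) x0 z = sd (\<lambda>y. W (y, t0)) x0 z" for z by (simp add: sd_def \<phi>_def)
  have \<psi>0: "\<psi> x0 = \<phi> (x0, t0)" by (rule \<psi>1) simp
  have sd\<psi>: "\<bar>sd \<psi> x0 z\<bar> \<le> K * (norm z)\<^sup>2" if z: "norm z \<le> 1 / 2" for z
  proof -
    have "sd \<psi> x0 z = sd (\<lambda>y. \<phi> (y, t0)) x0 z" unfolding sd_def using z \<psi>0 by (auto simp: \<psi>1 dist_norm)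
    thus ?thesis using K[OF t0, of x0 z] mult_left_mono[OF mn_le_sq K0, of z] unfolding sdW by linarith
  qed
  have half: "(0::real) < 1 / 2" by simp
  note pv = pv_limit[OF s \<psi>L half sd\<psi>]
  \<comment> \<open>The glued function lies below \<open>\<phi>\<close> and agrees with it at
    \<open>x0\<close>, so its second differences there are larger.\<close>
  have "flap s (\<lambda>y. W (y, t0)) x0 \<le> flap s \<psi> x0" unfolding flap_def
  proof (intro mult_left_mono integral_mono Wi pv(1) mult_right_mono)
    show "sd (\<lambda>y. W (y, t0)) x0 z \<le> sd \<psi> x0 z" for z
      unfolding sdW[symmetric] unfolding sd_def using \<psi>le[of "x0 + z"] \<psi>le[of "x0 - z"] \<psi>0 by simp
  qed auto
  hence "a x0 * (frac_const DIM('a) s * flap s (\<lambda>y. W (y, t0)) x0) \<le> a x0 * (frac_const DIM('a) s * flap s \<psi> x0)"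
    using a[of x0] frac_const_pos[OF s, of "DIM('a)"] by (intro mult_left_mono) (auto intro: less_imp_le)
  moreover have "Wt x0 t0 + S * (be * exp (be * t0)) \<le> - a x0 * (frac_const DIM('a) s * flap s \<psi> x0) + c x0 * u (x0, t0) + f x0"
    using main td pv(2) unfolding \<psi>_def by simp
  moreover have "c x0 * u (x0, t0) = c x0 * W (x0, t0) + c x0 * (S * exp (be * t0))" unfolding u0 \<phi>_def by (simp add: distrib_left)
  ultimately have "S * (be * exp (be * t0)) \<le> c x0 * (S * exp (be * t0))" using sup[OF t0', of x0] by simp
  moreover have "c x0 * (S * exp (be * t0)) < be * (S * exp (be * t0))" using be[of x0] S by (intro mult_strict_right_mono) auto
  ultimately show False by (simp add: mult_ac)
qed

section \<open>Stability under uniform limits\<close>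

text \<open>Only earlier times are compared, since at \<open>t = T\<close> there are no others; a
  maximum from the left already fixes the sign that subsolutions need.\<close>

lemma left_max_deriv:
  fixes q :: "real \<Rightarrow> real"
  assumes d: "(q has_vector_derivative d) (at t within {0<..T})" and t: "t \<in> {0<..T}" and l: "l < t"
    and max: "\<And>r. l \<le> r \<Longrightarrow> r \<le> t \<Longrightarrow> q r \<le> q t"
  shows "0 \<le> d"
proof -
  let ?S = "{max l 0<..<t}"
  have "(q has_vector_derivative d) (at t within ?S)" using d by (rule has_vector_derivative_within_subset) (use t in auto)
  hence "((\<lambda>y. (q y - q t) / (y - t)) \<longlongrightarrow> d) (at t within ?S)"
    by (simp add: has_field_derivative_iff[symmetric] has_real_derivative_iff_has_vector_derivative)
  moreover have "at t within ?S \<noteq> bot" using l t by (auto simp: trivial_limit_within intro!: islimpt_greaterThanLessThan2)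
  moreover have "\<forall>\<^sub>F y in at t within ?S. 0 \<le> (q y - q t) / (y - t)"
    unfolding eventually_at_topological using max l by (intro exI[of _ UNIV]) (auto intro!: divide_nonpos_nonpos)
  ultimately show ?thesis by (intro tendsto_lowerbound)
qed

lemma slice_deriv:
  fixes \<phi> :: "'a::euclidean_space \<times> real \<Rightarrow> real"
  assumes "(\<phi> has_derivative D) (at (x, t) within ST T)"
  shows "((\<lambda>r. \<phi> (x, r)) has_vector_derivative D (0, 1)) (at t within {0<..T})"
proof -
  have p: "((\<lambda>r. (x, r)) has_derivative (\<lambda>h. (0, h))) (at t within {0<..T})"
    by (intro has_derivative_Pair has_derivative_const has_derivative_ident)
  have "(\<lambda>r. (x, r)) ` {0<..T} \<subseteq> ST T" by (auto simp: ST_def)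
  from has_derivative_in_compose[OF p has_derivative_subset[OF assms this]]
  have "((\<lambda>r. \<phi> (x, r)) has_derivative (\<lambda>h. D (0, h))) (at t within {0<..T})" .
  moreover have "(\<lambda>h. D (0, h)) = (\<lambda>h. h *\<^sub>R D (0, 1))"
  proof
    fix h :: real
    have "D (h *\<^sub>R (0, 1)) = h *\<^sub>R D (0, 1)" by (rule linear_scale[OF has_derivative_linear[OF assms]])
    also have "h *\<^sub>R (0, 1) = (0 :: 'a, h)" by (simp only: scaleR_Pair) simp
    finally show "D (0, h) = h *\<^sub>R D (0, 1)" .
  qed
  ultimately show ?thesis unfolding has_vector_derivative_def by (simp only:)
qed

text \<open>The second derivative is bounded on a compact convex slab around the point; the slab has
  spatial radius \<open>2 * \<rho>\<close> to leave room for increments of norm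
  \<open>\<rho>\<close>.\<close>

lemma C2_local:
  fixes \<phi> :: "'a::euclidean_space \<times> real \<Rightarrow> real"
  assumes \<phi>: "C2_on (ST T) \<phi>" and U: "openin (top_of_set (ST T)) U" "(x0, t0) \<in> U"
  obtains D \<rho> L where "0 < \<rho>" "\<rho> < t0" "0 \<le> L"
    "\<And>p. p \<in> ST T \<Longrightarrow> (\<phi> has_derivative blinfun_apply (D p)) (at p within ST T)" "continuous_on (ST T) D"
    "\<And>x t. dist x0 x \<le> 2 * \<rho> \<Longrightarrow> \<bar>t - t0\<bar> \<le> \<rho> \<Longrightarrow> t \<le> T \<Longrightarrow> (x, t) \<in> U"
    "\<And>x t z. dist x0 x \<le> \<rho> \<Longrightarrow> \<bar>t - t0\<bar> \<le> \<rho> \<Longrightarrow> t \<le> T \<Longrightarrow> norm z \<le> \<rho> \<Longrightarrow> \<bar>sd (\<lambda>y. \<phi> (y, t)) x z\<bar> \<le> L * (norm z)\<^sup>2"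
proof -
  obtain D D2 where D: "\<And>z. z \<in> ST T \<Longrightarrow> (\<phi> has_derivative blinfun_apply (D z)) (at z within ST T)"
    and D2: "\<And>z. z \<in> ST T \<Longrightarrow> (D has_derivative blinfun_apply (D2 z)) (at z within ST T)" and D2c: "continuous_on (ST T) D2"
    using \<phi> unfolding C2_on_def by blast
  obtain V where V: "open V" "U = ST T \<inter> V" using U(1) openin_open by blast
  have xV: "(x0, t0) \<in> V" "0 < t0" "t0 \<le> T" using U(2) V(2) by (auto simp: ST_def)
  obtain r where r: "0 < r" "ball (x0, t0) r \<subseteq> V" using V(1) xV(1) open_contains_ball by blast
  define \<rho> where "\<rho> = min (r / 4) (t0 / 2)"
  have \<rho>: "0 < \<rho>" "\<rho> < t0" "3 * \<rho> < r" using r xV by (auto simp: \<rho>_def min_def)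
  have inU: "(x, t) \<in> U" if "dist x0 x \<le> 2 * \<rho>" "\<bar>t - t0\<bar> \<le> \<rho>" "t \<le> T" for x t
  proof -
    have "dist (x0, t0) (x, t) \<le> dist x0 x + \<bar>t0 - t\<bar>" unfolding dist_Pair_Pair dist_real_def by (rule sqrt_sum_squares_le_sum) auto
    hence "(x, t) \<in> V" using that \<rho> r(2) by auto
    thus ?thesis using that \<rho> by (simp add: V(2) ST_def)
  qed
  let ?K = "cball x0 (2 * \<rho>) \<times> {t0 - \<rho>..min T (t0 + \<rho>)}"
  have K: "compact ?K" "convex ?K" by (auto intro!: compact_Times convex_Times)
  have KS: "?K \<subseteq> ST T" using \<rho> by (auto simp: ST_def)
  have "bounded (D2 ` ?K)" by (intro compact_imp_bounded compact_continuous_image continuous_on_subset[OF D2c KS] K)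
  then obtain L where L: "\<And>p. p \<in> ?K \<Longrightarrow> norm (D2 p) \<le> L" by (auto simp: bounded_iff)
  have "(x0, t0) \<in> ?K" using \<rho> xV by simp
  hence L0: "0 \<le> L" using L order_trans norm_ge_zero by blast
  have sdb: "\<bar>sd (\<lambda>y. \<phi> (y, t)) x z\<bar> \<le> (2 * L) * (norm z)\<^sup>2" if "dist x0 x \<le> \<rho>" "\<bar>t - t0\<bar> \<le> \<rho>" "t \<le> T" "norm z \<le> \<rho>" for x t z
  proof -
    have "dist x0 (x + z) \<le> dist x0 x + norm z" "dist x0 (x - z) \<le> dist x0 x + norm z"
      using norm_triangle_ineq4[of "x0 - x" z] norm_triangle_ineq[of "x0 - x" z] by (simp_all add: dist_norm algebra_simps)
    hence "(x + z, t) \<in> ?K" "(x - z, t) \<in> ?K" using that \<rho> by auto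
    hence "\<bar>2 * \<phi> (x, t) - \<phi> ((x, t) + (z, 0)) - \<phi> ((x, t) - (z, 0))\<bar> \<le> 2 * L * (norm (z, 0::real))\<^sup>2"
      by (intro second_difference_bound[OF K(2) has_derivative_subset[OF D KS] has_derivative_subset[OF D2 KS] L])
        (use KS in auto)
    thus ?thesis by (simp add: sd_def norm_Pair)
  qed
  show thesis
  proof (rule that[of \<rho> "2 * L" D])
    show "continuous_on (ST T) D" using D2 by (meson has_derivative_continuous continuous_on_eq_continuous_within)
  qed (use \<rho> L0 D inU sdb in auto)
qed

lemma slice_continuous:
  fixes \<phi> :: "'a::euclidean_space \<times> real \<Rightarrow> real"
  assumes "continuous_on (UNIV \<times> I) \<phi>" "t \<in> I" shows "continuous_on UNIV (\<lambda>y. \<phi> (y, t))"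
  by (rule continuous_on_compose2[OF assms(1)]) (use assms(2) in \<open>auto intro!: continuous_intros\<close>)

lemma C2_continuous: "C2_on S \<phi> \<Longrightarrow> continuous_on S \<phi>"
  unfolding C2_on_def by (meson has_derivative_continuous continuous_on_eq_continuous_within)

lemma tendsto_on:
  assumes "continuous_on S f" "\<And>n. X n \<in> S" "X \<longlonglongrightarrow> x" "x \<in> S"
  shows "(\<lambda>n. f (X n)) \<longlonglongrightarrow> f x" using continuous_on_tendsto_compose[OF assms(1,3,4)] assms(2) by auto

text \<open>Near the touching point the glued function is the test function, so its second
  differences are quadratically small. At every touching point the principal value can thus be
  replaced by \<open>flap\<close>.\<close>

lemma glue_slice_pv:
  fixes u \<phi> :: "'a::euclidean_space \<times> real \<Rightarrow> real"
  assumes s: "0 < s" "s < 1" and \<phi>: "C2_on (ST T) \<phi>" and U: "openin (top_of_set (ST T)) U" "bounded U" "(x0, t0) \<in> U"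
    and uL: "(\<lambda>y. u (y, t0)) \<in> Ls_space s"
  shows "integrable lebesgue (\<lambda>z. sd (\<lambda>y. glue U \<phi> u (y, t0)) x0 z * nu s z)"
    "frac_laplacian s (\<lambda>y. glue U \<phi> u (y, t0)) x0 = frac_const DIM('a) s * flap s (\<lambda>y. glue U \<phi> u (y, t0)) x0"
proof -
  have t0: "t0 \<in> {0<..T}" using U openin_imp_subset by (fastforce simp: ST_def)
  obtain \<rho> L where \<rho>: "0 < \<rho>"
    and inU: "\<And>x t. dist x0 x \<le> 2 * \<rho> \<Longrightarrow> \<bar>t - t0\<bar> \<le> \<rho> \<Longrightarrow> t \<le> T \<Longrightarrow> (x, t) \<in> U"
    and sdb: "\<And>x t z. dist x0 x \<le> \<rho> \<Longrightarrow> \<bar>t - t0\<bar> \<le> \<rho> \<Longrightarrow> t \<le> T \<Longrightarrow> norm z \<le> \<rho> \<Longrightarrow> \<bar>sd (\<lambda>y. \<phi> (y, t)) x z\<bar> \<le> L * (norm z)\<^sup>2"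
    using C2_local[OF \<phi> U(1,3)] by metis
  have \<psi>: "(\<lambda>y. glue U \<phi> u (y, t0)) \<in> Ls_space s"
    by (rule glue_Ls[OF s U(1,2) t0 slice_continuous[OF C2_continuous[OF \<phi>, unfolded ST_def] t0] uL])
  have "\<bar>sd (\<lambda>y. glue U \<phi> u (y, t0)) x0 z\<bar> \<le> L * (norm z)\<^sup>2" if z: "norm z \<le> \<rho>" for z
  proof -
    have "(x0 + z, t0) \<in> U" "(x0 - z, t0) \<in> U" using z \<rho> t0 by (auto intro!: inU simp: dist_norm)
    hence "sd (\<lambda>y. glue U \<phi> u (y, t0)) x0 z = sd (\<lambda>y. \<phi> (y, t0)) x0 z" using U(3) by (simp add: sd_def glue_def)
    thus ?thesis using sdb[of x0 t0 z] z \<rho> t0 by simp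
  qed
  from pv_limit[OF s \<psi> \<rho> this]
  show "integrable lebesgue (\<lambda>z. sd (\<lambda>y. glue U \<phi> u (y, t0)) x0 z * nu s z)"
    "frac_laplacian s (\<lambda>y. glue U \<phi> u (y, t0)) x0 = frac_const DIM('a) s * flap s (\<lambda>y. glue U \<phi> u (y, t0)) x0" by auto
qed

section \<open>Exchange of sub- and supersolutions by a change of sign\<close>

lemma flap_minus: "flap s (\<lambda>y. - w y) x = - flap s w x"
proof -
  have "sd (\<lambda>y. - w y) x z * nu s z = - (sd w x z * nu s z)" for z by (simp add: sd_def algebra_simps)
  thus ?thesis unfolding flap_def by simp
qed

lemma Ls_minus: "v \<in> Ls_space s \<Longrightarrow> (\<lambda>x. - v x) \<in> Ls_space s"
  by (auto simp: Ls_space_def)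

lemma glue_minus: "glue U (\<lambda>z. - \<phi> z) (\<lambda>z. - u z) p = - glue U \<phi> u p"
  by (simp add: glue_def)

lemma C2_minus: "C2_on S \<phi> \<Longrightarrow> C2_on S (\<lambda>z. - \<phi> z)"
  using C2_on_mult[OF C2_on_const[of S "-1"]] by fastforce

lemma usc_minus: "usc_on S (\<lambda>z. - u z) \<longleftrightarrow> lsc_on S u"
proof -
  have e: "(\<forall>b. - u z < b \<longrightarrow> (\<forall>\<^sub>F w in F. - u w < b)) \<longleftrightarrow> (\<forall>b. b < u z \<longrightarrow> (\<forall>\<^sub>F w in F. b < u w))" for z F
  proof safe
    fix b assume h: "\<forall>b. - u z < b \<longrightarrow> (\<forall>\<^sub>F w in F. - u w < b)" "b < u z"
    show "\<forall>\<^sub>F w in F. b < u w" using h(1)[rule_format, of "- b"] h(2) by simp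
  next
    fix b assume h: "\<forall>b. b < u z \<longrightarrow> (\<forall>\<^sub>F w in F. b < u w)" "- u z < b"
    have "\<forall>\<^sub>F w in F. - b < u w" using h(1)[rule_format, of "- b"] h(2) by simp
    thus "\<forall>\<^sub>F w in F. - u w < b" by eventually_elim simp
  qed
  show ?thesis unfolding usc_on_def lsc_on_def e ..
qed

lemma glue_slice_minus:
  fixes u \<phi> :: "'a::euclidean_space \<times> real \<Rightarrow> real"
  assumes s: "0 < s" "s < 1" and \<phi>: "C2_on (ST T) \<phi>" and U: "openin (top_of_set (ST T)) U" "bounded U" "(x0, t0) \<in> U"
    and uL: "(\<lambda>y. u (y, t0)) \<in> Ls_space s"
  shows "frac_laplacian s (\<lambda>y. glue U (\<lambda>z. - \<phi> z) (\<lambda>z. - u z) (y, t0)) x0 = - frac_laplacian s (\<lambda>y. glue U \<phi> u (y, t0)) x0"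
    "time_deriv T (glue U (\<lambda>z. - \<phi> z) (\<lambda>z. - u z)) x0 t0 = - time_deriv T (glue U \<phi> u) x0 t0"
proof -
  show "frac_laplacian s (\<lambda>y. glue U (\<lambda>z. - \<phi> z) (\<lambda>z. - u z) (y, t0)) x0 = - frac_laplacian s (\<lambda>y. glue U \<phi> u (y, t0)) x0"
    using glue_slice_pv(2)[where u=u, OF s \<phi> U uL] glue_slice_pv(2)[where u="\<lambda>z. - u z", OF s C2_minus[OF \<phi>] U Ls_minus[OF uL]]
    unfolding glue_minus flap_minus by simp
  have t0: "t0 \<in> {0<..T}" and p: "(x0, t0) \<in> ST T" using U openin_imp_subset by (fastforce simp: ST_def)+
  obtain D where D: "(\<phi> has_derivative D) (at (x0, t0) within ST T)" using \<phi> p unfolding C2_on_def by blast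
  note d = slice_deriv[OF D]
  show "time_deriv T (glue U (\<lambda>z. - \<phi> z) (\<lambda>z. - u z)) x0 t0 = - time_deriv T (glue U \<phi> u) x0 t0"
    unfolding time_deriv_eq[where u=u, OF d t0 U(1,3)] by (rule time_deriv_eq[OF has_vector_derivative_minus[OF d] t0 U(1,3)])
qed

text \<open>Oddness of \<open>frac_laplacian\<close> is available where the principal value exists;
  \<open>glue_slice_minus\<close> provides it at every touching point.\<close>

lemma subsolution_minus:
  fixes u :: "'a::euclidean_space \<times> real \<Rightarrow> real"
  assumes s: "0 < s" "s < 1"
  shows "subsolution_eq s a c (\<lambda>x. - f x) T (\<lambda>z. - u z) \<longleftrightarrow> supersolution_eq s a c f T u"
proof
  assume h: "subsolution_eq s a c (\<lambda>x. - f x) T (\<lambda>z. - u z)"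
  hence L: "(\<lambda>x. u (x, t)) \<in> Ls_space s" if "t \<in> {0<..T}" for t
    using that Ls_minus[of "\<lambda>x. - u (x, t)"] unfolding subsolution_eq_def by simp
  show "supersolution_eq s a c f T u" unfolding supersolution_eq_def
  proof (intro conjI ballI allI impI L)
    show "lsc_on (ST T) u" using h unfolding subsolution_eq_def usc_minus by blast
    fix U x0 t0 \<phi>
    assume U: "openin (top_of_set (ST T)) U" "bounded U" "(x0, t0) \<in> U" and \<phi>: "C2_on (ST T) \<phi>"
      and e: "u (x0, t0) = \<phi> (x0, t0)" and m: "\<forall>z\<in>U. u (x0, t0) - \<phi> (x0, t0) \<le> u z - \<phi> z"
    have t0: "t0 \<in> {0<..T}" using U openin_imp_subset by (fastforce simp: ST_def)
    have "time_deriv T (glue U (\<lambda>z. - \<phi> z) (\<lambda>z. - u z)) x0 t0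
      \<le> - a x0 * frac_laplacian s (\<lambda>y. glue U (\<lambda>z. - \<phi> z) (\<lambda>z. - u z) (y, t0)) x0 + c x0 * - u (x0, t0) + - f x0"
    proof (rule h[unfolded subsolution_eq_def, THEN conjunct2, THEN conjunct2, rule_format, OF U C2_minus[OF \<phi>]])
      show "- u (x0, t0) = - \<phi> (x0, t0)" using e by simp
      show "- u (x0, t0) - - \<phi> (x0, t0) \<ge> - u z - - \<phi> z" if "z \<in> U" for z using bspec[OF m that] by simp
    qed
    thus "time_deriv T (glue U \<phi> u) x0 t0 \<ge> - a x0 * frac_laplacian s (\<lambda>y. glue U \<phi> u (y, t0)) x0 + c x0 * u (x0, t0) + f x0"
      unfolding glue_slice_minus[OF s \<phi> U L[OF t0]] by simp
  qed
next
  assume h: "supersolution_eq s a c f T u"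
  hence L: "(\<lambda>x. u (x, t)) \<in> Ls_space s" if "t \<in> {0<..T}" for t using that unfolding supersolution_eq_def by simp
  show "subsolution_eq s a c (\<lambda>x. - f x) T (\<lambda>z. - u z)" unfolding subsolution_eq_def
  proof (intro conjI ballI allI impI L Ls_minus)
    show "usc_on (ST T) (\<lambda>z. - u z)" using h unfolding supersolution_eq_def usc_minus by blast
    fix U x0 t0 \<phi>
    assume U: "openin (top_of_set (ST T)) U" "bounded U" "(x0, t0) \<in> U" and \<phi>: "C2_on (ST T) \<phi>"
      and e: "- u (x0, t0) = \<phi> (x0, t0)" and m: "\<forall>z\<in>U. - u (x0, t0) - \<phi> (x0, t0) \<ge> - u z - \<phi> z"
    have t0: "t0 \<in> {0<..T}" using U openin_imp_subset by (fastforce simp: ST_def)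
    have "time_deriv T (glue U (\<lambda>z. - \<phi> z) u) x0 t0
      \<ge> - a x0 * frac_laplacian s (\<lambda>y. glue U (\<lambda>z. - \<phi> z) u (y, t0)) x0 + c x0 * u (x0, t0) + f x0"
    proof (rule h[unfolded supersolution_eq_def, THEN conjunct2, THEN conjunct2, rule_format, OF U C2_minus[OF \<phi>]])
      show "u (x0, t0) = - \<phi> (x0, t0)" using e by simp
      show "u (x0, t0) - - \<phi> (x0, t0) \<le> u z - - \<phi> z" if "z \<in> U" for z using bspec[OF m that] by simp
    qed
    thus "time_deriv T (glue U \<phi> (\<lambda>z. - u z)) x0 t0 \<le> - a x0 * frac_laplacian s (\<lambda>y. glue U \<phi> (\<lambda>z. - u z) (y, t0)) x0 + c x0 * - u (x0, t0) + - f x0"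
      using glue_slice_minus[where u=u, OF s C2_minus[OF \<phi>] U L[OF t0]] by simp
  qed
qed

lemma slice_Ls:
  fixes u :: "'a::euclidean_space \<times> real \<Rightarrow> real"
  assumes s: "0 < s" "s < 1" and u: "continuous_on (ST_closed T) u" and B: "\<And>p. p \<in> ST_closed T \<Longrightarrow> \<bar>u p\<bar> \<le> B" and t: "t \<in> {0..T}"
  shows "(\<lambda>x. u (x, t)) \<in> Ls_space s"
proof (rule bounded_Ls[OF s borel_lebesgue])
  show "(\<lambda>x. u (x, t)) \<in> bmeas" by (rule cont_bmeas) (rule slice_continuous[OF u[unfolded ST_closed_def] t])
  show "\<bar>u (x, t)\<bar> \<le> B" for x using t by (intro B) (auto simp: ST_closed_def)
qed

lemma usc_on_continuous: "continuous_on S u \<Longrightarrow> usc_on S u"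
  unfolding usc_on_def continuous_on_def by (metis order_tendstoD(2))

text \<open>Perturbed maxima: subtracting a small multiple of \<open>|p - X0|^2\<close> forces the
  maxima of \<open>W n - \<phi>\<close> to converge to the touching point. The classical inequality
  holds at these maxima, and a common majorant takes the nonlocal term to the limit.\<close>

lemma stability:
  fixes u :: "'a::euclidean_space \<times> real \<Rightarrow> real"
  assumes s: "0 < s" "s < 1" and u: "continuous_on (ST_closed T) u" and B: "\<And>p. p \<in> ST_closed T \<Longrightarrow> \<bar>u p\<bar> \<le> B"
    and ac: "continuous_on UNIV a" and cc: "continuous_on UNIV c" and fc: "continuous_on UNIV f" and a: "\<And>x. 0 < a x"
    and app: "\<And>e. 0 < e \<Longrightarrow> \<exists>W Wt. reg T W Wt \<and>
        (\<forall>x. \<forall>t\<in>{0<..T}. resid s a c f W Wt x t \<le> 0) \<and>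
        (\<forall>p\<in>ST_closed T. \<bar>W p - u p\<bar> \<le> e)"
  shows "subsolution_eq s a c f T u" unfolding subsolution_eq_def
proof (intro conjI ballI allI impI)
  show uL: "(\<lambda>x. u (x, t)) \<in> Ls_space s" if "t \<in> {0<..T}" for t by (rule slice_Ls[OF s u B]) (use that in auto)
  have sub: "ST T \<subseteq> (ST_closed T :: ('a \<times> real) set)" by (auto simp: ST_def ST_closed_def)
  show "usc_on (ST T) u" by (rule usc_on_continuous[OF continuous_on_subset[OF u sub]])
  fix U x0 t0 \<phi>
  assume U: "openin (top_of_set (ST T)) U" "bounded U" "(x0, t0) \<in> U" and \<phi>: "C2_on (ST T) \<phi>"
    and eq: "u (x0, t0) = \<phi> (x0, t0)" and touch: "\<forall>z\<in>U. u (x0, t0) - \<phi> (x0, t0) \<ge> u z - \<phi> z"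
  have t0: "t0 \<in> {0<..T}" and p0: "(x0, t0) \<in> ST T" using U openin_imp_subset by (fastforce simp: ST_def)+
  obtain D \<rho> L where \<rho>: "0 < \<rho>" "\<rho> < t0" and L0: "0 \<le> L"
    and D: "\<And>p. p \<in> ST T \<Longrightarrow> (\<phi> has_derivative blinfun_apply (D p)) (at p within ST T)" and Dc: "continuous_on (ST T) D"
    and inU: "\<And>x t. dist x0 x \<le> 2 * \<rho> \<Longrightarrow> \<bar>t - t0\<bar> \<le> \<rho> \<Longrightarrow> t \<le> T \<Longrightarrow> (x, t) \<in> U"
    and sdb: "\<And>x t z. dist x0 x \<le> \<rho> \<Longrightarrow> \<bar>t - t0\<bar> \<le> \<rho> \<Longrightarrow> t \<le> T \<Longrightarrow> norm z \<le> \<rho> \<Longrightarrow> \<bar>sd (\<lambda>y. \<phi> (y, t)) x z\<bar> \<le> L * (norm z)\<^sup>2"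
    using C2_local[OF \<phi> U(1,3)] by metis
  have \<phi>c: "continuous_on (ST T) \<phi>" by (rule C2_continuous[OF \<phi>])
  define X0 where "X0 = (x0, t0)"
  let ?K = "cball x0 (2 * \<rho>) \<times> {t0 - \<rho>..min T (t0 + \<rho>)}"
  have K: "compact ?K" by (auto intro!: compact_Times)
  have KS: "?K \<subseteq> ST T" using \<rho> by (auto simp: ST_def)
  have X0K: "X0 \<in> ?K" using \<rho> t0 by (auto simp: X0_def)
  have KU: "?K \<subseteq> U" using inU by (auto simp: abs_le_iff)
  define eta where "eta = (\<lambda>n::nat. 1 / (real n + 1))"
  \<comment> \<open>Closeness is of smaller order than the penalty: \<open>2 * eps n / eta n\<close>
    tends to 0 and stays below \<open>\<rho>^2\<close>, so the maxima stay within distance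
    \<open>\<rho>\<close> of \<open>X0\<close> and converge to it.\<close>
  define eps where "eps = (\<lambda>n::nat. (eta n)\<^sup>2 * (\<rho>\<^sup>2 / 4))"
  have eta: "0 < eta n" "eta n \<le> 1" for n by (auto simp: eta_def)
  have eps: "0 < eps n" for n using eta[of n] \<rho> by (simp add: eps_def)
  have "\<forall>n. \<exists>W Wt. reg T W Wt \<and>
        (\<forall>x. \<forall>t\<in>{0<..T}. resid s a c f W Wt x t \<le> 0) \<and>
        (\<forall>p\<in>ST_closed T. \<bar>W p - u p\<bar> \<le> eps n)" using app[OF eps] by blast
  then obtain W Wt where W: "\<And>n. reg T (W n) (Wt n)"
    and sol: "\<And>n x t. t \<in> {0<..T} \<Longrightarrow> resid s a c f (W n) (Wt n) x t \<le> 0"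
    and close: "\<And>n p. p \<in> ST_closed T \<Longrightarrow> \<bar>W n p - u p\<bar> \<le> eps n" by metis
  define P where "P = (\<lambda>n p. W n p - \<phi> p - eta n * (norm (p - X0))\<^sup>2)"
  have "\<exists>X\<in>?K. \<forall>p\<in>?K. P n p \<le> P n X" for n
  proof (rule continuous_attains_sup[OF K])
    show "?K \<noteq> {}" using X0K by blast
    have "continuous_on ?K (W n)" using W[of n] continuous_on_subset unfolding reg_def by blast
    thus "continuous_on ?K (P n)" unfolding P_def by (intro continuous_intros continuous_on_subset[OF \<phi>c KS])
  qed
  then obtain X where XK: "\<And>n. X n \<in> ?K" and Xmax: "\<And>n p. p \<in> ?K \<Longrightarrow> P n p \<le> P n (X n)" by metis
  define x where "x = (\<lambda>n. fst (X n))"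
  define t where "t = (\<lambda>n. snd (X n))"
  have Xeq: "X n = (x n, t n)" for n by (simp add: x_def t_def)
  have d2: "(norm (X n - X0))\<^sup>2 \<le> eta n * (\<rho>\<^sup>2 / 2)" for n
  proof -
    have c1: "p \<in> ST_closed T" if "p \<in> ?K" for p using that KS sub by blast
    have "- eps n \<le> P n X0" using close[OF c1[OF X0K], of n] eq by (simp add: P_def X0_def)
    also have "\<dots> \<le> P n (X n)" by (rule Xmax[OF X0K])
    also have "\<dots> \<le> eps n - eta n * (norm (X n - X0))\<^sup>2"
      using close[OF c1[OF XK], of n n] bspec[OF touch, of "X n"] KU XK[of n] eq unfolding P_def by fastforce
    finally have "eta n * (norm (X n - X0))\<^sup>2 \<le> eta n * (eta n * (\<rho>\<^sup>2 / 2))" by (simp add: eps_def power2_eq_square mult_ac)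
    thus ?thesis using eta[of n] by simp
  qed
  have near: "norm (X n - X0) < \<rho>" for n
  proof -
    have "eta n * (\<rho>\<^sup>2 / 2) \<le> 1 * (\<rho>\<^sup>2 / 2)" using eta[of n] by (intro mult_right_mono) auto
    hence "(norm (X n - X0))\<^sup>2 < \<rho>\<^sup>2" using d2[of n] \<rho> by (smt (verit) field_sum_of_halves zero_less_power)
    thus ?thesis using \<rho> by (simp add: power2_less_imp_less)
  qed
  have xn: "dist x0 (x n) < \<rho>" and tn: "\<bar>t n - t0\<bar> < \<rho>" for n
    using near[of n] norm_fst_le[of "x n - x0" "t n - t0"] norm_snd_le[of "t n - t0" "x n - x0"]
    by (auto simp: Xeq X0_def dist_norm norm_minus_commute)
  have tT: "t n \<le> T" for n using XK[of n] by (auto simp: Xeq)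
  have tI: "t n \<in> {0<..T}" for n using tT tn[of n] \<rho> by auto
  have XS: "X n \<in> ST T" for n using tI by (simp add: Xeq ST_def)
  have eta0: "eta \<longlonglongrightarrow> 0" unfolding eta_def by real_asymp
  have eps0: "eps \<longlonglongrightarrow> 0" unfolding eps_def using tendsto_mult[OF tendsto_power[OF eta0, of 2] tendsto_const[of "\<rho>\<^sup>2 / 4"]] by simp
  have "(\<lambda>n. (norm (X n - X0))\<^sup>2) \<longlonglongrightarrow> 0"
  proof (rule tendsto_sandwich[OF _ _ tendsto_const])
    show "(\<lambda>n. eta n * (\<rho>\<^sup>2 / 2)) \<longlonglongrightarrow> 0" using tendsto_mult[OF eta0 tendsto_const[of "\<rho>\<^sup>2 / 2"]] by simp
  qed (use d2 in auto)
  hence "(\<lambda>n. sqrt ((norm (X n - X0))\<^sup>2)) \<longlonglongrightarrow> sqrt 0" by (intro tendsto_real_sqrt)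
  hence Xlim: "X \<longlonglongrightarrow> X0" by (simp add: tendsto_norm_zero_iff LIM_zero_iff)
  have xlim: "x \<longlonglongrightarrow> x0" and tlim: "t \<longlonglongrightarrow> t0"
    using tendsto_fst[OF Xlim] tendsto_snd[OF Xlim] by (simp_all add: x_def t_def X0_def)
  \<comment> \<open>Only a maximum over earlier times is used, which covers the final time; it gives
    one inequality, and this is the one required.\<close>
  have td: "blinfun_apply (D (X n)) (0, 1) + eta n * (2 * (t n - t0)) \<le> Wt n (x n) (t n)" for n
  proof -
    have nsq: "(norm ((x n, r) - X0))\<^sup>2 = (norm (x n - x0))\<^sup>2 + (r - t0)\<^sup>2" for r by (simp add: X0_def norm_Pair)
    have "((\<lambda>r. W n (x n, r)) has_real_derivative Wt n (x n) (t n)) (at (t n) within {0<..T})"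
      using W[of n] tI[of n] unfolding reg_def by (auto intro: has_field_derivative_at_within)
    moreover have "((\<lambda>r. \<phi> (x n, r)) has_real_derivative D (X n) (0, 1)) (at (t n) within {0<..T})"
      using slice_deriv[OF D[OF XS[of n], unfolded Xeq]] by (simp add: has_real_derivative_iff_has_vector_derivative Xeq)
    moreover have "((\<lambda>r. eta n * ((norm (x n - x0))\<^sup>2 + (r - t0)\<^sup>2)) has_real_derivative eta n * (2 * (t n - t0))) (at (t n) within {0<..T})"
      by (auto intro!: derivative_eq_intros)
    ultimately have "((\<lambda>r. W n (x n, r) - \<phi> (x n, r) - eta n * ((norm (x n - x0))\<^sup>2 + (r - t0)\<^sup>2)) has_real_derivative
        Wt n (x n) (t n) - D (X n) (0, 1) - eta n * (2 * (t n - t0))) (at (t n) within {0<..T})" by (intro DERIV_diff)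
    hence "((\<lambda>r. P n (x n, r)) has_vector_derivative Wt n (x n) (t n) - D (X n) (0, 1) - eta n * (2 * (t n - t0))) (at (t n) within {0<..T})"
      unfolding P_def nsq by (simp add: has_real_derivative_iff_has_vector_derivative)
    hence "0 \<le> Wt n (x n) (t n) - D (X n) (0, 1) - eta n * (2 * (t n - t0))"
    proof (rule left_max_deriv[OF _ tI])
      show "t0 - \<rho> < t n" using tn[of n] by (simp add: abs_less_iff)
      fix r assume "t0 - \<rho> \<le> r" "r \<le> t n"
      hence "(x n, r) \<in> ?K" using XK[of n] by (simp add: Xeq)
      from Xmax[OF this] show "P n (x n, r) \<le> P n (x n, t n)" by (simp add: Xeq)
    qed
    thus ?thesis by simp
  qed
  \<comment> \<open>Second difference of \<open>\<phi>\<close> for small increments and of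
    \<open>u\<close> for large ones. It bounds that of \<open>W n\<close> from below up to terms in
    \<open>eta\<close> and \<open>eps\<close>, but does not itself involve
    \<open>W n\<close>.\<close>
  define om where "om = (\<lambda>y r z. if z \<in> cball 0 \<rho> then sd (\<lambda>y. \<phi> (y, r)) y z else sd (\<lambda>y. u (y, r)) y z)"
  \<comment> \<open>Compares \<open>|z|^2\<close> inside the radius \<open>\<rho>\<close> and the
    constant 1 outside it with \<open>mn z\<close>.\<close>
  define M where "M = 2 + \<rho>\<^sup>2 + 1 / \<rho>\<^sup>2"
  have M: "0 < M" using \<rho> by (simp add: M_def add_pos_nonneg)
  have M1: "(norm z)\<^sup>2 \<le> M * mn z" if "norm z \<le> \<rho>" for z :: 'a
  proof (cases "(norm z)\<^sup>2 \<le> 1")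
    case True
    have "1 * (norm z)\<^sup>2 \<le> M * (norm z)\<^sup>2" by (intro mult_right_mono) (auto simp: M_def)
    thus ?thesis using True by (simp add: mn_def)
  next
    case False
    have "(norm z)\<^sup>2 \<le> \<rho>\<^sup>2" using that by (intro power_mono) auto
    moreover have "0 \<le> 1 / \<rho>\<^sup>2" by simp
    ultimately have "(norm z)\<^sup>2 \<le> M" unfolding M_def by linarith
    thus ?thesis using False by (simp add: mn_def)
  qed
  have M2: "1 \<le> M * mn z" if "\<not> norm z \<le> \<rho>" for z :: 'a
  proof (cases "(norm z)\<^sup>2 \<le> 1")
    case True
    have "\<rho>\<^sup>2 \<le> (norm z)\<^sup>2" using that \<rho> by (intro power_mono) auto
    hence "1 / \<rho>\<^sup>2 * \<rho>\<^sup>2 \<le> 1 / \<rho>\<^sup>2 * (norm z)\<^sup>2" by (intro mult_left_mono) auto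
    also have "\<dots> \<le> M * (norm z)\<^sup>2" by (intro mult_right_mono) (auto simp: M_def)
    finally show ?thesis using True \<rho> by (simp add: mn_def)
  next
    case False
    thus ?thesis using \<rho> by (simp add: mn_def M_def)
  qed
  have uB: "\<bar>u (y, r)\<bar> \<le> B" if "r \<in> {0<..T}" for y r using that by (intro B) (auto simp: ST_closed_def)
  have B0: "0 \<le> B" using uB[OF t0, of x0] by linarith
  define Q where "Q = (L + 4 * B) * M"
  have omb: "\<bar>om y r z\<bar> \<le> Q * mn z" if yr: "dist x0 y \<le> \<rho>" "\<bar>r - t0\<bar> \<le> \<rho>" "r \<in> {0<..T}" for y r z
  proof (cases "norm z \<le> \<rho>")
    case True
    hence "\<bar>om y r z\<bar> \<le> L * (norm z)\<^sup>2" using sdb[of y r z] yr by (simp add: om_def)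
    also have "\<dots> \<le> L * (M * mn z)" by (intro mult_left_mono M1 True L0)
    also have "\<dots> \<le> (L + 4 * B) * (M * mn z)" using B0 M by (intro mult_right_mono) auto
    finally show ?thesis by (simp add: Q_def mult_ac)
  next
    case False
    hence "\<bar>om y r z\<bar> \<le> 4 * B * 1"
      using uB[OF yr(3), of y] uB[OF yr(3), of "y + z"] uB[OF yr(3), of "y - z"] by (simp add: om_def sd_def)
    also have "\<dots> \<le> 4 * B * (M * mn z)" using B0 by (intro mult_left_mono M2 False) auto
    also have "\<dots> \<le> (L + 4 * B) * (M * mn z)" using L0 M by (intro mult_right_mono) auto
    finally show ?thesis by (simp add: Q_def mult_ac)
  qed
  \<comment> \<open>Inside, maximality of \<open>P n\<close> is used at \<open>x n + z\<close> and
    at \<open>x n - z\<close>, and the parallelogram law evaluates the penalty; outside,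
    \<open>W n\<close> is close to \<open>u\<close>.\<close>
  have omlow: "om (x n) (t n) z - 4 * (eta n + eps n) * M * mn z \<le> sd (\<lambda>y. W n (y, t n)) (x n) z" for n z
  proof (cases "norm z \<le> \<rho>")
    case True
    have "dist x0 (x n + z) \<le> dist x0 (x n) + norm z" "dist x0 (x n - z) \<le> dist x0 (x n) + norm z"
      using norm_triangle_ineq4[of "x0 - x n" z] norm_triangle_ineq[of "x0 - x n" z] by (simp_all add: dist_norm algebra_simps)
    hence "(x n + z, t n) \<in> ?K" "(x n - z, t n) \<in> ?K" using True xn[of n] XK[of n] by (auto simp: Xeq)
    hence *: "P n (x n + z, t n) \<le> P n (x n, t n)" "P n (x n - z, t n) \<le> P n (x n, t n)" using Xmax[of _ n] by (auto simp: Xeq)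
    have nsq: "(norm ((y, t n) - X0))\<^sup>2 = (norm (y - x0))\<^sup>2 + (t n - t0)\<^sup>2" for y by (simp add: X0_def norm_Pair)
    have par: "(norm (x n + z - x0))\<^sup>2 + (norm (x n - z - x0))\<^sup>2 = 2 * (norm (x n - x0))\<^sup>2 + 2 * (norm z)\<^sup>2"
      by (simp add: power2_norm_eq_inner algebra_simps inner_commute)
    have "eta n * (norm (x n + z - x0))\<^sup>2 + eta n * (norm (x n - z - x0))\<^sup>2 = 2 * (eta n * (norm (x n - x0))\<^sup>2) + 2 * (eta n * (norm z)\<^sup>2)"
      using arg_cong[OF par, of "\<lambda>v. eta n * v"] by (simp add: algebra_simps)
    hence "sd (\<lambda>y. \<phi> (y, t n)) (x n) z - 2 * (eta n * (norm z)\<^sup>2) \<le> sd (\<lambda>y. W n (y, t n)) (x n) z"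
      using * unfolding P_def nsq sd_def distrib_left by linarith
    moreover have "2 * (eta n * (norm z)\<^sup>2) \<le> 4 * (eta n + eps n) * M * mn z"
    proof -
      have "2 * eta n * (norm z)\<^sup>2 \<le> 4 * (eta n + eps n) * (M * mn z)" using eta[of n] eps[of n] by (intro mult_mono M1 True) auto
      thus ?thesis by (simp add: mult_ac)
    qed
    ultimately show ?thesis using True by (simp add: om_def)
  next
    case False
    have c: "\<bar>W n (y, t n) - u (y, t n)\<bar> \<le> eps n" for y using tI[of n] by (intro close) (auto simp: ST_closed_def)
    have "sd (\<lambda>y. u (y, t n)) (x n) z - 4 * eps n \<le> sd (\<lambda>y. W n (y, t n)) (x n) z"
      using c[of "x n"] c[of "x n + z"] c[of "x n - z"] unfolding sd_def abs_le_iff by linarith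
    moreover have "4 * eps n * 1 \<le> 4 * (eta n + eps n) * (M * mn z)" using eta[of n] eps[of n] by (intro mult_mono M2 False) auto
    ultimately show ?thesis using False by (simp add: om_def mult_ac)
  qed
  have nm: "nu s \<in> borel_measurable (lebesgue :: 'a measure)" by (rule borel_lebesgue) measurable
  have omm: "om y r \<in> borel_measurable lebesgue" if r: "r \<in> {0<..T}" for y r
  proof -
    have 1: "(\<lambda>y. \<phi> (y, r)) \<in> bmeas" by (rule cont_bmeas) (rule slice_continuous[OF \<phi>c[unfolded ST_def] r])
    have 2: "(\<lambda>y. u (y, r)) \<in> bmeas"
      by (rule cont_bmeas) (use r in \<open>auto intro!: slice_continuous[OF u[unfolded ST_closed_def]]\<close>)
    have "cball 0 \<rho> \<in> sets (borel :: 'a measure)" by simp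
    thus ?thesis unfolding om_def using 1 2 by (intro borel_lebesgue measurable_If_set sd_borel) auto
  qed
  define J where "J = (\<lambda>n. \<integral>z. om (x n) (t n) z * nu s z \<partial>lebesgue)"
  define mu where "mu = (\<integral>z. mn (z::'a) * nu s z \<partial>lebesgue)"
  have imn: "integrable lebesgue (\<lambda>z::'a. mn z * nu s z)" by (rule integrable_lebesgue_mn_nu[OF s])
  have omi: "norm (om y r z * nu s z) \<le> Q * (mn z * nu s z)" if "dist x0 y \<le> \<rho>" "\<bar>r - t0\<bar> \<le> \<rho>" "r \<in> {0<..T}" for y r z
    using mult_right_mono[OF omb[OF that] nu_nonneg[of s z]] by (simp add: abs_mult mult.assoc)
  have omint: "integrable lebesgue (\<lambda>z. om y r z * nu s z)" if yr: "dist x0 y \<le> \<rho>" "\<bar>r - t0\<bar> \<le> \<rho>" "r \<in> {0<..T}" for y r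
  proof (rule lint_bound[OF integrable_mult_right[OF imn, of Q]])
    show "AE z in lebesgue. norm (om y r z * nu s z) \<le> norm (Q * (mn z * nu s z))"
      by (intro AE_I2) (metis omi[OF yr] abs_ge_self order_trans real_norm_def)
  qed (intro borel_measurable_times omm nm yr)
  have Jint: "integrable lebesgue (\<lambda>z. om (x n) (t n) z * nu s z)" for n using xn[of n] tn[of n] tI[of n] by (intro omint) auto
  have Jlim: "J \<longlonglongrightarrow> (\<integral>z. om x0 t0 z * nu s z \<partial>lebesgue)" unfolding J_def
  proof (rule integral_dominated_convergence[where w="\<lambda>z. Q * (mn z * nu s z)"])
    show "AE z in lebesgue. norm (om (x n) (t n) z * nu s z) \<le> Q * (mn z * nu s z)" for n
      using xn[of n] tn[of n] tI[of n] by (intro AE_I2 omi) auto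
    show "AE z in lebesgue. (\<lambda>n. om (x n) (t n) z * nu s z) \<longlonglongrightarrow> om x0 t0 z * nu s z"
    proof (intro AE_I2 tendsto_mult tendsto_const)
      fix z
      have a: "(\<lambda>n. w (x n + v, t n)) \<longlonglongrightarrow> w (x0 + v, t0)" if "continuous_on (ST T) w" for w :: "'a \<times> real \<Rightarrow> real" and v
        by (rule tendsto_on[OF that]) (use tI t0 in \<open>auto simp: ST_def intro!: tendsto_intros xlim tlim\<close>)
      have b: "(\<lambda>n. sd (\<lambda>y. w (y, t n)) (x n) z) \<longlonglongrightarrow> sd (\<lambda>y. w (y, t0)) x0 z" if w: "continuous_on (ST T) w" for w :: "'a \<times> real \<Rightarrow> real"
        unfolding sd_def using a[OF w, of 0] a[OF w, of z] a[OF w, of "- z"] by (auto intro!: tendsto_intros)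
      show "(\<lambda>n. om (x n) (t n) z) \<longlonglongrightarrow> om x0 t0 z"
        unfolding om_def using b[OF \<phi>c] b[OF continuous_on_subset[OF u sub]] by (cases "z \<in> cball 0 \<rho>") auto
    qed
  qed (intro borel_measurable_times omm nm tI t0 integrable_mult_right imn)+
  let ?fc = "frac_const DIM('a) s"
  have fcp: "0 < ?fc" by (rule frac_const_pos[OF s])
  have ineq: "blinfun_apply (D (X n)) (0, 1) + eta n * (2 * (t n - t0)) + a (x n) * (?fc * (1 / 2 * (J n - 4 * (eta n + eps n) * M * mu)))
      - c (x n) * W n (X n) - f (x n) \<le> 0" for n
  proof -
    have "J n - 4 * (eta n + eps n) * M * mu = (\<integral>z. om (x n) (t n) z * nu s z - 4 * (eta n + eps n) * M * (mn z * nu s z) \<partial>lebesgue)"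
      unfolding J_def mu_def by (subst lint_diff[OF Jint integrable_mult_right[OF imn]]) simp
    also have "\<dots> \<le> (\<integral>z. sd (\<lambda>y. W n (y, t n)) (x n) z * nu s z \<partial>lebesgue)"
    proof (rule integral_mono)
      show "integrable lebesgue (\<lambda>z. om (x n) (t n) z * nu s z - 4 * (eta n + eps n) * M * (mn z * nu s z))"
        by (intro Bochner_Integration.integrable_diff Jint integrable_mult_right imn)
      show "integrable lebesgue (\<lambda>z. sd (\<lambda>y. W n (y, t n)) (x n) z * nu s z)" by (rule reg_flap(1)[OF s W]) (use tI[of n] in auto)
      show "om (x n) (t n) z * nu s z - 4 * (eta n + eps n) * M * (mn z * nu s z) \<le> sd (\<lambda>y. W n (y, t n)) (x n) z * nu s z" for z
        using mult_right_mono[OF omlow[of n z] nu_nonneg[of s z]] by (simp add: left_diff_distrib mult.assoc)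
    qed
    finally have "1 / 2 * (J n - 4 * (eta n + eps n) * M * mu) \<le> flap s (\<lambda>y. W n (y, t n)) (x n)" by (simp add: flap_def)
    hence "a (x n) * (?fc * (1 / 2 * (J n - 4 * (eta n + eps n) * M * mu))) \<le> a (x n) * (?fc * flap s (\<lambda>y. W n (y, t n)) (x n))"
      using a[of "x n"] fcp by (intro mult_left_mono) auto
    thus ?thesis using sol[OF tI[of n], where n=n and x="x n"] td[of n] by (simp add: Xeq)
  qed
  have "D X0 (0, 1) + 0 * (2 * (t0 - t0)) + a x0 * (?fc * (1 / 2 * ((\<integral>z. om x0 t0 z * nu s z \<partial>lebesgue) - 4 * (0 + 0) * M * mu)))
      - c x0 * u X0 - f x0 \<le> 0"
  proof (rule LIMSEQ_le_const2)
    have cl: "(\<lambda>n. w (x n)) \<longlonglongrightarrow> w x0" if "continuous_on UNIV w" for w :: "'a \<Rightarrow> real"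
      by (rule tendsto_on[OF that]) (auto intro: xlim)
    have Dl: "(\<lambda>n. D (X n)) \<longlonglongrightarrow> D X0" by (rule tendsto_on[OF Dc XS Xlim]) (simp add: X0_def p0)
    have ul: "(\<lambda>n. u (X n)) \<longlonglongrightarrow> u X0"
      by (rule tendsto_on[OF continuous_on_subset[OF u sub] XS Xlim]) (simp add: X0_def p0)
    have "(\<lambda>n. W n (X n) - u (X n)) \<longlonglongrightarrow> 0"
    proof (rule Lim_null_comparison[OF _ eps0])
      show "\<forall>\<^sub>F n in sequentially. norm (W n (X n) - u (X n)) \<le> eps n"
        using close[OF subsetD[OF sub XS]] by (intro always_eventually) simp
    qed
    from tendsto_add[OF this ul] have Wl: "(\<lambda>n. W n (X n)) \<longlonglongrightarrow> u X0" by simp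
    show "(\<lambda>n. blinfun_apply (D (X n)) (0, 1) + eta n * (2 * (t n - t0)) + a (x n) * (?fc * (1 / 2 * (J n - 4 * (eta n + eps n) * M * mu)))
      - c (x n) * W n (X n) - f (x n)) \<longlonglongrightarrow> D X0 (0, 1) + 0 * (2 * (t0 - t0)) + a x0 * (?fc * (1 / 2 * ((\<integral>z. om x0 t0 z * nu s z \<partial>lebesgue) - 4 * (0 + 0) * M * mu)))
      - c x0 * u X0 - f x0" by (intro tendsto_intros blinfun.tendsto Dl eta0 eps0 tlim cl ac cc fc Jlim Wl)
  qed (use ineq in blast)
  hence lim: "D X0 (0, 1) + a x0 * (?fc * (1 / 2 * (\<integral>z. om x0 t0 z * nu s z \<partial>lebesgue))) - c x0 * u X0 - f x0 \<le> 0" by simp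
  let ?\<psi> = "\<lambda>y. glue U \<phi> u (y, t0)"
  note pv = glue_slice_pv[OF s \<phi> U uL[OF t0]]
  have \<psi>u: "u (y, t0) \<le> ?\<psi> y" for y using touch eq by (auto simp: glue_def)
  have \<psi>0: "?\<psi> x0 = u (x0, t0)" using U(3) eq by (simp add: glue_def)
  \<comment> \<open>Beyond the radius \<open>\<rho>\<close> the glued function may still be
    \<open>\<phi>\<close>, which is at least \<open>u\<close> there; its second difference is
    therefore the smaller one.\<close>
  have "(\<integral>z. sd ?\<psi> x0 z * nu s z \<partial>lebesgue) \<le> (\<integral>z. om x0 t0 z * nu s z \<partial>lebesgue)"
  proof (rule integral_mono[OF pv(1)])
    show "integrable lebesgue (\<lambda>z. om x0 t0 z * nu s z)" using \<rho> t0 by (intro omint) auto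
    fix z
    show "sd ?\<psi> x0 z * nu s z \<le> om x0 t0 z * nu s z"
    proof (intro mult_right_mono nu_nonneg)
      show "sd ?\<psi> x0 z \<le> om x0 t0 z"
      proof (cases "norm z \<le> \<rho>")
        case True
        have "(x0 + z, t0) \<in> U" "(x0 - z, t0) \<in> U" using True \<rho> t0 by (auto intro!: inU simp: dist_norm)
        thus ?thesis using True U(3) by (simp add: om_def sd_def glue_def)
      next
        case False
        thus ?thesis using \<psi>u[of "x0 + z"] \<psi>u[of "x0 - z"] \<psi>0 by (simp add: om_def sd_def)
      qed
    qed
  qed
  hence "a x0 * (?fc * flap s ?\<psi> x0) \<le> a x0 * (?fc * (1 / 2 * (\<integral>z. om x0 t0 z * nu s z \<partial>lebesgue)))"
    using a[of x0] fcp unfolding flap_def by (intro mult_left_mono) auto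
  moreover have "time_deriv T (glue U \<phi> u) x0 t0 = D X0 (0, 1)" unfolding X0_def by (rule time_deriv_eq[OF slice_deriv[OF D[OF p0]] t0 U(1,3)])
  ultimately show "time_deriv T (glue U \<phi> u) x0 t0 \<le> - a x0 * frac_laplacian s ?\<psi> x0 + c x0 * u (x0, t0) + f x0"
    using lim unfolding pv(2) by (simp add: X0_def)
qed

section \<open>Classical sub- and supersolutions close to each other\<close>

lemma heat_C2:
  fixes v :: "'b::euclidean_space \<Rightarrow> real"
  assumes r: "0 < r" and v: "v \<in> bmeas" "\<And>x. \<bar>v x\<bar> \<le> B"
  obtains K where "0 \<le> K" "C2_on UNIV (heat r v)" "\<And>x z. \<bar>sd (heat r v) x z\<bar> \<le> K * mn z"
proof -
  obtain M where M: "0 < M" "\<And>v B. v \<in> bmeas \<Longrightarrow> (\<And>x::'b. \<bar>v x\<bar> \<le> B) \<Longrightarrow> C2_bounded (heat r v) (M * B)"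
    using heat_smooth[OF r, where 'b='b] by metis
  obtain D :: "'b \<Rightarrow> 'b \<Rightarrow>\<^sub>L real" and D2 where D: "\<And>z. (heat r v has_derivative blinfun_apply (D z)) (at z)"
    and D2: "\<And>z. (D has_derivative blinfun_apply (D2 z)) (at z)" and c: "continuous_on UNIV D2" and b: "\<And>z. norm (D2 z) \<le> M * B"
    using M(2)[OF v] unfolding C2_bounded_def by blast
  have B: "0 \<le> B" using v(2)[of 0] by linarith
  define K where "K = 2 * (M * B) + 4 * B"
  have K: "2 * (M * B) \<le> K" "4 * B \<le> K" "0 \<le> K" using B M by (auto simp: K_def)
  show thesis
  proof (rule that[OF K(3)])
    show "C2_on UNIV (heat r v)" unfolding C2_on_def using D D2 c by blast
    fix x z :: 'b
    have "\<bar>sd (heat r v) x z\<bar> \<le> 2 * (M * B) * (norm z)\<^sup>2"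
      unfolding sd_def by (rule second_difference_bound[where S=UNIV, OF convex_UNIV D D2 b]) auto
    also have "\<dots> \<le> K * (norm z)\<^sup>2" by (intro mult_right_mono K) auto
    finally have 1: "\<bar>sd (heat r v) x z\<bar> \<le> K * (norm z)\<^sup>2" .
    have "\<bar>heat r v y\<bar> \<le> B" for y by (rule heat_bound[OF v r])
    from this[of x] this[of "x + z"] this[of "x - z"] have "\<bar>sd (heat r v) x z\<bar> \<le> 4 * B" unfolding sd_def by linarith
    hence "\<bar>sd (heat r v) x z\<bar> \<le> K" using K by linarith
    thus "\<bar>sd (heat r v) x z\<bar> \<le> K * mn z" using 1 by (simp add: mn_def min_def)
  qed
qed

lemma sd_nu_integrable:
  fixes w :: "'a::euclidean_space \<Rightarrow> real"
  assumes s: "0 < s" "s < 1" and w: "w \<in> bmeas" "\<And>x. \<bar>w x\<bar> \<le> B" and K: "0 \<le> K" "\<And>z. \<bar>sd w x z\<bar> \<le> K * mn z"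
  shows "integrable lebesgue (\<lambda>z. sd w x z * nu s z)"
  by (rule pv_limit(1)[OF s bounded_Ls[OF s borel_lebesgue[OF w(1)] w(2)] zero_less_one, of _ K])
    (use K(2) mult_left_mono[OF mn_le_sq K(1)] order_trans in blast)

text \<open>The margin \<open>d\<close> lets the comparison at infinity be applied to functions that converge to \<open>g\<close>.\<close>

definition enclosing where
  "enclosing s a c f T g u0 ep P Pt M Mt d R \<longleftrightarrow> reg T P Pt \<and> reg T M Mt \<and>
    (\<forall>x. \<forall>t\<in>{0<..T}. 0 \<le> resid s a c f P Pt x t) \<and>
    (\<forall>x. \<forall>t\<in>{0<..T}. resid s a c f M Mt x t \<le> 0) \<and>
    (\<forall>p\<in>ST_closed T. P p \<le> M p + ep) \<and> (\<forall>x::'a::euclidean_space. M (x, 0) \<le> u0 x \<and> u0 x \<le> P (x, 0)) \<and> 0 < (d::real) \<and>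
    (\<forall>x. \<forall>t\<in>{0..T}. R \<le> norm x \<longrightarrow> M (x, t) \<le> g t - d \<and> g t + d \<le> P (x, t))"

text \<open>After division by \<open>exp (be * t)\<close> both functions have the form
  \<open>w + p + k * (1 + Br)\<close>: \<open>w\<close> comes from \<open>approx\<close>, the
  polynomial \<open>p\<close> follows the datum at infinity, and \<open>k\<close> is
  \<open>si\<close> or \<open>- si\<close>. The potential \<open>Br\<close> absorbs residuals
  relative to \<open>A * pw be1\<close>, the constant 1 absorbs the errors at time 0 and at
  infinity.\<close>

lemma sandwich:
  fixes a c f u0 :: "'a::euclidean_space \<Rightarrow> real"
  assumes s: "0 < s" "s < 1" and sN: "2 * s < real DIM('a)" and ac: "continuous_on UNIV a" and C0: "0 < C0" and al: "2 * s < al"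
    and aC: "\<And>x. C0 * (1 + (norm x)\<^sup>2) powr (al / 2) \<le> a x"
    and cc: "continuous_on UNIV c" and cB: "\<And>x. \<bar>c x\<bar> \<le> Bc" and fc: "continuous_on UNIV f" and fB: "\<And>x. \<bar>f x\<bar> \<le> Bf"
    and T: "0 < T" and g: "continuous_on {0..T} g" and u0: "continuous_on UNIV u0" "(u0 \<longlongrightarrow> g 0) at_infinity" and ep: "0 < ep"
  obtains Wp Wpt Wm Wmt d R where "enclosing s a c f T g u0 ep Wp Wpt Wm Wmt d R"
proof -
  define N where "N = real DIM('a)"
  \<comment> \<open>Capped below the dimension, where \<open>dom_exists\<close> applies; a faster
    decay of \<open>1 / a\<close> is weakened to this one.\<close>
  define al1 where "al1 = min al ((2 * s + N) / 2)"
  have al1: "2 * s < al1" "al1 < N" "al1 \<le> al" using al sN unfolding N_def[symmetric] by (auto simp: al1_def min_def)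
  define be1 where "be1 = (2 * s + al1) / 2"
  have be1: "2 * s < be1" "be1 < al1" "be1 < N" using al1 by (auto simp: be1_def)
  define fk where "fk = frac_const DIM('a) s"
  \<comment> \<open>The factor by which the fractional Laplacian of a smoothed potential differs
    from its smoothed density: the normalisation of the operator times the constant of
    \<open>Lam_pot\<close> over that of \<open>flap_Lam\<close>.\<close>
  define ka where "ka = fk * (wconst s / usub s TYPE('a))"
  have fk: "0 < fk" unfolding fk_def by (rule frac_const_pos[OF s])
  have us: "0 < usub s TYPE('a)" by (rule usub_pos[OF s])
  have ka: "0 < ka" unfolding ka_def using fk us wconst_pos[OF s] by simp
  have a0: "0 < a x" for x by (rule less_le_trans[OF _ aC]) (use C0 in \<open>simp add: add_nonneg_eq_0_iff\<close>)
  have Bc: "0 \<le> Bc" using cB[of 0] by linarith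
  \<comment> \<open>Makes \<open>be - c\<close> at least 2, hence an admissible zero-order
    coefficient.\<close>
  define be where "be = Bc + 2"
  define A where "A = (\<lambda>x. ka * a x)"
  define b0 where "b0 = (\<lambda>x. be - c x)"
  obtain C where C: "dom al1 C ((al1 + 2 * s) / 4) ((al1 - 2 * s) / 4) TYPE('a)"
    using dom_exists[of s al1, where 'a='a] s al1 unfolding N_def by blast
  obtain C' where C': "dom be1 C' ((be1 + 2 * s) / 4) ((be1 - 2 * s) / 4) TYPE('a)"
    using dom_exists[of s be1, where 'a='a] s be1 unfolding N_def by blast
  have AK: "1 / A x \<le> 1 / (ka * C0) * pw al1 x" for x
  proof -
    have p: "0 < (1 + (norm x)\<^sup>2) powr (al / 2)" by (simp add: add_nonneg_eq_0_iff)
    have "ka * (C0 * (1 + (norm x)\<^sup>2) powr (al / 2)) \<le> A x" unfolding A_def using aC[of x] ka by simp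
    hence "1 / A x \<le> 1 / (ka * (C0 * (1 + (norm x)\<^sup>2) powr (al / 2)))" using ka C0 p by (intro frac_le mult_pos_pos) auto
    also have "\<dots> = 1 / (ka * C0) * pw al x" unfolding pw_def powr_minus_divide by (simp only: times_divide_times_eq mult_1_left mult.assoc)
    also have "\<dots> \<le> 1 / (ka * C0) * pw al1 x" using ka C0 by (intro mult_left_mono pw_antimono al1) auto
    finally show ?thesis .
  qed
  interpret P: parab s al1 C "(al1 + 2 * s) / 4" "(al1 - 2 * s) / 4" "TYPE('a)" A b0 "1 / (ka * C0)" "be + Bc"
  proof unfold_locales
    show "continuous_on UNIV A" unfolding A_def by (intro continuous_intros ac)
    show "continuous_on UNIV b0" unfolding b0_def by (intro continuous_intros cc)
    show "1 \<le> b0 x" "b0 x \<le> be + Bc" for x using cB[of x] by (auto simp: b0_def be_def abs_le_iff)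
    show "0 < A x" for x using ka a0 by (simp add: A_def)
  qed (use s al1 C AK sN in auto)
  interpret Q: fpot s be1 C' "(be1 + 2 * s) / 4" "(be1 - 2 * s) / 4" "TYPE('a)" by unfold_locales (use s be1 C' in auto)
  have pm: "pw be1 \<in> borel_measurable (borel :: 'a measure)" by measurable
  have pK: "\<bar>pw be1 (x::'a)\<bar> \<le> 1 * pw be1 x" for x by simp
  \<comment> \<open>The shift 1 makes the barrier twice differentiable; \<open>heat_pw_ge\<close>
    shows that its smoothed density still dominates a multiple of the weight.\<close>
  define Br where "Br = pot s 1 (pw be1 :: 'a \<Rightarrow> real)"
  define PB where "PB = 1 * Q.pC"
  have BrB: "\<bar>Br x\<bar> \<le> PB" for x unfolding Br_def PB_def by (rule Q.pot_bound'[OF pm pK]) simp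
  have Br0: "0 \<le> Br x" for x
    unfolding Br_def pot_def heat_def by (intro integral_nonneg_AE AE_I2 mult_nonneg_nonneg) (auto simp: hk_nonneg ppw_def)
  have PB0: "0 \<le> PB" using Br0[of 0] BrB[of 0] by linarith
  define H where "H = heat 1 (pw be1 :: 'a \<Rightarrow> real)"
  obtain c1 where c1: "0 < c1" "\<And>x::'a. c1 * pw be1 x \<le> H x"
    using heat_pw_ge[of be1, where 'a='a] be1 s unfolding H_def by (metis less_eq_real_def order.strict_trans mult_pos_pos zero_less_numeral)
  have Breq: "Br = heat 1 (pot s 0 (pw be1))" unfolding Br_def using Q.heat_pot[OF pm pK, of 0 1] by auto
  obtain KB where KB: "0 \<le> KB" "C2_on UNIV Br" "\<And>x z. \<bar>sd Br x z\<bar> \<le> KB * mn z"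
    using heat_C2[OF zero_less_one Q.pot_measurable[OF pm pK, of 0] Q.pot_bound'[OF pm pK, of 0]] unfolding Breq by auto
  have Brc: "continuous_on UNIV Br" by (rule C2_continuous[OF KB(2)])
  have Brm: "Br \<in> bmeas" by (rule cont_bmeas[OF Brc])
  have flB: "fk * flap s Br x = ka * H x" for x
  proof -
    have "usub s TYPE('a) * flap s Br x = wconst s * H x"
      using flap_Lam[OF s Brm BrB KB(3)] Q.Lam_pot[OF pm pK, of 1 x] unfolding Br_def H_def by simp
    hence "flap s Br x = wconst s * H x / usub s TYPE('a)" using us by (simp add: field_simps)
    thus ?thesis by (simp add: ka_def)
  qed
  \<comment> \<open>The two functions differ by at most
    \<open>2 * si * exp (be * T) * (1 + PB)\<close>, which is then \<open>ep\<close>.\<close>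
  define si where "si = ep / (2 * exp (be * T) * (1 + PB))"
  have si: "0 < si" using ep PB0 by (simp add: si_def)
  have beta: "0 < be" using Bc by (simp add: be_def)
  have "continuous_on {0..T} (\<lambda>t. exp (- be * t) * g t)" by (intro continuous_intros g)
  \<comment> \<open>\<open>g\<close> is merely continuous, whereas a polynomial can be
    differentiated in time.\<close>
  then obtain p where p: "real_polynomial_function p" "\<And>t. t \<in> {0..T} \<Longrightarrow> \<bar>exp (- be * t) * g t - p t\<bar> < si / 4"
    using Stone_Weierstrass_real_polynomial_function[of "{0..T}" "\<lambda>t. exp (- be * t) * g t" "si / 4"] si by auto
  obtain p' where p': "real_polynomial_function p'" "\<And>t. (p has_real_derivative p' t) (at t)"
    using has_real_derivative_polynomial_function[OF p(1)] by metis
  obtain p'' where p'': "real_polynomial_function p''" "\<And>t. (p' has_real_derivative p'' t) (at t)"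
    using has_real_derivative_polynomial_function[OF p'(1)] by metis
  have pc: "continuous_on S p" "continuous_on S p'" "continuous_on S p''" for S
    using p(1) p'(1) p''(1) by (auto simp: real_polynomial_function_eq intro: continuous_on_polymonial_function)
  \<comment> \<open>Clamps time to \<open>{0..T}\<close>, so that the source below is bounded and
    continuous on the whole time axis, as \<open>approx\<close> requires.\<close>
  define tau where "tau = (\<lambda>t. max 0 (min T t))"
  have tau: "tau t \<in> {0..T}" for t using T by (auto simp: tau_def)
  have tauc: "continuous_on S (\<lambda>p. tau (snd (p::'a \<times> real)))" for S unfolding tau_def by (intro continuous_intros)
  have "bounded (p ` {0..T})" by (intro compact_imp_bounded compact_continuous_image pc compact_Icc)
  then obtain Bp where Bp: "\<And>t. t \<in> {0..T} \<Longrightarrow> \<bar>p t\<bar> \<le> Bp" unfolding bounded_iff by fastforce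
  have "bounded (p' ` {0..T})" by (intro compact_imp_bounded compact_continuous_image pc compact_Icc)
  then obtain Bp' where Bp': "\<And>t. t \<in> {0..T} \<Longrightarrow> \<bar>p' t\<bar> \<le> Bp'" unfolding bounded_iff by fastforce
  \<comment> \<open>The source left for \<open>w\<close> when \<open>exp (be * t) * (w + p)\<close>
    is inserted into the equation; \<open>p\<close> is constant in space and contributes no nonlocal
    term.\<close>
  define G0 where "G0 = (\<lambda>q::'a \<times> real. exp (- be * tau (snd q)) * f (fst q) - p' (tau (snd q)) - b0 (fst q) * p (tau (snd q)))"
  have G0c: "continuous_on UNIV G0" unfolding G0_def by (intro continuous_intros tauc continuous_on_compose2[OF fc] continuous_on_compose2[OF P.b0c]
        continuous_on_compose2[OF pc(1)[of UNIV] tauc] continuous_on_compose2[OF pc(2)[of UNIV] tauc]) auto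
  have G0B: "\<bar>G0 q\<bar> \<le> Bf + Bp' + (be + Bc) * Bp" for q
  proof -
    have "exp (- be * tau (snd q)) \<le> 1" using tau[of "snd q"] beta by simp
    hence "\<bar>exp (- be * tau (snd q)) * f (fst q)\<bar> \<le> 1 * Bf" unfolding abs_mult by (intro mult_mono fB) auto
    moreover have "\<bar>b0 (fst q) * p (tau (snd q))\<bar> \<le> (be + Bc) * Bp"
      unfolding abs_mult using P.b01[of "fst q"] P.b0B[of "fst q"] by (intro mult_mono Bp tau) auto
    ultimately show ?thesis using Bp'[OF tau, of "snd q"] unfolding G0_def by linarith
  qed
  define v0 where "v0 = (\<lambda>x. u0 x - g 0)"
  have v0c: "continuous_on UNIV v0" unfolding v0_def by (intro continuous_intros u0)
  have v0l: "(v0 \<longlongrightarrow> 0) at_infinity" unfolding v0_def using LIM_zero[OF u0(2)] by simp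
  \<comment> \<open>The first bound keeps the initial error within \<open>si\<close>; by the second
    and \<open>c1 * pw be1 <= H\<close>, the residual lies below \<open>si * A * H\<close>.\<close>
  define e where "e = min (si / 4) (si * c1)"
  have e: "0 < e" "e \<le> si / 4" "e \<le> si * c1" using si c1 by (auto simp: e_def)
  obtain w wt v r Bv F KF where r: "0 < (r::real)" and vc: "continuous_on UNIV v" and vB: "\<And>p. \<bar>v p\<bar> \<le> Bv" and w: "w = heat r v"
    and wt: "\<And>x t. ((\<lambda>u. w (x, u)) has_real_derivative wt x t) (at t)"
    and Fc: "\<And>t. continuous_on UNIV (F t)" and FK: "\<And>t x. \<bar>F t x\<bar> \<le> KF * pw al1 x" and wF: "\<And>x t. w (x, t) = pot s r (F t) x"
    and res: "\<And>x t. 0 \<le> t \<Longrightarrow> t \<le> T \<Longrightarrow> \<bar>wt x t + A x * heat r (F t) x + b0 x * w (x, t) - G0 (x, t)\<bar> \<le> e * (A x * pw be1 x)"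
    and w0: "\<And>x. \<bar>w (x, 0) - v0 x\<bar> \<le> e" using P.approx[OF G0c G0B v0c v0l be1(2) e(1), of T] by metis
  have vm: "v \<in> bmeas" by (rule cont_bmeas[OF vc])
  obtain Kw where Kw: "0 \<le> Kw" "C2_on UNIV w" "\<And>q z. \<bar>sd w q z\<bar> \<le> Kw * mn z" using heat_C2[OF r vm vB] unfolding w by metis
  have wc: "continuous_on UNIV w" by (rule C2_continuous[OF Kw(2)])
  have wB: "\<bar>w q\<bar> \<le> Bv" for q unfolding w by (rule heat_bound[OF vm vB r])
  have sdw: "\<bar>sd (\<lambda>y. w (y, t)) x z\<bar> \<le> Kw * mn z" for x z t
    using Kw(3)[of "(x, t)" "(z, 0)"] by (simp add: sd_def mn_def norm_Pair)
  have wm: "(\<lambda>y. w (y, t)) \<in> bmeas" for t by (rule cont_bmeas[OF slice_cont[OF wc]])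
  have flw: "fk * flap s (\<lambda>y. w (y, t)) x = ka * heat r (F t) x" for x t
  proof -
    have "usub s TYPE('a) * flap s (\<lambda>y. w (y, t)) x = Lam s (\<lambda>y. w (y, t)) x" by (rule flap_Lam[OF s wm wB sdw])
    also have "\<dots> = Lam s (pot s r (F t)) x" by (rule arg_cong[where f="\<lambda>v. Lam s v x"]) (rule ext, rule wF)
    also have "\<dots> = wconst s * heat r (F t) x" by (rule P.Lam_pot[OF cont_bmeas[OF Fc] FK r])
    finally have "flap s (\<lambda>y. w (y, t)) x = wconst s * heat r (F t) x / usub s TYPE('a)" using us by (simp add: field_simps)
    thus ?thesis by (simp add: ka_def)
  qed
  \<comment> \<open>The spatial decay of the potential is uniform in time because the density bound
    \<open>KF\<close> is.\<close>
  obtain R where R: "\<And>x t. R \<le> norm x \<Longrightarrow> \<bar>w (x, t)\<bar> \<le> si / 4"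
  proof -
    have "((\<lambda>x::'a. KF * P.pC * pw ((al1 - 2 * s) / 4) x) \<longlongrightarrow> KF * P.pC * 0) at_infinity"
      using al1 by (intro tendsto_mult tendsto_const pw_tendsto_0) auto
    hence "\<forall>\<^sub>F x in at_infinity. KF * P.pC * pw ((al1 - 2 * s) / 4) (x::'a) < si / 4" using si by (intro order_tendstoD(2)) auto
    then obtain R where R: "\<And>x::'a. R \<le> norm x \<Longrightarrow> KF * P.pC * pw ((al1 - 2 * s) / 4) x < si / 4"
      unfolding eventually_at_infinity by blast
    have "\<bar>w (x, t)\<bar> \<le> KF * P.pC * pw ((al1 - 2 * s) / 4) x" for x t
      unfolding wF by (rule P.pot_bound[OF cont_bmeas[OF Fc] FK]) (use r in simp)
    thus thesis using R by (intro that[of R]) (meson less_imp_le order_trans)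
  qed
  define W where "W = (\<lambda>k q. exp (be * snd q) * (w q + p (snd q) + k * (1 + Br (fst q))))"
  define Wt where "Wt = (\<lambda>k x t. be * exp (be * t) * (w (x, t) + p t + k * (1 + Br x)) + exp (be * t) * (wt x t + p' t))"
  have reg: "reg T (W k) (Wt k)" for k unfolding reg_def
  proof (intro conjI)
    have cf: "continuous_on UNIV (\<lambda>q::'a \<times> real. Br (fst q))" "continuous_on UNIV (\<lambda>q::'a \<times> real. p (snd q))"
      by (auto intro!: continuous_on_compose2[OF Brc] continuous_on_compose2[OF pc(1)[of UNIV]] continuous_intros)
    show "continuous_on UNIV (W k)" unfolding W_def by (intro continuous_intros cf wc)
    show "\<exists>B. \<forall>x. \<forall>t\<in>{0..T}. \<bar>W k (x, t)\<bar> \<le> B"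
    proof (intro exI[of _ "exp (be * T) * (Bv + Bp + \<bar>k\<bar> * (1 + PB))"] allI ballI)
      fix x t assume t: "t \<in> {0..T}"
      have 1: "\<bar>k * (1 + Br x)\<bar> \<le> \<bar>k\<bar> * (1 + PB)" unfolding abs_mult using BrB[of x] by (intro mult_left_mono) auto
      have "\<bar>W k (x, t)\<bar> = exp (be * t) * \<bar>w (x, t) + p t + k * (1 + Br x)\<bar>" by (simp add: W_def abs_mult)
      also have "\<dots> \<le> exp (be * T) * (Bv + Bp + \<bar>k\<bar> * (1 + PB))" using t beta 1 wB[of "(x, t)"] Bp[OF t] by (intro mult_mono) auto
      finally show "\<bar>W k (x, t)\<bar> \<le> exp (be * T) * (Bv + Bp + \<bar>k\<bar> * (1 + PB))" .
    qed
    show "\<forall>x. \<forall>t\<in>{0..T}. ((\<lambda>u. W k (x, u)) has_real_derivative Wt k x t) (at t)"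
      unfolding W_def Wt_def by (auto intro!: derivative_eq_intros wt p' simp: algebra_simps)
    show "\<exists>K. \<forall>x z. \<forall>t\<in>{0..T}. \<bar>sd (\<lambda>y. W k (y, t)) x z\<bar> \<le> K * mn z"
    proof (intro exI[of _ "exp (be * T) * (Kw + \<bar>k\<bar> * KB)"] allI ballI)
      fix x z t assume t: "t \<in> {0..T}"
      have 1: "\<bar>k * sd Br x z\<bar> \<le> \<bar>k\<bar> * (KB * mn z)" unfolding abs_mult by (intro mult_left_mono KB) auto
      have "sd (\<lambda>y. W k (y, t)) x z = exp (be * t) * (sd (\<lambda>y. w (y, t)) x z + k * sd Br x z)"
        by (simp add: sd_def W_def algebra_simps)
      hence "\<bar>sd (\<lambda>y. W k (y, t)) x z\<bar> = exp (be * t) * \<bar>sd (\<lambda>y. w (y, t)) x z + k * sd Br x z\<bar>" by (simp add: abs_mult)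
      also have "\<dots> \<le> exp (be * T) * (Kw * mn z + \<bar>k\<bar> * (KB * mn z))" using t beta 1 sdw[of t x z] by (intro mult_mono) auto
      finally show "\<bar>sd (\<lambda>y. W k (y, t)) x z\<bar> \<le> exp (be * T) * (Kw + \<bar>k\<bar> * KB) * mn z" by (simp add: algebra_simps)
    qed
    have "C2_on UNIV (\<lambda>t::real. exp (be * t))"
      by (rule C2_on_real[where f'="\<lambda>t. be * exp (be * t)" and f''="\<lambda>t. be * (be * exp (be * t))"])
        (auto intro!: derivative_eq_intros continuous_intros)
    thus "C2_on (ST T) (W k)" unfolding W_def by (intro C2_on_mult C2_on_add C2_on_const C2_on_fst[OF KB(2)] C2_on_subset[OF Kw(2)]
          C2_on_snd[OF C2_on_real[OF p'(2) p''(2) pc(3)]]) (rule C2_on_snd)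
  qed
  have fla: "fk * flap s (\<lambda>y. W k (y, t)) x = exp (be * t) * (ka * heat r (F t) x + k * (ka * H x))" for k t x
  proof -
    have i: "integrable lebesgue (\<lambda>z. sd (\<lambda>y. w (y, t)) x z * nu s z)" "integrable lebesgue (\<lambda>z. sd Br x z * nu s z)"
      using sd_nu_integrable[OF s wm wB Kw(1) sdw] sd_nu_integrable[OF s Brm BrB KB(1) KB(3)] by auto
    have "sd (\<lambda>y. W k (y, t)) x z * nu s z = exp (be * t) * (sd (\<lambda>y. w (y, t)) x z * nu s z + k * (sd Br x z * nu s z))" for z
      by (simp add: sd_def W_def algebra_simps)
    hence "flap s (\<lambda>y. W k (y, t)) x = 1 / 2 * (exp (be * t) * ((\<integral>z. sd (\<lambda>y. w (y, t)) x z * nu s z \<partial>lebesgue) + k * (\<integral>z. sd Br x z * nu s z \<partial>lebesgue)))"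
      unfolding flap_def using i by (simp only: integral_mult_right_zero Bochner_Integration.integral_add[OF i(1) integrable_mult_right[OF i(2)]])
    hence "flap s (\<lambda>y. W k (y, t)) x = exp (be * t) * (flap s (\<lambda>y. w (y, t)) x + k * flap s Br x)"
      unfolding flap_def by (simp only: distrib_left mult.left_commute)
    hence "fk * flap s (\<lambda>y. W k (y, t)) x = exp (be * t) * (fk * flap s (\<lambda>y. w (y, t)) x + k * (fk * flap s Br x))"
      by (simp add: algebra_simps)
    thus ?thesis unfolding flw flB .
  qed
  \<comment> \<open>An exact identity: the smoothing errors sit in the first bracket, and the
    barrier contributes the term with factor \<open>k\<close>.\<close>
  have eqn: "Wt k x t + a x * (fk * flap s (\<lambda>y. W k (y, t)) x) - c x * W k (x, t) - f x
     = exp (be * t) * ((wt x t + A x * heat r (F t) x + b0 x * w (x, t) - G0 (x, t)) + k * (b0 x * (1 + Br x) + A x * H x))"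
    if t: "t \<in> {0..T}" for k x t
  proof -
    have tt: "tau t = t" using t by (auto simp: tau_def)
    have "f x = exp (be * t) * (exp (- be * t) * f x)" by (simp flip: mult.assoc exp_add)
    thus ?thesis unfolding fla by (simp add: G0_def tt Wt_def W_def A_def b0_def algebra_simps)
  qed
  have core: "\<bar>wt x t + A x * heat r (F t) x + b0 x * w (x, t) - G0 (x, t)\<bar> \<le> si * (b0 x * (1 + Br x) + A x * H x)"
    if t: "t \<in> {0..T}" for x t
  proof -
    have "e * (A x * pw be1 x) \<le> si * c1 * (A x * pw be1 x)" using e P.Apos[of x] by (intro mult_right_mono) auto
    also have "\<dots> = si * A x * (c1 * pw be1 x)" by simp
    also have "\<dots> \<le> si * A x * H x" using c1 si P.Apos[of x] by (intro mult_left_mono) auto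
    also have "\<dots> \<le> si * (b0 x * (1 + Br x) + A x * H x)" using si P.b01[of x] Br0[of x] by (simp add: distrib_left mult.assoc)
    finally show ?thesis using res[of t x] t by simp
  qed
  have ini: "\<bar>w (x, 0) + p 0 - u0 x\<bar> \<le> si" for x
  proof -
    have "\<bar>g 0 - p 0\<bar> < si / 4" using p(2)[of 0] T by simp
    thus ?thesis using w0[of x] e si unfolding v0_def abs_le_iff abs_less_iff by argo
  qed
  have Wz: "W k (x, 0) = w (x, 0) + p 0 + k * (1 + Br x)" for k x by (simp add: W_def)
  have siBr: "si \<le> si * (1 + Br x)" for x using si Br0[of x] by simp
  \<comment> \<open>Half of \<open>si\<close> is spent on \<open>w\<close> and on the polynomial
    approximation; the other half becomes the margin \<open>d\<close> at infinity.\<close>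
  have far: "exp (be * t) * \<bar>w (x, t) + p t - exp (- be * t) * g t\<bar> \<le> exp (be * t) * (si / 2)" if "t \<in> {0..T}" "R \<le> norm x" for x :: 'a and t
  proof (intro mult_left_mono)
    show "\<bar>w (x, t) + p t - exp (- be * t) * g t\<bar> \<le> si / 2"
      using R[OF that(2), of t] p(2)[OF that(1)] unfolding abs_le_iff abs_less_iff by argo
  qed simp
  have ge1: "si / 2 \<le> exp (be * t) * (si / 2)" if "t \<in> {0..T}" for t using that beta si by simp
  have gexp: "exp (be * t) * (exp (- be * t) * g t) = g t" for t by (simp flip: mult.assoc exp_add)
  show thesis
  proof (rule that, unfold enclosing_def, intro conjI ballI allI impI)
    show "reg T (W si) (Wt si)" "reg T (W (- si)) (Wt (- si))" by (rule reg)+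
    show "0 \<le> resid s a c f (W si) (Wt si) x t" if "t \<in> {0<..T}" for x t
      unfolding fk_def[symmetric] using that core[of t x] by (subst eqn) (auto simp: abs_le_iff)
    show "resid s a c f (W (- si)) (Wt (- si)) x t \<le> 0" if "t \<in> {0<..T}" for x t
      unfolding fk_def[symmetric] using that core[of t x] by (subst eqn) (auto simp: mult_le_0_iff abs_le_iff)
    fix q :: "'a \<times> real" assume "q \<in> ST_closed T"
    hence q: "snd q \<in> {0..T}" by (auto simp: ST_closed_def)
    have df: "W si q - W (- si) q = exp (be * snd q) * (2 * si * (1 + Br (fst q)))" by (simp add: W_def algebra_simps)
    have "W si q - W (- si) q \<le> exp (be * T) * (2 * si * (1 + PB))"
      unfolding df using q beta si BrB[of "fst q"] Br0[of "fst q"] by (intro mult_mono) auto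
    also have "\<dots> = ep" using PB0 by (simp add: si_def)
    finally show "W si q \<le> W (- si) q + ep" by simp
  next
    show "W (- si) (x, 0) \<le> u0 x" "u0 x \<le> W si (x, 0)" for x unfolding Wz using ini[of x] siBr[of x] by (auto simp: abs_le_iff)
    show "0 < si / 2" using si by simp
    fix x :: 'a and t assume tx: "t \<in> {0..T}" "R \<le> norm x"
    have E: "exp (be * t) * (w (x, t) + p t) = g t + exp (be * t) * (w (x, t) + p t - exp (- be * t) * g t)"
      using gexp[of t] by (simp add: right_diff_distrib)
    have "\<bar>exp (be * t) * (w (x, t) + p t - exp (- be * t) * g t)\<bar> \<le> exp (be * t) * (si / 2)" using far[OF tx] by (simp add: abs_mult)
    moreover have "exp (be * t) * si \<le> exp (be * t) * (si * (1 + Br x))" using siBr[of x] by (intro mult_left_mono) auto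
    ultimately show "W (- si) (x, t) \<le> g t - si / 2" "g t + si / 2 \<le> W si (x, t)"
      using E ge1[OF tx(1)] by (auto simp: W_def distrib_left abs_le_iff)
  qed
qed

section \<open>Existence and uniqueness\<close>

lemma locally_holder_continuous:
  fixes h :: "'a::euclidean_space \<Rightarrow> real"
  assumes h: "locally_holder \<sigma> h" and \<sigma>: "0 < \<sigma>"
  shows "continuous_on UNIV h"
proof -
  have "isCont h x" for x
  proof -
    obtain L where L: "\<And>y z. y \<in> cball x 1 \<Longrightarrow> z \<in> cball x 1 \<Longrightarrow> \<bar>h y - h z\<bar> \<le> L * dist y z powr \<sigma>"
      using h[unfolded locally_holder_def, rule_format, OF compact_cball[of x 1]] by metis
    have "((\<lambda>y. dist y x) \<longlongrightarrow> dist x x) (at x)" by (intro tendsto_intros)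
    hence "((\<lambda>y. dist y x powr \<sigma>) \<longlongrightarrow> dist x x powr \<sigma>) (at x)"
      by (rule tendsto_powr2[OF _ tendsto_const _ \<sigma>]) (simp add: always_eventually)
    hence 0: "((\<lambda>y. L * dist y x powr \<sigma>) \<longlongrightarrow> L * 0) (at x)" using \<sigma> by (intro tendsto_mult tendsto_const) simp
    have "((\<lambda>y. h y - h x) \<longlongrightarrow> 0) (at x)"
    proof (rule Lim_null_comparison)
      have "\<forall>\<^sub>F y in at x. y \<in> ball x 1" by (rule eventually_at_in_open') auto
      thus "\<forall>\<^sub>F y in at x. norm (h y - h x) \<le> L * dist y x powr \<sigma>" by eventually_elim (use L[of _ x] in simp)
      show "((\<lambda>y. L * dist y x powr \<sigma>) \<longlongrightarrow> 0) (at x)" using 0 by simp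
    qed
    thus ?thesis unfolding isCont_def by (simp add: LIM_zero_iff)
  qed
  thus ?thesis by (simp add: continuous_at_imp_continuous_on)
qed

lemma reg_minus:
  assumes "reg T W Wt" shows "reg T (\<lambda>q. - W q) (\<lambda>x t. - Wt x t)"
proof -
  have "sd (\<lambda>y. - w y) x z = - sd w x z" for w :: "'a \<Rightarrow> real" and x z by (simp add: sd_def)
  thus ?thesis using assms C2_minus[of "ST T" W] unfolding reg_def by (auto intro!: continuous_intros DERIV_minus)
qed

lemma reg_bound:
  assumes "reg T W Wt" obtains B where "\<And>p. p \<in> ST_closed T \<Longrightarrow> \<bar>W p\<bar> \<le> B"
  using assms unfolding reg_def ST_closed_def by (metis mem_Sigma_iff prod.collapse)

lemma reg_continuous: "reg T W Wt \<Longrightarrow> continuous_on S W"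
  unfolding reg_def using continuous_on_subset by blast

lemma classical_minus:
  fixes W :: "'a::euclidean_space \<times> real \<Rightarrow> real"
  shows "- Wt x t + a x * (frac_const DIM('a) s * flap s (\<lambda>y. - W (y, t)) x) - c x * - W (x, t) - - f x
     = - (resid s a c f W Wt x t)" unfolding flap_minus by (simp add: algebra_simps)

text \<open>The enclosing pairs need not be monotone in \<open>n\<close>. Comparison across
  different indices puts every lower function below every upper one, so that the supremum of the
  lower ones is within \<open>1 / (n + 1)\<close> of both members of each pair.\<close>

lemma wellposed:
  fixes a c f u0 :: "'a::euclidean_space \<Rightarrow> real"
  assumes s: "0 < s" "s < 1" and sN: "2 * s < real DIM('a)" and ac: "continuous_on UNIV a" and C0: "0 < C0" and al: "2 * s < al"
    and aC: "\<And>x. C0 * (1 + (norm x)\<^sup>2) powr (al / 2) \<le> a x"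
    and cc: "continuous_on UNIV c" and cB: "\<And>x. \<bar>c x\<bar> \<le> Bc" and fc: "continuous_on UNIV f" and fB: "\<And>x. \<bar>f x\<bar> \<le> Bf"
    and T: "0 < T" and g: "continuous_on {0..T} g" and u0: "continuous_on UNIV u0" "(u0 \<longlongrightarrow> g 0) at_infinity"
  obtains u B where "cauchy_solution s a c f T u0 u" "uniform_limit {0..T} (\<lambda>x t. u (x, t)) g at_infinity"
    "\<And>v z. cauchy_solution s a c f T u0 v \<Longrightarrow> uniform_limit {0..T} (\<lambda>x t. v (x, t)) g at_infinity \<Longrightarrow> z \<in> ST_closed T \<Longrightarrow> v z = u z"
    "\<And>z. z \<in> ST_closed T \<Longrightarrow> \<bar>u z\<bar> \<le> (B::real)"
proof -
  have a: "0 < a x" for x by (rule less_le_trans[OF _ aC]) (use C0 in \<open>simp add: add_nonneg_eq_0_iff\<close>)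
  have be: "c x < Bc + 1" for x using cB[of x] by (simp add: abs_le_iff)
  let ?L = "\<lambda>f W Wt x t. resid s a c f W Wt x t"
  let ?e = "\<lambda>n. 1 / (real n + 1)"
  have e0: "?e \<longlonglongrightarrow> 0" by real_asymp
  have "\<exists>P Pt M Mt d R. enclosing s a c f T g u0 (?e n) P Pt M Mt d R" for n
  proof -
    have "0 < ?e n" by simp
    show ?thesis by (rule sandwich[OF s sN ac C0 al aC cc cB fc fB T g u0 \<open>0 < ?e n\<close>]) (intro exI, assumption)
  qed
  then obtain P Pt M Mt d R where "\<And>n. enclosing s a c f T g u0 (?e n) (P n) (Pt n) (M n) (Mt n) (d n) (R n)" by metis
  note good = this[unfolded enclosing_def]
  have rP: "\<And>n. reg T (P n) (Pt n)" and rM: "\<And>n. reg T (M n) (Mt n)"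
    and sP: "\<And>n x t. t \<in> {0<..T} \<Longrightarrow> 0 \<le> ?L f (P n) (Pt n) x t" and sM: "\<And>n x t. t \<in> {0<..T} \<Longrightarrow> ?L f (M n) (Mt n) x t \<le> 0"
    and MP: "\<And>n p. p \<in> ST_closed T \<Longrightarrow> P n p \<le> M n p + ?e n" and iM: "\<And>n x. M n (x, 0) \<le> u0 x" and iP: "\<And>n x. u0 x \<le> P n (x, 0)"
    and d: "\<And>n. 0 < d n" and fM: "\<And>n x t. t \<in> {0..T} \<Longrightarrow> R n \<le> norm x \<Longrightarrow> M n (x, t) \<le> g t - d n"
    and fP: "\<And>n x t. t \<in> {0..T} \<Longrightarrow> R n \<le> norm x \<Longrightarrow> g t + d n \<le> P n (x, t)" using good by blast+
  \<comment> \<open>Outside a large ball the margin \<open>d n\<close> exceeds the distance of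
    \<open>v\<close> from \<open>g\<close>, which turns convergence at infinity into the ordering
    that \<open>comparison\<close> needs.\<close>
  have below: "v (x, t) \<le> P n (x, t)" if v: "subsolution_eq s a c f T v" "usc_on (ST_closed T) v" "\<And>x. v (x, 0) \<le> u0 x"
      and far: "\<And>x t. t \<in> {0..T} \<Longrightarrow> r \<le> norm x \<Longrightarrow> v (x, t) \<le> g t + d n" and t: "t \<in> {0..T}" for v r n x t
    by (rule comparison[where R="max r (R n)" and be="Bc + 1" and f=f and c=c and a=a, OF s v(1,2) rP be a sP order_trans[OF v(3) iP] _ t])
      (auto intro: order_trans[OF far fP])
  have above: "M n (x, t) \<le> v (x, t)" if v: "supersolution_eq s a c f T v" "lsc_on (ST_closed T) v" "\<And>x. u0 x \<le> v (x, 0)"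
      and far: "\<And>x t. t \<in> {0..T} \<Longrightarrow> r \<le> norm x \<Longrightarrow> g t - d n \<le> v (x, t)" and t: "t \<in> {0..T}" for v r n x t
  proof -
    have "- v (x, t) \<le> - M n (x, t)"
    proof (rule comparison[where R="max r (R n)" and be="Bc + 1" and f="\<lambda>x. - f x" and c=c and a=a and u="\<lambda>z. - v z", OF s _ _ reg_minus[OF rM] be a _ _ _ t])
      show "subsolution_eq s a c (\<lambda>x. - f x) T (\<lambda>z. - v z)" using v(1) by (simp add: subsolution_minus[OF s])
      show "usc_on (ST_closed T) (\<lambda>z. - v z)" using v(2) by (simp add: usc_minus)
      show "0 \<le> ?L (\<lambda>x. - f x) (\<lambda>q. - M n q) (\<lambda>x t. - Mt n x t) x t" if "t \<in> {0<..T}" for x t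
        unfolding classical_minus using sM[OF that, of n x] by simp
      show "- v (x, 0) \<le> - M n (x, 0)" for x using order_trans[OF iM v(3)] by simp
      show "- v (x, t) \<le> - M n (x, t)" if "t \<in> {0..T}" "max r (R n) \<le> norm x" for x t using order_trans[OF fM far] that by simp
    qed
    thus ?thesis by simp
  qed
  \<comment> \<open>Stability along a constant sequence: a classical subsolution is a viscosity
    subsolution.\<close>
  have subM: "subsolution_eq s a c f T (M n)" for n
  proof -
    obtain B where B: "\<And>p. p \<in> ST_closed T \<Longrightarrow> \<bar>M n p\<bar> \<le> B" using reg_bound[OF rM] by blast
    show ?thesis
    proof (rule stability[OF s reg_continuous[OF rM] B ac cc fc a])
      show "\<exists>W Wt. reg T W Wt \<and> (\<forall>x. \<forall>t\<in>{0<..T}. ?L f W Wt x t \<le> 0) \<and> (\<forall>p\<in>ST_closed T. \<bar>W p - M n p\<bar> \<le> e)" if "0 < e" for e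
        by (rule exI[of _ "M n"], rule exI[of _ "Mt n"]) (intro conjI allI ballI rM sM; use that in simp)
    qed
  qed
  have MleP: "M n p \<le> P m p" if pS: "p \<in> ST_closed T" for n m p
  proof -
    obtain x t where p: "p = (x, t)" "t \<in> {0..T}" using pS unfolding ST_closed_def by (elim SigmaE)
    show ?thesis unfolding p(1)
    proof (rule below[OF subM usc_on_continuous[OF reg_continuous[OF rM]] iM _ p(2)])
      show "M n (x, t) \<le> g t + d m" if "t \<in> {0..T}" "R n \<le> norm x" for x t using fM[OF that] d[of n] d[of m] by linarith
    qed
  qed
  define u where "u = (\<lambda>p. SUP n. M n p)"
  have Mu: "M n p \<le> u p" if "p \<in> ST_closed T" for n p
    unfolding u_def by (rule cSUP_upper) (use MleP[OF that, of _ 0] in \<open>auto intro!: bdd_aboveI\<close>)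
  have uP: "u p \<le> P n p" if "p \<in> ST_closed T" for n p unfolding u_def by (rule cSUP_least) (use MleP[OF that] in auto)
  have uM: "\<bar>M n p - u p\<bar> \<le> ?e n" if "p \<in> ST_closed T" for n p
    using Mu[OF that, of n] uP[OF that, of n] MP[OF that, of n] by (simp add: abs_le_iff)
  have uPn: "\<bar>P n p - u p\<bar> \<le> ?e n" if "p \<in> ST_closed T" for n p
    using Mu[OF that, of n] uP[OF that, of n] MP[OF that, of n] by (simp add: abs_le_iff)
  have small: "\<exists>n. ?e n < e" if "0 < e" for e using reals_Archimedean[OF that] by (auto simp: inverse_eq_divide add.commute)
  have uc: "continuous_on (ST_closed T) u"
  proof (rule uniform_limit_theorem)
    show "\<forall>\<^sub>F n in sequentially. continuous_on (ST_closed T) (M n)" by (intro always_eventually allI reg_continuous[OF rM])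
    show "uniform_limit (ST_closed T) M u sequentially"
    proof (rule uniform_limitI)
      fix e :: real assume "0 < e"
      hence "\<forall>\<^sub>F n in sequentially. ?e n < e" using order_tendstoD(2)[OF e0] by blast
      thus "\<forall>\<^sub>F n in sequentially. \<forall>x\<in>ST_closed T. dist (M n x) (u x) < e"
        by eventually_elim (simp only: dist_real_def, intro ballI order.strict_trans1[OF uM])
    qed
  qed simp
  obtain B0 where B0: "\<And>p. p \<in> ST_closed T \<Longrightarrow> \<bar>M 0 p\<bar> \<le> B0" using reg_bound[OF rM] by blast
  have uB: "\<bar>u p\<bar> \<le> B0 + 1" if "p \<in> ST_closed T" for p using B0[OF that] uM[OF that, of 0] by (simp add: abs_le_iff)
  have sub: "subsolution_eq s a c f T u"
  proof (rule stability[OF s uc uB ac cc fc a])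
    fix e :: real assume "0 < e"
    then obtain n where n: "?e n < e" using small by blast
    show "\<exists>W Wt. reg T W Wt \<and> (\<forall>x. \<forall>t\<in>{0<..T}. ?L f W Wt x t \<le> 0) \<and> (\<forall>p\<in>ST_closed T. \<bar>W p - u p\<bar> \<le> e)"
      by (rule exI[of _ "M n"], rule exI[of _ "Mt n"])
        (intro conjI allI ballI rM sM order_trans[OF uM less_imp_le[OF n]])
  qed
  \<comment> \<open>The upper functions with reversed sign are classical subsolutions for the source
    \<open>- f\<close> and approximate \<open>- u\<close> uniformly.\<close>
  have super: "supersolution_eq s a c f T u" unfolding subsolution_minus[OF s, symmetric]
  proof (rule stability[OF s _ _ ac cc _ a])
    show "continuous_on (ST_closed T) (\<lambda>z. - u z)" "continuous_on UNIV (\<lambda>x. - f x)" by (intro continuous_intros uc fc)+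
    show "\<bar>- u p\<bar> \<le> B0 + 1" if "p \<in> ST_closed T" for p using uB[OF that] by simp
    fix e :: real assume "0 < e"
    then obtain n where n: "?e n < e" using small by blast
    have 1: "?L (\<lambda>x. - f x) (\<lambda>q. - P n q) (\<lambda>x t. - Pt n x t) x t \<le> 0" if "t \<in> {0<..T}" for x t
      unfolding classical_minus using sP[OF that, of n x] by simp
    have 2: "\<bar>- P n p - - u p\<bar> \<le> e" if "p \<in> ST_closed T" for p using uPn[OF that, of n] n by (simp add: abs_le_iff)
    show "\<exists>W Wt. reg T W Wt \<and> (\<forall>x. \<forall>t\<in>{0<..T}. ?L (\<lambda>x. - f x) W Wt x t \<le> 0) \<and> (\<forall>p\<in>ST_closed T. \<bar>W p - - u p\<bar> \<le> e)"
      by (rule exI[of _ "\<lambda>q. - P n q"], rule exI[of _ "\<lambda>x t. - Pt n x t"])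
        (intro conjI allI ballI reg_minus[OF rP] 1 2)
  qed
  have eqI: "y = (z :: real)" if "\<And>n. \<bar>y - z\<bar> \<le> ?e n" for y z
  proof (rule ccontr)
    assume "y \<noteq> z"
    thus False using small[of "\<bar>y - z\<bar>"] that not_le by auto
  qed
  have z0: "(x, 0) \<in> ST_closed T" for x :: 'a using T by (simp add: ST_closed_def)
  have u0eq: "u (x, 0) = u0 x" for x
  proof (rule eqI)
    fix n
    show "\<bar>u (x, 0) - u0 x\<bar> \<le> ?e n"
      using iM[of n x] iP[of x n] Mu[OF z0, of n x] uP[OF z0, of x n] MP[OF z0, of n x] unfolding abs_le_iff by linarith
  qed
  have uL: "(\<lambda>x. u (x, t)) \<in> Ls_space s" if "t \<in> {0..T}" for t by (rule slice_Ls[OF s uc uB that])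
  have usc: "usc_on (ST_closed T) u" by (rule usc_on_continuous[OF uc])
  have lsc: "lsc_on (ST_closed T) u" unfolding usc_minus[symmetric] by (intro usc_on_continuous continuous_intros uc)
  show thesis
  proof (rule that[of u "B0 + 1"])
    show "cauchy_solution s a c f T u0 u" unfolding cauchy_solution_def cauchy_subsolution_def cauchy_supersolution_def
      using uL usc lsc sub super u0eq by simp
    show "uniform_limit {0..T} (\<lambda>x t. u (x, t)) g at_infinity"
    proof (rule uniform_limitI)
      fix e :: real assume "0 < e"
      then obtain n where n: "?e n < e" using small by blast
      show "\<forall>\<^sub>F x in at_infinity. \<forall>t\<in>{0..T}. dist (u (x, t)) (g t) < e" unfolding eventually_at_infinity
      proof (intro exI[of _ "R n"] allI impI ballI)
        fix x :: 'a and t assume x: "R n \<le> norm x" and t: "t \<in> {0..T}"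
        have p: "(x, t) \<in> ST_closed T" using t by (simp add: ST_closed_def)
        show "dist (u (x, t)) (g t) < e" using fM[OF t x] fP[OF t x] uM[OF p, of n] uPn[OF p, of n] d[of n] n
          unfolding dist_real_def abs_le_iff abs_less_iff by linarith
      qed
    qed
    fix v and z :: "'a \<times> real" assume v: "cauchy_solution s a c f T u0 v" and lim: "uniform_limit {0..T} (\<lambda>x t. v (x, t)) g at_infinity"
      and z: "z \<in> ST_closed T"
    obtain x t where zxt: "z = (x, t)" and t: "t \<in> {0..T}" using z unfolding ST_closed_def by (elim SigmaE)
    \<comment> \<open>Any other solution is enclosed by the same pair for every \<open>n\<close>,
      hence differs from \<open>u\<close> by at most \<open>1 / (n + 1)\<close>.\<close>
    show "v z = u z"
    proof (rule eqI)
      fix n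
      have "\<forall>\<^sub>F x in at_infinity. \<forall>t\<in>{0..T}. dist (v (x, t)) (g t) < d n" using lim d unfolding uniform_limit_iff by blast
      then obtain r where r: "\<And>x t. r \<le> norm x \<Longrightarrow> t \<in> {0..T} \<Longrightarrow> \<bar>v (x, t) - g t\<bar> < d n"
        unfolding eventually_at_infinity dist_real_def by blast
      have "v (x, t) \<le> P n (x, t)"
      proof (rule below[OF _ _ _ _ t])
        show "v (x, t) \<le> g t + d n" if "t \<in> {0..T}" "r \<le> norm x" for x t using r[OF that(2,1)] by linarith
      qed (use v in \<open>auto simp: cauchy_solution_def cauchy_subsolution_def\<close>)
      moreover have "M n (x, t) \<le> v (x, t)"
      proof (rule above[OF _ _ _ _ t])
        show "g t - d n \<le> v (x, t)" if "t \<in> {0..T}" "r \<le> norm x" for x t using r[OF that(2,1)] by linarith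
      qed (use v in \<open>auto simp: cauchy_solution_def cauchy_supersolution_def\<close>)
      ultimately show "\<bar>v z - u z\<bar> \<le> ?e n" using Mu[OF z, of n] uP[OF z, of n] MP[OF z, of n] unfolding zxt abs_le_iff by linarith
    qed
  next
    show "\<bar>u z\<bar> \<le> B0 + 1" if "z \<in> ST_closed T" for z by (rule uB[OF that])
  qed
qed

theorem theorem2p7:
  fixes s \<sigma> C\<^sub>0 \<alpha> T :: real
    and a c f u\<^sub>0 :: "real ^ 'n \<Rightarrow> real"
    and g :: "real \<Rightarrow> real"
  assumes "0 < s" and "s < 1" and "2 * s < real CARD('n)"
    and "0 < \<sigma>" and "\<sigma> < 1"
    and "locally_holder \<sigma> a" and "\<And>x. 0 < a x"
    and "0 < C\<^sub>0" and "2 * s < \<alpha>"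
    and "\<And>x. C\<^sub>0 * (1 + (norm x)\<^sup>2) powr (\<alpha> / 2) \<le> a x"
    and "locally_holder \<sigma> c" and "bounded (range c)"
    and "locally_holder \<sigma> f" and "bounded (range f)"
    and "0 < T"
    and "continuous_on {0..T} g"
    and "continuous_on UNIV u\<^sub>0" and "bounded (range u\<^sub>0)"
    and "(u\<^sub>0 \<longlongrightarrow> g 0) at_infinity"
  shows "\<exists>u :: (real ^ 'n) \<times> real \<Rightarrow> real.
      cauchy_solution s a c f T u\<^sub>0 u \<and>
      uniform_limit {0..T} (\<lambda>x t. u (x, t)) g at_infinity \<and>
      (\<forall>v. cauchy_solution s a c f T u\<^sub>0 v \<and>
           uniform_limit {0..T} (\<lambda>x t. v (x, t)) g at_infinity \<longrightarrow>
           (\<forall>z\<in>ST_closed T. v z = u z)) \<and>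
      (\<exists>C>0. \<exists>\<beta>>0. \<forall>x. \<forall>t\<in>{0..T}. \<bar>u (x, t)\<bar> \<le> C * exp (\<beta> * T))"
proof -
  obtain Bc where Bc: "\<And>x. \<bar>c x\<bar> \<le> Bc" using assms(12) unfolding bounded_iff by auto
  obtain Bf where Bf: "\<And>x. \<bar>f x\<bar> \<le> Bf" using assms(14) unfolding bounded_iff by auto
  have N: "2 * s < real DIM(real ^ 'n)" using assms(3) by simp
  note cont = locally_holder_continuous[OF _ assms(4)]
  show ?thesis
  proof (rule wellposed[OF assms(1,2) N cont[OF assms(6)] assms(8,9,10) cont[OF assms(11)] Bc cont[OF assms(13)] Bf assms(15,16,17,19)])
    fix u B
    assume u: "cauchy_solution s a c f T u\<^sub>0 u" "uniform_limit {0..T} (\<lambda>x t. u (x, t)) g at_infinity"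
      "\<And>v z. cauchy_solution s a c f T u\<^sub>0 v \<Longrightarrow> uniform_limit {0..T} (\<lambda>x t. v (x, t)) g at_infinity \<Longrightarrow> z \<in> ST_closed T \<Longrightarrow> v z = u z"
      and B: "\<And>z. z \<in> ST_closed T \<Longrightarrow> \<bar>u z\<bar> \<le> B"
    \<comment> \<open>Any bound of \<open>u\<close> serves: with exponent 1 the exponential factor
      is at least 1, and \<open>max B 1\<close> makes the constant positive.\<close>
    have "\<bar>u (x, t)\<bar> \<le> max B 1 * exp (1 * T)" if "t \<in> {0..T}" for x t
    proof -
      have "\<bar>u (x, t)\<bar> \<le> max B 1 * 1" using B[of "(x, t)"] that by (simp add: ST_closed_def)
      also have "\<dots> \<le> max B 1 * exp (1 * T)" using assms(15) by (intro mult_left_mono) auto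
      finally show ?thesis .
    qed
    hence "\<exists>C>0. \<exists>\<beta>>0. \<forall>x. \<forall>t\<in>{0..T}. \<bar>u (x, t)\<bar> \<le> C * exp (\<beta> * T)"
      by (intro exI[of _ "max B 1"] conjI exI[of _ 1]) auto
    with u show ?thesis by blast
  qed
qed

end
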